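(* Let $N\in\{2,3\}$, let $\Omega\subset\mathbb{R}^N$ be a bounded domain, and let $T>0$. Let $\varrho_0\in L^\infty(\Omega)$, $\varrho_0>0$, be given. Then there exists a sequence of weak solutions $[\varrho_n,\mathbf{m}_n]$ to the compressible Euler system in $(0,T)\times\Omega$, with $\varrho_n=\varrho_n(x)$ independent of time, such that $$\varrho_n\to\varrho_0\ \text{weakly-( * ) in } L^\infty(\Omega),\qquad \mathbf{m}_n\to0\ \text{weakly-( * ) in } L^\infty((0,T)\times\Omega;\mathbb{R}^N),$$ $$\liminf_{n\to\infty}\int_\Omega|\varrho_n-\varrho_0|\,dx>0.$$
   Context: The Euler system is $\partial_t\varrho+\mathrm{div}_x\mathbf{m}=0$, $\partial_t\mathbf{m}+\mathrm{div}_x\left(\frac{\mathbf{m}\otimes\mathbf{m}}{\varrho}\right)+\nabla_xp(\varrho)=0$, with pressure $p(\varrho)=a\varrho^\gamma$, $a>0$, $\gamma>1$ constants, and impermeable boundary ($\mathbf{m}\cdot\mathbf{n}=0$ on $\partial\Omega$, in the weak sense). Weak solution in $(0,T)\times\Omega$: $\varrho\geq0$ and $\mathbf{m}$ are such that all terms below are integrable ($\mathbf{m}=0$ a.e. where $\varrho=0$, and $\frac{\mathbf{m}\otimes\mathbf{m}}{\varrho}$ is read as $0$ there), and the equations hold in the sense of distributions: $$\int_0^T\int_\Omega[\varrho\partial_t\varphi+\mathbf{m}\cdot\nabla_x\varphi]\,dx\,dt=0\quad\text{for all }\varphi\in C^1_c((0,T)\times\overline\Omega)$$ (which encodes the impermeability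 condition), and $$\int_0^T\int_\Omega\left[\mathbf{m}\cdot\partial_t\boldsymbol{\varphi}+\frac{\mathbf{m}\otimes\mathbf{m}}{\varrho}:\nabla_x\boldsymbol{\varphi}+p(\varrho)\,\mathrm{div}_x\boldsymbol{\varphi}\right]dx\,dt=0$$ for all $\boldsymbol{\varphi}\in C^1_c((0,T)\times\Omega;\mathbb{R}^N)$ and, if $\partial\Omega$ is Lipschitz (so that the normal $\mathbf{n}$ is defined a.e. on $\partial\Omega$), for all $\boldsymbol{\varphi}\in C^1_c((0,T)\times\overline\Omega;\mathbb{R}^N)$ with $\boldsymbol{\varphi}\cdot\mathbf{n}|_{\partial\Omega}=0$. *)

theory Defs
  imports "HOL-Analysis.Analysis"
begin

text \<open>Space-time points are pairs \<open>(t, x)\<close> of type \<open>real \<times> (real^'n)\<close>; the space dimension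
  is \<open>CARD('n)\<close>.\<close>

section \<open>Function spaces\<close>

definition Linfty :: "'a measure \<Rightarrow> ('a \<Rightarrow> 'b::euclidean_space) set" where
  "Linfty M = {f. f \<in> borel_measurable M \<and> (\<exists>C. AE x in M. norm (f x) \<le> C)}"

definition weak_star_Linfty ::
    "'a measure \<Rightarrow> (nat \<Rightarrow> 'a \<Rightarrow> 'b::euclidean_space) \<Rightarrow> ('a \<Rightarrow> 'b) \<Rightarrow> bool" where
  "weak_star_Linfty M f g \<longleftrightarrow>
     (\<forall>n. f n \<in> Linfty M) \<and> g \<in> Linfty M \<and>
     (\<forall>\<psi>. integrable M \<psi> \<longrightarrow>
        (\<lambda>n. \<integral>x. f n x \<bullet> \<psi> x \<partial>M) \<longlonglongrightarrow> (\<integral>x. g x \<bullet> \<psi> x \<partial>M))"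

text \<open>\<open>C1c U D\<close>, for \<open>U\<close> open and \<open>U \<subseteq> D \<subseteq> closure U\<close>, is the space of functions that are
  \<open>C\<^sup>1\<close> in \<open>U\<close>, that extend together with their derivative continuously to \<open>D\<close>, and that have
  compact support in \<open>D\<close>. Thus \<open>C1c U U\<close> is the usual space of compactly supported \<open>C\<^sup>1\<close>
  functions, while for larger \<open>D\<close> the functions need not vanish on \<open>D - U\<close>.
  Values outside \<open>D\<close> are irrelevant.\<close>

definition C1c ::
    "'a::euclidean_space set \<Rightarrow> 'a set \<Rightarrow> ('a \<Rightarrow> 'b::euclidean_space) set" where
  "C1c U D = {\<phi>.
     (\<exists>\<phi>' :: 'a \<Rightarrow> 'a \<Rightarrow>\<^sub>L 'b.
        continuous_on D \<phi> \<and> continuous_on D \<phi>' \<and>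
        (\<forall>z\<in>U. (\<phi> has_derivative blinfun_apply (\<phi>' z)) (at z))) \<and>
     (\<exists>K. compact K \<and> K \<subseteq> D \<and> (\<forall>z\<in>D - K. \<phi> z = 0))}"

definition dt :: "(real \<times> (real^'n) \<Rightarrow> 'b::real_normed_vector) \<Rightarrow> real \<times> (real^'n) \<Rightarrow> 'b" where
  "dt \<phi> z = frechet_derivative \<phi> (at z) (1, 0)"

definition dx :: "'n \<Rightarrow> (real \<times> (real^'n) \<Rightarrow> 'b::real_normed_vector) \<Rightarrow> real \<times> (real^'n) \<Rightarrow> 'b" where
  "dx j \<phi> z = frechet_derivative \<phi> (at z) (0, axis j 1)"

definition grad_x :: "(real \<times> (real^'n) \<Rightarrow> real) \<Rightarrow> real \<times> (real^'n) \<Rightarrow> real^'n" where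
  "grad_x \<phi> z = (\<chi> j. dx j \<phi> z)"

definition jac_x :: "(real \<times> (real^'n) \<Rightarrow> real^'n) \<Rightarrow> real \<times> (real^'n) \<Rightarrow> real^'n^'n" where
  "jac_x \<phi> z = (\<chi> i j. dx j \<phi> z $ i)"

definition div_x :: "(real \<times> (real^'n) \<Rightarrow> real^'n) \<Rightarrow> real \<times> (real^'n) \<Rightarrow> real" where
  "div_x \<phi> z = (\<Sum>j\<in>UNIV. dx j \<phi> z $ j)"

section \<open>Lipschitz boundaries and the outer normal\<close>

text \<open>Near \<open>x\<close>, in coordinates centred at \<open>x\<close> with vertical direction \<open>\<nu>\<close>, the set \<open>\<Omega>\<close> is the
  strict subgraph of a Lipschitz function \<open>h\<close> on the hyperplane orthogonal to \<open>\<nu>\<close>. For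
  \<open>x \<in> frontier \<Omega>\<close> this forces \<open>h 0 = 0\<close>, and \<open>frontier \<Omega>\<close> is the graph of \<open>h\<close> near \<open>x\<close>.\<close>

definition lipschitz_chart ::
    "(real^'n) set \<Rightarrow> real^'n \<Rightarrow> real^'n \<Rightarrow> (real^'n \<Rightarrow> real) \<Rightarrow> bool" where
  "lipschitz_chart \<Omega> x \<nu> h \<longleftrightarrow>
     norm \<nu> = 1 \<and>
     (\<exists>L. L-lipschitz_on {v. v \<bullet> \<nu> = 0} h) \<and>
     (\<exists>r>0. \<forall>y\<in>ball x r.
        y \<in> \<Omega> \<longleftrightarrow> (y - x) \<bullet> \<nu> < h ((y - x) - ((y - x) \<bullet> \<nu>) *\<^sub>R \<nu>))"

definition lipschitz_boundary :: "(real^'n) set \<Rightarrow> bool" where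
  "lipschitz_boundary \<Omega> \<longleftrightarrow> (\<forall>x\<in>frontier \<Omega>. \<exists>\<nu> h. lipschitz_chart \<Omega> x \<nu> h)"

text \<open>At a point where the local graph function \<open>h\<close> is differentiable with (tangential)
  gradient \<open>g\<close>, the outer unit normal is \<open>(\<nu> - g) / \<bar>\<nu> - g\<bar>\<close>.\<close>

definition outer_normal :: "(real^'n) set \<Rightarrow> real^'n \<Rightarrow> real^'n \<Rightarrow> bool" where
  "outer_normal \<Omega> x n \<longleftrightarrow>
     (\<exists>\<nu> h g. lipschitz_chart \<Omega> x \<nu> h \<and> g \<bullet> \<nu> = 0 \<and>
        (h has_derivative (\<lambda>v. g \<bullet> v)) (at 0 within {v. v \<bullet> \<nu> = 0}) \<and>
        n = (1 / norm (\<nu> - g)) *\<^sub>R (\<nu> - g))"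

text \<open>Sets of vanishing \<open>s\<close>-dimensional Hausdorff measure, for \<open>s \<ge> 1\<close>. (Smallness of the
  covering sets follows from smallness of the sum, so no bound on the diameters is needed.)\<close>

definition hausdorff_null :: "nat \<Rightarrow> 'a::metric_space set \<Rightarrow> bool" where
  "hausdorff_null s A \<longleftrightarrow>
     (\<forall>\<epsilon>>0. \<exists>C :: nat \<Rightarrow> 'a set.
        A \<subseteq> (\<Union>i. C i) \<and> (\<forall>i. bounded (C i)) \<and>
        summable (\<lambda>i. diameter (C i) ^ s) \<and> (\<Sum>i. diameter (C i) ^ s) < \<epsilon>)"

text \<open>\<open>\<phi> \<bullet> n = 0\<close> almost everywhere on the boundary with respect to the surface measure, at
  every time in \<open>(0, T)\<close>. On a Lipschitz boundary the normal exists almost everywhere.\<close>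

definition zero_normal_trace ::
    "real \<Rightarrow> (real^'n) set \<Rightarrow> (real \<times> (real^'n) \<Rightarrow> real^'n) \<Rightarrow> bool" where
  "zero_normal_trace T \<Omega> \<phi> \<longleftrightarrow>
     (\<forall>t\<in>{0<..<T}. hausdorff_null (CARD('n) - 1)
        {x \<in> frontier \<Omega>. \<not> (\<exists>n. outer_normal \<Omega> x n \<and> \<phi> (t, x) \<bullet> n = 0)})"

section \<open>Weak solutions of the Euler system\<close>

definition pressure :: "real \<Rightarrow> real \<Rightarrow> real \<Rightarrow> real" where
  "pressure a \<gamma> r = a * r powr \<gamma>"

text \<open>The tensor \<open>(m \<otimes> m) / r\<close>; by the convention \<open>x / 0 = 0\<close> it is zero when \<open>r = 0\<close>.\<close>

definition convective :: "real \<Rightarrow> real^'n \<Rightarrow> real^'n^'n" where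
  "convective r m = (\<chi> i j. m $ i * m $ j / r)"

definition continuity_tests :: "real \<Rightarrow> (real^'n) set \<Rightarrow> (real \<times> (real^'n) \<Rightarrow> real) set" where
  "continuity_tests T \<Omega> = C1c ({0<..<T} \<times> \<Omega>) ({0<..<T} \<times> closure \<Omega>)"

definition momentum_tests :: "real \<Rightarrow> (real^'n) set \<Rightarrow> (real \<times> (real^'n) \<Rightarrow> real^'n) set" where
  "momentum_tests T \<Omega> =
     C1c ({0<..<T} \<times> \<Omega>) ({0<..<T} \<times> \<Omega>) \<union>
     {\<phi> \<in> C1c ({0<..<T} \<times> \<Omega>) ({0<..<T} \<times> closure \<Omega>).
        lipschitz_boundary \<Omega> \<and> zero_normal_trace T \<Omega> \<phi>}"

text \<open>In the momentum equation, the inner product of \<open>real^'n^'n\<close> is the contraction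
  \<open>A : B = (\<Sum>i j. A\<^sub>i\<^sub>j B\<^sub>i\<^sub>j)\<close>.\<close>

definition euler_weak_solution ::
    "real \<Rightarrow> real \<Rightarrow> real \<Rightarrow> (real^'n) set \<Rightarrow>
     (real \<times> (real^'n) \<Rightarrow> real) \<Rightarrow> (real \<times> (real^'n) \<Rightarrow> real^'n) \<Rightarrow> bool" where
  "euler_weak_solution a \<gamma> T \<Omega> \<rho> m \<longleftrightarrow>
     (let Q = lebesgue_on ({0<..<T} \<times> \<Omega>) in
       \<rho> \<in> borel_measurable Q \<and> m \<in> borel_measurable Q \<and>
       (AE z in Q. \<rho> z \<ge> 0) \<and>
       (AE z in Q. \<rho> z = 0 \<longrightarrow> m z = 0) \<and>
       (\<forall>\<phi> \<in> continuity_tests T \<Omega>.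
          integrable Q (\<lambda>z. \<rho> z * dt \<phi> z) \<and>
          integrable Q (\<lambda>z. m z \<bullet> grad_x \<phi> z) \<and>
          (\<integral>z. \<rho> z * dt \<phi> z + m z \<bullet> grad_x \<phi> z \<partial>Q) = 0) \<and>
       (\<forall>\<phi> \<in> momentum_tests T \<Omega>.
          integrable Q (\<lambda>z. m z \<bullet> dt \<phi> z) \<and>
          integrable Q (\<lambda>z. convective (\<rho> z) (m z) \<bullet> jac_x \<phi> z) \<and>
          integrable Q (\<lambda>z. pressure a \<gamma> (\<rho> z) * div_x \<phi> z) \<and>
          (\<integral>z. m z \<bullet> dt \<phi> z + convective (\<rho> z) (m z) \<bullet> jac_x \<phi> z
                + pressure a \<gamma> (\<rho> z) * div_x \<phi> z \<partial>Q) = 0))"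

end

theory Submission
  imports Defs
begin

text \<open>The densities oscillate and the momenta are produced by convex integration.

  Let \<open>s\<close> be constant on the cells of a fine dyadic grid and close to \<open>\<rho>0\<close> in \<open>L\<^sup>1\<close>, and let \<open>r \<in> {1, -1}\<close>
  alternate from one layer of cells to the next. Then \<open>\<rho> = s (1 + r / 2)\<close> is weakly close to \<open>\<rho>0\<close>, since the
  sign averages out, while \<open>\<bar>\<rho> - \<rho>0\<bar>\<close> stays close to \<open>\<rho>0 / 2\<close> (\<open>checker_density_weak\<close>).

  For such a \<open>\<rho>\<close> the momentum is \<open>m = \<rho> v\<close>, where, on the open set \<open>G\<close> of the space-time points off the grid,
  \<open>div v = 0\<close> and \<open>\<partial>\<^sub>t v + div (v \<otimes> v - c Id) = 0\<close> with \<open>\<rho> c = P - p(\<rho>)\<close>,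
  with a constant \<open>P > max p(\<rho>)\<close>. These equations are required against all functions that are \<open>C\<^sup>1\<close> with bounded
  derivative in \<open>G\<close>, without any condition at the boundary of \<open>G\<close>; hence all fluxes vanish weakly there.
  A test function for the Euler system may therefore be multiplied by \<open>\<rho>\<close>, which jumps across the grid. This
  gives the continuity equation, and the momentum equation up to the term \<open>P \<integral> div \<phi>\<close>. That term
  is zero: for a compactly supported field trivially, otherwise by the Gauss theorem on Lipschitz domains
  (\<open>gauss_lipschitz\<close>). The same freedom in the choice of the test function makes \<open>m\<close> orthogonal to all functions
  that are constant on the cells, so \<open>m \<rightarrow> 0\<close> weakly as the grid is refined (\<open>weak_null_of_step_tests\<close>).

  The field \<open>v\<close> comes from the method of De Lellis and Szekelyhidi (\<open>convex_integration\<close>). A subsolution is a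
  compactly supported solution of \<open>div v = 0\<close>, \<open>\<partial>\<^sub>t v + div S = 0\<close> with \<open>v \<otimes> v < c Id + S\<close> and
  \<open>trace (c Id + S) < (N + 1) c\<close>; zero is one. Adding localised plane waves yields a new subsolution, almost
  orthogonal in its increment to all earlier ones, whose energy is larger by a multiple of the squared defect
  \<open>\<integral> (trace (c Id + S) - \<bar>v\<bar>\<^sup>2)\<^sup>2\<close> (\<open>subsolution_perturbation\<close>). The energies are bounded, so the
  iterates converge strongly and the defect tends to zero; in the limit \<open>v \<otimes> v = c Id + S\<close>.\<close>

section \<open>Integration by parts\<close>

lemma integrable_compact_support:
  fixes f :: "'a::euclidean_space \<Rightarrow> 'b::{banach,second_countable_topology}"
  assumes "open G" "compact K" "K \<subseteq> G" "continuous_on G f" "\<And>y. y \<notin> K \<Longrightarrow> f y = 0"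
  shows "continuous_on UNIV f" "integrable lborel f"
proof -
  have "continuous_on (G \<union> - K) f"
  proof (rule continuous_on_open_Un)
    show "open (- K)" using assms(2) by (simp add: compact_imp_closed open_Compl)
    show "continuous_on (- K) f"
      by (rule continuous_on_eq[of _ "\<lambda>_. 0"]) (use assms(5) in auto)
  qed (use assms in auto)
  moreover have "G \<union> - K = UNIV" using assms(3) by auto
  ultimately show c: "continuous_on UNIV f" by simp
  have "integrable lborel (\<lambda>x. indicator K x *\<^sub>R f x)"
    by (rule borel_integrable_compact[OF assms(2)]) (use c continuous_on_subset in blast)
  also have "(\<lambda>x. indicator K x *\<^sub>R f x) = f"
    using assms(5) by (auto simp: indicator_def fun_eq_iff)
  finally show "integrable lborel f" .
qed

lemma integrable_const_indicator:
  "bounded (S :: 'a::euclidean_space set) \<Longrightarrow> S \<in> sets borel \<Longrightarrow> integrable lborel (\<lambda>y. (b::real) * indicator S y)"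
  using emeasure_bounded_finite by (intro integrable_mult_right) (auto simp: integrable_indicator_iff)

lemma has_derivative_zero_near:
  "open U \<Longrightarrow> y \<in> U \<Longrightarrow> (\<And>z. z \<in> U \<Longrightarrow> f z = 0) \<Longrightarrow> (f has_derivative (\<lambda>_. 0)) (at y)"
  by (rule has_derivative_transform_within_open[OF has_derivative_const[of 0]]) auto

lemma integral_translate_lborel:
  fixes f :: "'a::euclidean_space \<Rightarrow> real"
  assumes "f \<in> borel_measurable borel"
  shows "(\<integral>y. f (y + c) \<partial>lborel) = (\<integral>y. f y \<partial>lborel)"
    and "integrable lborel (\<lambda>y. f (y + c)) \<longleftrightarrow> integrable lborel f"
proof -
  have e: "lborel = distr lborel borel (\<lambda>y::'a. c + y)"
    by (simp add: lborel_distr_plus)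
  have "(\<integral>y. f y \<partial>lborel) = (\<integral>y. f y \<partial>(distr lborel borel (\<lambda>y::'a. c + y)))"
    using e by simp
  also have "\<dots> = (\<integral>y. f (c + y) \<partial>lborel)"
    by (rule integral_distr) (use assms in auto)
  finally show "(\<integral>y. f (y + c) \<partial>lborel) = (\<integral>y. f y \<partial>lborel)" by (simp add: add.commute)
  have "integrable lborel f \<longleftrightarrow> integrable (distr lborel borel (\<lambda>y::'a. c + y)) f"
    using e by simp
  also have "\<dots> \<longleftrightarrow> integrable lborel (\<lambda>y. f (c + y))"
    by (rule integrable_distr_eq) (use assms in auto)
  finally show "integrable lborel (\<lambda>y. f (y + c)) \<longleftrightarrow> integrable lborel f" by (simp add: add.commute)
qed

text \<open>The difference quotients have integral zero by translation invariance, and the one-sided Lipschitz bound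
  provides the dominating function. Only a.e. convergence is asked for, because the lemma is also applied to
  Lipschitz cut-offs at a boundary and to functions that are smooth in one direction only.\<close>

lemma integral_directional_derivative_eq_0:
  fixes f g :: "'a::euclidean_space \<Rightarrow> real"
  assumes f: "f \<in> borel_measurable borel" "integrable lborel f"
    and g: "g \<in> borel_measurable borel"
    and S: "bounded S" "\<And>y. y \<notin> S \<Longrightarrow> f y = 0"
    and \<delta>: "\<delta> > 0"
    and lip: "\<And>y h. 0 < h \<Longrightarrow> h < \<delta> \<Longrightarrow> \<bar>f (y + h *\<^sub>R u) - f y\<bar> \<le> C * h"
    and lim: "AE y in lborel. ((\<lambda>h. (f (y + h *\<^sub>R u) - f y) / h) \<longlongrightarrow> g y) (at_right 0)"
  shows "integrable lborel g" "(\<integral>y. g y \<partial>lborel) = 0"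
proof -
  define h where "h n = \<delta> / (real n + 2)" for n :: nat
  have h0: "h n > 0" "h n < \<delta>" for n
    using \<delta> by (auto simp: h_def field_simps add_pos_nonneg)
  have hl: "filterlim h (at_right 0) sequentially"
    unfolding filterlim_at_right_to_0 filterlim_at
  proof
    show "h \<longlonglongrightarrow> 0" unfolding h_def by real_asymp
    show "eventually (\<lambda>n. h n \<in> {0<..} \<and> h n \<noteq> 0) sequentially" using h0 by (auto simp: less_imp_neq[symmetric])
  qed
  obtain R where R: "\<And>y. y \<in> S \<Longrightarrow> norm y \<le> R" using S(1) bounded_iff by blast
  define B where "B = cball (0::'a) (R + \<delta> * norm u)"
  define s where "s n y = (f (y + h n *\<^sub>R u) - f y) / h n" for n y
  have int0: "(\<integral>y. s n y \<partial>lborel) = 0" for n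
  proof -
    have "integrable lborel (\<lambda>y. f (y + h n *\<^sub>R u))" using integral_translate_lborel(2)[OF f(1)] f(2) by simp
    then show ?thesis using f(2) integral_translate_lborel(1)[OF f(1), of "h n *\<^sub>R u"]
      by (simp add: s_def)
  qed
  have dom: "norm (s n y) \<le> C * indicator B y" for n y
  proof (cases "y \<in> B")
    case True
    then show ?thesis using lip[OF h0, of y n] h0(1)[of n]
      by (simp add: s_def abs_divide divide_le_eq mult.commute)
  next
    case False
    then have n: "norm y > R + \<delta> * norm u" by (auto simp: B_def)
    have "y \<notin> S" using R[of y] n \<delta> by (smt (verit) mult_nonneg_nonneg norm_ge_zero)
    moreover have "y + h n *\<^sub>R u \<notin> S"
    proof
      assume "y + h n *\<^sub>R u \<in> S"
      then have "norm (y + h n *\<^sub>R u) \<le> R" using R by blast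
      moreover have "norm y \<le> norm (y + h n *\<^sub>R u) + norm (h n *\<^sub>R u)"
        by (metis add_diff_cancel_right' norm_triangle_ineq4)
      moreover have "norm (h n *\<^sub>R u) \<le> \<delta> * norm u" using h0[of n] by (simp add: mult_right_mono)
      ultimately show False using n by linarith
    qed
    ultimately show ?thesis using S(2) False by (simp add: s_def)
  qed
  have w: "integrable lborel (\<lambda>y. C * indicator B y)"
    using bounded_cball[of 0 "R + \<delta> * norm u"] by (intro integrable_const_indicator) (auto simp: B_def)
  have sm: "s n \<in> borel_measurable lborel" for n
  proof -
    have [measurable]: "f \<in> borel_measurable borel" by (rule f(1))
    show ?thesis unfolding s_def[abs_def] by measurable
  qed
  have gm: "g \<in> borel_measurable lborel" using g by simp
  have slim: "AE y in lborel. (\<lambda>n. s n y) \<longlonglongrightarrow> g y"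
    using lim
  proof eventually_elim
    case (elim y)
    then show ?case unfolding s_def using filterlim_compose[OF elim hl] by simp
  qed
  show "integrable lborel g"
    by (rule integrable_dominated_convergence[OF gm sm w slim]) (use dom in auto)
  have "(\<lambda>n. \<integral>y. s n y \<partial>lborel) \<longlonglongrightarrow> (\<integral>y. g y \<partial>lborel)"
    by (rule integral_dominated_convergence[OF gm sm w slim]) (use dom in auto)
  then show "(\<integral>y. g y \<partial>lborel) = 0" using int0 LIMSEQ_unique[of "\<lambda>n. 0::real"] by auto
qed

lemma has_derivative_imp_right_quotient:
  fixes f :: "'a::real_normed_vector \<Rightarrow> real"
  assumes "(f has_derivative f') (at y)"
  shows "((\<lambda>h. (f (y + h *\<^sub>R u) - f y) / h) \<longlongrightarrow> f' u) (at_right 0)"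
proof -
  have l: "linear f'" using assms has_derivative_linear by blast
  have "((\<lambda>h. f (y + h *\<^sub>R u)) has_derivative (\<lambda>h. f' (h *\<^sub>R u))) (at 0)"
  proof -
    have "((\<lambda>h. y + h *\<^sub>R u) has_derivative (\<lambda>h. h *\<^sub>R u)) (at 0)"
      by (auto intro!: derivative_eq_intros)
    then show ?thesis using has_derivative_compose[of "\<lambda>h. y + h *\<^sub>R u" "\<lambda>h. h *\<^sub>R u" 0 UNIV f f'] assms by simp
  qed
  moreover have "(\<lambda>h. f' (h *\<^sub>R u)) = (\<lambda>h. f' u * h)" using l by (simp add: linear_scale mult.commute)
  ultimately have "((\<lambda>h. f (y + h *\<^sub>R u)) has_real_derivative f' u) (at 0)"
    by (simp add: has_field_derivative_def)
  then have "((\<lambda>h. (f (y + h *\<^sub>R u) - f y) / h) \<longlongrightarrow> f' u) (at 0)"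
    by (simp add: DERIV_def)
  then show ?thesis using filterlim_at_split by blast
qed

definition dir_D :: "'a::real_normed_vector \<Rightarrow> ('a \<Rightarrow> real) \<Rightarrow> 'a \<Rightarrow> real" where
  "dir_D u f y = frechet_derivative f (at y) u"

lemma dir_D_eqI: "(f has_derivative f') (at y) \<Longrightarrow> dir_D u f y = f' u"
  by (simp add: dir_D_def frechet_derivative_at[symmetric])

lemma dir_D_works: "f differentiable (at y) \<Longrightarrow> (f has_derivative (\<lambda>u. dir_D u f y)) (at y)"
  unfolding dir_D_def by (simp add: frechet_derivative_works)

lemma integral_dir_D_eq_0:
  fixes f :: "'a::euclidean_space \<Rightarrow> real"
  assumes d: "\<And>y. f differentiable (at y)" and c: "continuous_on UNIV (dir_D u f)"
    and K: "compact K" "\<And>y. y \<notin> K \<Longrightarrow> f y = 0"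
  shows "integrable lborel (dir_D u f)" "(\<integral>y. dir_D u f y \<partial>lborel) = 0"
proof -
  have D0: "dir_D u f y = 0" if "y \<notin> K" for y
  proof -
    have "(f has_derivative (\<lambda>_. 0)) (at y)"
      by (rule has_derivative_zero_near[of "- K"])
         (use that K in \<open>auto simp: compact_imp_closed open_Compl\<close>)
    then show ?thesis by (rule dir_D_eqI)
  qed
  have cf: "continuous_on UNIV f"
    using d differentiable_imp_continuous_within continuous_on_eq_continuous_within by blast
  obtain C where C: "\<And>y. \<bar>dir_D u f y\<bar> \<le> C" "C \<ge> 0"
  proof -
    have "bounded (dir_D u f ` K)"
      using K(1) c continuous_on_subset compact_continuous_image compact_imp_bounded by blast
    then obtain C where C: "\<And>y. y \<in> K \<Longrightarrow> \<bar>dir_D u f y\<bar> \<le> C" by (auto simp: bounded_iff)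
    have "\<bar>dir_D u f y\<bar> \<le> max C 0" for y using C[of y] D0[of y] by (cases "y \<in> K") auto
    then show ?thesis using that[of "max C 0"] by auto
  qed
  have lip: "\<bar>f (y + h *\<^sub>R u) - f y\<bar> \<le> C * h" if hpos: "h > 0" for y h
  proof -
    have der: "((\<lambda>s. f (y + s *\<^sub>R u)) has_real_derivative dir_D u f (y + s *\<^sub>R u)) (at s)" for s
    proof -
      have "((\<lambda>s. y + s *\<^sub>R u) has_derivative (\<lambda>h. h *\<^sub>R u)) (at s)"
        by (auto intro!: derivative_eq_intros)
      from has_derivative_compose[OF this dir_D_works[OF d]]
      have "((\<lambda>s. f (y + s *\<^sub>R u)) has_derivative (\<lambda>h. dir_D (h *\<^sub>R u) f (y + s *\<^sub>R u))) (at s)" .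
      moreover have "(\<lambda>h. dir_D (h *\<^sub>R u) f (y + s *\<^sub>R u)) = (\<lambda>h. dir_D u f (y + s *\<^sub>R u) * h)"
        using linear_scale[OF has_derivative_linear[OF dir_D_works[OF d]]] by (auto simp: mult.commute fun_eq_iff)
      ultimately show ?thesis by (simp add: has_field_derivative_def)
    qed
    obtain z where "z > 0" "z < h" "f (y + h *\<^sub>R u) - f (y + 0 *\<^sub>R u) = (h - 0) * dir_D u f (y + z *\<^sub>R u)"
      using MVT2[where a=0 and b=h and f="\<lambda>s. f (y + s *\<^sub>R u)" and f'="\<lambda>s. dir_D u f (y + s *\<^sub>R u)"] hpos der by blast
    then show ?thesis using C(1)[of "y + z *\<^sub>R u"] that by (simp add: abs_mult mult.commute)
  qed
  have fi: "integrable lborel f"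
    by (rule integrable_compact_support(2)[OF open_UNIV K(1)]) (use cf K in auto)
  have fm: "f \<in> borel_measurable borel" using cf borel_measurable_continuous_onI by blast
  have gm: "dir_D u f \<in> borel_measurable borel" using c borel_measurable_continuous_onI by blast
  note * = integral_directional_derivative_eq_0[OF fm fi gm compact_imp_bounded[OF K(1)] K(2) zero_less_one lip
     AE_I2[OF has_derivative_imp_right_quotient[OF dir_D_works[OF d]]]]
  show "integrable lborel (dir_D u f)" "(\<integral>y. dir_D u f y \<partial>lborel) = 0"
    using * by auto
qed

text \<open>The product is extended by zero; the function \<open>\<theta>\<close> needs to be smooth only near the support of \<open>\<psi>\<close>.\<close>

lemma integration_by_parts_test:
  fixes \<psi> \<theta> :: "'a::euclidean_space \<Rightarrow> real" and T :: "'a \<Rightarrow> 'a \<Rightarrow> real"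
  assumes G: "open G" and K: "compact K" "K \<subseteq> G" "\<And>y. y \<notin> K \<Longrightarrow> \<psi> y = 0"
    and d: "\<And>y. \<psi> differentiable (at y)" and c: "continuous_on UNIV (dir_D u \<psi>)"
    and \<theta>: "\<And>y. y \<in> G \<Longrightarrow> (\<theta> has_derivative T y) (at y)" "continuous_on G (\<lambda>y. T y u)"
  shows "integrable lborel (\<lambda>y. \<psi> y * T y u)" "integrable lborel (\<lambda>y. dir_D u \<psi> y * \<theta> y)"
    "(\<integral>y. \<psi> y * T y u \<partial>lborel) = - (\<integral>y. dir_D u \<psi> y * \<theta> y \<partial>lborel)"
proof -
  have D0: "(\<psi> has_derivative (\<lambda>_. 0)) (at y)" if "y \<notin> K" for y
  proof -
    show ?thesis
      by (rule has_derivative_zero_near[of "- K"])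
         (use that K in \<open>auto simp: compact_imp_closed open_Compl\<close>)
  qed
  have D0': "dir_D u \<psi> y = 0" if "y \<notin> K" for y using dir_D_eqI[OF D0[OF that]] by simp
  have c\<psi>: "continuous_on A \<psi>" for A
    using d differentiable_imp_continuous_within continuous_on_eq_continuous_within continuous_on_subset
    by (metis subset_UNIV)
  have c\<theta>: "continuous_on G \<theta>"
    by (meson \<theta>(1) continuous_at_imp_continuous_on has_derivative_continuous)
  define f where "f y = \<psi> y * \<theta> y" for y
  have df: "(f has_derivative (\<lambda>v. \<psi> y * T y v + dir_D v \<psi> y * \<theta> y)) (at y)" if "y \<in> G" for y
    unfolding f_def by (rule has_derivative_mult[OF dir_D_works[OF d] \<theta>(1)[OF that]])
  have df0: "(f has_derivative (\<lambda>_. 0)) (at y)" if "y \<notin> K" for y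
  proof -
    show ?thesis
      by (rule has_derivative_zero_near[of "- K"])
         (use that K in \<open>auto simp: compact_imp_closed open_Compl f_def\<close>)
  qed
  have dd: "f differentiable (at y)" for y
    using df df0 K(2) by (cases "y \<in> K") (auto simp: differentiable_def)
  have Df: "dir_D u f = (\<lambda>y. \<psi> y * T y u + dir_D u \<psi> y * \<theta> y)"
  proof
    fix y show "dir_D u f y = \<psi> y * T y u + dir_D u \<psi> y * \<theta> y"
    proof (cases "y \<in> K")
      case True then show ?thesis using dir_D_eqI[OF df] K(2) by auto
    next
      case False then show ?thesis using dir_D_eqI[OF df0] K(3) D0' by auto
    qed
  qed
  note 1 = integrable_compact_support[OF G K(1,2), of "\<lambda>y. \<psi> y * T y u"]
  note 2 = integrable_compact_support[OF G K(1,2), of "\<lambda>y. dir_D u \<psi> y * \<theta> y"]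
  have c1: "continuous_on G (\<lambda>y. \<psi> y * T y u)" by (intro continuous_intros c\<psi> \<theta>)
  have c2: "continuous_on G (\<lambda>y. dir_D u \<psi> y * \<theta> y)"
    by (intro continuous_intros c\<theta> continuous_on_subset[OF c]) auto
  show i1: "integrable lborel (\<lambda>y. \<psi> y * T y u)" using 1(2)[OF c1] K(3) by simp
  show i2: "integrable lborel (\<lambda>y. dir_D u \<psi> y * \<theta> y)" using 2(2)[OF c2] D0' by simp
  have "continuous_on UNIV (dir_D u f)"
    unfolding Df by (intro continuous_on_add 1(1)[OF c1] 2(1)[OF c2]) (use K(3) D0' in auto)
  then have "(\<integral>y. dir_D u f y \<partial>lborel) = 0"
    by (intro integral_dir_D_eq_0(2)[OF dd _ K(1)]) (use K(3) in \<open>auto simp: f_def\<close>)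
  then show "(\<integral>y. \<psi> y * T y u \<partial>lborel) = - (\<integral>y. dir_D u \<psi> y * \<theta> y \<partial>lborel)"
    unfolding Df using i1 i2 by simp
qed

section \<open>Functions of class C^k\<close>

text \<open>Symmetry of the second derivatives is built into the class; it survives sums, products and compositions.\<close>

fun Ck :: "nat \<Rightarrow> ('a::real_normed_vector \<Rightarrow> real) \<Rightarrow> bool" where
  "Ck 0 f \<longleftrightarrow> continuous_on UNIV f"
| "Ck (Suc k) f \<longleftrightarrow> (\<forall>x. f differentiable (at x)) \<and> (\<forall>u. Ck k (dir_D u f)) \<and>
     (k \<noteq> 0 \<longrightarrow> (\<forall>u v. dir_D u (dir_D v f) = dir_D v (dir_D u f)))"

lemma Ck_imp_continuous: "Ck k f \<Longrightarrow> continuous_on UNIV f"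
  by (cases k) (auto simp: differentiable_imp_continuous_within continuous_on_eq_continuous_within)

lemma Ck_Suc: "Ck (Suc k) f \<Longrightarrow> Ck k f"
proof (induction k arbitrary: f)
  case 0
  then show ?case using Ck_imp_continuous by fastforce
next
  case (Suc k)
  then show ?case by auto
qed

lemma Ck_le: "Ck k f \<Longrightarrow> j \<le> k \<Longrightarrow> Ck j f"
proof (induction k)
  case (Suc k) then show ?case using Ck_Suc le_Suc_eq by blast
qed auto

lemma dir_D_const: "dir_D u (\<lambda>_. c) = (\<lambda>_. 0)"
  using dir_D_eqI[OF has_derivative_const] by blast

lemma Ck_const: "Ck k (\<lambda>_. c)"
  by (induction k arbitrary: c) (auto simp: dir_D_const)

lemma dir_D_inner: "dir_D u (\<lambda>y. b \<bullet> y) = (\<lambda>_. b \<bullet> u)"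
  by (intro ext dir_D_eqI) (auto intro!: derivative_eq_intros)

lemma Ck_inner: "Ck k (\<lambda>y. b \<bullet> y)"
proof (cases k)
  case (Suc j)
  have "(\<lambda>y. b \<bullet> y) differentiable (at x)" for x
    using bounded_linear_imp_differentiable bounded_linear_inner_right by blast
  then show ?thesis by (simp add: Suc dir_D_inner Ck_const dir_D_const)
qed (auto intro!: continuous_intros)

lemma dir_D_add: "f differentiable (at y) \<Longrightarrow> g differentiable (at y) \<Longrightarrow> dir_D u (\<lambda>y. f y + g y) y = dir_D u f y + dir_D u g y"
  by (intro dir_D_eqI has_derivative_add dir_D_works)

lemma dir_D_mult: "f differentiable (at y) \<Longrightarrow> g differentiable (at y) \<Longrightarrow>
    dir_D u (\<lambda>y. f y * g y) y = f y * dir_D u g y + dir_D u f y * g y"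
  by (intro dir_D_eqI has_derivative_mult dir_D_works)

lemma Ck_add: "Ck k f \<Longrightarrow> Ck k g \<Longrightarrow> Ck k (\<lambda>y. f y + g y)"
proof (induction k arbitrary: f g)
  case 0 then show ?case by (auto intro: continuous_on_add)
next
  case (Suc k)
  have *: "dir_D u (\<lambda>y. f y + g y) = (\<lambda>y. dir_D u f y + dir_D u g y)" for u
    using Suc.prems dir_D_add by (intro ext) (auto simp: dir_D_add)
  have **: "dir_D v (\<lambda>y. dir_D u f y + dir_D u g y) = (\<lambda>y. dir_D v (dir_D u f) y + dir_D v (dir_D u g) y)" if "k \<noteq> 0" for u v
  proof -
    obtain j where j: "k = Suc j" using \<open>k \<noteq> 0\<close> not0_implies_Suc by blast
    show ?thesis using Suc.prems by (intro ext) (auto simp: dir_D_add j)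
  qed
  show ?case using Suc by (auto simp: * ** intro: differentiable_add)
qed

lemma Ck_mult: "Ck k f \<Longrightarrow> Ck k g \<Longrightarrow> Ck k (\<lambda>y. f y * g y)"
proof (induction k arbitrary: f g)
  case 0 then show ?case by (auto intro: continuous_on_mult)
next
  case (Suc k)
  have *: "dir_D u (\<lambda>y. f y * g y) = (\<lambda>y. f y * dir_D u g y + dir_D u f y * g y)" for u
    using Suc.prems by (intro ext) (auto simp: dir_D_mult)
  have **: "dir_D v (\<lambda>y. f y * dir_D u g y + dir_D u f y * g y) =
      (\<lambda>y. f y * dir_D v (dir_D u g) y + dir_D v f y * dir_D u g y + (dir_D u f y * dir_D v g y + dir_D v (dir_D u f) y * g y))" if "k \<noteq> 0" for u v
  proof -
    obtain j where j: "k = Suc j" using \<open>k \<noteq> 0\<close> not0_implies_Suc by blast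
    have a: "f differentiable at y" "g differentiable at y" "dir_D u f differentiable at y" "dir_D u g differentiable at y" for y
      using Suc.prems by (auto simp: j)
    show ?thesis by (intro ext) (simp add: dir_D_add dir_D_mult a differentiable_mult)
  qed
  have ***: "dir_D u (dir_D v f) = dir_D v (dir_D u f)" "dir_D u (dir_D v g) = dir_D v (dir_D u g)" if "k \<noteq> 0" for u v
    using Suc.prems that by auto
  have "Ck k f" "Ck k g" using Suc.prems Ck_Suc by blast+
  then have "Ck k (\<lambda>y. f y * dir_D u g y + dir_D u f y * g y)" for u
    using Suc.IH Suc.prems by (intro Ck_add) auto
  moreover have "dir_D u (dir_D v (\<lambda>y. f y * g y)) = dir_D v (dir_D u (\<lambda>y. f y * g y))" if "k \<noteq> 0" for u v
    unfolding * **[OF that] ***[OF that, of u v] by (simp add: fun_eq_iff algebra_simps)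
  ultimately show ?case using Suc.prems by (auto simp: * intro: differentiable_mult)
qed

lemma dir_D_compose:
  assumes "(h has_real_derivative h') (at (f y))" "f differentiable (at y)"
  shows "dir_D u (\<lambda>y. h (f y)) y = h' * dir_D u f y"
  by (rule dir_D_eqI[OF has_derivative_compose[OF dir_D_works[OF assms(2)] assms(1)[unfolded has_field_derivative_def], simplified]])

lemma Ck_compose:
  fixes h :: "nat \<Rightarrow> real \<Rightarrow> real"
  assumes "\<And>i x. i < k \<Longrightarrow> (h i has_real_derivative h (Suc i) x) (at x)" "continuous_on UNIV (h k)"
    and "Ck k f"
  shows "Ck k (\<lambda>y. h 0 (f y))"
  using assms
proof (induction k arbitrary: h)
  case 0
  then show ?case by (auto intro: continuous_on_compose2[where t=UNIV])
next
  case (Suc k)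
  have df: "f differentiable (at x)" for x using Suc.prems(3) by auto
  have *: "dir_D u (\<lambda>y. h 0 (f y)) = (\<lambda>y. h 1 (f y) * dir_D u f y)" for u
    by (intro ext dir_D_compose) (use Suc.prems(1)[of 0] df in auto)
  have "Ck k (\<lambda>y. h (Suc 0) (f y))"
    by (rule Suc.IH[of "\<lambda>i. h (Suc i)"]) (use Suc.prems Ck_Suc in auto)
  then have 1: "Ck k (\<lambda>y. h 1 (f y) * dir_D u f y)" for u
    using Suc.prems(3) by (intro Ck_mult) auto
  have "dir_D v (\<lambda>y. h 1 (f y) * dir_D u f y) = (\<lambda>y. h 1 (f y) * dir_D v (dir_D u f) y + h 2 (f y) * dir_D v f y * dir_D u f y)"
    if "k \<noteq> 0" for u v
  proof
    fix y
    obtain j where j: "k = Suc j" using \<open>k \<noteq> 0\<close> not0_implies_Suc by blast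
    have h1: "(h 1 has_real_derivative h 2 x) (at x)" for x
      using Suc.prems(1)[of 1 x] j by (simp add: numeral_2_eq_2)
    have d1: "(\<lambda>y. h 1 (f y)) differentiable (at y)"
      using has_derivative_compose[OF dir_D_works[OF df] h1[unfolded has_field_derivative_def]] by (auto simp: differentiable_def)
    have d2: "dir_D u f differentiable (at y)" using Suc.prems(3) j by auto
    show "dir_D v (\<lambda>y. h 1 (f y) * dir_D u f y) y = h 1 (f y) * dir_D v (dir_D u f) y + h 2 (f y) * dir_D v f y * dir_D u f y"
      using dir_D_mult[OF d1 d2, of v] dir_D_compose[OF h1 df, of v] by simp
  qed
  moreover have "(\<lambda>y. h 0 (f y)) differentiable (at x)" for x
    using has_derivative_compose[OF dir_D_works[OF df] Suc.prems(1)[of 0, unfolded has_field_derivative_def]] by (auto simp: differentiable_def)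
  ultimately show ?case using 1 Suc.prems(3) by (auto simp: * fun_eq_iff mult_ac)
qed

section \<open>Potentials for the relaxed system\<close>

lemma dir_D_zero_outside:
  assumes "closed K" "\<And>y. y \<notin> K \<Longrightarrow> f y = 0" "y \<notin> K"
  shows "dir_D u f y = 0"
proof -
  have "(f has_derivative (\<lambda>_. 0)) (at y)"
    by (rule has_derivative_zero_near[of "- K"])
       (use assms in \<open>auto simp: open_Compl\<close>)
  then show ?thesis by (rule dir_D_eqI)
qed

text \<open>Second derivatives of \<open>\<psi>\<close> commute. This is the source of all exact solutions below: every antisymmetrised
  derivative of a potential is divergence free.\<close>

lemma curl_gradient_eq_0:
  fixes \<psi> \<theta> :: "'a::euclidean_space \<Rightarrow> real" and T :: "'a \<Rightarrow> 'a \<Rightarrow> real"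
  assumes G: "open G" and K: "compact K" "K \<subseteq> G" "\<And>y. y \<notin> K \<Longrightarrow> \<psi> y = 0"
    and C: "Ck 2 \<psi>"
    and \<theta>: "\<And>y. y \<in> G \<Longrightarrow> (\<theta> has_derivative T y) (at y)" "\<And>u. continuous_on G (\<lambda>y. T y u)"
  shows "integrable lborel (\<lambda>y. dir_D a \<psi> y * T y b - dir_D b \<psi> y * T y a)" (is ?I)
    "(\<integral>y. (dir_D a \<psi> y * T y b - dir_D b \<psi> y * T y a) \<partial>lborel) = 0" (is ?Z)
proof -
  have C1: "Ck 1 (dir_D u \<psi>)" for u using C by (simp add: numeral_2_eq_2)
  have *: "dir_D b (dir_D a \<psi>) = dir_D a (dir_D b \<psi>)" using C by (simp add: numeral_2_eq_2)
  have d: "dir_D u \<psi> differentiable (at y)" "continuous_on UNIV (dir_D v (dir_D u \<psi>))" for u v y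
    using C1[of u] by auto
  have z: "dir_D u \<psi> y = 0" if "y \<notin> K" for u y
    using dir_D_zero_outside[OF compact_imp_closed[OF K(1)] K(3) that] .
  note 1 = integration_by_parts_test[OF G K(1,2) z d \<theta>]
  have ia: "integrable lborel (\<lambda>y. dir_D a \<psi> y * T y b)" and ib: "integrable lborel (\<lambda>y. dir_D b \<psi> y * T y a)"
    using 1(1) by blast+
  then show ?I by simp
  show ?Z using ia ib 1(3)[of a b] 1(3)[of b a] by (simp add: *)
qed

definition outer :: "real^'n \<Rightarrow> real^'n \<Rightarrow> real^'n^'n" where
  "outer a b = (\<chi> i j. a $ i * b $ j)"

definition contract :: "real^'n^'n \<Rightarrow> (real \<times> (real^'n) \<Rightarrow> real^'n) \<Rightarrow> real" where
  "contract M L = (\<Sum>j\<in>UNIV. column j M \<bullet> L (0, axis j 1))"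

lemma column_add: "column j (A + B) = column j A + column j B"
  by (simp add: column_def vec_eq_iff)

lemma column_scaleR: "column j (c *\<^sub>R A) = c *\<^sub>R column j A"
  by (simp add: column_def vec_eq_iff)

lemma contract_add: "contract (A + B) L = contract A L + contract B L"
  by (simp add: contract_def column_add inner_add_left sum.distrib)

lemma contract_scaleR: "contract (c *\<^sub>R A) L = c * contract A L"
  by (simp add: contract_def column_scaleR sum_distrib_left)

lemma contract_diff: "contract (A - B) L = contract A L - contract B L"
  using contract_add[of A "(-1) *\<^sub>R B" L] contract_scaleR[of "-1" B L] by simp

lemma contract_zero [simp]: "contract 0 L = 0"
  by (simp add: contract_def column_def zero_vec_def[symmetric])

lemma contract_outer:
  assumes "linear L"
  shows "contract (outer a b) L = a \<bullet> L (0, b)"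
proof -
  have b: "(0::real, b) = (\<Sum>j\<in>UNIV. b $ j *\<^sub>R (0, axis j 1))"
    using basis_expansion[of b] by (simp add: scalar_mult_eq_scaleR prod_eq_iff fst_sum snd_sum)
  have c: "column j (outer a b) = b $ j *\<^sub>R a" for j
    by (simp add: column_def outer_def vec_eq_iff)
  show ?thesis
    unfolding b contract_def c
    using linear_scale[OF assms, of "b $ j" "(0, axis j 1)" for j]
    by (simp add: linear_sum[OF assms] inner_sum_right)
qed

lemma transpose_add: "transpose (A + B) = transpose A + transpose (B :: real^'n^'n)"
  by (simp add: transpose_def vec_eq_iff)

lemma transpose_diff: "transpose (A - B) = transpose A - transpose (B :: real^'n^'n)"
  by (simp add: transpose_def vec_eq_iff)

lemma transpose_scaleR: "transpose (c *\<^sub>R A) = c *\<^sub>R transpose (A :: real^'n^'n)"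
  by (simp add: transpose_def vec_eq_iff)

lemma transpose_outer: "transpose (outer a b) = outer b a"
  by (simp add: transpose_def outer_def vec_eq_iff mult.commute)

text \<open>The linear system \<open>div p = 0\<close>, \<open>\<partial>\<^sub>t p + div V = 0\<close> for fields \<open>p\<close> and \<open>V\<close> with compact support in
  \<open>G\<close>. The test functions are arbitrary near the boundary of \<open>G\<close>, where they may jump or blow up.\<close>

definition solves_lin :: "(real \<times> (real^'n)) set \<Rightarrow> (real \<times> (real^'n) \<Rightarrow> real^'n) \<Rightarrow> (real \<times> (real^'n) \<Rightarrow> real^'n^'n) \<Rightarrow> bool" where
  "solves_lin G p V \<longleftrightarrow>
     (\<forall>\<theta> (T :: real \<times> (real^'n) \<Rightarrow> (real \<times> (real^'n)) \<Rightarrow>\<^sub>L real).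
        (\<forall>y\<in>G. (\<theta> has_derivative blinfun_apply (T y)) (at y)) \<and> continuous_on G T \<longrightarrow>
        (\<integral>y. T y (0, p y) \<partial>lborel) = 0) \<and>
     (\<forall>\<theta> (T :: real \<times> (real^'n) \<Rightarrow> (real \<times> (real^'n)) \<Rightarrow>\<^sub>L (real^'n)).
        (\<forall>y\<in>G. (\<theta> has_derivative blinfun_apply (T y)) (at y)) \<and> continuous_on G T \<longrightarrow>
        (\<integral>y. (p y \<bullet> T y (1, 0) + contract (V y) (T y)) \<partial>lborel) = 0)"

text \<open>For a single second-order potential \<open>\<phi>\<close> the fields \<open>p\<close> and \<open>V\<close> below are combinations of the
  antisymmetric expressions of the previous lemma. When \<open>\<phi>\<close> oscillates in a direction \<open>\<eta>\<close> with
  \<open>\<eta> \<bullet> (0, w) = \<eta> \<bullet> (1, \<sigma>) = 0\<close>, only the first term of each survives at leading order.\<close>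

definition wave_p :: "(real \<times> (real^'n) \<Rightarrow> real) \<Rightarrow> real^'n \<Rightarrow> real^'n \<Rightarrow> real \<times> (real^'n) \<Rightarrow> real^'n" where
  "wave_p \<phi> w \<xi> y = dir_D (0, \<xi>) (dir_D (0, \<xi>) \<phi>) y *\<^sub>R w - dir_D (0, w) (dir_D (0, \<xi>) \<phi>) y *\<^sub>R \<xi>"

definition wave_V :: "(real \<times> (real^'n) \<Rightarrow> real) \<Rightarrow> real^'n \<Rightarrow> real^'n \<Rightarrow> real^'n \<Rightarrow> real \<times> (real^'n) \<Rightarrow> real^'n^'n" where
  "wave_V \<phi> w \<sigma> \<xi> y =
      dir_D (0, \<xi>) (dir_D (0, \<xi>) \<phi>) y *\<^sub>R (outer w \<sigma> + outer \<sigma> w)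
    - dir_D (0, \<xi>) (dir_D (1, \<sigma>) \<phi>) y *\<^sub>R (outer w \<xi> + outer \<xi> w)
    - dir_D (0, w) (dir_D (0, \<xi>) \<phi>) y *\<^sub>R (outer \<xi> \<sigma> + outer \<sigma> \<xi>)
    + (2 * dir_D (0, w) (dir_D (1, \<sigma>) \<phi>) y) *\<^sub>R outer \<xi> \<xi>"

lemma wave_solves_lin:
  fixes \<phi> :: "real \<times> (real^'n) \<Rightarrow> real"
  assumes C: "Ck 3 \<phi>" and K: "compact K" "\<And>y. y \<notin> K \<Longrightarrow> \<phi> y = 0" and G: "open G" "K \<subseteq> G"
  shows "solves_lin G (wave_p \<phi> w \<xi>) (wave_V \<phi> w \<sigma> \<xi>)"
proof -
  have C2: "Ck 2 (dir_D u \<phi>)" for u using C unfolding numeral_3_eq_3 numeral_2_eq_2 Ck.simps(2)[of "Suc (Suc 0)"] by blast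
  have com: "dir_D u (dir_D v \<phi>) = dir_D v (dir_D u \<phi>)" for u v using C unfolding numeral_3_eq_3 Ck.simps(2)[of "Suc (Suc 0)"] by blast
  have z: "dir_D u \<phi> y = 0" if "y \<notin> K" for u y
    using dir_D_zero_outside[OF compact_imp_closed[OF K(1)] K(2) that] .
  have zz: "dir_D v (dir_D u \<phi>) y = 0" if "y \<notin> K" for u v y
    using dir_D_zero_outside[OF compact_imp_closed[OF K(1)] z that] .
  note cg = curl_gradient_eq_0[OF G(1) K(1) G(2) z C2]
  show ?thesis
    unfolding solves_lin_def
  proof (intro conjI allI impI, goal_cases)
    case (1 \<theta> T)
    have c: "continuous_on G (\<lambda>y. T y u)" for u
      using 1 by (auto intro!: continuous_intros)
    have "T y (0, wave_p \<phi> w \<xi> y) = dir_D (0, \<xi>) (dir_D (0, \<xi>) \<phi>) y * T y (0, w) - dir_D (0, w) (dir_D (0, \<xi>) \<phi>) y * T y (0, \<xi>)" for y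
    proof -
      have "(0::real, wave_p \<phi> w \<xi> y) = dir_D (0, \<xi>) (dir_D (0, \<xi>) \<phi>) y *\<^sub>R (0, w) - dir_D (0, w) (dir_D (0, \<xi>) \<phi>) y *\<^sub>R (0, \<xi>)"
        by (simp add: wave_p_def)
      then show ?thesis by (simp only: blinfun.diff_right blinfun.scaleR_right real_scaleR_def)
    qed
    then show ?case using cg(2)[of \<theta> "\<lambda>y. blinfun_apply (T y)" "(0,\<xi>)" "(0,\<xi>)" "(0,w)"] 1 c by simp
  next
    case (2 \<theta> T)
    have c: "continuous_on G (\<lambda>y. a \<bullet> T y u)" for u a
      using 2 by (auto intro!: continuous_intros)
    have d: "((\<lambda>y. a \<bullet> \<theta> y) has_derivative (\<lambda>u. a \<bullet> T y u)) (at y)" if "y \<in> G" for a y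
      using 2 that by (auto intro!: derivative_eq_intros)
    let ?X = "(0::real,\<xi>)" and ?W = "(0::real,w)" and ?S = "(1::real,\<sigma>)"
    define f where "f u a b e y = dir_D a (dir_D u \<phi>) y * (e \<bullet> T y b) - dir_D b (dir_D u \<phi>) y * (e \<bullet> T y a)" for u a b e y
    have f: "integrable lborel (f u a b e)" "(\<integral>y. f u a b e y \<partial>lborel) = 0" for u a b e
      unfolding f_def
      using cg(1)[of "\<lambda>y. e \<bullet> \<theta> y" "\<lambda>y v. e \<bullet> T y v"] cg(2)[of "\<lambda>y. e \<bullet> \<theta> y" "\<lambda>y v. e \<bullet> T y v"] d c by blast+
    have "wave_p \<phi> w \<xi> y \<bullet> T y (1, 0) + contract (wave_V \<phi> w \<sigma> \<xi> y) (T y) =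
       f ?X ?X ?S w y + f ?X ?X ?W \<sigma> y - f ?S ?X ?W \<xi> y - f ?W ?X ?S \<xi> y" for y
    proof -
      have S: "T y (1, \<sigma>) = T y (1, 0) + T y (0, \<sigma>)"
        by (simp add: blinfun.add_right[symmetric])
      have L: "linear (blinfun_apply (T y))" using bounded_linear.linear blinfun.bounded_linear_right by blast
      show ?thesis
        unfolding f_def wave_p_def wave_V_def contract_add contract_diff contract_scaleR contract_outer[OF L] S
          com[of "(0,w)" "(0,\<xi>)"] com[of "(1,\<sigma>)" "(0,\<xi>)"] com[of "(1,\<sigma>)" "(0,w)"]
        by (simp add: inner_diff_left inner_add_right algebra_simps)
    qed
    then show ?case using f by simp
  qed
qed

section \<open>Localised plane waves\<close>

lemma DERIV_pospart_power:
  "((\<lambda>x::real. (max 0 x) ^ Suc (Suc n)) has_real_derivative real (Suc (Suc n)) * (max 0 x) ^ Suc n) (at x)"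
proof -
  consider "x > 0" | "x < 0" | "x = 0" by linarith
  then show ?thesis
  proof cases
    case 1
    have "((\<lambda>x::real. x ^ Suc (Suc n)) has_real_derivative real (Suc (Suc n)) * (max 0 x) ^ Suc n) (at x)"
      using DERIV_pow[of "Suc (Suc n)" x] 1 by simp
    then show ?thesis
      by (rule has_field_derivative_transform_within_open[of _ _ _ "{0<..}"]) (use 1 in auto)
  next
    case 2
    have "((\<lambda>x::real. 0) has_real_derivative real (Suc (Suc n)) * (max 0 x) ^ Suc n) (at x)"
      using 2 by auto
    then show ?thesis
      by (rule has_field_derivative_transform_within_open[of _ _ _ "{..<0}"]) (use 2 in auto)
  next
    case 3
    have "((\<lambda>h::real. (max 0 h) ^ Suc (Suc n) / h) \<longlongrightarrow> 0) (at 0)"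
    proof (rule Lim_null_comparison)
      show "\<forall>\<^sub>F h::real in at 0. norm ((max 0 h) ^ Suc (Suc n) / h) \<le> \<bar>h\<bar> ^ Suc n"
        by (rule always_eventually) (auto simp: max_def abs_mult power_abs intro: mult_nonpos_nonneg)
      show "((\<lambda>h::real. \<bar>h\<bar> ^ Suc n) \<longlongrightarrow> 0) (at 0)"
        by (auto intro!: tendsto_eq_intros)
    qed
    then show ?thesis using 3 by (simp add: DERIV_def)
  qed
qed

lemma Ck_sum: "finite A \<Longrightarrow> (\<And>i. i \<in> A \<Longrightarrow> Ck k (f i)) \<Longrightarrow> Ck k (\<lambda>y. \<Sum>i\<in>A. f i y)"
  by (induction A rule: finite_induct) (auto simp: Ck_const intro: Ck_add)

lemma Ck_norm_sq: "Ck k (\<lambda>y::'a::euclidean_space. (norm (y - a))\<^sup>2)"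
proof -
  have "Ck k (\<lambda>y. (b \<bullet> y + - (b \<bullet> a)) * (b \<bullet> y + - (b \<bullet> a)))" for b
    by (intro Ck_mult Ck_add Ck_inner Ck_const)
  then have "Ck k (\<lambda>y. \<Sum>b\<in>Basis. (b \<bullet> y + - (b \<bullet> a)) * (b \<bullet> y + - (b \<bullet> a)))"
    by (intro Ck_sum) auto
  moreover have "(\<lambda>y. \<Sum>b\<in>Basis. (b \<bullet> y + - (b \<bullet> a)) * (b \<bullet> y + - (b \<bullet> a))) = (\<lambda>y. (norm (y - a))\<^sup>2)"
  proof
    fix y
    have "(norm (y - a))\<^sup>2 = (\<Sum>b\<in>Basis. ((y - a) \<bullet> b) * ((y - a) \<bullet> b))"
      unfolding power2_norm_eq_inner by (rule euclidean_inner)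
    then show "(\<Sum>b\<in>Basis. (b \<bullet> y + - (b \<bullet> a)) * (b \<bullet> y + - (b \<bullet> a))) = (norm (y - a))\<^sup>2"
      by (simp add: inner_diff_right inner_commute)
  qed
  ultimately show ?thesis by simp
qed

text \<open>The fourth power makes the function of class \<open>C\<^sup>3\<close>, as the potentials require.\<close>

definition bump :: "'a::euclidean_space \<Rightarrow> real \<Rightarrow> 'a \<Rightarrow> real" where
  "bump a r y = (max 0 (1 - (norm (y - a))\<^sup>2 / r\<^sup>2)) ^ 4"

lemma Ck_bump: "Ck 3 (bump a r)"
proof -
  define h :: "nat \<Rightarrow> real \<Rightarrow> real" where
    "h i = (case i of 0 \<Rightarrow> (\<lambda>x. (max 0 x) ^ 4) | Suc 0 \<Rightarrow> (\<lambda>x. 4 * (max 0 x) ^ 3) |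
       Suc (Suc 0) \<Rightarrow> (\<lambda>x. 12 * (max 0 x)^2) | _ \<Rightarrow> (\<lambda>x. 24 * max 0 x))" for i
  have d: "(h i has_real_derivative h (Suc i) x) (at x)" if "i < 3" for i x
  proof -
    have "i = 0 \<or> i = 1 \<or> i = 2" using that by linarith
    then consider "i = 0" | "i = 1" | "i = 2" by blast
    then show ?thesis
    proof cases
      case 1 then show ?thesis using DERIV_pospart_power[of 2 x] by (simp add: h_def numeral_eq_Suc)
    next
      case 2 then show ?thesis using DERIV_cmult[OF DERIV_pospart_power[of 1 x], of 4] by (simp add: h_def numeral_eq_Suc)
    next
      case 3 then show ?thesis using DERIV_cmult[OF DERIV_pospart_power[of 0 x], of 12] by (simp add: h_def numeral_eq_Suc)
    qed
  qed
  have c: "continuous_on UNIV (h 3)" by (simp add: h_def numeral_3_eq_3) (intro continuous_intros)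
  have f: "Ck 3 (\<lambda>y. 1 + (- 1 / r\<^sup>2) * (norm (y - a))\<^sup>2)"
    by (intro Ck_add Ck_mult Ck_const Ck_norm_sq)
  have "Ck 3 (\<lambda>y. h 0 (1 + (- 1 / r\<^sup>2) * (norm (y - a))\<^sup>2))"
    by (rule Ck_compose[where k=3, OF d c f])
  then show ?thesis by (simp add: h_def bump_def[abs_def])
qed

lemma bump_outside: "r > 0 \<Longrightarrow> y \<notin> cball a r \<Longrightarrow> bump a r y = 0"
proof -
  assume r: "r > 0" "y \<notin> cball a r"
  then have "norm (y - a) > r" by (simp add: dist_norm norm_minus_commute)
  then have "(norm (y - a))\<^sup>2 \<ge> r\<^sup>2" using r by (intro power_mono) auto
  then show ?thesis using r by (simp add: bump_def max_def field_simps)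
qed

lemma bump_range: "0 \<le> bump a r y" "bump a r y \<le> 1"
  by (auto simp: bump_def intro!: power_le_one)

lemma bump_ge: "r > 0 \<Longrightarrow> y \<in> ball a (r / 2) \<Longrightarrow> bump a r y \<ge> (3/4) ^ 4"
proof -
  assume r: "r > 0" "y \<in> ball a (r/2)"
  then have "norm (y - a) \<le> r/2" by (simp add: dist_norm norm_minus_commute)
  then have "(norm (y - a))\<^sup>2 \<le> (r/2)\<^sup>2" using r by (intro power_mono) auto
  then have "(norm (y - a))\<^sup>2 / r\<^sup>2 \<le> 1/4" using r by (simp add: field_simps power2_eq_square)
  then have m: "3/4 \<le> max 0 (1 - (norm (y - a))\<^sup>2 / r\<^sup>2)" by linarith
  show ?thesis unfolding bump_def by (rule power_mono[OF m]) simp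
qed

lemma Ck_phase: "Ck k (\<lambda>y::'a::euclidean_space. c * cos (\<kappa> * (\<eta> \<bullet> y) + b))"
proof -
  define h where "h i s = c * \<kappa> ^ i * cos (\<kappa> * s + b + real i * (pi/2))" for i s
  have "(h i has_real_derivative h (Suc i) x) (at x)" for i x
  proof -
    have e: "cos (\<kappa> * x + b + real (Suc i) * (pi/2)) = - sin (\<kappa> * x + b + real i * (pi/2))"
    proof -
      have "\<kappa> * x + b + real (Suc i) * (pi/2) = (\<kappa> * x + b + real i * (pi/2)) + pi/2"
        by (simp add: algebra_simps add_divide_distrib)
      then show ?thesis by (simp only: cos_add) simp
    qed
    have d: "((\<lambda>s. \<kappa> * s + b + real i * (pi/2)) has_real_derivative \<kappa>) (at x)"
      by (auto intro!: derivative_eq_intros)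
    show ?thesis unfolding h_def e
      using DERIV_cmult[OF DERIV_chain'[OF d DERIV_cos], of "c * \<kappa> ^ i"] by (simp add: mult_ac)
  qed
  then have "Ck k (\<lambda>y. h 0 (\<eta> \<bullet> y))"
    by (intro Ck_compose[where h=h] Ck_inner) (auto intro!: continuous_intros simp: h_def[abs_def])
  then show ?thesis by (simp add: h_def)
qed

lemma dir_D_phase: "dir_D v (\<lambda>y::'a::euclidean_space. c * cos (\<kappa> * (\<eta> \<bullet> y) + b)) =
    (\<lambda>y. - c * (\<eta> \<bullet> v) * \<kappa> * sin (\<kappa> * (\<eta> \<bullet> y) + b))"
  by (intro ext dir_D_eqI) (auto intro!: derivative_eq_intros simp: mult_ac)

lemma second_D_phase: "dir_D u (dir_D v (\<lambda>y::'a::euclidean_space. c * cos (\<kappa> * (\<eta> \<bullet> y) + b))) =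
    (\<lambda>y. - c * \<kappa>\<^sup>2 * (\<eta> \<bullet> u) * (\<eta> \<bullet> v) * cos (\<kappa> * (\<eta> \<bullet> y) + b))"
  unfolding dir_D_phase
  by (intro ext dir_D_eqI) (auto intro!: derivative_eq_intros simp: mult_ac power2_eq_square)

lemma second_D_mult:
  assumes "Ck 2 f" "Ck 2 g"
  shows "dir_D u (dir_D v (\<lambda>y. f y * g y)) y =
     f y * dir_D u (dir_D v g) y + dir_D u f y * dir_D v g y + (dir_D v f y * dir_D u g y + dir_D u (dir_D v f) y * g y)"
proof -
  have a: "f differentiable at y" "g differentiable at y" "dir_D v f differentiable at y" "dir_D v g differentiable at y" for y
    using assms by (auto simp: numeral_2_eq_2)
  have "dir_D v (\<lambda>y. f y * g y) = (\<lambda>y. f y * dir_D v g y + dir_D v f y * g y)"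
    by (intro ext dir_D_mult a)
  then show ?thesis
    by (simp add: dir_D_add dir_D_mult a differentiable_mult)
qed

lemma bounded_second_D_bump:
  "\<exists>B\<ge>0. \<forall>u\<in>F. \<forall>v\<in>F. \<forall>y. \<bar>dir_D u (bump a r) y\<bar> \<le> B \<and> \<bar>dir_D u (dir_D v (bump a r)) y\<bar> \<le> B"
  if "finite F" "r > 0" for a :: "'a::euclidean_space"
proof -
  have bd: "\<exists>C. \<forall>y. \<bar>f y\<bar> \<le> C" if "continuous_on UNIV f" "\<And>y. y \<notin> cball a r \<Longrightarrow> f y = 0" for f :: "'a \<Rightarrow> real"
  proof -
    have "bounded (f ` cball a r)"
      by (intro compact_imp_bounded compact_continuous_image continuous_on_subset[OF that(1)]) auto
    then obtain C where C0: "\<And>y. y \<in> cball a r \<Longrightarrow> \<bar>f y\<bar> \<le> C"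
      unfolding bounded_iff by (metis (no_types) imageI real_norm_def)
    then have "\<bar>f y\<bar> \<le> max C 0" for y using that(2)[of y] C0[of y] unfolding le_max_iff_disj by (cases "y \<in> cball a r") auto
    then show ?thesis by blast
  qed
  have C: "Ck 2 (dir_D u (bump a r))" for u
    using Ck_bump[of a r] unfolding numeral_3_eq_3 numeral_2_eq_2 Ck.simps(2)[of "Suc (Suc 0)"] by blast
  have z: "dir_D u (bump a r) y = 0" if "y \<notin> cball a r" for u y
    by (rule dir_D_zero_outside[of "cball a r"]) (use that bump_outside \<open>r > 0\<close> in auto)
  have zz: "dir_D v (dir_D u (bump a r)) y = 0" if "y \<notin> cball a r" for u v y
    by (rule dir_D_zero_outside[of "cball a r"]) (use that z in auto)
  have 1: "\<exists>C. \<forall>y. \<bar>dir_D u (bump a r) y\<bar> \<le> C" for u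
    by (rule bd) (use Ck_imp_continuous[OF C] z in auto)
  have "Ck 1 (dir_D v (dir_D u (bump a r)))" for u v using C[of u] by (simp add: numeral_2_eq_2)
  then have 2: "\<exists>C. \<forall>y. \<bar>dir_D v (dir_D u (bump a r)) y\<bar> \<le> C" for u v
    by (rule bd[OF Ck_imp_continuous zz])
  obtain C1 where C1: "\<And>u y. \<bar>dir_D u (bump a r) y\<bar> \<le> C1 u" using 1 by metis
  define C2 where "C2 u v = (SOME C. \<forall>y. \<bar>dir_D v (dir_D u (bump a r)) y\<bar> \<le> C)" for u v
  have C2: "\<bar>dir_D v (dir_D u (bump a r)) y\<bar> \<le> C2 u v" for u v y
    using someI_ex[OF 2[of v u]] unfolding C2_def by blast
  define B where "B = (\<Sum>u\<in>F. \<bar>C1 u\<bar>) + (\<Sum>(u,v)\<in>F \<times> F. \<bar>C2 u v\<bar>)"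
  have s: "(\<Sum>u\<in>F. \<bar>C1 u\<bar>) \<ge> 0" "(\<Sum>(u,v)\<in>F \<times> F. \<bar>C2 u v\<bar>) \<ge> 0" by (auto intro!: sum_nonneg)
  have "C1 u \<le> B" if "u \<in> F" for u
    using member_le_sum[of u F "\<lambda>u. \<bar>C1 u\<bar>"] that \<open>finite F\<close> s by (force simp: B_def)
  moreover have "C2 u v \<le> B" if "u \<in> F" "v \<in> F" for u v
  proof -
    have "(\<lambda>(u,v). \<bar>C2 u v\<bar>) (u,v) \<le> (\<Sum>(u,v)\<in>F \<times> F. \<bar>C2 u v\<bar>)"
      by (rule member_le_sum) (use that \<open>finite F\<close> in auto)
    then have "\<bar>C2 u v\<bar> \<le> (\<Sum>(u,v)\<in>F \<times> F. \<bar>C2 u v\<bar>)" by simp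
    then show ?thesis using s abs_ge_self[of "C2 u v"] unfolding B_def by linarith
  qed
  moreover have "B \<ge> 0" using s by (simp add: B_def)
  ultimately show ?thesis using order_trans[OF C1] order_trans[OF C2] by (intro exI[of _ B]) blast
qed

text \<open>If a derivative falls on the bump, a power of the frequency \<open>\<kappa>\<close> is lost; so all terms but the one with
  both derivatives on the cosine are small for large \<open>\<kappa>\<close>.\<close>

lemma oscillation_second_D:
  fixes a :: "'a::euclidean_space"
  assumes F: "finite F" and r: "r > 0" and \<epsilon>: "\<epsilon> > 0"
  shows "\<exists>\<kappa>>0. \<forall>b. \<forall>u\<in>F. \<forall>v\<in>F. \<forall>y.
    \<bar>dir_D u (dir_D v (\<lambda>y. bump a r y * ((- 1 / \<kappa>\<^sup>2) * cos (\<kappa> * (\<eta> \<bullet> y) + b)))) y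
      - bump a r y * cos (\<kappa> * (\<eta> \<bullet> y) + b) * (\<eta> \<bullet> u) * (\<eta> \<bullet> v)\<bar> \<le> \<epsilon>"
proof -
  obtain B where B: "B \<ge> 0" "\<And>u y. u \<in> F \<Longrightarrow> \<bar>dir_D u (bump a r) y\<bar> \<le> B"
    "\<And>u v y. u \<in> F \<Longrightarrow> v \<in> F \<Longrightarrow> \<bar>dir_D u (dir_D v (bump a r)) y\<bar> \<le> B"
    using bounded_second_D_bump[OF F r, of a] by blast
  define E where "E = (\<Sum>u\<in>F. \<bar>\<eta> \<bullet> u\<bar>)"
  have E: "\<bar>\<eta> \<bullet> u\<bar> \<le> E" if "u \<in> F" for u
    unfolding E_def using member_le_sum[of u F "\<lambda>u. \<bar>\<eta> \<bullet> u\<bar>"] that F by simp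
  have E0: "E \<ge> 0" by (auto simp: E_def intro: sum_nonneg)
  define \<kappa> where "\<kappa> = max 1 ((B * E + B * E + B) / \<epsilon>)"
  have \<kappa>: "\<kappa> \<ge> 1" "(B * E + B * E + B) / \<kappa> \<le> \<epsilon>"
  proof -
    show k1: "\<kappa> \<ge> 1" by (simp add: \<kappa>_def)
    have "(B * E + B * E + B) / \<epsilon> \<le> \<kappa>" by (simp add: \<kappa>_def)
    then show "(B * E + B * E + B) / \<kappa> \<le> \<epsilon>" using \<epsilon> k1 by (simp add: field_simps)
  qed
  have C2: "Ck 2 (bump a r)" by (rule Ck_le[OF Ck_bump]) simp
  show ?thesis
  proof (intro exI[of _ \<kappa>] conjI allI ballI)
    show "\<kappa> > 0" using \<kappa> by simp
    fix b u v y assume uv: "u \<in> F" "v \<in> F"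
    define c where "c = - 1 / \<kappa>\<^sup>2"
    have ck: "c * \<kappa>\<^sup>2 = -1" using \<kappa>(1) by (simp add: c_def)
    have ck1: "\<bar>c * \<kappa>\<bar> = 1 / \<kappa>" using \<kappa>(1) by (simp add: c_def power2_eq_square abs_mult)
    have c1: "\<bar>c\<bar> \<le> 1 / \<kappa>" using \<kappa>(1) by (simp add: c_def power2_eq_square field_simps)
    let ?z = "\<kappa> * (\<eta> \<bullet> y) + b"
    have t: "\<bar>dir_D p (bump a r) y * (- c * (\<eta> \<bullet> q) * \<kappa> * sin ?z)\<bar> \<le> B * E / \<kappa>" if "p \<in> F" "q \<in> F" for p q
    proof -
      have "\<bar>dir_D p (bump a r) y * (- c * (\<eta> \<bullet> q) * \<kappa> * sin ?z)\<bar> = \<bar>dir_D p (bump a r) y\<bar> * (\<bar>\<eta> \<bullet> q\<bar> * \<bar>sin ?z\<bar>) * \<bar>c * \<kappa>\<bar>"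
        by (simp add: abs_mult)
      also have "\<dots> \<le> B * (E * 1) * (1 / \<kappa>)"
      proof -
        have "\<bar>\<eta> \<bullet> q\<bar> * \<bar>sin ?z\<bar> \<le> E * 1" by (rule mult_mono[OF E[OF that(2)] abs_sin_le_one E0]) simp
        then have "\<bar>dir_D p (bump a r) y\<bar> * (\<bar>\<eta> \<bullet> q\<bar> * \<bar>sin ?z\<bar>) \<le> B * (E * 1)"
          by (rule mult_mono[OF B(2)[OF that(1)] _ B(1)]) simp
        then show ?thesis unfolding ck1 by (rule mult_right_mono) (use \<kappa>(1) in simp)
      qed
      finally show ?thesis by simp
    qed
    have t3: "\<bar>dir_D u (dir_D v (bump a r)) y * (c * cos ?z)\<bar> \<le> B / \<kappa>"
    proof -
      have "\<bar>dir_D u (dir_D v (bump a r)) y * (c * cos ?z)\<bar> = \<bar>dir_D u (dir_D v (bump a r)) y\<bar> * (\<bar>c\<bar> * \<bar>cos ?z\<bar>)"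
        by (simp add: abs_mult)
      also have "\<dots> \<le> B * ((1 / \<kappa>) * 1)"
      proof -
        have "\<bar>c\<bar> * \<bar>cos ?z\<bar> \<le> (1 / \<kappa>) * 1" by (rule mult_mono[OF c1 abs_cos_le_one]) (use \<kappa>(1) in auto)
        then show ?thesis by (rule mult_mono[OF B(3)[OF uv] _ B(1)]) simp
      qed
      finally show ?thesis by simp
    qed
    have "dir_D u (dir_D v (\<lambda>y. bump a r y * (c * cos (\<kappa> * (\<eta> \<bullet> y) + b)))) y
       = bump a r y * (- c * \<kappa>\<^sup>2 * (\<eta> \<bullet> u) * (\<eta> \<bullet> v) * cos ?z)
         + dir_D u (bump a r) y * (- c * (\<eta> \<bullet> v) * \<kappa> * sin ?z)
         + (dir_D v (bump a r) y * (- c * (\<eta> \<bullet> u) * \<kappa> * sin ?z) + dir_D u (dir_D v (bump a r)) y * (c * cos ?z))"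
      using second_D_mult[OF C2 Ck_phase[of 2 c \<kappa> \<eta> b], of u v y] by (simp only: dir_D_phase second_D_phase[unfolded dir_D_phase])
    moreover have "bump a r y * (- c * \<kappa>\<^sup>2 * (\<eta> \<bullet> u) * (\<eta> \<bullet> v) * cos ?z) = bump a r y * cos ?z * (\<eta> \<bullet> u) * (\<eta> \<bullet> v)"
      using ck by simp
    moreover have "B * E / \<kappa> + B * E / \<kappa> + B / \<kappa> \<le> \<epsilon>" using \<kappa>(2) by (simp add: add_divide_distrib)
    ultimately show "\<bar>dir_D u (dir_D v (\<lambda>y. bump a r y * ((- 1 / \<kappa>\<^sup>2) * cos (\<kappa> * (\<eta> \<bullet> y) + b)))) y
      - bump a r y * cos ?z * (\<eta> \<bullet> u) * (\<eta> \<bullet> v)\<bar> \<le> \<epsilon>"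
      using t[OF uv] t[OF uv(2,1)] t3 unfolding c_def[symmetric] by linarith
  qed
qed

definition wave_gain :: "nat \<Rightarrow> real" where
  "wave_gain d = (3/4) ^ 8 / 2 ^ d / 4"

lemma wave_gain_pos: "wave_gain d > 0"
  by (simp add: wave_gain_def)

lemma content_half_ball:
  "r \<ge> 0 \<Longrightarrow> measure lborel (ball (a::'a::euclidean_space) (r/2)) = measure lborel (ball a r) / 2 ^ DIM('a)"
  by (simp add: content_ball power_divide)

text \<open>The squares of sine and cosine add up to one, so one of the two phases carries at least half of
  \<open>\<integral> bump\<^sup>2\<close>.\<close>

lemma phase_with_large_energy:
  fixes a :: "'a::euclidean_space"
  assumes r: "r > 0"
  shows "\<exists>b. integrable lborel (\<lambda>y. (bump a r y * cos (\<kappa> * (\<eta> \<bullet> y) + b))\<^sup>2) \<and>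
     (\<integral>y. (bump a r y * cos (\<kappa> * (\<eta> \<bullet> y) + b))\<^sup>2 \<partial>lborel) \<ge> 2 * wave_gain DIM('a) * measure lborel (ball a r)"
proof -
  let ?s = "\<lambda>b y. (bump a r y * cos (\<kappa> * (\<eta> \<bullet> y) + b))\<^sup>2"
  have cb: "continuous_on UNIV (bump a r)" using Ck_imp_continuous Ck_bump by blast
  have i: "integrable lborel (?s b)" for b
    by (rule integrable_compact_support(2)[OF open_UNIV compact_cball[of a r]])
       (use cb bump_outside[OF r] in \<open>auto intro!: continuous_intros\<close>)
  have e: "?s 0 y + ?s (- (pi/2)) y = (bump a r y)\<^sup>2" for y
  proof -
    have "cos (\<kappa> * (\<eta> \<bullet> y) + - (pi/2)) = sin (\<kappa> * (\<eta> \<bullet> y))"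
      by (simp add: cos_diff)
    then show ?thesis by (simp add: power_mult_distrib distrib_left[symmetric])
  qed
  have ib: "integrable lborel (\<lambda>y. (bump a r y)\<^sup>2)"
    by (rule integrable_compact_support(2)[OF open_UNIV compact_cball[of a r]])
       (use cb bump_outside[OF r] in \<open>auto intro!: continuous_intros\<close>)
  have "(\<integral>y. (3/4)^8 * indicator (ball a (r/2)) y \<partial>lborel) \<le> (\<integral>y. (bump a r y)\<^sup>2 \<partial>lborel)"
  proof (rule integral_mono)
    show "integrable lborel (\<lambda>y. (3/4)^8 * indicator (ball a (r/2)) y :: real)"
      using bounded_ball[of a "r/2"] by (intro integrable_const_indicator) auto
    show "(3/4)^8 * indicator (ball a (r/2)) y \<le> (bump a r y)\<^sup>2" for y
    proof (cases "y \<in> ball a (r/2)")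
      case True
      have "((3/4::real)^4)\<^sup>2 \<le> (bump a r y)\<^sup>2"
        by (rule power_mono[OF bump_ge[OF r True]]) simp
      then show ?thesis using True by (simp add: power_mult[symmetric])
    qed auto
  qed (rule ib)
  moreover have "(\<integral>y. (3/4)^8 * indicator (ball a (r/2)) y \<partial>lborel) = 4 * wave_gain DIM('a) * measure lborel (ball a r)"
    using r by (simp add: content_half_ball wave_gain_def)
  moreover have "(\<integral>y. (bump a r y)\<^sup>2 \<partial>lborel) = (\<integral>y. ?s 0 y \<partial>lborel) + (\<integral>y. ?s (- (pi/2)) y \<partial>lborel)"
    unfolding e[symmetric] by (rule Bochner_Integration.integral_add[OF i i])
  ultimately have "2 * wave_gain DIM('a) * measure lborel (ball a r) \<le> (\<integral>y. ?s 0 y \<partial>lborel) \<or>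
     2 * wave_gain DIM('a) * measure lborel (ball a r) \<le> (\<integral>y. ?s (- (pi/2)) y \<partial>lborel)" by linarith
  then show ?thesis using i by blast
qed

text \<open>The values of the wave stay \<open>\<epsilon>\<close>-close to the segment through \<open>(w, w \<otimes> \<sigma> + \<sigma> \<otimes> w)\<close>, and its energy is a
  fixed fraction of the volume of the ball. In two or more dimensions there is a unit vector \<open>\<xi>\<close> orthogonal to \<open>w\<close>,
  which is what the potential needs.\<close>

lemma localised_wave:
  fixes a :: "real \<times> (real^'n)" and w \<sigma> :: "real^'n"
  assumes N: "CARD('n) \<ge> 2" and r: "r > 0" and w: "norm w = 1" and \<epsilon>: "\<epsilon> > 0"
  shows "\<exists>p V. continuous_on UNIV p \<and> continuous_on UNIV V \<and>
    (\<forall>y. y \<notin> cball a r \<longrightarrow> p y = 0 \<and> V y = 0) \<and>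
    (\<forall>G. open G \<longrightarrow> cball a r \<subseteq> G \<longrightarrow> solves_lin G p V) \<and>
    (\<forall>y. transpose (V y) = V y) \<and>
    (\<forall>y. \<exists>s. \<bar>s\<bar> \<le> 1 \<and> norm (p y - s *\<^sub>R w) \<le> \<epsilon> \<and> norm (V y - s *\<^sub>R (outer w \<sigma> + outer \<sigma> w)) \<le> \<epsilon>) \<and>
    (\<integral>y. (norm (p y))\<^sup>2 \<partial>lborel) \<ge> wave_gain DIM(real \<times> (real^'n)) * measure lborel (ball a r)"
proof -
  let ?g = "wave_gain DIM(real \<times> (real^'n))"
  obtain \<xi>0 :: "real^'n" where \<xi>0: "\<xi>0 \<noteq> 0" "orthogonal w \<xi>0"
    using orthogonal_to_vector_exists[of w] N by (auto simp: DIM_cart)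
  define \<xi> where "\<xi> = \<xi>0 /\<^sub>R norm \<xi>0"
  have \<xi>: "norm \<xi> = 1" "w \<bullet> \<xi> = 0" using \<xi>0 by (auto simp: \<xi>_def orthogonal_def)
  \<comment> \<open>The temporal frequency is chosen so that the wave is transported with velocity \<open>\<sigma>\<close>.\<close>
  define \<eta> where "\<eta> = (- (\<sigma> \<bullet> \<xi>), \<xi>)"
  have \<eta>: "\<eta> \<bullet> (0, \<xi>) = 1" "\<eta> \<bullet> (0, w) = 0" "\<eta> \<bullet> (1, \<sigma>) = 0"
    using \<xi> by (auto simp: \<eta>_def inner_commute norm_eq_1)
  define K where "K = 2 + norm (outer w \<sigma> + outer \<sigma> w) + norm (outer w \<xi> + outer \<xi> w)
    + norm (outer \<xi> \<sigma> + outer \<sigma> \<xi>) + 2 * norm (outer \<xi> \<xi>)"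
  have K: "K \<ge> 2" unfolding K_def by (smt (verit) norm_ge_zero)
  define \<epsilon>' where "\<epsilon>' = min \<epsilon> (?g / 4)"
  have \<epsilon>': "\<epsilon>' > 0" "\<epsilon>' \<le> \<epsilon>" "4 * \<epsilon>' \<le> ?g" using \<epsilon> wave_gain_pos by (auto simp: \<epsilon>'_def)
  define e where "e = \<epsilon>' / K"
  have e: "e > 0" "e * K = \<epsilon>'" using \<epsilon>' K by (auto simp: e_def)
  obtain \<kappa> where \<kappa>: "\<And>b u v y. u \<in> {(0,\<xi>),(0,w),(1,\<sigma>)} \<Longrightarrow> v \<in> {(0,\<xi>),(0,w),(1,\<sigma>)} \<Longrightarrow>
    \<bar>dir_D u (dir_D v (\<lambda>y. bump a r y * ((- 1 / \<kappa>\<^sup>2) * cos (\<kappa> * (\<eta> \<bullet> y) + b)))) y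
      - bump a r y * cos (\<kappa> * (\<eta> \<bullet> y) + b) * (\<eta> \<bullet> u) * (\<eta> \<bullet> v)\<bar> \<le> e"
    using oscillation_second_D[of "{(0,\<xi>),(0,w),(1,\<sigma>)}" r e a \<eta>] r e by blast
  obtain b where b: "integrable lborel (\<lambda>y. (bump a r y * cos (\<kappa> * (\<eta> \<bullet> y) + b))\<^sup>2)"
     "(\<integral>y. (bump a r y * cos (\<kappa> * (\<eta> \<bullet> y) + b))\<^sup>2 \<partial>lborel) \<ge> 2 * ?g * measure lborel (ball a r)"
    using phase_with_large_energy[OF r, of a \<kappa> \<eta>] by blast
  define \<phi> where "\<phi> y = bump a r y * ((- 1 / \<kappa>\<^sup>2) * cos (\<kappa> * (\<eta> \<bullet> y) + b))" for y
  define s where "s y = bump a r y * cos (\<kappa> * (\<eta> \<bullet> y) + b)" for y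
  have DD: "\<bar>dir_D u (dir_D v \<phi>) y - s y * (\<eta> \<bullet> u) * (\<eta> \<bullet> v)\<bar> \<le> e"
    if "u \<in> {(0,\<xi>),(0,w),(1,\<sigma>)}" "v \<in> {(0,\<xi>),(0,w),(1,\<sigma>)}" for u v y
    using \<kappa>[OF that, of b y] unfolding \<phi>_def[abs_def] s_def .
  have D1: "\<bar>dir_D (0,\<xi>) (dir_D (0,\<xi>) \<phi>) y - s y\<bar> \<le> e" "\<bar>dir_D (0,w) (dir_D (0,\<xi>) \<phi>) y\<bar> \<le> e"
    "\<bar>dir_D (0,\<xi>) (dir_D (1,\<sigma>) \<phi>) y\<bar> \<le> e" "\<bar>dir_D (0,w) (dir_D (1,\<sigma>) \<phi>) y\<bar> \<le> e" for y
    using DD[of "(0,\<xi>)" "(0,\<xi>)" y] DD[of "(0,w)" "(0,\<xi>)" y] DD[of "(0,\<xi>)" "(1,\<sigma>)" y] DD[of "(0,w)" "(1,\<sigma>)" y]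
    by (simp_all add: \<eta>)
  have C3: "Ck 3 \<phi>" unfolding \<phi>_def[abs_def] by (intro Ck_mult Ck_bump Ck_phase)
  have \<phi>0: "\<phi> y = 0" if "y \<notin> cball a r" for y using bump_outside[OF r that] by (simp add: \<phi>_def)
  have z: "dir_D u (dir_D v \<phi>) y = 0" if "y \<notin> cball a r" for u v y
    by (rule dir_D_zero_outside[OF closed_cball dir_D_zero_outside[OF closed_cball \<phi>0] that])
  have cD: "continuous_on UNIV (dir_D u (dir_D v \<phi>))" for u v
    using C3 Ck_imp_continuous[of 1] unfolding numeral_3_eq_3 Ck.simps(2)[of "Suc (Suc 0)"] Ck.simps(2)[of "Suc 0"] One_nat_def by blast
  define p where "p = wave_p \<phi> w \<xi>"
  define V where "V = wave_V \<phi> w \<sigma> \<xi>"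
  have cp: "continuous_on UNIV p" unfolding p_def wave_p_def[abs_def] by (intro continuous_intros cD)
  have cV: "continuous_on UNIV V" unfolding V_def wave_V_def[abs_def] by (intro continuous_intros cD)
  have z': "p y = 0 \<and> V y = 0" if "y \<notin> cball a r" for y
    by (simp add: p_def V_def wave_p_def wave_V_def z[OF that])
  have sol: "solves_lin G p V" if "open G" "cball a r \<subseteq> G" for G
    unfolding p_def V_def by (rule wave_solves_lin[OF C3 compact_cball \<phi>0 that])
  have tr: "transpose (V y) = V y" for y
    by (simp add: V_def wave_V_def transpose_add transpose_diff transpose_scaleR transpose_outer add.commute)
  have s1: "\<bar>s y\<bar> \<le> 1" for y
    unfolding s_def abs_mult using bump_range[of a r y] by (intro mult_le_one) auto
  have np: "norm (p y - s y *\<^sub>R w) \<le> \<epsilon>'" for y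
  proof -
    have "p y - s y *\<^sub>R w = (dir_D (0,\<xi>) (dir_D (0,\<xi>) \<phi>) y - s y) *\<^sub>R w - dir_D (0,w) (dir_D (0,\<xi>) \<phi>) y *\<^sub>R \<xi>"
      by (simp add: p_def wave_p_def algebra_simps)
    also have "norm \<dots> \<le> \<bar>dir_D (0,\<xi>) (dir_D (0,\<xi>) \<phi>) y - s y\<bar> + \<bar>dir_D (0,w) (dir_D (0,\<xi>) \<phi>) y\<bar>"
      using norm_triangle_ineq4[of "(dir_D (0,\<xi>) (dir_D (0,\<xi>) \<phi>) y - s y) *\<^sub>R w" "dir_D (0,w) (dir_D (0,\<xi>) \<phi>) y *\<^sub>R \<xi>"] w \<xi> by simp
    also have "\<dots> \<le> e * 2" using D1(1,2)[of y] by simp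
    also have "\<dots> \<le> e * K" using e K by (intro mult_left_mono) auto
    finally show ?thesis using e by simp
  qed
  have nV: "norm (V y - s y *\<^sub>R (outer w \<sigma> + outer \<sigma> w)) \<le> \<epsilon>'" for y
  proof -
    let ?A = "outer w \<sigma> + outer \<sigma> w" and ?B = "outer w \<xi> + outer \<xi> w" and ?C = "outer \<xi> \<sigma> + outer \<sigma> \<xi>" and ?E = "outer \<xi> \<xi>"
    have n4: "norm (A - B - C + E) \<le> norm A + norm B + norm C + norm E" for A B C E :: "real^'n^'n"
      using norm_triangle_ineq[of "A - B - C" E] norm_triangle_ineq4[of "A - B" C] norm_triangle_ineq4[of A B] by linarith
    have n5: "norm (\<alpha> *\<^sub>R A - \<beta> *\<^sub>R B - \<gamma> *\<^sub>R C + \<delta> *\<^sub>R E) \<le> \<bar>\<alpha>\<bar> * norm A + \<bar>\<beta>\<bar> * norm B + \<bar>\<gamma>\<bar> * norm C + \<bar>\<delta>\<bar> * norm E"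
      for \<alpha> \<beta> \<gamma> \<delta> and A B C E :: "real^'n^'n"
      using n4[of "\<alpha> *\<^sub>R A" "\<beta> *\<^sub>R B" "\<gamma> *\<^sub>R C" "\<delta> *\<^sub>R E"] by (simp only: norm_scaleR)
    have eq: "V y - s y *\<^sub>R ?A = (dir_D (0,\<xi>) (dir_D (0,\<xi>) \<phi>) y - s y) *\<^sub>R ?A - dir_D (0,\<xi>) (dir_D (1,\<sigma>) \<phi>) y *\<^sub>R ?B
       - dir_D (0,w) (dir_D (0,\<xi>) \<phi>) y *\<^sub>R ?C + (2 * dir_D (0,w) (dir_D (1,\<sigma>) \<phi>) y) *\<^sub>R ?E"
      by (simp add: V_def wave_V_def scaleR_diff_left)
    have "norm (V y - s y *\<^sub>R ?A) \<le> \<bar>dir_D (0,\<xi>) (dir_D (0,\<xi>) \<phi>) y - s y\<bar> * norm ?A + \<bar>dir_D (0,\<xi>) (dir_D (1,\<sigma>) \<phi>) y\<bar> * norm ?B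
       + \<bar>dir_D (0,w) (dir_D (0,\<xi>) \<phi>) y\<bar> * norm ?C + \<bar>2 * dir_D (0,w) (dir_D (1,\<sigma>) \<phi>) y\<bar> * norm ?E"
      unfolding eq by (rule n5)
    moreover have "\<bar>2 * dir_D (0,w) (dir_D (1,\<sigma>) \<phi>) y\<bar> \<le> 2 * e" using D1(4)[of y] by (simp add: abs_mult)
    note mult_right_mono[OF this norm_ge_zero[of ?E]]
      mult_right_mono[OF D1(1)[of y] norm_ge_zero[of ?A]] mult_right_mono[OF D1(3)[of y] norm_ge_zero[of ?B]]
      mult_right_mono[OF D1(2)[of y] norm_ge_zero[of ?C]]
    moreover have "e * (K - 2) = e * norm ?A + e * norm ?B + e * norm ?C + (2 * e) * norm ?E"
      by (simp add: K_def algebra_simps)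
    moreover have "e * (K - 2) \<le> e * K" using e by (intro mult_left_mono) auto
    ultimately show ?thesis using e by linarith
  qed
  have gain: "(\<integral>y. (norm (p y))\<^sup>2 \<partial>lborel) \<ge> ?g * measure lborel (ball a r)"
  proof -
    have "(\<integral>y. (s y)\<^sup>2 - 2 * \<epsilon>' * indicator (cball a r) y \<partial>lborel) \<le> (\<integral>y. (norm (p y))\<^sup>2 \<partial>lborel)"
    proof (rule integral_mono)
      show "integrable lborel (\<lambda>y. (s y)\<^sup>2 - 2 * \<epsilon>' * indicator (cball a r) y)"
        using emeasure_bounded_finite[OF bounded_cball, of a r] b(1)
        by (intro Bochner_Integration.integrable_diff integrable_mult_right) (auto simp: integrable_indicator_iff s_def)
      show "integrable lborel (\<lambda>y. (norm (p y))\<^sup>2)"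
        by (rule integrable_compact_support(2)[OF open_UNIV compact_cball[of a r]])
           (use cp z' in \<open>auto intro!: continuous_intros\<close>)
      show "(s y)\<^sup>2 - 2 * \<epsilon>' * indicator (cball a r) y \<le> (norm (p y))\<^sup>2" for y
      proof (cases "y \<in> cball a r")
        case True
        have "\<bar>s y\<bar> \<le> norm (p y) + \<epsilon>'"
          using np[of y] norm_triangle_ineq2[of "s y *\<^sub>R w" "p y"] w by (simp add: norm_minus_commute)
        moreover have "(s y)\<^sup>2 - 2 * \<epsilon>' \<le> (norm (p y))\<^sup>2"
        proof (cases "\<bar>s y\<bar> \<le> \<epsilon>'")
          case True
          have "\<bar>s y\<bar> * \<bar>s y\<bar> \<le> 1 * \<epsilon>'" using True s1[of y] by (intro mult_mono) auto
          then have "(s y)\<^sup>2 - 2 * \<epsilon>' \<le> 0" using \<epsilon>' by (simp add: power2_eq_square)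
          then show ?thesis by (meson order_trans zero_le_power2)
        next
          case False
          then have "(\<bar>s y\<bar> - \<epsilon>')\<^sup>2 \<le> (norm (p y))\<^sup>2"
            using \<open>\<bar>s y\<bar> \<le> norm (p y) + \<epsilon>'\<close> by (intro power_mono) auto
          moreover have "(\<bar>s y\<bar> - \<epsilon>')\<^sup>2 = (s y)\<^sup>2 - 2 * \<epsilon>' * \<bar>s y\<bar> + \<epsilon>'\<^sup>2"
            by (simp add: power2_eq_square algebra_simps)
          moreover have "2 * \<epsilon>' * \<bar>s y\<bar> \<le> 2 * \<epsilon>' * 1" using s1[of y] \<epsilon>' by (intro mult_left_mono) auto
          ultimately show ?thesis by (smt (verit) zero_le_power2)
        qed
        ultimately show ?thesis using True by simp
      next
        case False
        then show ?thesis using bump_outside[OF r False] by (simp add: s_def)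
      qed
    qed
    moreover have "(\<integral>y. (s y)\<^sup>2 - 2 * \<epsilon>' * indicator (cball a r) y \<partial>lborel) = (\<integral>y. (s y)\<^sup>2 \<partial>lborel) - 2 * \<epsilon>' * measure lborel (ball a r)"
    proof -
      have "measure lborel (cball a r) = measure lborel (ball a r)" using r by (simp add: content_ball content_cball)
      moreover have "integrable lborel (\<lambda>y. 2 * \<epsilon>' * indicator (cball a r) y)"
        using bounded_cball[of a r] by (intro integrable_const_indicator) auto
      ultimately show ?thesis using b(1) by (simp add: s_def)
    qed
    moreover have "2 * \<epsilon>' * measure lborel (ball a r) \<le> ?g * measure lborel (ball a r)"
      using \<epsilon>' by (intro mult_right_mono) auto
    ultimately show ?thesis using b(2)[folded s_def] by linarith
  qed
  have "\<exists>s. \<bar>s\<bar> \<le> 1 \<and> norm (p y - s *\<^sub>R w) \<le> \<epsilon> \<and> norm (V y - s *\<^sub>R (outer w \<sigma> + outer \<sigma> w)) \<le> \<epsilon>" for y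
    using s1[of y] np[of y] nV[of y] \<epsilon>'(2) by (intro exI[of _ "s y"]) auto
  then show ?thesis using cp cV z' sol tr gain by blast
qed

section \<open>Admissible states\<close>

text \<open>The state \<open>(v, M)\<close> lies in the open convex set \<open>v \<otimes> v < M\<close>, \<open>trace M < l\<close>. The solutions sought
  are the boundary states \<open>M = v \<otimes> v\<close>; the distance to them is the trace defect.\<close>

definition admissible :: "real \<Rightarrow> real^'n \<Rightarrow> real^'n^'n \<Rightarrow> bool" where
  "admissible l v M \<longleftrightarrow> transpose M = M \<and> (\<forall>x. x \<noteq> 0 \<longrightarrow> (v \<bullet> x)\<^sup>2 < x \<bullet> (M *v x)) \<and> trace M < l"

definition defect :: "real^'n \<Rightarrow> real^'n^'n \<Rightarrow> real" where
  "defect v M = trace M - (norm v)\<^sup>2"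

lemma inner_outer: "y \<bullet> (outer a b *v x) = (a \<bullet> y) * (b \<bullet> x)"
proof -
  have "outer a b *v x = (b \<bullet> x) *\<^sub>R a"
    by (simp add: outer_def matrix_vector_mult_def vec_eq_iff inner_vec_def sum_distrib_left sum_distrib_right mult_ac)
  then show ?thesis by (simp add: inner_commute)
qed

lemma trace_outer: "trace (outer a b) = a \<bullet> b"
  by (simp add: trace_def outer_def inner_vec_def)

lemma trace_scaleR: "trace (c *\<^sub>R A) = c * trace (A :: real^'n^'n)"
  by (simp add: trace_def sum_distrib_left)

lemma inner_axis_mult: "axis i 1 \<bullet> (M *v axis j 1) = (M :: real^'n^'n) $ i $ j"
  by (simp add: inner_axis' matrix_vector_mult_basis column_def)

lemma norm_sq_vec: "(norm (x :: real^'n))\<^sup>2 = (\<Sum>i\<in>UNIV. (x $ i)\<^sup>2)"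
  unfolding power2_norm_eq_inner inner_vec_def by (simp add: power2_eq_square)

lemma norm_sq_matrix: "(norm (A :: real^'n^'m))\<^sup>2 = (\<Sum>i\<in>UNIV. (norm (A $ i))\<^sup>2)"
  unfolding power2_norm_eq_inner by (simp add: inner_vec_def)

lemma norm_matrix_vector_le: "norm (A *v x) \<le> norm (A :: real^'n^'m) * norm x"
proof -
  have "(norm (A *v x))\<^sup>2 = (\<Sum>i\<in>UNIV. (A $ i \<bullet> x)\<^sup>2)"
    by (simp add: norm_sq_vec matrix_vector_mult_def inner_vec_def)
  also have "\<dots> \<le> (\<Sum>i\<in>UNIV. (norm (A $ i))\<^sup>2 * (norm x)\<^sup>2)"
  proof (rule sum_mono)
    fix i show "(A $ i \<bullet> x)\<^sup>2 \<le> (norm (A $ i))\<^sup>2 * (norm x)\<^sup>2"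
      using Cauchy_Schwarz_ineq[of "A $ i" x] by (simp add: power2_norm_eq_inner)
  qed
  also have "\<dots> = (norm A)\<^sup>2 * (norm x)\<^sup>2"
    by (simp add: norm_sq_matrix sum_distrib_right)
  finally have "(norm (A *v x))\<^sup>2 \<le> (norm A * norm x)\<^sup>2" by (simp add: power_mult_distrib)
  then show ?thesis by (rule power2_le_imp_le) simp
qed

lemma abs_quadratic_form_le: "\<bar>x \<bullet> (A *v x)\<bar> \<le> norm (A :: real^'n^'n) * (norm x)\<^sup>2"
proof -
  have "\<bar>x \<bullet> (A *v x)\<bar> \<le> norm x * norm (A *v x)" by (rule Cauchy_Schwarz_ineq2)
  also have "\<dots> \<le> norm x * (norm A * norm x)" by (intro mult_left_mono norm_matrix_vector_le) simp
  finally show ?thesis by (simp add: power2_eq_square mult_ac)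
qed

lemma abs_trace_le: "\<bar>trace (A :: real^'n^'n)\<bar> \<le> real CARD('n) * norm A"
proof -
  have "\<bar>trace A\<bar> \<le> (\<Sum>i\<in>UNIV. \<bar>A $ i $ i\<bar>)" unfolding trace_def by (rule sum_abs)
  also have "\<dots> \<le> (\<Sum>i\<in>(UNIV::'n set). norm A)"
  proof (rule sum_mono)
    fix i show "\<bar>A $ i $ i\<bar> \<le> norm A"
      using component_le_norm_cart[of "A $ i" i] Finite_Cartesian_Product.norm_nth_le[of A i] by linarith
  qed
  finally show ?thesis by simp
qed

lemma admissible_nonneg: "admissible l v M \<Longrightarrow> 0 \<le> x \<bullet> (M *v x) - (v \<bullet> x)\<^sup>2"
  unfolding admissible_def by (cases "x = 0") (auto simp: less_imp_le)

lemma defect_sum: "defect v M = (\<Sum>i\<in>UNIV. M $ i $ i - (v $ i)\<^sup>2)"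
  by (simp add: defect_def trace_def sum_subtractf norm_sq_vec)

lemma admissible_diag: "admissible l v M \<Longrightarrow> 0 < M $ i $ i - (v $ i)\<^sup>2"
  unfolding admissible_def using inner_axis_mult[of i M i]
  by (metis axis_eq_0_iff diff_gt_0_iff_gt inner_axis inner_real_def mult.right_neutral zero_neq_one)

lemma admissible_defect_pos:
  fixes v :: "real^'n"
  shows "admissible l v M \<Longrightarrow> 0 < defect v M"
  unfolding defect_sum by (rule sum_pos) (simp, simp, rule admissible_diag)

lemma admissible_norm: "admissible l v M \<Longrightarrow> (norm v)\<^sup>2 < l"
  using admissible_defect_pos[of l v M] by (auto simp: admissible_def defect_def)

lemma admissible_defect_le: "admissible l v M \<Longrightarrow> defect v M < l"
  by (auto simp: admissible_def defect_def) (smt (verit) zero_le_power2)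

text \<open>The positive semidefinite matrix \<open>M - v \<otimes> v\<close> is bounded entrywise by its trace. Hence a vanishing defect
  forces \<open>M = v \<otimes> v\<close>.\<close>

lemma admissible_entry_le_defect:
  fixes v :: "real^'n"
  assumes "admissible l v M"
  shows "\<bar>M $ i $ j - v $ i * v $ j\<bar> \<le> defect v M"
proof -
  have sym: "M $ j $ i = M $ i $ j" 
  proof -
    have "transpose M $ i $ j = M $ i $ j" using assms by (simp add: admissible_def)
    then show ?thesis by (simp add: transpose_def)
  qed
  have d: "M $ k $ k - (v $ k)\<^sup>2 \<ge> 0" for k using admissible_diag[OF assms, of k] by simp
  show ?thesis
  proof (cases "i = j")
    case True
    have "M $ i $ i - (v $ i)\<^sup>2 \<le> defect v M"
      unfolding defect_sum by (rule member_le_sum) (use d in auto)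
    then show ?thesis using True d[of i] by (simp add: power2_eq_square)
  next
    case False
    have "(\<Sum>k\<in>{i,j}. M $ k $ k - (v $ k)\<^sup>2) \<le> defect v M"
      unfolding defect_sum by (rule sum_mono2) (use d in auto)
    then have s: "M $ i $ i - (v $ i)\<^sup>2 + (M $ j $ j - (v $ j)\<^sup>2) \<le> defect v M" using False by simp
    have q: "0 \<le> M $ i $ i - (v $ i)\<^sup>2 + (M $ j $ j - (v $ j)\<^sup>2) + 2 * e * (M $ i $ j - v $ i * v $ j)" if "e = 1 \<or> e = -1" for e
    proof -
      let ?x = "axis i 1 + e *\<^sub>R axis j (1::real)"
      have "M *v ?x = M *v axis i 1 + e *\<^sub>R (M *v axis j 1)"
        by (simp only: matrix_vector_right_distrib matrix_vector_mult_scaleR)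
      then have "?x \<bullet> (M *v ?x) = M $ i $ i + e * M $ j $ i + e * (M $ i $ j + e * M $ j $ j)"
        by (simp only: inner_add_left inner_add_right inner_axis_mult inner_scaleR_left inner_scaleR_right)
      moreover have "v \<bullet> ?x = v $ i + e * v $ j" by (simp add: inner_add_right inner_axis)
      moreover have "e * e = 1" using that by auto
      moreover have "(v $ i + e * v $ j)\<^sup>2 = (v $ i)\<^sup>2 + 2 * e * (v $ i * v $ j) + (e * e) * (v $ j)\<^sup>2"
        by (simp add: power2_eq_square algebra_simps)
      moreover have "M $ i $ i + e * M $ j $ i + e * (M $ i $ j + e * M $ j $ j) = M $ i $ i + 2 * (e * M $ i $ j) + (e * e) * M $ j $ j"
        unfolding sym by (simp add: algebra_simps)
      moreover have "2 * e * (M $ i $ j - v $ i * v $ j) = 2 * (e * M $ i $ j) - 2 * e * (v $ i * v $ j)"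
        by (simp add: algebra_simps)
      ultimately show ?thesis using admissible_nonneg[OF assms, of ?x] by simp
    qed
    show ?thesis using q[of 1] q[of "-1"] s d[of i] d[of j] by (simp add: abs_le_iff)
  qed
qed

lemma residual_Cauchy_Schwarz:
  assumes "admissible l v M" and e: "e \<noteq> 0"
  shows "(x \<bullet> (M *v e - (v \<bullet> e) *\<^sub>R v))\<^sup>2 \<le> (x \<bullet> (M *v x) - (v \<bullet> x)\<^sup>2) * (e \<bullet> (M *v e) - (v \<bullet> e)\<^sup>2)"
proof -
  define A where "A = x \<bullet> (M *v x) - (v \<bullet> x)\<^sup>2"
  define B where "B = x \<bullet> (M *v e - (v \<bullet> e) *\<^sub>R v)"
  define C where "C = e \<bullet> (M *v e) - (v \<bullet> e)\<^sup>2"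
  have C: "C > 0" using assms by (auto simp: admissible_def C_def)
  have sym: "e \<bullet> (M *v x) = x \<bullet> (M *v e)"
    using assms(1) by (metis admissible_def dot_lmul_matrix inner_commute matrix_vector_mul_lid transpose_matrix_vector)
  define t where "t = - (B / C)"
  have "0 \<le> (x + t *\<^sub>R e) \<bullet> (M *v (x + t *\<^sub>R e)) - (v \<bullet> (x + t *\<^sub>R e))\<^sup>2"
    using admissible_nonneg[OF assms(1)] .
  also have "\<dots> = A + 2 * t * B + t * t * C"
    by (simp add: A_def B_def C_def matrix_vector_right_distrib matrix_vector_mult_scaleR inner_add_left inner_add_right
        inner_diff_right sym power2_eq_square algebra_simps inner_commute)
  also have "\<dots> = A - B\<^sup>2 / C" using C by (simp add: t_def power2_eq_square field_simps)
  finally have "B\<^sup>2 \<le> A * C" using C by (simp add: field_simps)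
  then show ?thesis by (simp add: A_def B_def C_def)
qed

text \<open>A direction in which \<open>M - v \<otimes> v\<close> exceeds the rank-one form \<open>(defect / N) w \<otimes> w\<close>. In place of an
  eigenvector, take a diagonal entry not below the average, at \<open>e\<close>, and normalise \<open>(M - v \<otimes> v) e\<close>; the Cauchy-Schwarz
  inequality for the form does the rest.\<close>

lemma admissible_direction:
  fixes v :: "real^'n"
  assumes a: "admissible l v M"
  shows "\<exists>w. norm w = 1 \<and> (\<forall>x. defect v M / CARD('n) * (w \<bullet> x)\<^sup>2 \<le> x \<bullet> (M *v x) - (v \<bullet> x)\<^sup>2)"
proof -
  let ?q = "defect v M / CARD('n)"
  have "\<exists>i. ?q \<le> M $ i $ i - (v $ i)\<^sup>2"
  proof (rule ccontr)
    assume "\<not> ?thesis"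
    then have "(\<Sum>i\<in>(UNIV::'n set). M $ i $ i - (v $ i)\<^sup>2) < (\<Sum>i\<in>(UNIV::'n set). ?q)"
      by (intro sum_strict_mono) (auto simp: not_le)
    then show False by (simp add: defect_sum)
  qed
  then obtain i where i: "?q \<le> M $ i $ i - (v $ i)\<^sup>2" by blast
  define e where "e = (axis i 1 :: real^'n)"
  have e0: "e \<noteq> 0" by (simp add: e_def axis_eq_0_iff)
  define r where "r = M $ i $ i - (v $ i)\<^sup>2"
  have r: "e \<bullet> (M *v e) - (v \<bullet> e)\<^sup>2 = r" by (simp add: r_def e_def inner_axis_mult inner_axis)
  have r0: "r > 0" using admissible_diag[OF a] by (simp add: r_def)
  define u where "u = M *v e - (v \<bullet> e) *\<^sub>R v"
  have eu: "e \<bullet> u = r" by (simp add: u_def inner_diff_right r[symmetric] power2_eq_square inner_commute)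
  have nu: "norm u \<ge> r" using Cauchy_Schwarz_ineq2[of e u] eu r0 by (simp add: e_def norm_axis_1)
  define w where "w = u /\<^sub>R norm u"
  have u0: "norm u > 0" using nu r0 by linarith
  have "norm w = 1" using u0 by (simp add: w_def)
  moreover have "?q * (w \<bullet> x)\<^sup>2 \<le> x \<bullet> (M *v x) - (v \<bullet> x)\<^sup>2" for x
  proof -
    have "(x \<bullet> u)\<^sup>2 \<le> (x \<bullet> (M *v x) - (v \<bullet> x)\<^sup>2) * r"
      using residual_Cauchy_Schwarz[OF a e0, of x] by (simp add: u_def r)
    moreover have "x \<bullet> u = norm u * (w \<bullet> x)" using u0 by (simp add: w_def inner_commute)
    ultimately have "(norm u)\<^sup>2 * (w \<bullet> x)\<^sup>2 \<le> (x \<bullet> (M *v x) - (v \<bullet> x)\<^sup>2) * r" by (simp add: power_mult_distrib)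
    moreover have "r * r * (w \<bullet> x)\<^sup>2 \<le> (norm u)\<^sup>2 * (w \<bullet> x)\<^sup>2"
      unfolding power2_eq_square[of "norm u"] using nu r0 by (intro mult_right_mono mult_mono) auto
    ultimately have "r * (r * (w \<bullet> x)\<^sup>2) \<le> r * (x \<bullet> (M *v x) - (v \<bullet> x)\<^sup>2)" by (simp add: mult_ac)
    then have "r * (w \<bullet> x)\<^sup>2 \<le> x \<bullet> (M *v x) - (v \<bullet> x)\<^sup>2" using r0 by (simp only: mult_le_cancel_left_pos)
    moreover have "?q * (w \<bullet> x)\<^sup>2 \<le> r * (w \<bullet> x)\<^sup>2" using i by (intro mult_right_mono) (auto simp: r_def)
    ultimately show ?thesis by linarith
  qed
  ultimately show ?thesis by blast
qed

text \<open>With \<open>\<sigma> = v - (w \<bullet> v) w\<close> the matrix \<open>M - v \<otimes> v\<close> changes only by a multiple of \<open>w \<otimes> w\<close> along the segment, and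
  the previous lemma pays for it. So one can move by an amount proportional to the defect and lose at most half of
  the form. As \<open>w \<bullet> \<sigma> = 0\<close>, the trace of \<open>M\<close> does not change.\<close>

lemma admissible_segment:
  fixes v :: "real^'n" and L :: real
  assumes a: "admissible l v M" and L: "L > 0" "l \<le> L\<^sup>2"
  shows "\<exists>w \<sigma>. norm w = 1 \<and> w \<bullet> \<sigma> = 0 \<and>
    (\<forall>s x. \<bar>s\<bar> \<le> defect v M / (8 * CARD('n) * L) \<longrightarrow>
      x \<bullet> (M *v x) - (v \<bullet> x)\<^sup>2 \<le>
        2 * (x \<bullet> ((M + s *\<^sub>R (outer w \<sigma> + outer \<sigma> w)) *v x) - ((v + s *\<^sub>R w) \<bullet> x)\<^sup>2))"
proof -
  define q where "q = defect v M / CARD('n)"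
  obtain w where w: "norm w = 1" "\<And>x. q * (w \<bullet> x)\<^sup>2 \<le> x \<bullet> (M *v x) - (v \<bullet> x)\<^sup>2"
    using admissible_direction[OF a] unfolding q_def by blast
  define \<sigma> where "\<sigma> = v - (w \<bullet> v) *\<^sub>R w"
  have ws: "w \<bullet> \<sigma> = 0" using w(1) by (simp add: \<sigma>_def inner_diff_right norm_eq_1)
  have N1: "real CARD('n) \<ge> 1" by (simp add: Suc_le_eq)
  have q0: "q > 0" using admissible_defect_pos[OF a] by (simp add: q_def)
  have "defect v M \<le> L\<^sup>2" using admissible_defect_le[OF a] L by simp
  moreover have "defect v M / CARD('n) \<le> defect v M / 1"
    using admissible_defect_pos[OF a] N1 by (intro divide_left_mono) auto
  ultimately have qL: "q \<le> L\<^sup>2" by (simp add: q_def)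
  have vL: "norm v \<le> L"
  proof (rule power2_le_imp_le)
    show "(norm v)\<^sup>2 \<le> L\<^sup>2" using admissible_norm[OF a] L by linarith
  qed (use L in simp)
  have wv: "\<bar>w \<bullet> v\<bar> \<le> L" using Cauchy_Schwarz_ineq2[of w v] w(1) vL by simp
  have "x \<bullet> (M *v x) - (v \<bullet> x)\<^sup>2 \<le>
        2 * (x \<bullet> ((M + s *\<^sub>R (outer w \<sigma> + outer \<sigma> w)) *v x) - ((v + s *\<^sub>R w) \<bullet> x)\<^sup>2)"
    if s: "\<bar>s\<bar> \<le> defect v M / (8 * CARD('n) * L)" for s x
  proof -
    have s': "\<bar>s\<bar> \<le> q / (8 * L)" using s by (simp add: q_def field_simps)
    have sL: "\<bar>s\<bar> * L \<le> q / 8" using s' L by (simp add: field_simps)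
    have ss: "s * s \<le> q / 64"
    proof -
      have "\<bar>s\<bar> * \<bar>s\<bar> \<le> (q / (8 * L)) * (q / (8 * L))" using s' q0 L by (intro mult_mono) auto
      also have "\<dots> = q * q / (64 * L\<^sup>2)" by (simp add: power2_eq_square)
      also have "\<dots> \<le> q * L\<^sup>2 / (64 * L\<^sup>2)" using qL q0 L by (intro divide_right_mono mult_left_mono) auto
      also have "\<dots> = q / 64" using L by simp
      finally show ?thesis by (simp add: abs_mult[symmetric])
    qed
    have "2 * s * (w \<bullet> v) \<le> 2 * (\<bar>s\<bar> * L)"
    proof -
      have "2 * s * (w \<bullet> v) \<le> 2 * (\<bar>s\<bar> * \<bar>w \<bullet> v\<bar>)" by (simp add: abs_mult[symmetric])
      also have "\<dots> \<le> 2 * (\<bar>s\<bar> * L)" using wv by (intro mult_left_mono) auto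
      finally show ?thesis .
    qed
    then have k: "2 * s * (w \<bullet> v) + s * s \<le> q / 2" using sL ss q0 by linarith
    have "x \<bullet> ((M + s *\<^sub>R (outer w \<sigma> + outer \<sigma> w)) *v x) = x \<bullet> (M *v x) + s * (2 * (w \<bullet> x) * (\<sigma> \<bullet> x))"
      by (simp add: matrix_vector_mult_add_rdistrib scaleR_matrix_vector_assoc[symmetric] inner_add_right inner_outer)
    moreover have "(v + s *\<^sub>R w) \<bullet> x = v \<bullet> x + s * (w \<bullet> x)" by (simp add: inner_add_left)
    moreover have "\<sigma> \<bullet> x = v \<bullet> x - (w \<bullet> v) * (w \<bullet> x)" by (simp add: \<sigma>_def inner_diff_left)
    ultimately have e: "x \<bullet> ((M + s *\<^sub>R (outer w \<sigma> + outer \<sigma> w)) *v x) - ((v + s *\<^sub>R w) \<bullet> x)\<^sup>2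
       = x \<bullet> (M *v x) - (v \<bullet> x)\<^sup>2 - (2 * s * (w \<bullet> v) + s * s) * (w \<bullet> x)\<^sup>2"
      by (simp add: power2_eq_square algebra_simps)
    have "(2 * s * (w \<bullet> v) + s * s) * (w \<bullet> x)\<^sup>2 \<le> q / 2 * (w \<bullet> x)\<^sup>2" using k by (intro mult_right_mono) auto
    moreover have "q / 2 * (w \<bullet> x)\<^sup>2 = (q * (w \<bullet> x)\<^sup>2) / 2" by simp
    moreover note w(2)[of x]
    ultimately have "2 * ((2 * s * (w \<bullet> v) + s * s) * (w \<bullet> x)\<^sup>2) \<le> x \<bullet> (M *v x) - (v \<bullet> x)\<^sup>2" by linarith
    then show ?thesis unfolding e right_diff_distrib by linarith
  qed
  then show ?thesis using w(1) ws by blast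
qed

lemma admissible_coercive:
  fixes v :: "real^'n"
  assumes a: "admissible l v M"
  shows "\<exists>m>0. \<forall>x. m * (norm x)\<^sup>2 \<le> x \<bullet> (M *v x) - (v \<bullet> x)\<^sup>2"
proof -
  let ?f = "\<lambda>x. x \<bullet> (M *v x) - (v \<bullet> x)\<^sup>2"
  have "continuous_on (sphere 0 1) ?f"
    by (intro continuous_intros matrix_vector_mult_linear_continuous_on)
  then obtain x0 where x0: "x0 \<in> sphere 0 1" "\<And>x. x \<in> sphere 0 1 \<Longrightarrow> ?f x0 \<le> ?f x"
    using continuous_attains_inf[OF compact_sphere, of 0 1 ?f] by auto
  have "x0 \<noteq> 0" using x0(1) by auto
  then have "?f x0 > 0" using a by (auto simp: admissible_def)
  moreover have "?f x0 * (norm x)\<^sup>2 \<le> ?f x" for x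
  proof (cases "x = 0")
    case False
    let ?y = "x /\<^sub>R norm x"
    have "?f x = (norm x)\<^sup>2 * ?f ?y"
      using False by (simp add: matrix_vector_mult_scaleR power2_eq_square field_simps)
    moreover have "?y \<in> sphere 0 1" using False by simp
    then have "?f x0 \<le> ?f ?y" by (rule x0(2))
    ultimately show ?thesis by (simp add: mult.commute mult_left_mono)
  qed auto
  ultimately show ?thesis by blast
qed

text \<open>The whole segment has a uniform neighbourhood of admissible states. This absorbs the error terms of the wave and
  the variation of a continuous subsolution over a small ball.\<close>

lemma admissible_stable:
  fixes v :: "real^'n" and L :: real
  assumes a: "admissible l v M" and L: "L > 0" "l \<le> L\<^sup>2"
  shows "\<exists>w \<sigma> \<delta>. norm w = 1 \<and> \<delta> > 0 \<and>
    (\<forall>s v' M' l'. \<bar>s\<bar> \<le> defect v M / (8 * CARD('n) * L) \<longrightarrow> norm (v' - (v + s *\<^sub>R w)) \<le> \<delta> \<longrightarrow>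
       norm (M' - (M + s *\<^sub>R (outer w \<sigma> + outer \<sigma> w))) \<le> \<delta> \<longrightarrow> transpose M' = M' \<longrightarrow> l - \<delta> \<le> l' \<longrightarrow>
       admissible l' v' M')"
proof -
  obtain w \<sigma> where w: "norm w = 1" "w \<bullet> \<sigma> = 0" and
    ws: "\<And>s x. \<bar>s\<bar> \<le> defect v M / (8 * CARD('n) * L) \<Longrightarrow>
      x \<bullet> (M *v x) - (v \<bullet> x)\<^sup>2 \<le>
        2 * (x \<bullet> ((M + s *\<^sub>R (outer w \<sigma> + outer \<sigma> w)) *v x) - ((v + s *\<^sub>R w) \<bullet> x)\<^sup>2)"
    using admissible_segment[OF a L] by blast
  obtain m where m: "m > 0" "\<And>x. m * (norm x)\<^sup>2 \<le> x \<bullet> (M *v x) - (v \<bullet> x)\<^sup>2"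
    using admissible_coercive[OF a] by blast
  define b where "b = norm v + defect v M / (8 * CARD('n) * L)"
  have b0: "b \<ge> 0" using admissible_defect_pos[OF a] L by (simp add: b_def)
  define g where "g = l - trace M"
  have g: "g > 0" using a by (simp add: g_def admissible_def)
  define \<delta> where "\<delta> = min 1 (min (m / (4 * (2 + 2 * b))) (g / (2 * (CARD('n) + 1))))"
  have \<delta>0: "\<delta> > 0" using m g b0 by (auto simp: \<delta>_def)
  have \<delta>1: "\<delta> \<le> 1" by (simp add: \<delta>_def)
  have \<delta>2: "\<delta> * (2 + 2 * b) \<le> m / 4"
  proof -
    have "\<delta> \<le> m / (4 * (2 + 2 * b))" by (simp add: \<delta>_def)
    then show ?thesis using b0 by (simp add: field_simps)
  qed
  have \<delta>3: "\<delta> * (CARD('n) + 1) < g"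
  proof -
    have "\<delta> \<le> g / (2 * (CARD('n) + 1))" by (simp add: \<delta>_def)
    then have "\<delta> * (CARD('n) + 1) \<le> g / 2" by (simp add: field_simps)
    then show ?thesis using g by simp
  qed
  have "admissible l' v' M'" if s: "\<bar>s\<bar> \<le> defect v M / (8 * CARD('n) * L)" and v': "norm (v' - (v + s *\<^sub>R w)) \<le> \<delta>"
    and M': "norm (M' - (M + s *\<^sub>R (outer w \<sigma> + outer \<sigma> w))) \<le> \<delta>" and sym: "transpose M' = M'" and l': "l - \<delta> \<le> l'"
    for s v' M' l'
    unfolding admissible_def
  proof (intro conjI allI impI)
    define vs where "vs = v + s *\<^sub>R w"
    define Ms where "Ms = M + s *\<^sub>R (outer w \<sigma> + outer \<sigma> w)"
    show "transpose M' = M'" by (rule sym)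
    have "trace M' = trace Ms + trace (M' - Ms)" by (simp add: trace_sub)
    moreover have "trace Ms = trace M"
      using w(2) by (simp add: Ms_def trace_add trace_scaleR trace_outer inner_commute)
    moreover have "trace (M' - Ms) \<le> CARD('n) * \<delta>"
    proof -
      have "trace (M' - Ms) \<le> CARD('n) * norm (M' - Ms)" using abs_trace_le[of "M' - Ms"] by linarith
      also have "\<dots> \<le> CARD('n) * \<delta>" using M' by (intro mult_left_mono) (auto simp: Ms_def)
      finally show ?thesis .
    qed
    ultimately show "trace M' < l'" using \<delta>3 l' by (simp add: g_def algebra_simps)
    fix x :: "real^'n" assume x: "x \<noteq> 0"
    have vs: "norm vs \<le> b"
    proof -
      have "norm vs \<le> norm v + \<bar>s\<bar>" using norm_triangle_ineq[of v "s *\<^sub>R w"] w(1) by (simp add: vs_def)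
      then show ?thesis using s by (simp add: b_def)
    qed
    have "x \<bullet> (M' *v x) = x \<bullet> (Ms *v x) + x \<bullet> ((M' - Ms) *v x)"
      by (simp add: matrix_vector_mult_diff_rdistrib inner_diff_right)
    moreover have "\<bar>x \<bullet> ((M' - Ms) *v x)\<bar> \<le> \<delta> * (norm x)\<^sup>2"
      using abs_quadratic_form_le[of x "M' - Ms"] mult_right_mono[OF M'[folded Ms_def], of "(norm x)\<^sup>2"] by simp
    moreover have "(v' \<bullet> x)\<^sup>2 - (vs \<bullet> x)\<^sup>2 \<le> \<delta> * (1 + 2 * b) * (norm x)\<^sup>2"
    proof -
      have "(v' \<bullet> x)\<^sup>2 - (vs \<bullet> x)\<^sup>2 = ((v' - vs) \<bullet> x) * ((v' + vs) \<bullet> x)"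
        by (simp add: power2_eq_square inner_diff_left inner_add_left algebra_simps)
      also have "\<dots> \<le> \<bar>(v' - vs) \<bullet> x\<bar> * \<bar>(v' + vs) \<bullet> x\<bar>" by (simp add: abs_mult[symmetric])
      also have "\<dots> \<le> (norm (v' - vs) * norm x) * (norm (v' + vs) * norm x)"
        by (intro mult_mono Cauchy_Schwarz_ineq2) auto
      also have "\<dots> \<le> (\<delta> * norm x) * ((1 + 2 * b) * norm x)"
      proof -
        have "norm (v' + vs) \<le> norm (v' - vs) + 2 * norm vs"
        proof -
          have e: "v' - vs + (vs + vs) = v' + vs" by simp
          show ?thesis using norm_triangle_ineq[of "v' - vs" "vs + vs", unfolded e] norm_triangle_ineq[of vs vs] by linarith
        qed
        then have "norm (v' + vs) \<le> 1 + 2 * b" using v' \<delta>1 vs by (simp add: vs_def)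
        then show ?thesis using v' \<delta>0 b0 by (intro mult_mono) (auto simp: vs_def)
      qed
      finally show ?thesis by (simp add: power2_eq_square mult_ac)
    qed
    moreover have "m * (norm x)\<^sup>2 \<le> 2 * (x \<bullet> (Ms *v x) - (vs \<bullet> x)\<^sup>2)"
      using ws[OF s, of x] m(2)[of x] by (simp add: Ms_def vs_def)
    moreover have "\<delta> * (2 + 2 * b) * (norm x)\<^sup>2 \<le> m / 4 * (norm x)\<^sup>2" using \<delta>2 by (intro mult_right_mono) auto
    moreover have "\<delta> * (norm x)\<^sup>2 + \<delta> * (1 + 2 * b) * (norm x)\<^sup>2 = \<delta> * (2 + 2 * b) * (norm x)\<^sup>2" by (simp add: algebra_simps)
    moreover have "m * (norm x)\<^sup>2 > 0" using m x by simp
    moreover have "m / 4 * (norm x)\<^sup>2 = (m * (norm x)\<^sup>2) / 4" by simp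
    ultimately show "(v' \<bullet> x)\<^sup>2 < x \<bullet> (M' *v x)" unfolding right_diff_distrib by linarith
  qed
  then show ?thesis using w(1) \<delta>0 by blast
qed

section \<open>Subsolutions and their local perturbation\<close>

definition defect_sq :: "(real \<times> (real^'n) \<Rightarrow> real) \<Rightarrow> (real \<times> (real^'n) \<Rightarrow> real^'n) \<Rightarrow> (real \<times> (real^'n) \<Rightarrow> real^'n^'n) \<Rightarrow> real \<times> (real^'n) \<Rightarrow> real" where
  "defect_sq c v S y = (defect (v y) (mat (c y) + S y))\<^sup>2"

text \<open>The value \<open>(N + 1) c\<close> exceeds \<open>trace (c Id) = N c\<close>, so that zero is a subsolution; any constant larger than \<open>N\<close>
  would do.\<close>

definition subsolution :: "(real \<times> (real^'n)) set \<Rightarrow> (real \<times> (real^'n) \<Rightarrow> real) \<Rightarrow> (real \<times> (real^'n) \<Rightarrow> real^'n) \<Rightarrow> (real \<times> (real^'n) \<Rightarrow> real^'n^'n) \<Rightarrow> bool" where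
  "subsolution G c v S \<longleftrightarrow> continuous_on UNIV v \<and> continuous_on UNIV S \<and>
     (\<exists>K. compact K \<and> K \<subseteq> G \<and> (\<forall>y. y \<notin> K \<longrightarrow> v y = 0 \<and> S y = 0)) \<and> solves_lin G v S \<and>
     (\<forall>y\<in>G. admissible ((real CARD('n) + 1) * c y) (v y) (mat (c y) + S y))"

text \<open>Energy of a wave of amplitude \<open>defect / (8 N L)\<close>, relative to the squared defect.\<close>

definition step_gain :: "'n::finite itself \<Rightarrow> real \<Rightarrow> real" where
  "step_gain _ L = wave_gain DIM(real \<times> (real^'n)) / (8 * real CARD('n) * L)\<^sup>2"

lemma step_gain_pos: "L > 0 \<Longrightarrow> step_gain TYPE('n::finite) L > 0"
  by (simp add: step_gain_def wave_gain_pos)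

lemma contract_sum: "contract M L = (\<Sum>j\<in>UNIV. \<Sum>i\<in>UNIV. M $ i $ j * L (0, axis j 1) $ i)"
  by (simp add: contract_def inner_vec_def column_def)

lemma test_integrable:
  fixes T :: "real \<times> (real^'n) \<Rightarrow> (real \<times> (real^'n)) \<Rightarrow>\<^sub>L real"
  assumes "open G" "compact K" "K \<subseteq> G" "continuous_on UNIV p" "\<And>y. y \<notin> K \<Longrightarrow> p y = 0" "continuous_on G T"
  shows "integrable lborel (\<lambda>y. T y (0, p y))"
proof (rule integrable_compact_support(2)[OF assms(1-3)])
  show "continuous_on G (\<lambda>y. T y (0, p y))"
    by (intro continuous_intros continuous_on_subset[OF assms(4)] assms(6)) auto
  show "T y (0, p y) = 0" if "y \<notin> K" for y
    using assms(5)[OF that] by (metis blinfun.zero_right zero_prod_def)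
qed

lemma test_integrable_vec:
  fixes T :: "real \<times> (real^'n) \<Rightarrow> (real \<times> (real^'n)) \<Rightarrow>\<^sub>L (real^'n)"
  assumes "open G" "compact K" "K \<subseteq> G" "continuous_on UNIV p" "continuous_on UNIV V"
     "\<And>y. y \<notin> K \<Longrightarrow> p y = 0" "\<And>y. y \<notin> K \<Longrightarrow> V y = 0" "continuous_on G T"
  shows "integrable lborel (\<lambda>y. p y \<bullet> T y (1, 0) + contract (V y) (T y))"
proof (rule integrable_compact_support(2)[OF assms(1-3)])
  show "continuous_on G (\<lambda>y. p y \<bullet> T y (1, 0) + contract (V y) (T y))"
    unfolding contract_sum
    by (intro continuous_intros continuous_on_subset[OF assms(4)] continuous_on_subset[OF assms(5)] assms(8)) auto
  show "p y \<bullet> T y (1, 0) + contract (V y) (T y) = 0" if "y \<notin> K" for y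
    using assms(6,7)[OF that] by simp
qed

lemma solves_linD1:
  fixes T :: "real \<times> (real^'n) \<Rightarrow> (real \<times> (real^'n)) \<Rightarrow>\<^sub>L real"
  assumes "solves_lin G p V" "\<And>y. y \<in> G \<Longrightarrow> (\<theta> has_derivative blinfun_apply (T y)) (at y)" "continuous_on G T"
  shows "(\<integral>y. T y (0, p y) \<partial>lborel) = 0"
  using assms unfolding solves_lin_def by blast

lemma solves_linD2:
  fixes T :: "real \<times> (real^'n) \<Rightarrow> (real \<times> (real^'n)) \<Rightarrow>\<^sub>L (real^'n)"
  assumes "solves_lin G p V" "\<And>y. y \<in> G \<Longrightarrow> (\<theta> has_derivative blinfun_apply (T y)) (at y)" "continuous_on G T"
  shows "(\<integral>y. (p y \<bullet> T y (1, 0) + contract (V y) (T y)) \<partial>lborel) = 0"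
  using assms unfolding solves_lin_def by blast

lemma solves_linI:
  fixes p :: "real \<times> (real^'n) \<Rightarrow> real^'n"
  assumes "\<And>\<theta> (T :: real \<times> (real^'n) \<Rightarrow> (real \<times> (real^'n)) \<Rightarrow>\<^sub>L real).
      (\<And>y. y \<in> G \<Longrightarrow> (\<theta> has_derivative blinfun_apply (T y)) (at y)) \<Longrightarrow> continuous_on G T \<Longrightarrow>
      (\<integral>y. T y (0, p y) \<partial>lborel) = 0"
    and "\<And>\<theta> (T :: real \<times> (real^'n) \<Rightarrow> (real \<times> (real^'n)) \<Rightarrow>\<^sub>L (real^'n)).
      (\<And>y. y \<in> G \<Longrightarrow> (\<theta> has_derivative blinfun_apply (T y)) (at y)) \<Longrightarrow> continuous_on G T \<Longrightarrow>
      (\<integral>y. (p y \<bullet> T y (1, 0) + contract (V y) (T y)) \<partial>lborel) = 0"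
  shows "solves_lin G p V"
  using assms unfolding solves_lin_def by blast

lemma solves_lin_scale:
  fixes p :: "real \<times> (real^'n) \<Rightarrow> real^'n"
  assumes sol: "solves_lin G p V"
  shows "solves_lin G (\<lambda>y. s *\<^sub>R p y) (\<lambda>y. s *\<^sub>R V y)"
proof (rule solves_linI, goal_cases)
  case (1 \<theta> T)
  have "T y (0, s *\<^sub>R p y) = s * T y (0, p y)" for y
    using blinfun.scaleR_right[of "T y" s "(0, p y)"] by simp
  then show ?case using solves_linD1[OF sol 1] by simp
next
  case (2 \<theta> T)
  have "s *\<^sub>R p y \<bullet> T y (1, 0) + contract (s *\<^sub>R V y) (T y) = s * (p y \<bullet> T y (1, 0) + contract (V y) (T y))" for y
    by (simp add: contract_scaleR algebra_simps)
  then show ?case using solves_linD2[OF sol 2] by simp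
qed

lemma solves_lin_add:
  fixes p q :: "real \<times> (real^'n) \<Rightarrow> real^'n"
  assumes G: "open G"
    and p: "continuous_on UNIV p" "continuous_on UNIV V" "compact K" "K \<subseteq> G" "\<And>y. y \<notin> K \<Longrightarrow> p y = 0 \<and> V y = 0" "solves_lin G p V"
    and q: "continuous_on UNIV q" "continuous_on UNIV W" "compact K'" "K' \<subseteq> G" "\<And>y. y \<notin> K' \<Longrightarrow> q y = 0 \<and> W y = 0" "solves_lin G q W"
  shows "solves_lin G (\<lambda>y. p y + q y) (\<lambda>y. V y + W y)"
proof (rule solves_linI, goal_cases)
  case (1 \<theta> T)
  have e: "T y (0, p y + q y) = T y (0, p y) + T y (0, q y)" for y
    by (simp add: blinfun.add_right[symmetric])
  have i: "integrable lborel (\<lambda>y. T y (0, p y))" "integrable lborel (\<lambda>y. T y (0, q y))"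
    using test_integrable[OF G p(3,4,1) _ 1(2)] test_integrable[OF G q(3,4,1) _ 1(2)] p(5) q(5) by blast+
  show ?case unfolding e using i solves_linD1[OF p(6) 1] solves_linD1[OF q(6) 1] by simp
next
  case (2 \<theta> T)
  have e: "(p y + q y) \<bullet> T y (1, 0) + contract (V y + W y) (T y) =
    (p y \<bullet> T y (1, 0) + contract (V y) (T y)) + (q y \<bullet> T y (1, 0) + contract (W y) (T y))" for y
    by (simp add: contract_add inner_add_left)
  have i: "integrable lborel (\<lambda>y. p y \<bullet> T y (1, 0) + contract (V y) (T y))" "integrable lborel (\<lambda>y. q y \<bullet> T y (1, 0) + contract (W y) (T y))"
    using test_integrable_vec[OF G p(3,4,1,2) _ _ 2(2)] test_integrable_vec[OF G q(3,4,1,2) _ _ 2(2)] p(5) q(5) by blast+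
  show ?case unfolding e using i solves_linD2[OF p(6) 2] solves_linD2[OF q(6) 2] by simp
qed

lemma solves_lin_zero: "solves_lin G (\<lambda>y. 0 :: real^'n) (\<lambda>y. 0)"
proof (rule solves_linI, goal_cases)
  case (1 \<theta> T)
  have "T y (0, 0) = 0" for y
    by (metis blinfun.zero_right zero_prod_def)
  then show ?case by simp
qed simp

lemma solves_lin_sum:
  assumes G: "open G" and F: "finite F"
    and p: "\<And>i. i \<in> F \<Longrightarrow> continuous_on UNIV (p i)" "\<And>i. i \<in> F \<Longrightarrow> continuous_on UNIV (V i)"
    "\<And>i. i \<in> F \<Longrightarrow> compact (K i)" "\<And>i. i \<in> F \<Longrightarrow> K i \<subseteq> G"
    "\<And>i y. i \<in> F \<Longrightarrow> y \<notin> K i \<Longrightarrow> p i y = 0 \<and> V i y = 0" "\<And>i. i \<in> F \<Longrightarrow> solves_lin G (p i) (V i)"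
  shows "solves_lin G (\<lambda>y. \<Sum>i\<in>F. p i y) (\<lambda>y. \<Sum>i\<in>F. V i y)"
  using F p
proof (induction F rule: finite_induct)
  case empty
  then show ?case by (simp add: solves_lin_zero)
next
  case (insert j F)
  have "solves_lin G (\<lambda>y. p j y + (\<Sum>i\<in>F. p i y)) (\<lambda>y. V j y + (\<Sum>i\<in>F. V i y))"
  proof (rule solves_lin_add[OF G, of "p j" "V j" "K j" _ _ "\<Union>i\<in>F. K i"])
    show "continuous_on UNIV (\<lambda>y. \<Sum>i\<in>F. p i y)" "continuous_on UNIV (\<lambda>y. \<Sum>i\<in>F. V i y)"
      using insert.prems(1,2) by (auto intro!: continuous_on_sum)
    show "compact (\<Union>i\<in>F. K i)" using insert by (intro compact_UN) auto
    show "(\<Union>i\<in>F. K i) \<subseteq> G" using insert.prems(4) by blast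
    show "(\<Sum>i\<in>F. p i y) = 0 \<and> (\<Sum>i\<in>F. V i y) = 0" if "y \<notin> (\<Union>i\<in>F. K i)" for y
      using insert.prems(5) that by (auto intro!: sum.neutral)
    show "solves_lin G (\<lambda>y. \<Sum>i\<in>F. p i y) (\<lambda>y. \<Sum>i\<in>F. V i y)" by (rule insert.IH) (use insert.prems in auto)
  qed (use insert.prems in auto)
  then show ?case using insert.hyps by simp
qed

text \<open>Test with a linear function of time only.\<close>

lemma solves_lin_mean_zero:
  fixes p :: "real \<times> (real^'n) \<Rightarrow> real^'n"
  assumes "solves_lin UNIV p V"
  shows "(\<integral>y. b \<bullet> p y \<partial>lborel) = 0"
proof -
  have bl: "bounded_linear (\<lambda>z::real \<times> (real^'n). b \<bullet> snd z)"
    by (intro bounded_linear_intros)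
  define B where "B = Blinfun (\<lambda>z::real \<times> (real^'n). b \<bullet> snd z)"
  have B: "blinfun_apply B = (\<lambda>z. b \<bullet> snd z)" unfolding B_def by (rule bounded_linear_Blinfun_apply[OF bl])
  have "((\<lambda>z. b \<bullet> snd z) has_derivative blinfun_apply B) (at y)" for y
    unfolding B by (rule bounded_linear_imp_has_derivative[OF bl])
  then have "(\<integral>y. blinfun_apply B (0, p y) \<partial>lborel) = 0"
    using solves_linD1[OF assms, of "\<lambda>z. b \<bullet> snd z" "\<lambda>_. B"] by simp
  then show ?thesis by (simp add: B)
qed

lemma continuous_mat: "continuous_on G c \<Longrightarrow> continuous_on G (\<lambda>y. mat (c y) :: real^'n^'n)"
proof -
  assume c: "continuous_on G c"
  have "continuous_on G (\<lambda>x. if i = j then c x else 0)" for i j :: 'n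
    using c by (cases "i = j") auto
  then show ?thesis unfolding mat_def by (intro continuous_on_vec_lambda)
qed

lemma continuous_defect_sq:
  assumes "continuous_on G c" "continuous_on G v" "continuous_on G S"
  shows "continuous_on G (defect_sq c v S)"
  unfolding defect_sq_def[abs_def] defect_def trace_def
  by (intro continuous_intros continuous_mat assms)

lemma transpose_mat': "transpose (mat k) = (mat k :: real^'n^'n)"
  by (simp add: transpose_mat)

text \<open>The wave is scaled to the amplitude that the admissible segment at the centre allows. Its integral is zero,
  so against a function that is almost constant on the ball it gives almost zero.\<close>

lemma local_perturbation:
  fixes c :: "real \<times> (real^'n) \<Rightarrow> real" and L \<epsilon> :: real
  assumes N: "CARD('n) \<ge> 2" and sub: "subsolution G c v S" and G: "open G" and c: "continuous_on G c"
    and cL: "\<And>y. y \<in> G \<Longrightarrow> (real CARD('n) + 1) * c y \<le> L\<^sup>2" and L: "L > 0" and a: "a \<in> G" and \<epsilon>: "\<epsilon> > 0"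
    and H: "finite H" "\<And>g. g \<in> H \<Longrightarrow> continuous_on UNIV g"
  shows "\<exists>r0>0. \<forall>r. 0 < r \<longrightarrow> r < r0 \<longrightarrow> cball a r \<subseteq> G \<and>
    (\<exists>p V. continuous_on UNIV p \<and> continuous_on UNIV V \<and> (\<forall>y. y \<notin> cball a r \<longrightarrow> p y = 0 \<and> V y = 0) \<and>
      solves_lin G p V \<and>
      (\<forall>y\<in>cball a r. admissible ((real CARD('n) + 1) * c y) (v y + p y) (mat (c y) + (S y + V y))) \<and>
      step_gain TYPE('n) L * (\<integral>y. indicator (cball a r) y * defect_sq c v S y \<partial>lborel) \<le>
        (\<integral>y. (norm (p y))\<^sup>2 \<partial>lborel) + \<epsilon> * measure lborel (ball a r) \<and>
      (\<forall>g\<in>H. \<bar>\<integral>y. g y \<bullet> p y \<partial>lborel\<bar> \<le> \<epsilon> * measure lborel (ball a r)))"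
proof -
  let ?l = "\<lambda>y. (real CARD('n) + 1) * c y"
  let ?M = "\<lambda>y. mat (c y) + S y"
  let ?\<kappa> = "step_gain TYPE('n) L"
  have vS: "continuous_on UNIV v" "continuous_on UNIV S" and admG: "\<And>y. y \<in> G \<Longrightarrow> admissible (?l y) (v y) (?M y)"
    using sub by (auto simp: subsolution_def)
  have \<kappa>: "?\<kappa> > 0" by (rule step_gain_pos[OF L])
  have ad: "admissible (?l a) (v a) (?M a)" using admG[OF a] .
  \<comment> \<open>The amplitude: half the length of the admissible segment at \<open>a\<close>.\<close>
  define sb where "sb = defect (v a) (?M a) / (8 * CARD('n) * L)"
  have sb: "sb > 0" using admissible_defect_pos[OF ad] L by (simp add: sb_def)
  obtain w \<sigma> \<delta> where w: "norm w = 1" and \<delta>: "\<delta> > 0" and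
    st: "\<And>s v' M' l'. \<bar>s\<bar> \<le> sb \<Longrightarrow> norm (v' - (v a + s *\<^sub>R w)) \<le> \<delta> \<Longrightarrow>
       norm (M' - (?M a + s *\<^sub>R (outer w \<sigma> + outer \<sigma> w))) \<le> \<delta> \<Longrightarrow> transpose M' = M' \<Longrightarrow> ?l a - \<delta> \<le> l' \<Longrightarrow>
       admissible l' v' M'"
    using admissible_stable[OF ad L cL[OF a]] unfolding sb_def by blast
  have cM: "continuous_on G ?M" by (intro continuous_intros continuous_mat c continuous_on_subset[OF vS(2)]) auto
  have cd: "continuous_on G (defect_sq c v S)"
    by (intro continuous_defect_sq c continuous_on_subset[OF vS(1)] continuous_on_subset[OF vS(2)]) auto
  have ev: "\<forall>\<^sub>F y in nhds a. dist (f y) (f a) < e" if "continuous_on G f" "e > 0" for f :: "_ \<Rightarrow> 'z::metric_space" and e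
  proof -
    have "isCont f a" using that(1) G a by (simp add: continuous_on_eq_continuous_at)
    then have "(f \<longlongrightarrow> f a) (nhds a)" by (simp add: continuous_at tendsto_at_iff_tendsto_nhds)
    then show ?thesis using that(2) by (rule tendstoD)
  qed
  have sub': "continuous_on G v" "continuous_on G ?l"
    by (auto intro!: continuous_intros c continuous_on_subset[OF vS(1)])
  have "\<forall>\<^sub>F y in nhds a. y \<in> G \<and> dist (v y) (v a) < \<delta>/2 \<and> dist (?M y) (?M a) < \<delta>/2 \<and> dist (?l y) (?l a) < \<delta> \<and>
     dist (defect_sq c v S y) (defect_sq c v S a) < \<epsilon> / ?\<kappa> \<and> (\<forall>g\<in>H. dist (g y) (g a) < \<epsilon> / (2 * sb))"
    using G a \<delta> \<epsilon> \<kappa> sb H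
    by (intro eventually_conj eventually_nhds_in_open ev sub' cM cd eventually_ball_finite)
       (auto intro!: ev continuous_on_subset[OF H(2)])
  then obtain r1 where r1: "r1 > 0" "\<And>y. dist y a < r1 \<Longrightarrow> y \<in> G \<and> dist (v y) (v a) < \<delta>/2 \<and> dist (?M y) (?M a) < \<delta>/2 \<and> dist (?l y) (?l a) < \<delta> \<and>
     dist (defect_sq c v S y) (defect_sq c v S a) < \<epsilon> / ?\<kappa> \<and> (\<forall>g\<in>H. dist (g y) (g a) < \<epsilon> / (2 * sb))"
    unfolding eventually_nhds_metric by blast
  show ?thesis
  proof (intro exI[of _ r1] conjI allI impI r1(1))
    fix r assume r: "0 < r" "r < r1"
    have B: "dist y a < r1" if "y \<in> cball a r" for y using that r by (simp add: dist_commute)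
    note near = r1(2)[OF B]
    show sG: "cball a r \<subseteq> G" using near by blast
    define e where "e = min 1 (\<delta> / (2 * sb))"
    have e: "e > 0" "e \<le> 1" "sb * e \<le> \<delta> / 2"
    proof -
      show "e > 0" "e \<le> 1" using \<delta> sb by (auto simp: e_def)
      have "e \<le> \<delta> / (2 * sb)" by (simp add: e_def)
      then show "sb * e \<le> \<delta> / 2" using sb by (simp add: field_simps)
    qed
    obtain p0 V0 where p0: "continuous_on UNIV p0" "continuous_on UNIV V0" "\<And>y. y \<notin> cball a r \<Longrightarrow> p0 y = 0 \<and> V0 y = 0"
      "\<And>G. open G \<Longrightarrow> cball a r \<subseteq> G \<Longrightarrow> solves_lin G p0 V0" "\<And>y. transpose (V0 y) = V0 y"
      "\<And>y. \<exists>s. \<bar>s\<bar> \<le> 1 \<and> norm (p0 y - s *\<^sub>R w) \<le> e \<and> norm (V0 y - s *\<^sub>R (outer w \<sigma> + outer \<sigma> w)) \<le> e"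
      "(\<integral>y. (norm (p0 y))\<^sup>2 \<partial>lborel) \<ge> wave_gain DIM(real \<times> (real^'n)) * measure lborel (ball a r)"
      using localised_wave[OF N r(1) w e(1), of a \<sigma>] by blast
    define p where "p y = sb *\<^sub>R p0 y" for y
    define V where "V y = sb *\<^sub>R V0 y" for y
    have mcb: "measure lborel (cball a r) = measure lborel (ball a r)" using r by (simp add: content_ball content_cball)
    have icb: "integrable lborel (indicator (cball a r) :: _ \<Rightarrow> real)"
      using emeasure_bounded_finite[OF bounded_cball, of a r] by (auto simp: integrable_indicator_iff)
    have 1: "continuous_on UNIV p" "continuous_on UNIV V" unfolding p_def V_def by (intro continuous_intros p0)+
    have 2: "p y = 0 \<and> V y = 0" if "y \<notin> cball a r" for y using p0(3)[OF that] by (simp add: p_def V_def)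
    have 3: "solves_lin G p V" "solves_lin UNIV p V"
      unfolding p_def[abs_def] V_def[abs_def] using p0(4)[OF G sG] p0(4)[of UNIV] by (auto intro: solves_lin_scale)
    have 4: "admissible (?l y) (v y + p y) (mat (c y) + (S y + V y))" if y: "y \<in> cball a r" for y
    proof -
      obtain s where s: "\<bar>s\<bar> \<le> 1" "norm (p0 y - s *\<^sub>R w) \<le> e" "norm (V0 y - s *\<^sub>R (outer w \<sigma> + outer \<sigma> w)) \<le> e"
        using p0(6) by blast
      have sc: "norm (A + sb *\<^sub>R A0 - (A' + (sb * s) *\<^sub>R A1)) \<le> \<delta>" if "dist A A' < \<delta>/2" "norm (A0 - s *\<^sub>R A1) \<le> e"
        for A A' A0 A1 :: "'z::real_normed_vector"
      proof -
        have eq: "A + sb *\<^sub>R A0 - (A' + (sb * s) *\<^sub>R A1) = (A - A') + sb *\<^sub>R (A0 - s *\<^sub>R A1)" by (simp add: algebra_simps)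
        have "norm (A + sb *\<^sub>R A0 - (A' + (sb * s) *\<^sub>R A1)) \<le> norm (A - A') + sb * norm (A0 - s *\<^sub>R A1)"
          unfolding eq using norm_triangle_ineq[of "A - A'" "sb *\<^sub>R (A0 - s *\<^sub>R A1)"] sb by simp
        also have "\<dots> \<le> \<delta>/2 + sb * e" using that sb by (intro add_mono mult_left_mono) (auto simp: dist_norm)
        finally show ?thesis using e(3) by linarith
      qed
      show ?thesis
      proof (rule st[of "sb * s"])
        show "\<bar>sb * s\<bar> \<le> sb" using s(1) sb by (simp add: abs_mult mult_left_le)
        show "norm (v y + p y - (v a + (sb * s) *\<^sub>R w)) \<le> \<delta>"
          unfolding p_def by (rule sc) (use near[OF y] s in auto)
        have "norm (?M y + V y - (?M a + (sb * s) *\<^sub>R (outer w \<sigma> + outer \<sigma> w))) \<le> \<delta>"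
          unfolding V_def by (rule sc) (use near[OF y] s in auto)
        then show "norm (mat (c y) + (S y + V y) - (?M a + (sb * s) *\<^sub>R (outer w \<sigma> + outer \<sigma> w))) \<le> \<delta>"
          by (simp add: add.assoc)
        have "transpose (?M y) = ?M y" using admG near[OF y] by (simp add: admissible_def)
        then have "transpose (?M y + V y) = ?M y + V y"
          by (simp only: transpose_add V_def transpose_scaleR p0(5))
        then show "transpose (mat (c y) + (S y + V y)) = mat (c y) + (S y + V y)" by (simp add: add.assoc)
        have "dist (?l y) (?l a) < \<delta>" using near[OF y] by blast
        then show "?l a - \<delta> \<le> ?l y" unfolding dist_real_def by linarith
      qed
    qed
    have pn: "norm (p y) \<le> 2 * sb" for y
    proof -
      obtain s where s: "\<bar>s\<bar> \<le> 1" "norm (p0 y - s *\<^sub>R w) \<le> e" using p0(6) by blast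
      have "norm (p0 y) \<le> norm (p0 y - s *\<^sub>R w) + norm (s *\<^sub>R w)"
        using norm_triangle_ineq[of "p0 y - s *\<^sub>R w" "s *\<^sub>R w"] by simp
      then have "norm (p0 y) \<le> 2" using s e w by simp
      then show ?thesis using sb by (simp add: p_def)
    qed
    have 5: "?\<kappa> * (\<integral>y. indicator (cball a r) y * defect_sq c v S y \<partial>lborel) \<le>
        (\<integral>y. (norm (p y))\<^sup>2 \<partial>lborel) + \<epsilon> * measure lborel (ball a r)"
    proof -
      have ii: "integrable lborel (\<lambda>y. indicator (cball a r) y *\<^sub>R defect_sq c v S y)"
        by (rule borel_integrable_compact[OF compact_cball]) (rule continuous_on_subset[OF cd sG])
      have "(\<integral>y. indicator (cball a r) y * defect_sq c v S y \<partial>lborel) \<le> (\<integral>y. (defect_sq c v S a + \<epsilon> / ?\<kappa>) * indicator (cball a r) y \<partial>lborel)"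
      proof (rule integral_mono)
        show "integrable lborel (\<lambda>y. indicator (cball a r) y * defect_sq c v S y)" using ii by simp
        show "integrable lborel (\<lambda>y. (defect_sq c v S a + \<epsilon> / ?\<kappa>) * indicator (cball a r) y)" using icb by simp
        show "indicator (cball a r) y * defect_sq c v S y \<le> (defect_sq c v S a + \<epsilon> / ?\<kappa>) * indicator (cball a r) y" for y
          using near[of y] by (cases "y \<in> cball a r") (auto simp: dist_real_def)
      qed
      also have "\<dots> = (defect_sq c v S a + \<epsilon> / ?\<kappa>) * measure lborel (ball a r)" by (simp add: mcb)
      finally have "?\<kappa> * (\<integral>y. indicator (cball a r) y * defect_sq c v S y \<partial>lborel) \<le> ?\<kappa> * ((defect_sq c v S a + \<epsilon> / ?\<kappa>) * measure lborel (ball a r))"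
        using \<kappa> by (intro mult_left_mono) auto
      also have "\<dots> = ?\<kappa> * defect_sq c v S a * measure lborel (ball a r) + \<epsilon> * measure lborel (ball a r)"
        using \<kappa> by (simp add: algebra_simps)
      also have "?\<kappa> * defect_sq c v S a = sb\<^sup>2 * wave_gain DIM(real \<times> (real^'n))"
        by (simp add: step_gain_def sb_def defect_sq_def power_divide)
      also have "sb\<^sup>2 * wave_gain DIM(real \<times> (real^'n)) * measure lborel (ball a r) \<le> (\<integral>y. (norm (p y))\<^sup>2 \<partial>lborel)"
      proof -
        have "(\<integral>y. (norm (p y))\<^sup>2 \<partial>lborel) = sb\<^sup>2 * (\<integral>y. (norm (p0 y))\<^sup>2 \<partial>lborel)"
          by (simp add: p_def power_mult_distrib)
        then show ?thesis using mult_left_mono[OF p0(7), of "sb\<^sup>2"] by (simp add: mult.assoc)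
      qed
      finally show ?thesis by simp
    qed
    have 6: "\<bar>\<integral>y. g y \<bullet> p y \<partial>lborel\<bar> \<le> \<epsilon> * measure lborel (ball a r)" if g: "g \<in> H" for g
    proof -
      have ig: "integrable lborel (\<lambda>y. f y \<bullet> p y)" if "continuous_on UNIV f" for f
        by (rule integrable_compact_support(2)[OF open_UNIV compact_cball[of a r]])
           (use 1 2 that in \<open>auto intro!: continuous_intros\<close>)
      have "(\<integral>y. g y \<bullet> p y \<partial>lborel) = (\<integral>y. (g y - g a) \<bullet> p y \<partial>lborel)"
        using ig[OF H(2)[OF g]] ig[of "\<lambda>_. g a"] solves_lin_mean_zero[OF 3(2), of "g a"] by (simp add: inner_diff_left)
      also have "\<bar>\<dots>\<bar> \<le> (\<integral>y. \<epsilon> * indicator (cball a r) y \<partial>lborel)"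
      proof (rule order_trans[OF integral_abs_bound], rule integral_mono)
        show "integrable lborel (\<lambda>y. \<bar>(g y - g a) \<bullet> p y\<bar>)"
          by (intro integrable_abs ig continuous_intros H(2)[OF g])
        show "integrable lborel (\<lambda>y. \<epsilon> * indicator (cball a r) y)" using icb by simp
        show "\<bar>(g y - g a) \<bullet> p y\<bar> \<le> \<epsilon> * indicator (cball a r) y" for y
        proof (cases "y \<in> cball a r")
          case True
          have "\<bar>(g y - g a) \<bullet> p y\<bar> \<le> norm (g y - g a) * norm (p y)" by (rule Cauchy_Schwarz_ineq2)
          also have "\<dots> \<le> \<epsilon> / (2 * sb) * (2 * sb)"
            using near[OF True] g pn sb \<epsilon> by (intro mult_mono) (auto simp: dist_norm less_imp_le)
          finally show ?thesis using True sb by simp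
        qed (use 2 in auto)
      qed
      finally show ?thesis by (simp add: mcb)
    qed
    show "\<exists>p V. continuous_on UNIV p \<and> continuous_on UNIV V \<and> (\<forall>y. y \<notin> cball a r \<longrightarrow> p y = 0 \<and> V y = 0) \<and>
      solves_lin G p V \<and>
      (\<forall>y\<in>cball a r. admissible (?l y) (v y + p y) (mat (c y) + (S y + V y))) \<and>
      ?\<kappa> * (\<integral>y. indicator (cball a r) y * defect_sq c v S y \<partial>lborel) \<le>
        (\<integral>y. (norm (p y))\<^sup>2 \<partial>lborel) + \<epsilon> * measure lborel (ball a r) \<and>
      (\<forall>g\<in>H. \<bar>\<integral>y. g y \<bullet> p y \<partial>lborel\<bar> \<le> \<epsilon> * measure lborel (ball a r))"
      using 1 2 3(1) 4 5 6 by blast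
  qed
qed

section \<open>Perturbation of a subsolution on the whole domain\<close>

lemma finite_vitali_cover:
  fixes G :: "'a::euclidean_space set"
  assumes G: "open G" "bounded G" and \<rho>: "\<forall>a\<in>G. \<rho> a > 0" and \<eta>: "\<eta> > 0"
  shows "\<exists>F. finite F \<and> (\<forall>i\<in>F. fst i \<in> G \<and> 0 < snd i \<and> snd i < \<rho> (fst i)) \<and>
     (\<forall>i\<in>F. \<forall>j\<in>F. i \<noteq> j \<longrightarrow> cball (fst i) (snd i) \<inter> cball (fst j) (snd j) = {}) \<and>
     measure lborel (G - (\<Union>i\<in>F. cball (fst i) (snd i))) < \<eta>"
proof -
  define K where "K = {(a,r). a \<in> G \<and> 0 < r \<and> r < \<rho> a}"
  have 1: "0 < snd i" if "i \<in> K" for i using that by (auto simp: K_def)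
  have 2: "\<exists>i. i \<in> K \<and> x \<in> cball (fst i) (snd i) \<and> snd i < d" if "x \<in> G" "0 < d" for x d
    using bspec[OF \<rho> that(1)] that
    by (intro exI[of _ "(x, min (\<rho> x) d / 2)"]) (auto simp: K_def min_def)
  obtain C where C: "countable C" "C \<subseteq> K"
     "pairwise (\<lambda>i j. disjnt (cball (fst i) (snd i)) (cball (fst j) (snd j))) C"
     "negligible (G - (\<Union>i\<in>C. cball (fst i) (snd i)))"
    using Vitali_covering_theorem_cballs[of K snd G fst, OF 1 2] by blast
  have fin: "emeasure lborel A \<noteq> \<infinity>" if "A \<subseteq> G" for A
    using emeasure_bounded_finite[OF bounded_subset[OF G(2) that]] by auto
  have bG: "G \<in> sets borel" using G by simp
  have m0: "measure lborel (G - (\<Union>i\<in>C. cball (fst i) (snd i))) = 0"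
  proof -
    have b: "G - (\<Union>i\<in>C. cball (fst i) (snd i)) \<in> sets lborel"
      using C(1) bG by (auto intro!: sets.Diff sets.countable_UN')
    have "measure lebesgue (G - (\<Union>i\<in>C. cball (fst i) (snd i))) = 0"
      using C(4) by (simp add: negligible_iff_null_sets null_setsD1 measure_def)
    then show ?thesis using measure_completion[OF b] by simp
  qed
  have "\<exists>F. finite F \<and> F \<subseteq> C \<and> measure lborel (G - (\<Union>i\<in>F. cball (fst i) (snd i))) < \<eta>"
  proof (cases "C = {}")
    case True then show ?thesis using m0 \<eta> by (intro exI[of _ "{}"]) auto
  next
    case False
    let ?e = "from_nat_into C"
    have r: "range ?e = C" using range_from_nat_into[OF False C(1)] .
    let ?A = "\<lambda>n. G - (\<Union>i\<in>?e ` {..<n}. cball (fst i) (snd i))"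
    have dec: "decseq ?A" by (rule decseq_SucI) (auto simp: lessThan_Suc)
    have sets: "range ?A \<subseteq> sets lborel" using bG by auto
    have "(\<lambda>n. measure lborel (?A n)) \<longlonglongrightarrow> measure lborel (\<Inter>n. ?A n)"
      by (rule Lim_measure_decseq[OF sets dec fin]) auto
    moreover have "(\<Inter>n. ?A n) = G - (\<Union>i\<in>C. cball (fst i) (snd i))"
    proof -
      have U: "(\<Union>i\<in>C. cball (fst i) (snd i)) = (\<Union>n. cball (fst (?e n)) (snd (?e n)))"
        using arg_cong[OF r, of "\<lambda>C. \<Union>i\<in>C. cball (fst i) (snd i)"] by simp
      have "x \<in> (\<Inter>n. ?A n) \<longleftrightarrow> x \<in> G \<and> (\<forall>n i. i < n \<longrightarrow> x \<notin> cball (fst (?e i)) (snd (?e i)))" for x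
        by auto
      moreover have "(\<forall>n i. i < n \<longrightarrow> P i) \<longleftrightarrow> (\<forall>i. P i)" for P :: "nat \<Rightarrow> bool" by blast
      ultimately show ?thesis unfolding U by blast
    qed
    ultimately have "(\<lambda>n. measure lborel (?A n)) \<longlonglongrightarrow> 0" using m0 by simp
    then have "eventually (\<lambda>n. measure lborel (?A n) < \<eta>) sequentially" using \<eta> by (rule order_tendstoD(2))
    then obtain n where "measure lborel (?A n) < \<eta>" by (auto simp: eventually_sequentially)
    moreover have "?e ` {..<n} \<subseteq> C" using r by auto
    ultimately show ?thesis by (intro exI[of _ "?e ` {..<n}"]) auto
  qed
  then obtain F where F: "finite F" "F \<subseteq> C" "measure lborel (G - (\<Union>i\<in>F. cball (fst i) (snd i))) < \<eta>" by blast
  have "\<forall>i\<in>F. fst i \<in> G \<and> 0 < snd i \<and> snd i < \<rho> (fst i)" using F(2) C(2) by (auto simp: K_def)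
  moreover have "\<forall>i\<in>F. \<forall>j\<in>F. i \<noteq> j \<longrightarrow> cball (fst i) (snd i) \<inter> cball (fst j) (snd j) = {}"
    using C(3) F(2) unfolding pairwise_def disjnt_def by (meson subsetD)
  ultimately show ?thesis using F by blast
qed

lemma sum_eq_single:
  assumes "finite F" "i \<in> F" "\<And>j. j \<in> F \<Longrightarrow> j \<noteq> i \<Longrightarrow> f j = 0"
  shows "sum f F = (f i :: 'a::comm_monoid_add)"
  using assms by (simp add: sum.remove)

lemma subsolution_defsq_bound:
  fixes L :: real
  assumes "subsolution G c v S" "y \<in> G" "(real CARD('n) + 1) * c y \<le> L\<^sup>2"
  shows "0 \<le> defect_sq c v S y" "defect_sq c v (S :: real \<times> (real^'n) \<Rightarrow> real^'n^'n) y \<le> L ^ 4"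
proof -
  have a: "admissible ((real CARD('n) + 1) * c y) (v y) (mat (c y) + S y)" using assms by (auto simp: subsolution_def)
  show "0 \<le> defect_sq c v S y" by (simp add: defect_sq_def)
  have "defect_sq c v S y \<le> (L\<^sup>2)\<^sup>2"
    unfolding defect_sq_def using admissible_defect_pos[OF a] admissible_defect_le[OF a] assms(3) by (intro power_mono) auto
  then show "defect_sq c v S y \<le> L ^ 4" by simp
qed

lemma subsolution_norm_bound:
  fixes L :: real
  assumes "subsolution G c v S" "y \<in> G" "(real CARD('n) + 1) * c y \<le> L\<^sup>2"
  shows "(norm (v y :: real^'n))\<^sup>2 \<le> L\<^sup>2"
proof -
  have a: "admissible ((real CARD('n) + 1) * c y) (v y) (mat (c y) + S y)" using assms by (auto simp: subsolution_def)
  show ?thesis using admissible_norm[OF a] assms(3) by linarith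
qed

lemma subsolution_defsq_integrable:
  fixes S :: "real \<times> (real^'n) \<Rightarrow> real^'n^'n"
  assumes sub: "subsolution G c v S" and G: "open G" "bounded G" and c: "continuous_on G c"
    and cL: "\<And>y. y \<in> G \<Longrightarrow> (real CARD('n) + 1) * c y \<le> L\<^sup>2"
    and A: "A \<in> sets borel"
  shows "integrable lborel (\<lambda>y. indicator A y * (indicator G y * defect_sq c v S y))"
proof (rule Bochner_Integration.integrable_bound)
  have cd: "continuous_on G (defect_sq c v S)"
    using sub by (intro continuous_defect_sq c) (auto simp: subsolution_def intro: continuous_on_subset)
  have m: "(\<lambda>y. indicator G y * defect_sq c v S y) \<in> borel_measurable borel"
    using borel_measurable_continuous_on_indicator[OF _ cd] G by simp
  show "(\<lambda>y. indicator A y * (indicator G y * defect_sq c v S y)) \<in> borel_measurable lborel"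
    using A m by auto
  show "integrable lborel (\<lambda>y. L ^ 4 * indicator G y)"
    using G(2) G by (intro integrable_const_indicator) auto
  show "AE y in lborel. norm (indicator A y * (indicator G y * defect_sq c v S y)) \<le> norm (L ^ 4 * indicator G y)"
    using subsolution_defsq_bound[OF sub _ cL] by (intro AE_I2) (auto simp: indicator_def)
qed

text \<open>Fill \<open>G\<close>, up to small measure, with finitely many disjoint balls that are small enough for the local
  construction, and sum the waves. The defect is bounded, so the uncovered part costs little.\<close>

lemma subsolution_perturbation:
  fixes c :: "real \<times> (real^'n) \<Rightarrow> real" and L \<epsilon> :: real
  assumes N: "CARD('n) \<ge> 2" and sub: "subsolution G c v S" and G: "open G" "bounded G" and c: "continuous_on G c"
    and cL: "\<And>y. y \<in> G \<Longrightarrow> (real CARD('n) + 1) * c y \<le> L\<^sup>2" and L: "L > 0" and \<epsilon>: "\<epsilon> > 0"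
    and H: "finite H" "\<And>g. g \<in> H \<Longrightarrow> continuous_on UNIV g"
  shows "\<exists>v' S'. subsolution G c v' S' \<and>
    step_gain TYPE('n) L * (\<integral>y. indicator G y * defect_sq c v S y \<partial>lborel) \<le> (\<integral>y. (norm (v' y - v y))\<^sup>2 \<partial>lborel) + \<epsilon> \<and>
    (\<forall>g\<in>H. \<bar>\<integral>y. g y \<bullet> (v' y - v y) \<partial>lborel\<bar> \<le> \<epsilon>)"
proof -
  let ?\<kappa> = "step_gain TYPE('n) L"
  let ?m = "measure lborel G"
  have \<kappa>: "?\<kappa> > 0" by (rule step_gain_pos[OF L])
  define e where "e = \<epsilon> / (2 * (?m + 1))"
  have m0: "?m \<ge> 0" by simp
  have e: "e > 0" "e * ?m \<le> \<epsilon> / 2"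
  proof -
    show "e > 0" unfolding e_def using \<epsilon> m0 by (intro divide_pos_pos mult_pos_pos add_nonneg_pos) auto
    have "e * ?m \<le> e * (?m + 1)" using \<open>e > 0\<close> by (intro mult_left_mono) auto
    also have "\<dots> = \<epsilon> / 2"
    proof -
      have "?m + 1 \<noteq> 0" using m0 by linarith
      moreover have "\<epsilon> / (2 * M) * M = \<epsilon> / 2" if "M \<noteq> 0" for M :: real using that by simp
      ultimately show ?thesis unfolding e_def by blast
    qed
    finally show "e * ?m \<le> \<epsilon> / 2" .
  qed
  define \<eta> where "\<eta> = \<epsilon> / (2 * ?\<kappa> * L ^ 4)"
  have \<eta>: "\<eta> > 0" "?\<kappa> * (L ^ 4 * \<eta>) = \<epsilon> / 2" using \<epsilon> \<kappa> L by (auto simp: \<eta>_def field_simps)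
  define good where "good a r p V \<longleftrightarrow> continuous_on UNIV p \<and> continuous_on UNIV V \<and> (\<forall>y. y \<notin> cball a r \<longrightarrow> p y = 0 \<and> V y = 0) \<and>
      solves_lin G p V \<and>
      (\<forall>y\<in>cball a r. admissible ((real CARD('n) + 1) * c y) (v y + p y) (mat (c y) + (S y + V y))) \<and>
      ?\<kappa> * (\<integral>y. indicator (cball a r) y * defect_sq c v S y \<partial>lborel) \<le>
        (\<integral>y. (norm (p y))\<^sup>2 \<partial>lborel) + e * measure lborel (ball a r) \<and>
      (\<forall>g\<in>H. \<bar>\<integral>y. g y \<bullet> p y \<partial>lborel\<bar> \<le> e * measure lborel (ball a r))" for a r p V
  have "\<forall>a\<in>G. \<exists>r0>0. \<forall>r. 0 < r \<longrightarrow> r < r0 \<longrightarrow> cball a r \<subseteq> G \<and> (\<exists>p V. good a r p V)"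
    unfolding good_def using local_perturbation[OF N sub G(1) c cL L _ e(1) H] by blast
  then obtain \<rho> where \<rho>: "\<And>a. a \<in> G \<Longrightarrow> \<rho> a > 0"
    "\<And>a r. a \<in> G \<Longrightarrow> 0 < r \<Longrightarrow> r < \<rho> a \<Longrightarrow> cball a r \<subseteq> G \<and> (\<exists>p V. good a r p V)"
    by metis
  have \<rho>1: "\<forall>a\<in>G. \<rho> a > 0" using \<rho>(1) by simp
  obtain F where F: "finite F" "\<forall>i\<in>F. fst i \<in> G \<and> 0 < snd i \<and> snd i < \<rho> (fst i)"
     "\<forall>i\<in>F. \<forall>j\<in>F. i \<noteq> j \<longrightarrow> cball (fst i) (snd i) \<inter> cball (fst j) (snd j) = {}"
     "measure lborel (G - (\<Union>i\<in>F. cball (fst i) (snd i))) < \<eta>"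
    using finite_vitali_cover[OF G \<rho>1 \<eta>(1)] by (elim exE conjE) (rule that)
  let ?B = "\<lambda>i. cball (fst i) (snd i)"
  have BG: "?B i \<subseteq> G" and ex: "\<exists>p V. good (fst i) (snd i) p V" and rp: "snd i > 0" if "i \<in> F" for i
    using that F(2) \<rho>(2)[of "fst i" "snd i"] by auto
  obtain p V where pV: "\<And>i. i \<in> F \<Longrightarrow> good (fst i) (snd i) (p i) (V i)" using ex by metis
  have 1: "continuous_on UNIV (p i)" "continuous_on UNIV (V i)" "\<And>y. y \<notin> ?B i \<Longrightarrow> p i y = 0 \<and> V i y = 0"
     "solves_lin G (p i) (V i)" "\<And>y. y \<in> ?B i \<Longrightarrow> admissible ((real CARD('n) + 1) * c y) (v y + p i y) (mat (c y) + (S y + V i y))"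
     "?\<kappa> * (\<integral>y. indicator (?B i) y * defect_sq c v S y \<partial>lborel) \<le> (\<integral>y. (norm (p i y))\<^sup>2 \<partial>lborel) + e * measure lborel (?B i)"
     "\<And>g. g \<in> H \<Longrightarrow> \<bar>\<integral>y. g y \<bullet> p i y \<partial>lborel\<bar> \<le> e * measure lborel (?B i)" if "i \<in> F" for i
  proof -
    have "measure lborel (?B i) = measure lborel (ball (fst i) (snd i))" using rp[OF that] by (simp add: content_ball content_cball)
    then show "continuous_on UNIV (p i)" "continuous_on UNIV (V i)" "\<And>y. y \<notin> ?B i \<Longrightarrow> p i y = 0 \<and> V i y = 0"
     "solves_lin G (p i) (V i)" "\<And>y. y \<in> ?B i \<Longrightarrow> admissible ((real CARD('n) + 1) * c y) (v y + p i y) (mat (c y) + (S y + V i y))"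
     "?\<kappa> * (\<integral>y. indicator (?B i) y * defect_sq c v S y \<partial>lborel) \<le> (\<integral>y. (norm (p i y))\<^sup>2 \<partial>lborel) + e * measure lborel (?B i)"
     "\<And>g. g \<in> H \<Longrightarrow> \<bar>\<integral>y. g y \<bullet> p i y \<partial>lborel\<bar> \<le> e * measure lborel (?B i)"
      using pV[OF that] unfolding good_def by auto
  qed
  have other: "p j y = 0" "V j y = 0" if "i \<in> F" "j \<in> F" "j \<noteq> i" "y \<in> ?B i" for i j y
    using F(3) 1(3)[of j y] that by (metis disjoint_iff)+
  have sumB: "(\<Sum>i\<in>F. measure lborel (?B i)) \<le> ?m"
  proof -
    have "(\<Sum>i\<in>F. measure lborel (?B i)) = measure lborel (\<Union>i\<in>F. ?B i)"
    proof (rule measure_finite_Union[symmetric])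
      show "disjoint_family_on ?B F" using F(3) unfolding disjoint_family_on_def by blast
      show "emeasure lborel (?B i) \<noteq> \<infinity>" for i using emeasure_bounded_finite[OF bounded_cball, of "fst i" "snd i"] by simp
    qed (use F(1) in auto)
    also have "\<dots> \<le> ?m"
      using BG F(1) G emeasure_bounded_finite[OF G(2)]
      by (intro measure_mono_fmeasurable) (auto intro!: fmeasurableI sets.finite_UN simp: less_top)
    finally show ?thesis .
  qed
  define P where "P y = (\<Sum>i\<in>F. p i y)" for y
  define W where "W y = (\<Sum>i\<in>F. V i y)" for y
  have cP: "continuous_on UNIV P" "continuous_on UNIV W"
    unfolding P_def W_def using 1(1,2) by (auto intro!: continuous_on_sum)
  have P_in: "P y = p i y" "W y = V i y" if "i \<in> F" "y \<in> ?B i" for i y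
    unfolding P_def W_def using other[OF that(1) _ _ that(2)] that F(1) by (auto intro!: sum_eq_single)
  have P_out: "P y = 0 \<and> W y = 0" if "y \<notin> (\<Union>i\<in>F. ?B i)" for y
    unfolding P_def W_def using 1(3) that by (auto intro!: sum.neutral)
  have cU: "compact (\<Union>i\<in>F. ?B i)" using F(1) by (intro compact_UN) auto
  have UG: "(\<Union>i\<in>F. ?B i) \<subseteq> G" using BG by blast
  have solP: "solves_lin G P W"
    unfolding P_def[abs_def] W_def[abs_def]
    by (rule solves_lin_sum[OF G(1) F(1), where K = ?B]) (use 1 BG in auto)
  obtain K where K: "compact K" "K \<subseteq> G" "\<And>y. y \<notin> K \<Longrightarrow> v y = 0 \<and> S y = 0"
    and vS: "continuous_on UNIV v" "continuous_on UNIV S" "solves_lin G v S"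
    "\<And>y. y \<in> G \<Longrightarrow> admissible ((real CARD('n) + 1) * c y) (v y) (mat (c y) + S y)"
    using sub unfolding subsolution_def by blast
  have new: "subsolution G c (\<lambda>y. v y + P y) (\<lambda>y. S y + W y)"
    unfolding subsolution_def
  proof (intro conjI)
    show "continuous_on UNIV (\<lambda>y. v y + P y)" "continuous_on UNIV (\<lambda>y. S y + W y)"
      by (intro continuous_intros vS cP)+
    show "\<exists>K. compact K \<and> K \<subseteq> G \<and> (\<forall>y. y \<notin> K \<longrightarrow> v y + P y = 0 \<and> S y + W y = 0)"
      using K cU UG P_out by (intro exI[of _ "K \<union> (\<Union>i\<in>F. ?B i)"]) auto
    show "solves_lin G (\<lambda>y. v y + P y) (\<lambda>y. S y + W y)"
      by (rule solves_lin_add[OF G(1) vS(1,2) K(1,2) K(3) vS(3) cP cU UG P_out solP])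
    show "\<forall>y\<in>G. admissible ((real CARD('n) + 1) * c y) (v y + P y) (mat (c y) + (S y + W y))"
    proof
      fix y assume y: "y \<in> G"
      show "admissible ((real CARD('n) + 1) * c y) (v y + P y) (mat (c y) + (S y + W y))"
      proof (cases "y \<in> (\<Union>i\<in>F. ?B i)")
        case True
        then obtain i where "i \<in> F" "y \<in> ?B i" by blast
        then show ?thesis using 1(5) P_in by simp
      next
        case False
        then show ?thesis using P_out vS(4)[OF y] by simp
      qed
    qed
  qed
  have ip2: "integrable lborel (\<lambda>y. (norm (p i y))\<^sup>2)" if "i \<in> F" for i
    by (rule integrable_compact_support(2)[OF open_UNIV compact_cball[of "fst i" "snd i"]])
       (use 1(1,3)[OF that] in \<open>auto intro!: continuous_intros\<close>)
  have nP: "(\<integral>y. (norm (P y))\<^sup>2 \<partial>lborel) = (\<Sum>i\<in>F. \<integral>y. (norm (p i y))\<^sup>2 \<partial>lborel)"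
  proof -
    have "(norm (P y))\<^sup>2 = (\<Sum>i\<in>F. (norm (p i y))\<^sup>2)" for y
    proof (cases "y \<in> (\<Union>i\<in>F. ?B i)")
      case True
      then obtain i where i: "i \<in> F" "y \<in> ?B i" by blast
      have "(\<Sum>i\<in>F. (norm (p i y))\<^sup>2) = (norm (p i y))\<^sup>2"
        using other[OF i(1) _ _ i(2)] i F(1) by (intro sum_eq_single) auto
      then show ?thesis using P_in[OF i] by simp
    next
      case False
      then have "p i y = 0" if "i \<in> F" for i using 1(3) that by blast
      then show ?thesis using P_out[OF False] by simp
    qed
    then show ?thesis using ip2 by (simp add: Bochner_Integration.integral_sum)
  qed
  note di = subsolution_defsq_integrable[OF sub G c cL]
  have gain: "?\<kappa> * (\<integral>y. indicator G y * defect_sq c v S y \<partial>lborel) \<le> (\<integral>y. (norm (P y))\<^sup>2 \<partial>lborel) + \<epsilon>"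
  proof -
    let ?U = "\<Union>i\<in>F. ?B i"
    have bU: "G - ?U \<in> sets borel" using G F(1) by (auto intro!: sets.Diff sets.finite_UN)
    have split: "indicator G y * defect_sq c v S y = (\<Sum>i\<in>F. indicator (?B i) y * (indicator G y * defect_sq c v S y)) + indicator (G - ?U) y * (indicator G y * defect_sq c v S y)" for y
    proof (cases "y \<in> ?U")
      case True
      then obtain i where i: "i \<in> F" "y \<in> ?B i" by blast
      have "(\<Sum>i\<in>F. indicator (?B i) y * (indicator G y * defect_sq c v S y)) = indicator (?B i) y * (indicator G y * defect_sq c v S y)"
      proof (rule sum_eq_single[OF F(1) i(1)])
        fix j assume "j \<in> F" "j \<noteq> i"
        then have "y \<notin> ?B j" using F(3) i by (metis disjoint_iff)
        then show "indicator (?B j) y * (indicator G y * defect_sq c v S y) = 0" by simp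
      qed
      moreover have "indicator (?B i) y = (1::real)" using i by simp
      moreover have "indicator (G - ?U) y = (0::real)" using True by (simp add: indicator_def)
      ultimately show ?thesis by simp
    next
      case False
      have "(\<Sum>i\<in>F. indicator (?B i) y * (indicator G y * defect_sq c v S y)) = 0"
        using False by (intro sum.neutral) (auto simp: indicator_def)
      then show ?thesis using False by (auto simp: indicator_def)
    qed
    have "(\<integral>y. indicator G y * defect_sq c v S y \<partial>lborel) =
      (\<Sum>i\<in>F. \<integral>y. indicator (?B i) y * (indicator G y * defect_sq c v S y) \<partial>lborel) + (\<integral>y. indicator (G - ?U) y * (indicator G y * defect_sq c v S y) \<partial>lborel)"
    proof -
      have "(\<integral>y. indicator G y * defect_sq c v S y \<partial>lborel) =
        (\<integral>y. (\<Sum>i\<in>F. indicator (?B i) y * (indicator G y * defect_sq c v S y)) + indicator (G - ?U) y * (indicator G y * defect_sq c v S y) \<partial>lborel)"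
        by (rule Bochner_Integration.integral_cong[OF refl split])
      also have "\<dots> = (\<integral>y. (\<Sum>i\<in>F. indicator (?B i) y * (indicator G y * defect_sq c v S y)) \<partial>lborel) + (\<integral>y. indicator (G - ?U) y * (indicator G y * defect_sq c v S y) \<partial>lborel)"
        by (intro Bochner_Integration.integral_add Bochner_Integration.integrable_sum di bU) auto
      also have "(\<integral>y. (\<Sum>i\<in>F. indicator (?B i) y * (indicator G y * defect_sq c v S y)) \<partial>lborel) = (\<Sum>i\<in>F. \<integral>y. indicator (?B i) y * (indicator G y * defect_sq c v S y) \<partial>lborel)"
        by (intro Bochner_Integration.integral_sum di) auto
      finally show ?thesis .
    qed
    also have "(\<Sum>i\<in>F. \<integral>y. indicator (?B i) y * (indicator G y * defect_sq c v S y) \<partial>lborel) = (\<Sum>i\<in>F. \<integral>y. indicator (?B i) y * defect_sq c v S y \<partial>lborel)"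
    proof (intro sum.cong refl Bochner_Integration.integral_cong)
      fix i y assume "i \<in> F"
      then show "indicator (?B i) y * (indicator G y * defect_sq c v S y) = indicator (?B i) y * defect_sq c v S y"
        using BG[of i] by (auto simp: indicator_def)
    qed
    finally have eq: "(\<integral>y. indicator G y * defect_sq c v S y \<partial>lborel) =
      (\<Sum>i\<in>F. \<integral>y. indicator (?B i) y * defect_sq c v S y \<partial>lborel) + (\<integral>y. indicator (G - ?U) y * (indicator G y * defect_sq c v S y) \<partial>lborel)" .
    have rest: "(\<integral>y. indicator (G - ?U) y * (indicator G y * defect_sq c v S y) \<partial>lborel) \<le> L ^ 4 * \<eta>"
    proof -
      have fm: "emeasure lborel (G - ?U) < \<infinity>" using emeasure_bounded_finite[OF bounded_subset[OF G(2)], of "G - ?U"] by blast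
      have "(\<integral>y. indicator (G - ?U) y * (indicator G y * defect_sq c v S y) \<partial>lborel) \<le> (\<integral>y. L ^ 4 * indicator (G - ?U) y \<partial>lborel)"
      proof (rule integral_mono)
        show "integrable lborel (\<lambda>y. indicator (G - ?U) y * (indicator G y * defect_sq c v S y))"
          by (rule di[OF _ bU])
        show "integrable lborel (\<lambda>y. L ^ 4 * indicator (G - ?U) y)"
          using fm bU by (intro integrable_mult_right) (auto simp: integrable_indicator_iff)
        show "indicator (G - ?U) y * (indicator G y * defect_sq c v S y) \<le> L ^ 4 * indicator (G - ?U) y" for y
          using subsolution_defsq_bound[OF sub _ cL, of y] by (auto simp: indicator_def)
      qed
      also have "\<dots> = L ^ 4 * measure lborel (G - ?U)" using bU by simp
      also have "\<dots> \<le> L ^ 4 * \<eta>" using F(4) L by (intro mult_left_mono) auto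
      finally show ?thesis .
    qed
    have "?\<kappa> * (\<Sum>i\<in>F. \<integral>y. indicator (?B i) y * defect_sq c v S y \<partial>lborel) \<le> (\<Sum>i\<in>F. (\<integral>y. (norm (p i y))\<^sup>2 \<partial>lborel) + e * measure lborel (?B i))"
      unfolding sum_distrib_left using 1(6) by (intro sum_mono) auto
    also have "\<dots> = (\<integral>y. (norm (P y))\<^sup>2 \<partial>lborel) + e * (\<Sum>i\<in>F. measure lborel (?B i))"
      by (simp add: nP sum.distrib sum_distrib_left)
    also have "\<dots> \<le> (\<integral>y. (norm (P y))\<^sup>2 \<partial>lborel) + e * ?m"
      using sumB e by (intro add_left_mono mult_left_mono) auto
    finally have "?\<kappa> * (\<Sum>i\<in>F. \<integral>y. indicator (?B i) y * defect_sq c v S y \<partial>lborel) \<le> (\<integral>y. (norm (P y))\<^sup>2 \<partial>lborel) + \<epsilon> / 2"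
      using e by linarith
    moreover have "?\<kappa> * (\<integral>y. indicator (G - ?U) y * (indicator G y * defect_sq c v S y) \<partial>lborel) \<le> \<epsilon> / 2"
      using mult_left_mono[OF rest, of ?\<kappa>] \<kappa> \<eta> by simp
    ultimately show ?thesis unfolding eq by (simp add: distrib_left)
  qed
  have orth: "\<bar>\<integral>y. g y \<bullet> P y \<partial>lborel\<bar> \<le> \<epsilon>" if g: "g \<in> H" for g
  proof -
    have ig: "integrable lborel (\<lambda>y. g y \<bullet> p i y)" if "i \<in> F" for i
      by (rule integrable_compact_support(2)[OF open_UNIV compact_cball[of "fst i" "snd i"]])
         (use 1(1,3)[OF that] H(2)[OF g] in \<open>auto intro!: continuous_intros\<close>)
    have "(\<integral>y. g y \<bullet> P y \<partial>lborel) = (\<Sum>i\<in>F. \<integral>y. g y \<bullet> p i y \<partial>lborel)"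
      unfolding P_def inner_sum_right using ig by (rule Bochner_Integration.integral_sum)
    also have "\<bar>\<dots>\<bar> \<le> (\<Sum>i\<in>F. e * measure lborel (?B i))"
      by (rule order_trans[OF sum_abs sum_mono]) (use 1(7) g in auto)
    also have "\<dots> \<le> e * ?m" unfolding sum_distrib_left[symmetric] using sumB e by (intro mult_left_mono) auto
    also have "\<dots> \<le> \<epsilon>" using e \<epsilon> by linarith
    finally show ?thesis .
  qed
  show ?thesis
    by (intro exI[of _ "\<lambda>y. v y + P y"] exI[of _ "\<lambda>y. S y + W y"]) (use new gain orth in auto)
qed

section \<open>Convex integration\<close>

lemma mat_mult_vec: "mat k *v x = k *\<^sub>R (x :: real^'n)"
proof -
  have "(mat k :: real^'n^'n) = k *\<^sub>R mat 1" by (simp add: mat_def vec_eq_iff)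
  then show ?thesis by (simp add: scaleR_matrix_vector_assoc[symmetric])
qed

lemma admissible_initial:
  assumes "k > 0"
  shows "admissible ((real CARD('n) + 1) * k) (0 :: real^'n) (mat k + 0)"
proof -
  have "trace (mat k :: real^'n^'n) = real CARD('n) * k" by (simp add: trace_def mat_def)
  then show ?thesis using assms by (simp add: admissible_def transpose_mat' mat_mult_vec distrib_right)
qed

lemma subsolution_initial:
  fixes G :: "(real \<times> (real^'n)) set"
  assumes "\<And>y. y \<in> G \<Longrightarrow> 0 < c y"
  shows "subsolution G c (\<lambda>_. 0 :: real^'n) (\<lambda>_. 0)"
  unfolding subsolution_def using assms solves_lin_zero[of G] admissible_initial by (auto intro!: exI[of _ "{}"])

text \<open>The finite set carried along collects the iterates found so far, to which the next increment is made almost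
  orthogonal.\<close>

lemma subsolution_sequence:
  fixes c :: "real \<times> (real^'n) \<Rightarrow> real" and L :: real
  assumes N: "CARD('n) \<ge> 2" and G: "open G" "bounded G" and c: "continuous_on G c" "\<And>y. y \<in> G \<Longrightarrow> 0 < c y"
    and cL: "\<And>y. y \<in> G \<Longrightarrow> (real CARD('n) + 1) * c y \<le> L\<^sup>2" and L: "L > 0"
  shows "\<exists>v S. \<forall>k. subsolution G c (v k) (S k) \<and>
    step_gain TYPE('n) L * (\<integral>y. indicator G y * defect_sq c (v k) (S k) y \<partial>lborel) \<le> (\<integral>y. (norm (v (Suc k) y - v k y))\<^sup>2 \<partial>lborel) + (1/2) ^ k \<and>
    (\<forall>j\<le>k. \<bar>\<integral>y. v j y \<bullet> (v (Suc k) y - v k y) \<partial>lborel\<bar> \<le> (1/2) ^ k)"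
proof -
  define P where "P x \<longleftrightarrow> subsolution G c (fst (snd x)) (snd (snd x)) \<and> finite (fst x) \<and> fst (snd x) \<in> fst x \<and> (\<forall>g\<in>fst x. continuous_on UNIV g)"
    for x :: "(real \<times> (real^'n) \<Rightarrow> real^'n) set \<times> (real \<times> (real^'n) \<Rightarrow> real^'n) \<times> (real \<times> (real^'n) \<Rightarrow> real^'n^'n)"
  define Q where "Q k x x' \<longleftrightarrow> fst x' = insert (fst (snd x')) (fst x) \<and>
     step_gain TYPE('n) L * (\<integral>y. indicator G y * defect_sq c (fst (snd x)) (snd (snd x)) y \<partial>lborel)
        \<le> (\<integral>y. (norm (fst (snd x') y - fst (snd x) y))\<^sup>2 \<partial>lborel) + (1/2) ^ k \<and>
     (\<forall>g\<in>fst x. \<bar>\<integral>y. g y \<bullet> (fst (snd x') y - fst (snd x) y) \<partial>lborel\<bar> \<le> (1/2) ^ k)"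
    for k and x x' :: "(real \<times> (real^'n) \<Rightarrow> real^'n) set \<times> (real \<times> (real^'n) \<Rightarrow> real^'n) \<times> (real \<times> (real^'n) \<Rightarrow> real^'n^'n)"
  have "\<exists>f. \<forall>k. P (f k) \<and> Q k (f k) (f (Suc k))"
  proof (rule dependent_nat_choice)
    show "\<exists>x. P x"
      by (rule exI[of _ "({\<lambda>_. 0}, \<lambda>_. 0, \<lambda>_. 0)"]) (use subsolution_initial[OF c(2)] in \<open>auto simp: P_def\<close>)
    fix x and k :: nat assume x: "P x"
    obtain H v S where xe: "x = (H, v, S)" by (cases x) auto
    have sub: "subsolution G c v S" and H: "finite H" "v \<in> H" "\<And>g. g \<in> H \<Longrightarrow> continuous_on UNIV g"
      using x by (auto simp: P_def xe)
    have e: "(1/2::real) ^ k > 0" by simp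
    obtain v' S' where 1: "subsolution G c v' S'"
      "step_gain TYPE('n) L * (\<integral>y. indicator G y * defect_sq c v S y \<partial>lborel) \<le> (\<integral>y. (norm (v' y - v y))\<^sup>2 \<partial>lborel) + (1/2) ^ k"
      "\<forall>g\<in>H. \<bar>\<integral>y. g y \<bullet> (v' y - v y) \<partial>lborel\<bar> \<le> (1/2) ^ k"
      using subsolution_perturbation[OF N sub G c(1) cL L e H(1,3)] by blast
    have "continuous_on UNIV v'" using 1(1) by (simp add: subsolution_def)
    then show "\<exists>x'. P x' \<and> Q k x x'"
      using 1 H by (intro exI[of _ "(insert v' H, v', S')"]) (auto simp: P_def Q_def xe)
  qed
  then obtain f where f: "\<And>k. P (f k)" "\<And>k. Q k (f k) (f (Suc k))" by blast
  define v where "v k = fst (snd (f k))" for k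
  define S where "S k = snd (snd (f k))" for k
  have sub: "fst (f j) \<subseteq> fst (f k)" if "j \<le> k" for j k
    using that by (induction k rule: dec_induct) (use f(2) in \<open>auto simp: Q_def\<close>)
  have vin: "v j \<in> fst (f k)" if "j \<le> k" for j k
    using sub[OF that] f(1)[of j] by (auto simp: P_def v_def)
  show ?thesis
  proof (intro exI[of _ v] exI[of _ S] allI conjI impI)
    show "subsolution G c (v k) (S k)" for k using f(1)[of k] by (simp add: P_def v_def S_def)
    show "step_gain TYPE('n) L * (\<integral>y. indicator G y * defect_sq c (v k) (S k) y \<partial>lborel) \<le> (\<integral>y. (norm (v (Suc k) y - v k y))\<^sup>2 \<partial>lborel) + (1/2) ^ k" for k
      using f(2)[of k] by (simp add: Q_def v_def S_def)
    show "\<bar>\<integral>y. v j y \<bullet> (v (Suc k) y - v k y) \<partial>lborel\<bar> \<le> (1/2) ^ k" if "j \<le> k" for k j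
      using f(2)[of k] vin[OF that] by (simp add: Q_def v_def)
  qed
qed

text \<open>Near-orthogonality turns the gain inequality into growth of the energy: up to a geometric error,
  \<open>\<parallel>v (k+1)\<parallel>\<^sup>2 - \<parallel>v k\<parallel>\<^sup>2\<close> dominates both the squared defect and \<open>\<parallel>v (k+1) - v k\<parallel>\<^sup>2\<close>. As the energy is
  bounded, it converges. Then the defects tend to zero and the sequence is Cauchy in \<open>L\<^sup>2\<close>.\<close>

lemma subsolution_cauchy:
  fixes c :: "real \<times> (real^'n) \<Rightarrow> real" and L :: real
  assumes G: "open G" "bounded G"
    and cL: "\<And>y. y \<in> G \<Longrightarrow> (real CARD('n) + 1) * c y \<le> L\<^sup>2" and L: "L > 0"
    and sub: "\<And>k. subsolution G c (v k) (S k)"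
    and gain: "\<And>k. step_gain TYPE('n) L * (\<integral>y. indicator G y * defect_sq c (v k) (S k) y \<partial>lborel) \<le> (\<integral>y. (norm (v (Suc k) y - v k y))\<^sup>2 \<partial>lborel) + (1/2) ^ k"
    and orth: "\<And>k j. j \<le> k \<Longrightarrow> \<bar>\<integral>y. v j y \<bullet> (v (Suc k) y - v k y) \<partial>lborel\<bar> \<le> (1/2) ^ k"
  shows "(\<lambda>k. \<integral>y. indicator G y * defect_sq c (v k) (S k) y \<partial>lborel) \<longlonglongrightarrow> 0"
    and "\<And>e. e > 0 \<Longrightarrow> \<exists>K. \<forall>i\<ge>K. \<forall>j\<ge>K. (\<integral>y. norm (v i y - v j y) \<partial>lborel) < e"
    and "\<And>k. integrable lborel (v k)"
proof -
  let ?\<kappa> = "step_gain TYPE('n) L"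
  let ?m = "measure lborel G"
  have \<kappa>: "?\<kappa> > 0" by (rule step_gain_pos[OF L])
  have cv: "continuous_on UNIV (v k)" for k using sub by (simp add: subsolution_def)
  have "\<exists>K. compact K \<and> K \<subseteq> G \<and> (\<forall>y. y \<notin> K \<longrightarrow> v k y = 0)" for k using sub[of k] unfolding subsolution_def by blast
  then obtain K where K: "\<And>k. compact (K k)" "\<And>k. K k \<subseteq> G" "\<And>k y. y \<notin> K k \<Longrightarrow> v k y = 0" by metis
  have v0: "v k y = 0" if "y \<notin> G" for k y using K that by blast
  have fG: "emeasure lborel G < \<infinity>" by (rule emeasure_bounded_finite[OF G(2)])
  have iG: "integrable lborel (\<lambda>y. a * indicator G y)" for a :: real
    using fG G by (intro integrable_mult_right) (auto simp: integrable_indicator_iff)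
  show iv: "integrable lborel (v k)" for k
    by (rule integrable_compact_support(2)[OF open_UNIV K(1)]) (use cv K(3) in auto)
  have ii: "integrable lborel (\<lambda>y. v i y \<bullet> v j y)" for i j
    by (rule integrable_compact_support(2)[OF open_UNIV K(1)[of i]]) (use cv K(3) in \<open>auto intro!: continuous_intros\<close>)
  define I where "I i j = (\<integral>y. v i y \<bullet> v j y \<partial>lborel)" for i j
  have Isym: "I i j = I j i" for i j by (simp add: I_def inner_commute)
  have I2: "(\<integral>y. (norm (v i y - v j y))\<^sup>2 \<partial>lborel) = I i i - 2 * I j i + I j j" for i j
  proof -
    have "(norm (v i y - v j y))\<^sup>2 = v i y \<bullet> v i y - 2 * (v j y \<bullet> v i y) + v j y \<bullet> v j y" for y
      by (simp add: power2_norm_eq_inner inner_diff_left inner_diff_right inner_commute)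
    then show ?thesis using ii by (simp add: I_def)
  qed
  have orth': "\<bar>I j (Suc k) - I j k\<bar> \<le> (1/2) ^ k" if "j \<le> k" for j k
    using orth[OF that] ii by (simp add: I_def inner_diff_right)
  define d where "d k = (\<integral>y. indicator G y * defect_sq c (v k) (S k) y \<partial>lborel)" for k
  have d0: "d k \<ge> 0" for k unfolding d_def by (intro integral_nonneg_AE AE_I2) (auto simp: defect_sq_def)
  have Eb: "I k k \<le> L\<^sup>2 * ?m" for k
  proof -
    have "I k k \<le> (\<integral>y. L\<^sup>2 * indicator G y \<partial>lborel)"
      unfolding I_def
    proof (rule integral_mono[OF ii iG])
      show "v k y \<bullet> v k y \<le> L\<^sup>2 * indicator G y" for y
        using subsolution_norm_bound[OF sub[of k], where y = y and L = L] cL[of y] v0[of y k] by (cases "y \<in> G") (auto simp: power2_norm_eq_inner)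
    qed
    then show ?thesis using G by simp
  qed
  \<comment> \<open>The correction makes the energy monotone: one step loses at most \<open>3 (1/2)^k\<close>, which is \<open>6 (1/2)^k - 6 (1/2)^(k+1)\<close>.\<close>
  define F where "F k = I k k - 6 * (1/2) ^ k" for k
  have F: "?\<kappa> * d k \<le> F (Suc k) - F k" for k
  proof -
    have "?\<kappa> * d k \<le> I (Suc k) (Suc k) - 2 * I k (Suc k) + I k k + (1/2) ^ k"
      using gain[of k] unfolding d_def I2[of "Suc k" k] .
    then show ?thesis using orth'[of k k] by (simp add: F_def)
  qed
  have "incseq F" using F d0 \<kappa> by (intro incseq_SucI) (smt (verit) mult_nonneg_nonneg)
  moreover have "F k \<le> L\<^sup>2 * ?m" for k using Eb[of k] zero_le_power[of "1/2::real" k] unfolding F_def by linarith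
  then have "\<forall>k. F k \<le> L\<^sup>2 * ?m" by blast
  ultimately obtain F' where F': "F \<longlonglongrightarrow> F'" using incseq_convergent by blast
  have "(\<lambda>k. (F (Suc k) - F k) / ?\<kappa>) \<longlonglongrightarrow> (F' - F') / ?\<kappa>"
    using \<kappa> by (intro tendsto_intros LIMSEQ_Suc F') auto
  then have Fd: "(\<lambda>k. (F (Suc k) - F k) / ?\<kappa>) \<longlonglongrightarrow> 0" by simp
  show "(\<lambda>k. \<integral>y. indicator G y * defect_sq c (v k) (S k) y \<partial>lborel) \<longlonglongrightarrow> 0"
    unfolding d_def[symmetric]
  proof (rule tendsto_sandwich[OF _ _ tendsto_const Fd])
    show "\<forall>\<^sub>F k in sequentially. 0 \<le> d k" using d0 by simp
    show "\<forall>\<^sub>F k in sequentially. d k \<le> (F (Suc k) - F k) / ?\<kappa>"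
      using F \<kappa> by (simp add: field_simps)
  qed
  have Ijk: "\<bar>I j k - I j j\<bar> \<le> 2 * (1/2) ^ j - 2 * (1/2) ^ k" if "j \<le> k" for j k
    using that
  proof (induction k rule: dec_induct)
    case (step k)
    then show ?case using orth'[of j k] by simp
  qed simp
  have diff: "(\<integral>y. (norm (v k y - v j y))\<^sup>2 \<partial>lborel) \<le> (F k - F j) + 10 * (1/2) ^ j" if "j \<le> k" for j k
  proof -
    have "(1/2::real) ^ k \<le> (1/2) ^ j" using that by (intro power_decreasing) auto
    then show ?thesis unfolding I2 F_def using Ijk[OF that] zero_le_power[of "1/2::real" k] by linarith
  qed
  have L2: "\<exists>K. \<forall>j\<ge>K. \<forall>k\<ge>j. (\<integral>y. (norm (v k y - v j y))\<^sup>2 \<partial>lborel) < e" if "e > 0" for e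
  proof -
    have "Cauchy F" using F' by (rule LIMSEQ_imp_Cauchy)
    then obtain K1 where K1: "\<And>j k. j \<ge> K1 \<Longrightarrow> k \<ge> K1 \<Longrightarrow> dist (F k) (F j) < e/2"
      using \<open>e > 0\<close> unfolding Cauchy_def by (meson half_gt_zero)
    have "(\<lambda>j. 10 * (1/2::real) ^ j) \<longlonglongrightarrow> 10 * 0" by (intro tendsto_mult tendsto_const LIMSEQ_power_zero) auto
    then have "\<forall>\<^sub>F j in sequentially. 10 * (1/2::real) ^ j < e/2"
      by (rule order_tendstoD(2)) (use \<open>e > 0\<close> in simp)
    then obtain K2 where K2: "\<And>j. j \<ge> K2 \<Longrightarrow> 10 * (1/2::real) ^ j < e/2" by (auto simp: eventually_sequentially)
    have "(\<integral>y. (norm (v k y - v j y))\<^sup>2 \<partial>lborel) < e" if "j \<ge> max K1 K2" "k \<ge> j" for j k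
    proof -
      have "dist (F k) (F j) < e/2" "10 * (1/2::real) ^ j < e/2" using K1[of j k] K2[of j] that by auto
      then show ?thesis using diff[OF that(2)] unfolding dist_real_def by linarith
    qed
    then show ?thesis by blast
  qed
  show "\<exists>K. \<forall>i\<ge>K. \<forall>j\<ge>K. (\<integral>y. norm (v i y - v j y) \<partial>lborel) < e" if e: "e > 0" for e
  proof -
    define \<delta> where "\<delta> = e / (2 * (?m + 1))"
    have \<delta>: "\<delta> > 0" "\<delta> * ?m < e / 2"
    proof -
      have m1: "?m + 1 > 0" by (simp add: add_nonneg_pos)
      show d0: "\<delta> > 0" unfolding \<delta>_def using e m1 by (intro divide_pos_pos mult_pos_pos) auto
      have "\<delta> * ?m < \<delta> * (?m + 1)" using d0 by (intro mult_strict_left_mono) auto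
      moreover have "e / (2 * M) * M = e / 2" if "M \<noteq> 0" for M :: real using that by simp
      ultimately show "\<delta> * ?m < e / 2" using m1 unfolding \<delta>_def by (metis less_irrefl)
    qed
    obtain K0 where K0: "\<And>j k. j \<ge> K0 \<Longrightarrow> k \<ge> j \<Longrightarrow> (\<integral>y. (norm (v k y - v j y))\<^sup>2 \<partial>lborel) < \<delta> * (e/2)"
      using L2[of "\<delta> * (e/2)"] \<delta> e by auto
    have i2: "integrable lborel (\<lambda>y. (norm (v k y - v j y))\<^sup>2)" for j k
    proof -
      have "(norm (v k y - v j y))\<^sup>2 = v k y \<bullet> v k y - 2 * (v j y \<bullet> v k y) + v j y \<bullet> v j y" for y
        by (simp add: power2_norm_eq_inner inner_diff_left inner_diff_right inner_commute)
      then show ?thesis using ii by simp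
    qed
    have 1: "(\<integral>y. norm (v k y - v j y) \<partial>lborel) < e" if "j \<ge> K0" "k \<ge> j" for j k
    proof -
      have "(\<integral>y. norm (v k y - v j y) \<partial>lborel) \<le> (\<integral>y. \<delta> * indicator G y + (norm (v k y - v j y))\<^sup>2 / \<delta> \<partial>lborel)"
      proof (rule integral_mono)
        show "integrable lborel (\<lambda>y. norm (v k y - v j y))" using iv by simp
        show "integrable lborel (\<lambda>y. \<delta> * indicator G y + (norm (v k y - v j y))\<^sup>2 / \<delta>)"
          using iG i2 by simp
        fix y
        have t: "t \<le> \<delta> + t\<^sup>2 / \<delta>" if "t \<ge> 0" for t
        proof (cases "t \<le> \<delta>")
          case True then show ?thesis using \<delta>(1) by (smt (verit) divide_nonneg_pos zero_le_power2)
        next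
          case False
          then have "t * \<delta> \<le> t * t" using that by (intro mult_left_mono) auto
          then have "t \<le> t\<^sup>2 / \<delta>" using \<delta>(1) by (simp add: field_simps power2_eq_square)
          then show ?thesis using \<delta>(1) by linarith
        qed
        show "norm (v k y - v j y) \<le> \<delta> * indicator G y + (norm (v k y - v j y))\<^sup>2 / \<delta>"
          using t[of "norm (v k y - v j y)"] v0[of y] by (cases "y \<in> G") auto
      qed
      also have "\<dots> = \<delta> * ?m + (\<integral>y. (norm (v k y - v j y))\<^sup>2 \<partial>lborel) / \<delta>"
        using iG i2 G by simp
      also have "(\<integral>y. (norm (v k y - v j y))\<^sup>2 \<partial>lborel) / \<delta> \<le> e / 2"
        using K0[OF that] \<delta>(1) by (simp add: field_simps)
      finally show ?thesis using \<delta>(2) by linarith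
    qed
    show ?thesis
    proof (intro exI[of _ K0] allI impI)
      fix i j assume "i \<ge> K0" "j \<ge> K0"
      then show "(\<integral>y. norm (v i y - v j y) \<partial>lborel) < e"
        using 1[of j i] 1[of i j] by (cases "i \<le> j") (auto simp: norm_minus_commute)
    qed
  qed
qed

lemma blinfun_expand:
  fixes T :: "(real \<times> (real^'n)) \<Rightarrow>\<^sub>L 'b::real_normed_vector"
  shows "T (0, x) = (\<Sum>j\<in>UNIV. x $ j *\<^sub>R T (0, axis j 1))"
proof -
  have "(0::real, x) = (\<Sum>j\<in>UNIV. x $ j *\<^sub>R (0, axis j 1))"
    using basis_expansion[of x] by (simp add: scalar_mult_eq_scaleR prod_eq_iff fst_sum snd_sum)
  then show ?thesis by (simp only: blinfun.sum_right blinfun.scaleR_right)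
qed

lemma borel_measurable_component:
  "f \<in> borel_measurable M \<Longrightarrow> (\<lambda>y. (f y :: real^'n) $ j) \<in> borel_measurable M"
  by (rule measurable_compose[of f M borel "\<lambda>x. x $ j"])
     (auto intro!: borel_measurable_continuous_onI continuous_intros)

lemma norm_blinfun_axis: "norm (T (0, axis j 1)) \<le> norm T" for T :: "(real \<times> (real^'n)) \<Rightarrow>\<^sub>L 'b::real_normed_vector"
  using norm_blinfun[of T "(0, axis j 1)"] by (simp add: norm_Pair norm_axis_1)

text \<open>Along a subsequence the subsolutions and their defects converge a.e., so \<open>c Id + S\<close> converges to
  \<open>v \<otimes> v\<close>. All fields are uniformly bounded, and the linear identities pass to the limit by dominated
  convergence. For that the derivative of the test function has to be bounded on \<open>G\<close>.\<close>

lemma convex_integration: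
  fixes c :: "real \<times> (real^'n) \<Rightarrow> real" and C :: real
  assumes N: "CARD('n) \<ge> 2" and G: "open G" "bounded G" and c: "continuous_on G c" "\<And>y. y \<in> G \<Longrightarrow> 0 < c y"
    and cC: "\<And>y. y \<in> G \<Longrightarrow> c y \<le> C"
  shows "\<exists>v. v \<in> borel_measurable borel \<and> (\<forall>y. y \<notin> G \<longrightarrow> v y = 0) \<and>
    (AE y in lborel. y \<in> G \<longrightarrow> (norm (v y))\<^sup>2 \<le> (real CARD('n) + 1) * c y) \<and>
    (\<forall>\<theta> T B. (\<forall>y\<in>G. (\<theta> has_derivative blinfun_apply (T y)) (at y)) \<and> continuous_on G T \<and> (\<forall>y\<in>G. norm (T y) \<le> B) \<longrightarrow>
       (\<integral>y. indicator G y * blinfun_apply (T y :: (real \<times> (real^'n)) \<Rightarrow>\<^sub>L real) (0, v y) \<partial>lborel) = 0) \<and>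
    (\<forall>\<theta> T B. (\<forall>y\<in>G. (\<theta> has_derivative blinfun_apply (T y)) (at y)) \<and> continuous_on G T \<and> (\<forall>y\<in>G. norm (T y) \<le> B) \<longrightarrow>
       (\<integral>y. indicator G y * (v y \<bullet> blinfun_apply (T y :: (real \<times> (real^'n)) \<Rightarrow>\<^sub>L (real^'n)) (1, v y)
          - c y * (\<Sum>j\<in>UNIV. blinfun_apply (T y) (0, axis j 1) $ j)) \<partial>lborel) = 0)"
proof -
  define L where "L = sqrt ((real CARD('n) + 1) * max C 1)"
  have L: "L > 0" by (simp add: L_def)
  have L2: "L\<^sup>2 = (real CARD('n) + 1) * max C 1" by (simp add: L_def)
  have cL: "(real CARD('n) + 1) * c y \<le> L\<^sup>2" if "y \<in> G" for y
    unfolding L2 using cC[OF that] by (intro mult_left_mono) auto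
  obtain v S where vS: "\<And>k. subsolution G c (v k) (S k)"
    "\<And>k. step_gain TYPE('n) L * (\<integral>y. indicator G y * defect_sq c (v k) (S k) y \<partial>lborel) \<le> (\<integral>y. (norm (v (Suc k) y - v k y))\<^sup>2 \<partial>lborel) + (1/2) ^ k"
    "\<And>k j. j \<le> k \<Longrightarrow> \<bar>\<integral>y. v j y \<bullet> (v (Suc k) y - v k y) \<partial>lborel\<bar> \<le> (1/2) ^ k"
    using subsolution_sequence[OF N G c cL L] by blast
  note ca = subsolution_cauchy[OF G cL L vS]
  have iG: "integrable lborel (\<lambda>y. a * indicator G y)" for a :: real
    using G(2) G by (intro integrable_const_indicator) auto
  obtain r1 where r1: "strict_mono r1" "AE y in lborel. Cauchy (\<lambda>k. v (r1 k) y)"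
    by (rule cauchy_L1_AE_cauchy_subseq[of lborel v, OF ca(3)]) (use ca(2) in auto)
  define u where "u k y = indicator G y * defect_sq c (v (r1 k)) (S (r1 k)) y" for k y
  have u: "integrable lborel (u k)" for k
    using subsolution_defsq_integrable[OF vS(1)[of "r1 k"] G c(1) cL, of UNIV] by (simp add: u_def[abs_def])
  have "(\<lambda>k. \<integral>y. norm (u k y) \<partial>lborel) \<longlonglongrightarrow> 0"
  proof -
    have "norm (u k y) = u k y" for k y by (simp add: u_def defect_sq_def)
    then show ?thesis using LIMSEQ_subseq_LIMSEQ[OF ca(1) r1(1)] by (simp add: u_def o_def)
  qed
  then obtain r2 where r2: "strict_mono r2" "AE y in lborel. (\<lambda>k. u (r2 k) y) \<longlonglongrightarrow> 0"
    using tendsto_L1_AE_subseq[of lborel u, OF u] by blast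
  define p where "p k = v (r1 (r2 k))" for k
  define W where "W k = S (r1 (r2 k))" for k
  have sub: "subsolution G c (p k) (W k)" for k using vS(1) by (simp add: p_def W_def)
  have cp: "continuous_on UNIV (p k)" "continuous_on UNIV (W k)" "solves_lin G (p k) (W k)" for k using sub[of k] by (auto simp: subsolution_def)
  have ad: "admissible ((real CARD('n) + 1) * c y) (p k y) (mat (c y) + W k y)" if "y \<in> G" for k y
    using sub that by (auto simp: subsolution_def)
  have p0: "p k y = 0" "W k y = 0" if "y \<notin> G" for k y
    using sub[of k] that unfolding subsolution_def by blast+
  define q where "q y = indicator G y *\<^sub>R lim (\<lambda>k. p k y)" for y
  have pm: "p k \<in> borel_measurable borel" for k using cp by (simp add: borel_measurable_continuous_onI)
  have qm[measurable]: "q \<in> borel_measurable borel"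
    unfolding q_def[abs_def] using G pm by (intro borel_measurable_scaleR borel_measurable_lim_metric) auto
  have q0: "q y = 0" if "y \<notin> G" for y using that by (simp add: q_def)
  have lim: "AE y in lborel. (\<lambda>k. p k y) \<longlonglongrightarrow> q y \<and> (y \<in> G \<longrightarrow> (\<lambda>k. defect (p k y) (mat (c y) + W k y)) \<longlonglongrightarrow> 0)"
    using r1(2) r2(2)
  proof eventually_elim
    case (elim y)
    show ?case
    proof (cases "y \<in> G")
      case True
      have "Cauchy (\<lambda>k. p k y)"
        using Cauchy_subseq_Cauchy[OF elim(1) r2(1)] by (simp add: p_def o_def)
      then have "(\<lambda>k. p k y) \<longlonglongrightarrow> lim (\<lambda>k. p k y)" by (simp add: Cauchy_convergent_iff convergent_LIMSEQ_iff)
      moreover have "(\<lambda>k. (defect (p k y) (mat (c y) + W k y))\<^sup>2) \<longlonglongrightarrow> 0"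
        using elim(2) True by (simp add: u_def defect_sq_def p_def W_def)
      then have "(\<lambda>k. defect (p k y) (mat (c y) + W k y)) \<longlonglongrightarrow> 0"
        by (simp add: power_tendsto_0_iff)
      ultimately show ?thesis using True by (simp add: q_def)
    next
      case False
      then show ?thesis using p0 q0 by simp
    qed
  qed
  have pL: "norm (p k y) \<le> L" for k y
  proof (cases "y \<in> G")
    case True
    have "(norm (p k y))\<^sup>2 \<le> L\<^sup>2" using subsolution_norm_bound[OF sub True cL[OF True]] .
    then show ?thesis using L by (auto intro: power2_le_imp_le)
  qed (use p0 L in simp)
  have entry: "\<bar>(mat (c y) + W k y) $ i $ j - p k y $ i * p k y $ j\<bar> \<le> defect (p k y) (mat (c y) + W k y)" if "y \<in> G" for k y i j
    by (rule admissible_entry_le_defect[OF ad[OF that]])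
  have WL: "\<bar>W k y $ i $ j\<bar> \<le> 3 * L\<^sup>2" for k y i j
  proof (cases "y \<in> G")
    case True
    have "\<bar>p k y $ i * p k y $ j\<bar> \<le> L * L"
      unfolding abs_mult using component_le_norm_cart[of "p k y"] pL[of k y] L by (intro mult_mono) (auto intro: order_trans)
    moreover have "defect (p k y) (mat (c y) + W k y) \<le> L\<^sup>2" using admissible_defect_le[OF ad[OF True]] cL[OF True] by (meson less_imp_le order_trans)
    moreover have "\<bar>mat (c y) $ i $ j\<bar> \<le> L\<^sup>2"
    proof -
      have "c y * 1 \<le> c y * (real CARD('n) + 1)" using c(2)[OF True] by (intro mult_left_mono) auto
      then have "c y \<le> L\<^sup>2" using cL[OF True] by (metis mult.commute mult.right_neutral order_trans)
      then show ?thesis using c(2)[OF True] by (auto simp: mat_def)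
    qed
    ultimately show ?thesis using entry[OF True, of k i j] by (simp add: power2_eq_square)
  qed (use p0 in simp)
  have fin: "AE y in lborel. y \<in> G \<longrightarrow> (norm (q y))\<^sup>2 \<le> (real CARD('n) + 1) * c y"
    using lim
  proof eventually_elim
    case (elim y)
    show ?case
    proof
      assume y: "y \<in> G"
      have "(\<lambda>k. (norm (p k y))\<^sup>2) \<longlonglongrightarrow> (norm (q y))\<^sup>2" using elim by (intro tendsto_intros) auto
      then show "(norm (q y))\<^sup>2 \<le> (real CARD('n) + 1) * c y"
        by (rule LIMSEQ_le_const2) (use admissible_norm[OF ad[OF y]] in \<open>auto intro!: less_imp_le\<close>)
    qed
  qed
  have meas: "(\<lambda>y. indicator G y * f y) \<in> borel_measurable borel" if "continuous_on G f" for f :: "real \<times> (real^'n) \<Rightarrow> real"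
    using borel_measurable_continuous_on_indicator[OF _ that] G by simp
  have eq1: "(\<integral>y. indicator G y * blinfun_apply (T y) (0, q y) \<partial>lborel) = 0"
    if T: "\<And>y. y \<in> G \<Longrightarrow> (\<theta> has_derivative blinfun_apply (T y)) (at y)" "continuous_on G T" "\<And>y. y \<in> G \<Longrightarrow> norm (T y) \<le> B"
    for \<theta> and T :: "real \<times> (real^'n) \<Rightarrow> (real \<times> (real^'n)) \<Rightarrow>\<^sub>L real" and B
  proof -
    have "(\<lambda>k. \<integral>y. indicator G y * blinfun_apply (T y) (0, p k y) \<partial>lborel) \<longlonglongrightarrow> (\<integral>y. indicator G y * blinfun_apply (T y) (0, q y) \<partial>lborel)"
    proof (rule integral_dominated_convergence[where w = "\<lambda>y. (B * L) * indicator G y"])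
      have e: "indicator G y * blinfun_apply (T y) (0, z y) = (\<Sum>j\<in>UNIV. z y $ j * (indicator G y * blinfun_apply (T y) (0, axis j 1)))" for y and z :: "_ \<Rightarrow> real^'n"
        by (simp add: blinfun_expand[of "T y" "z y"] sum_distrib_left mult_ac)
      have m: "(\<lambda>y. indicator G y * blinfun_apply (T y) (0, axis j 1)) \<in> borel_measurable borel" for j
        by (intro meas continuous_intros T(2))
      have "(\<lambda>y. indicator G y * blinfun_apply (T y) (0, z y)) \<in> borel_measurable lborel" if "z \<in> borel_measurable borel" for z :: "_ \<Rightarrow> real^'n"
      proof -
        have "(\<lambda>y. z y $ j) \<in> borel_measurable borel" for j by (rule borel_measurable_component[OF that])
        then show ?thesis unfolding e using m by simp
      qed
      then show "(\<lambda>y. indicator G y * blinfun_apply (T y) (0, q y)) \<in> borel_measurable lborel"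
        "(\<lambda>y. indicator G y * blinfun_apply (T y) (0, p k y)) \<in> borel_measurable lborel" for k using qm pm by blast+
      show "AE y in lborel. (\<lambda>k. indicator G y * blinfun_apply (T y) (0, p k y)) \<longlonglongrightarrow> indicator G y * blinfun_apply (T y) (0, q y)"
        using lim by eventually_elim (intro tendsto_intros, simp)
      show "AE y in lborel. norm (indicator G y * blinfun_apply (T y) (0, p k y)) \<le> (B * L) * indicator G y" for k
      proof (rule AE_I2)
        fix y
        show "norm (indicator G y * blinfun_apply (T y) (0, p k y)) \<le> (B * L) * indicator G y"
        proof (cases "y \<in> G")
          case True
          have "norm (blinfun_apply (T y) (0, p k y)) \<le> norm (T y) * norm (p k y)"
            using norm_blinfun[of "T y" "(0, p k y)"] by (simp add: norm_Pair)
          also have "\<dots> \<le> B * L" using T(3)[OF True] pL[of k y] by (intro mult_mono) (auto intro: order_trans[OF norm_ge_zero])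
          finally show ?thesis using True by simp
        qed simp
      qed
    qed (rule iG)
    moreover have "(\<integral>y. indicator G y * blinfun_apply (T y) (0, p k y) \<partial>lborel) = 0" for k
    proof -
      have e: "indicator G y * blinfun_apply (T y) (0, p k y) = blinfun_apply (T y) (0, p k y)" for y
        using p0(1)[of y k] by (cases "y \<in> G") (auto simp: zero_prod_def[symmetric])
      show ?thesis unfolding e by (rule solves_linD1[OF cp(3) T(1,2)])
    qed
    ultimately show ?thesis using LIMSEQ_unique[OF _ tendsto_const] by auto
  qed
  have eq2: "(\<integral>y. indicator G y * (q y \<bullet> blinfun_apply (T y) (1, q y) - c y * (\<Sum>j\<in>UNIV. blinfun_apply (T y) (0, axis j 1) $ j)) \<partial>lborel) = 0"
    if T: "\<And>y. y \<in> G \<Longrightarrow> (\<theta> has_derivative blinfun_apply (T y)) (at y)" "continuous_on G T" "\<And>y. y \<in> G \<Longrightarrow> norm (T y) \<le> B"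
    for \<theta> and T :: "real \<times> (real^'n) \<Rightarrow> (real \<times> (real^'n)) \<Rightarrow>\<^sub>L (real^'n)" and B
  proof -
    let ?f = "\<lambda>z A y. (\<Sum>i\<in>UNIV. z y $ i * (indicator G y * (blinfun_apply (T y) (1, 0) $ i)))
       + (\<Sum>j\<in>UNIV. \<Sum>i\<in>UNIV. A y $ i $ j * (indicator G y * (blinfun_apply (T y) (0, axis j 1) $ i)))"
    define A where "A y = outer (q y) (q y) - indicator G y *\<^sub>R mat (c y)" for y
    have m1: "(\<lambda>y. indicator G y * (blinfun_apply (T y) u $ i)) \<in> borel_measurable borel" for u i
      by (intro meas continuous_intros T(2))
    have comp: "\<bar>blinfun_apply (T y) u $ i\<bar> \<le> B" if "y \<in> G" "norm u = 1" for y u i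
      using component_le_norm_cart[of "blinfun_apply (T y) u" i] norm_blinfun[of "T y" u] T(3)[OF that(1)] that(2) by simp
    have mm: "?f z A \<in> borel_measurable lborel" if "\<And>i. (\<lambda>y. z y $ i) \<in> borel_measurable borel" "\<And>i j. (\<lambda>y. indicator G y * A y $ i $ j) \<in> borel_measurable borel"
      for z :: "_ \<Rightarrow> real^'n" and A :: "_ \<Rightarrow> real^'n^'n"
    proof -
      have e: "A y $ i $ j * (indicator G y * (blinfun_apply (T y) (0, axis j 1) $ i)) = (indicator G y * A y $ i $ j) * (indicator G y * (blinfun_apply (T y) (0, axis j 1) $ i))" for y i j
        by (simp add: indicator_def)
      have h1: "(\<lambda>y. z y $ i * (indicator G y * (blinfun_apply (T y) (1, 0) $ i))) \<in> borel_measurable lborel" for i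
        using borel_measurable_times[OF that(1) m1] by simp
      have h2: "(\<lambda>y. (indicator G y * A y $ i $ j) * (indicator G y * (blinfun_apply (T y) (0, axis j 1) $ i))) \<in> borel_measurable lborel" for i j
        using borel_measurable_times[OF that(2) m1] by simp
      show ?thesis unfolding e by (intro borel_measurable_add borel_measurable_sum h1 h2)
    qed
    have qi: "(\<lambda>y. q y $ i) \<in> borel_measurable borel" for i by (rule borel_measurable_component[OF qm])
    have pi: "(\<lambda>y. p k y $ i) \<in> borel_measurable borel" for i k by (rule borel_measurable_component[OF pm])
    have "(\<lambda>k. \<integral>y. ?f (p k) (W k) y \<partial>lborel) \<longlonglongrightarrow> (\<integral>y. ?f q A y \<partial>lborel)"
    proof (rule integral_dominated_convergence[where w = "\<lambda>y. (CARD('n) * (L * B) + CARD('n) * (CARD('n) * (3 * L\<^sup>2 * B))) * indicator G y"])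
      show "?f q A \<in> borel_measurable lborel"
      proof (rule mm[OF qi])
        fix i j
        have e: "indicator G y * A y $ i $ j = indicator G y * (q y $ i * q y $ j) - (if i = j then indicator G y * c y else 0)" for y
          by (simp add: A_def outer_def mat_def indicator_def)
        have h1: "(\<lambda>y. indicator G y * (q y $ i * q y $ j)) \<in> borel_measurable borel"
          using qi G by (intro borel_measurable_times borel_measurable_indicator) auto
        have h2: "(\<lambda>y. if i = j then indicator G y * c y else 0) \<in> borel_measurable borel"
          using meas[OF c(1)] by (cases "i = j") auto
        show "(\<lambda>y. indicator G y * A y $ i $ j) \<in> borel_measurable borel"
          unfolding e by (rule borel_measurable_diff[OF h1 h2])
      qed
      show "?f (p k) (W k) \<in> borel_measurable lborel" for k
      proof (rule mm[OF pi])
        fix i j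
        show "(\<lambda>y. indicator G y * W k y $ i $ j) \<in> borel_measurable borel"
          by (intro meas continuous_intros continuous_on_subset[OF cp(2)]) auto
      qed
      show "AE y in lborel. (\<lambda>k. ?f (p k) (W k) y) \<longlonglongrightarrow> ?f q A y"
        using lim
      proof eventually_elim
        case (elim y)
        show ?case
        proof (cases "y \<in> G")
          case True
          have w: "(\<lambda>k. W k y $ i $ j) \<longlonglongrightarrow> A y $ i $ j" for i j
          proof -
            have h1: "(\<lambda>k. (mat (c y) + W k y) $ i $ j - p k y $ i * p k y $ j) \<longlonglongrightarrow> 0"
              by (rule Lim_null_comparison[OF _ conjunct2[OF elim, rule_format, OF True]]) (use entry[OF True] in auto)
            have h2: "(\<lambda>k. p k y $ i * p k y $ j) \<longlonglongrightarrow> q y $ i * q y $ j"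
              using elim by (intro tendsto_intros) auto
            have "(\<lambda>k. ((mat (c y) + W k y) $ i $ j - p k y $ i * p k y $ j) + p k y $ i * p k y $ j - mat (c y) $ i $ j) \<longlonglongrightarrow> 0 + q y $ i * q y $ j - mat (c y) $ i $ j"
              by (rule tendsto_diff[OF tendsto_add[OF h1 h2] tendsto_const])
            then show ?thesis using True by (simp add: A_def outer_def)
          qed
          show ?thesis using elim by (intro tendsto_intros w) auto
        next
          case False then show ?thesis by simp
        qed
      qed
      show "AE y in lborel. norm (?f (p k) (W k) y) \<le> (CARD('n) * (L * B) + CARD('n) * (CARD('n) * (3 * L\<^sup>2 * B))) * indicator G y" for k
      proof (rule AE_I2)
        fix y
        show "norm (?f (p k) (W k) y) \<le> (CARD('n) * (L * B) + CARD('n) * (CARD('n) * (3 * L\<^sup>2 * B))) * indicator G y"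
        proof (cases "y \<in> G")
          case True
          have "norm (\<Sum>i\<in>UNIV. p k y $ i * (indicator G y * (blinfun_apply (T y) (1, 0) $ i))) \<le> (\<Sum>i\<in>(UNIV::'n set). L * B)"
          proof (rule order_trans[OF norm_sum sum_mono])
            fix i
            have "\<bar>p k y $ i\<bar> \<le> L" using component_le_norm_cart[of "p k y" i] pL[of k y] by linarith
            then show "norm (p k y $ i * (indicator G y * (blinfun_apply (T y) (1, 0) $ i))) \<le> L * B"
              using comp[OF True, of "(1,0)" i] True L by (simp add: abs_mult norm_Pair) (intro mult_mono, auto)
          qed
          moreover have "norm (\<Sum>j\<in>UNIV. \<Sum>i\<in>UNIV. W k y $ i $ j * (indicator G y * (blinfun_apply (T y) (0, axis j 1) $ i)))
             \<le> (\<Sum>j\<in>(UNIV::'n set). \<Sum>i\<in>(UNIV::'n set). 3 * L\<^sup>2 * B)"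
          proof (rule order_trans[OF norm_sum sum_mono], rule order_trans[OF norm_sum sum_mono])
            fix i j
            show "norm (W k y $ i $ j * (indicator G y * (blinfun_apply (T y) (0, axis j 1) $ i))) \<le> 3 * L\<^sup>2 * B"
              using comp[OF True, of "(0, axis j 1)" i] WL[of k y i j] True by (simp add: abs_mult norm_Pair norm_axis_1) (intro mult_mono, auto)
          qed
          ultimately show ?thesis using True
            norm_triangle_ineq[of "\<Sum>i\<in>UNIV. p k y $ i * (indicator G y * (blinfun_apply (T y) (1, 0) $ i))" "\<Sum>j\<in>UNIV. \<Sum>i\<in>UNIV. W k y $ i $ j * (indicator G y * (blinfun_apply (T y) (0, axis j 1) $ i))"]
            by simp
        qed simp
      qed
    qed (rule iG)
    moreover have "(\<integral>y. ?f (p k) (W k) y \<partial>lborel) = 0" for k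
    proof -
      have e: "?f (p k) (W k) y = p k y \<bullet> T y (1, 0) + contract (W k y) (T y)" for y
        using p0[of y k] by (cases "y \<in> G") (auto simp: contract_sum inner_vec_def)
      show ?thesis unfolding e by (rule solves_linD2[OF cp(3) T(1,2)])
    qed
    ultimately have z: "(\<integral>y. ?f q A y \<partial>lborel) = 0" using LIMSEQ_unique[OF _ tendsto_const] by auto
    have e: "?f q A y = indicator G y * (q y \<bullet> blinfun_apply (T y) (1, q y) - c y * (\<Sum>j\<in>UNIV. blinfun_apply (T y) (0, axis j 1) $ j))" for y
    proof (cases "y \<in> G")
      case True
      have l: "linear (blinfun_apply (T y))" using bounded_linear.linear blinfun.bounded_linear_right by blast
      have "?f q A y = q y \<bullet> T y (1, 0) + contract (A y) (T y)" using True by (simp add: contract_sum inner_vec_def)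
      also have "contract (A y) (T y) = q y \<bullet> T y (0, q y) - contract (mat (c y)) (T y)"
        using True by (simp add: A_def contract_diff contract_outer[OF l])
      also have "contract (mat (c y)) (T y) = c y * (\<Sum>j\<in>UNIV. blinfun_apply (T y) (0, axis j 1) $ j)"
        by (simp add: contract_sum mat_def if_distrib[of "\<lambda>a. a * b" for b] sum.delta sum_distrib_left cong: if_cong)
      also have "q y \<bullet> T y (1, 0) + (q y \<bullet> T y (0, q y) - c y * (\<Sum>j\<in>UNIV. blinfun_apply (T y) (0, axis j 1) $ j)) = q y \<bullet> T y (1, q y) - c y * (\<Sum>j\<in>UNIV. blinfun_apply (T y) (0, axis j 1) $ j)"
      proof -
        have "T y (1, q y) = T y (1, 0) + T y (0, q y)" by (simp add: blinfun.add_right[symmetric])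
        then show ?thesis by (simp add: inner_add_right)
      qed
      finally show ?thesis using True by simp
    qed simp
    show ?thesis using z unfolding e .
  qed
  show ?thesis
    using qm q0 fin eq1 eq2 by (intro exI[of _ q]) blast
qed

section \<open>Cylinders over Hausdorff null sets\<close>

lemma hausdorff_null_subset: "hausdorff_null s A \<Longrightarrow> B \<subseteq> A \<Longrightarrow> hausdorff_null s B"
  unfolding hausdorff_null_def by (meson subset_trans)

lemma enlarge_power:
  fixes a e :: real
  assumes "0 \<le> a" "a < 1" "e > 0"
  shows "\<exists>b. a < b \<and> b \<le> 1 \<and> b ^ s \<le> a ^ s + e"
proof -
  have "((\<lambda>b. b ^ s) \<longlongrightarrow> a ^ s) (at_right a)" by (intro tendsto_intros)
  then have "\<forall>\<^sub>F b in at_right a. b ^ s < a ^ s + e" by (rule order_tendstoD(2)) (use assms in simp)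
  moreover have "\<forall>\<^sub>F b in at_right a. b \<in> {a<..<1}" using assms(2) by (rule eventually_at_right_real)
  ultimately have "\<forall>\<^sub>F b in at_right a. b ^ s < a ^ s + e \<and> b \<in> {a<..<1}" by (rule eventually_conj)
  then obtain b where "b ^ s < a ^ s + e \<and> b \<in> {a<..<1}"
    using eventually_happens' trivial_limit_at_right_real by blast
  then show ?thesis by (intro exI[of _ b]) auto
qed

text \<open>A piece of diameter \<open>d\<close> generates a cylinder that is covered by about \<open>R / d\<close> balls of radius \<open>d\<close>, of volume
  \<open>R d\<^sup>N\<^sup>-\<^sup>1\<close> up to constants. Thus a set of zero surface measure is avoided by almost every line in direction
  \<open>\<nu>\<close>.\<close>

lemma negligible_cylinder_over_hausdorff_null:
  fixes Z :: "(real^'n) set"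
  assumes Z: "hausdorff_null (CARD('n) - 1) Z" and \<nu>: "norm \<nu> = 1" and R: "R > 0"
  shows "negligible {y. \<exists>s. \<bar>s\<bar> \<le> R \<and> y + s *\<^sub>R \<nu> \<in> Z}"
  unfolding negligible_outer
proof (intro allI impI)
  fix e :: real assume e: "e > 0"
  let ?N = "CARD('n)"
  have N1: "?N \<ge> 1" by (simp add: Suc_le_eq)
  define V where "V = unit_ball_vol (real ?N)"
  have V: "V \<ge> 0" by (simp add: V_def)
  define A where "A = V * 2 ^ ?N * (2 * R + 2)"
  have A: "A \<ge> 0" using V R by (simp add: A_def)
  define \<epsilon> where "\<epsilon> = min (1/2) (e / (4 * (A + 1)))"
  have \<epsilon>: "\<epsilon> > 0" "\<epsilon> < 1" "A * (3 * \<epsilon>) < e"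
  proof -
    show "\<epsilon> > 0" "\<epsilon> < 1" using e A by (auto simp: \<epsilon>_def)
    have "\<epsilon> \<le> e / (4 * (A + 1))" by (simp add: \<epsilon>_def)
    then have "4 * (A + 1) * \<epsilon> \<le> e" using A by (simp add: field_simps)
    moreover have "A * (3 * \<epsilon>) < 4 * (A + 1) * \<epsilon>"
    proof -
      have "A * \<epsilon> \<ge> 0" using A \<open>\<epsilon> > 0\<close> by simp
      then show ?thesis using \<open>\<epsilon> > 0\<close> by (simp add: algebra_simps)
    qed
    ultimately show "A * (3 * \<epsilon>) < e" by linarith
  qed
  obtain C where C: "Z \<subseteq> (\<Union>i. C i)" "\<And>i. bounded (C i)" "summable (\<lambda>i. diameter (C i) ^ (?N - 1))"
    "(\<Sum>i. diameter (C i) ^ (?N - 1)) < \<epsilon>"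
    using Z \<epsilon>(1) unfolding hausdorff_null_def by blast
  have d0: "diameter (C i) \<ge> 0" for i using C(2) by (rule diameter_ge_0)
  define dd where "dd i = (if ?N = 1 then 0 else diameter (C i))" for i :: nat
  have dd: "0 \<le> dd i" "dd i < 1" for i
  proof -
    show "0 \<le> dd i" using d0 by (simp add: dd_def)
    show "dd i < 1"
    proof (cases "?N = 1")
      case False
      have "diameter (C i) ^ (?N - 1) \<le> (\<Sum>i. diameter (C i) ^ (?N - 1))"
        using sum_le_suminf[OF C(3), of "{i}"] d0 by simp
      then have "diameter (C i) ^ (?N - 1) < 1" using C(4) \<epsilon>(2) by linarith
      then show ?thesis using False N1 one_le_power[of "diameter (C i)" "?N - 1"] by (auto simp: dd_def not_le[symmetric])
    qed (simp add: dd_def)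
  qed
  \<comment> \<open>For \<open>N = 1\<close> every \<open>diameter ^ 0\<close> is 1 and the series cannot converge.\<close>
  show "\<exists>T. {y. \<exists>s. \<bar>s\<bar> \<le> R \<and> y + s *\<^sub>R \<nu> \<in> Z} \<subseteq> T \<and> T \<in> lmeasurable \<and> measure lebesgue T < e"
  proof (cases "?N = 1")
    case True
    have "(\<Sum>i. diameter (C i) ^ (?N - 1)) = (\<Sum>i::nat. 1)" using True by simp
    moreover have "summable (\<lambda>i::nat. 1::real)" using C(3) True by simp
    ultimately have False using summable_LIMSEQ_zero[of "\<lambda>i::nat. 1::real"] LIMSEQ_unique[OF tendsto_const, of "1::real" 0] by fastforce
    then show ?thesis ..
  next
    case False
    then have dC: "dd i = diameter (C i)" for i by (simp add: dd_def)
    have "\<forall>i. \<exists>b. dd i < b \<and> b \<le> 1 \<and> b ^ (?N - 1) \<le> dd i ^ (?N - 1) + \<epsilon> * (1/2) ^ i"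
      using enlarge_power dd \<epsilon>(1) by simp
    then obtain \<delta> where \<delta>: "\<And>i. dd i < \<delta> i" "\<And>i. \<delta> i \<le> 1" "\<And>i. \<delta> i ^ (?N - 1) \<le> dd i ^ (?N - 1) + \<epsilon> * (1/2) ^ i"
      by metis
    have \<delta>0: "\<delta> i > 0" for i using \<delta>(1)[of i] dd(1)[of i] by linarith
    define p where "p i = (SOME x. x \<in> C i)" for i
    define M where "M i = nat \<lceil>2 * R / \<delta> i\<rceil>" for i
    define B where "B i = (\<Union>m\<in>{0..M i}. cball (p i - (- R + real m * \<delta> i) *\<^sub>R \<nu>) (2 * \<delta> i))" for i
    define T where "T = (\<Union>i. B i)"
    have Bs: "B i \<in> sets lborel" for i by (auto simp: B_def)
    have sub: "{y. \<exists>s. \<bar>s\<bar> \<le> R \<and> y + s *\<^sub>R \<nu> \<in> Z} \<subseteq> T"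
    proof
      fix y assume "y \<in> {y. \<exists>s. \<bar>s\<bar> \<le> R \<and> y + s *\<^sub>R \<nu> \<in> Z}"
      then obtain s where s: "\<bar>s\<bar> \<le> R" "y + s *\<^sub>R \<nu> \<in> Z" by blast
      then obtain i where i: "y + s *\<^sub>R \<nu> \<in> C i" using C(1) by blast
      have pi: "p i \<in> C i" unfolding p_def using i by (rule someI)
      have n1: "norm (y + s *\<^sub>R \<nu> - p i) \<le> \<delta> i"
        using diameter_bounded_bound[OF C(2) i pi] \<delta>(1)[of i] by (simp add: dC dist_norm)
      define m where "m = nat \<lfloor>(s + R) / \<delta> i\<rfloor>"
      have q0: "(s + R) / \<delta> i \<ge> 0" using s(1) \<delta>0[of i] by simp
      have m1: "real m \<le> (s + R) / \<delta> i" "(s + R) / \<delta> i < real m + 1" using q0 by (auto simp: m_def)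
      have "real m \<le> 2 * R / \<delta> i"
        using m1(1) divide_right_mono[of "s + R" "2 * R" "\<delta> i"] s(1) \<delta>0[of i] by linarith
      then have mM: "m \<le> M i" unfolding M_def by linarith
      have "\<bar>s - (- R + real m * \<delta> i)\<bar> \<le> \<delta> i"
      proof -
        have "real m * \<delta> i \<le> s + R" using m1(1) \<delta>0[of i] by (simp add: field_simps)
        moreover have "s + R < real m * \<delta> i + \<delta> i" using m1(2) \<delta>0[of i] by (simp add: field_simps)
        ultimately show ?thesis by linarith
      qed
      then have n2: "norm ((s - (- R + real m * \<delta> i)) *\<^sub>R \<nu>) \<le> \<delta> i" using \<nu> by simp
      have e3: "y - (p i - (- R + real m * \<delta> i) *\<^sub>R \<nu>) = (y + s *\<^sub>R \<nu> - p i) - (s - (- R + real m * \<delta> i)) *\<^sub>R \<nu>"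
        by (simp add: algebra_simps)
      have "norm (y - (p i - (- R + real m * \<delta> i) *\<^sub>R \<nu>)) \<le> 2 * \<delta> i"
        unfolding e3 using norm_triangle_ineq4[of "y + s *\<^sub>R \<nu> - p i" "(s - (- R + real m * \<delta> i)) *\<^sub>R \<nu>"] n1 n2 by linarith
      then have "y \<in> B i" unfolding B_def using mM by (auto simp: dist_norm norm_minus_commute intro!: bexI[of _ m])
      then show "y \<in> T" by (auto simp: T_def)
    qed
    have eB: "emeasure lborel (B i) \<le> ennreal (A * \<delta> i ^ (?N - 1))" for i
    proof -
      have "emeasure lborel (B i) \<le> (\<Sum>m\<in>{0..M i}. emeasure lborel (cball (p i - (- R + real m * \<delta> i) *\<^sub>R \<nu>) (2 * \<delta> i)))"
        unfolding B_def by (intro emeasure_subadditive_finite) auto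
      also have "\<dots> = (\<Sum>m\<in>{0..M i}. ennreal (V * (2 * \<delta> i) ^ ?N))"
        using \<delta>0[of i] by (intro sum.cong refl) (simp add: emeasure_cball V_def)
      also have "\<dots> = ennreal ((real (M i) + 1) * (V * (2 * \<delta> i) ^ ?N))"
        using V \<delta>0[of i] by (subst sum_ennreal) (auto simp: algebra_simps)
      also have "\<dots> \<le> ennreal (A * \<delta> i ^ (?N - 1))"
      proof (rule ennreal_leI)
        have "real (M i) \<le> 2 * R / \<delta> i + 1" unfolding M_def using R \<delta>0[of i] by simp
        then have "(real (M i) + 1) * \<delta> i \<le> 2 * R + 2 * \<delta> i" using \<delta>0[of i] by (simp add: field_simps)
        also have "\<dots> \<le> 2 * R + 2" using \<delta>(2)[of i] by simp
        finally have 1: "(real (M i) + 1) * \<delta> i \<le> 2 * R + 2" .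
        have "\<delta> i ^ ?N = \<delta> i * \<delta> i ^ (?N - 1)" using N1 by (simp add: power_eq_if)
        then have "(real (M i) + 1) * (V * (2 * \<delta> i) ^ ?N) = (V * 2 ^ ?N * \<delta> i ^ (?N - 1)) * ((real (M i) + 1) * \<delta> i)"
          by (simp add: power_mult_distrib)
        also have "\<dots> \<le> (V * 2 ^ ?N * \<delta> i ^ (?N - 1)) * (2 * R + 2)"
          using V \<delta>0[of i] 1 by (intro mult_left_mono) auto
        finally show "(real (M i) + 1) * (V * (2 * \<delta> i) ^ ?N) \<le> A * \<delta> i ^ (?N - 1)" by (simp add: A_def mult_ac)
      qed
      finally show ?thesis .
    qed
    have sg: "(\<lambda>i. \<epsilon> * (1/2) ^ i) sums (\<epsilon> * 2)"
      using sums_mult[OF geometric_sums[of "1/2::real"], of \<epsilon>] by simp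
    have s1: "(\<lambda>i. A * (diameter (C i) ^ (?N - 1) + \<epsilon> * (1/2) ^ i)) sums (A * ((\<Sum>i. diameter (C i) ^ (?N - 1)) + \<epsilon> * 2))"
      by (intro sums_mult sums_add summable_sums C(3) sg)
    have "emeasure lborel T \<le> (\<Sum>i. emeasure lborel (B i))"
      unfolding T_def by (rule emeasure_subadditive_countably) (use Bs in auto)
    also have "\<dots> \<le> (\<Sum>i. ennreal (A * (diameter (C i) ^ (?N - 1) + \<epsilon> * (1/2) ^ i)))"
    proof (rule suminf_le)
      show "emeasure lborel (B i) \<le> ennreal (A * (diameter (C i) ^ (?N - 1) + \<epsilon> * (1/2) ^ i))" for i
        using \<delta>(3)[of i] A by (intro order_trans[OF eB] ennreal_leI mult_left_mono) (auto simp: dC)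
    qed auto
    also have "\<dots> = ennreal (A * ((\<Sum>i. diameter (C i) ^ (?N - 1)) + \<epsilon> * 2))"
    proof -
      have "\<And>i. 0 \<le> A * (diameter (C i) ^ (?N - 1) + \<epsilon> * (1/2) ^ i)"
        using A d0 \<epsilon>(1) by (intro mult_nonneg_nonneg add_nonneg_nonneg) auto
      then show ?thesis by (rule suminf_ennreal_eq[OF _ s1])
    qed
    also have "\<dots> < ennreal e"
    proof (rule ennreal_lessI[OF e])
      have "A * ((\<Sum>i. diameter (C i) ^ (?N - 1)) + \<epsilon> * 2) \<le> A * (3 * \<epsilon>)"
        using C(4) A by (intro mult_left_mono) auto
      then show "A * ((\<Sum>i. diameter (C i) ^ (?N - 1)) + \<epsilon> * 2) < e" using \<epsilon>(3) by linarith
    qed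
    finally have eT: "emeasure lborel T < ennreal e" .
    have Ts: "T \<in> sets lborel" using Bs by (auto simp: T_def)
    have fT: "emeasure lborel T < \<infinity>" by (rule less_trans[OF eT]) simp
    have fm: "T \<in> fmeasurable lborel" by (rule fmeasurableI[OF Ts fT])
    have mT: "measure lborel T < e"
      using eT by (simp add: emeasure_eq_measure2[OF fm] ennreal_less_iff)
    have "T \<in> lmeasurable" using Ts fT by (intro fmeasurableI) (auto simp: emeasure_completion)
    moreover have "measure lebesgue T < e" using mT measure_completion[OF Ts] by simp
    ultimately have "T \<in> lmeasurable" "measure lebesgue T < e" .
    then show ?thesis using sub by blast
  qed
qed

section \<open>Lipschitz charts\<close>

text \<open>The height of the boundary graph above \<open>y\<close>: positive inside the domain, zero on the boundary, and decreasing
  with slope one along \<open>\<nu>\<close>.\<close>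

definition chart_fun :: "real^'n \<Rightarrow> real^'n \<Rightarrow> (real^'n \<Rightarrow> real) \<Rightarrow> real^'n \<Rightarrow> real" where
  "chart_fun x \<nu> h y = h ((y - x) - ((y - x) \<bullet> \<nu>) *\<^sub>R \<nu>) - (y - x) \<bullet> \<nu>"

lemma chart_fun_shift:
  assumes "norm \<nu> = 1"
  shows "chart_fun x \<nu> h (y + s *\<^sub>R \<nu>) = chart_fun x \<nu> h y - s"
proof -
  have n: "\<nu> \<bullet> \<nu> = 1" using assms by (simp add: norm_eq_1)
  have e1: "(y + s *\<^sub>R \<nu> - x) \<bullet> \<nu> = (y - x) \<bullet> \<nu> + s" using n by (simp add: inner_diff_left inner_add_left)
  have e2: "(y + s *\<^sub>R \<nu> - x) - ((y - x) \<bullet> \<nu> + s) *\<^sub>R \<nu> = (y - x) - ((y - x) \<bullet> \<nu>) *\<^sub>R \<nu>"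
    by (simp add: algebra_simps)
  show ?thesis unfolding chart_fun_def e1 e2 by simp
qed

lemma norm_projection_le:
  assumes "norm \<nu> = 1"
  shows "norm (z - (z \<bullet> \<nu>) *\<^sub>R \<nu>) \<le> norm (z :: 'a::real_inner)"
proof (rule power2_le_imp_le)
  have n: "\<nu> \<bullet> \<nu> = 1" using assms by (simp add: norm_eq_1)
  have "(norm (z - (z \<bullet> \<nu>) *\<^sub>R \<nu>))\<^sup>2 = (norm z)\<^sup>2 - (z \<bullet> \<nu>)\<^sup>2"
    unfolding power2_norm_eq_inner using n by (simp add: inner_diff_left inner_diff_right power2_eq_square inner_commute)
  then show "(norm (z - (z \<bullet> \<nu>) *\<^sub>R \<nu>))\<^sup>2 \<le> (norm z)\<^sup>2" by simp
qed simp

lemma chart_fun_lipschitz: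
  assumes \<nu>: "norm \<nu> = 1" and L: "L-lipschitz_on {v. v \<bullet> \<nu> = 0} h"
  shows "\<bar>chart_fun x \<nu> h y - chart_fun x \<nu> h z\<bar> \<le> (L + 1) * norm (y - z)"
proof -
  have n: "\<nu> \<bullet> \<nu> = 1" using \<nu> by (simp add: norm_eq_1)
  let ?\<pi> = "\<lambda>w. w - (w \<bullet> \<nu>) *\<^sub>R \<nu>"
  have "?\<pi> w \<in> {v. v \<bullet> \<nu> = 0}" for w using n by (simp add: inner_diff_left)
  then have "dist (h (?\<pi> (y - x))) (h (?\<pi> (z - x))) \<le> L * dist (?\<pi> (y - x)) (?\<pi> (z - x))"
    using lipschitz_onD[OF L] by blast
  moreover have "?\<pi> (y - x) - ?\<pi> (z - x) = ?\<pi> (y - z)" by (simp add: inner_diff_left algebra_simps)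
  moreover have "L * norm (?\<pi> (y - z)) \<le> L * norm (y - z)"
    using lipschitz_on_nonneg[OF L] norm_projection_le[OF \<nu>] by (intro mult_left_mono) auto
  ultimately have "\<bar>h (?\<pi> (y - x)) - h (?\<pi> (z - x))\<bar> \<le> L * norm (y - z)" by (simp add: dist_norm)
  moreover have "\<bar>(y - x) \<bullet> \<nu> - (z - x) \<bullet> \<nu>\<bar> \<le> norm (y - z)"
    using Cauchy_Schwarz_ineq2[of "y - z" \<nu>] \<nu> by (simp add: inner_diff_left)
  ultimately show ?thesis unfolding chart_fun_def distrib_right by linarith
qed

lemma chart_fun_zero_iff_frontier:
  assumes \<Omega>: "open \<Omega>" and \<nu>: "norm \<nu> = 1" and L: "L-lipschitz_on {v. v \<bullet> \<nu> = 0} h"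
    and r: "\<And>y. y \<in> ball x r \<Longrightarrow> y \<in> \<Omega> \<longleftrightarrow> chart_fun x \<nu> h y > 0" and b: "b \<in> ball x r"
  shows "chart_fun x \<nu> h b = 0 \<longleftrightarrow> b \<in> frontier \<Omega>"
proof
  let ?d = "chart_fun x \<nu> h"
  have cont: "continuous_on UNIV ?d"
  proof -
    have "(L + 1)-lipschitz_on UNIV ?d"
      using chart_fun_lipschitz[OF \<nu> L] lipschitz_on_nonneg[OF L] by (intro lipschitz_onI) (auto simp: dist_norm)
    then show ?thesis by (rule lipschitz_on_continuous_on)
  qed
  assume d0: "?d b = 0"
  have "b \<notin> \<Omega>" using r[OF b] d0 by simp
  moreover have "b \<in> closure \<Omega>"
    unfolding closure_approachable
  proof (intro allI impI)
    fix e :: real assume e: "e > 0"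
    define s where "s = min e (r - dist x b) / 2"
    have s: "s > 0" "s < e" "s < r - dist x b" using e b by (auto simp: s_def min_def)
    have "b - s *\<^sub>R \<nu> \<in> ball x r"
    proof -
      have "dist x (b - s *\<^sub>R \<nu>) \<le> dist x b + dist b (b - s *\<^sub>R \<nu>)" by (rule dist_triangle)
      also have "dist b (b - s *\<^sub>R \<nu>) = s" using s \<nu> by (simp add: dist_norm)
      finally show ?thesis using s by simp
    qed
    moreover have "?d (b - s *\<^sub>R \<nu>) = s" using chart_fun_shift[OF \<nu>, of x h b "- s"] d0 by simp
    ultimately have "b - s *\<^sub>R \<nu> \<in> \<Omega>" using r s by simp
    moreover have "dist (b - s *\<^sub>R \<nu>) b < e" using s \<nu> by (simp add: dist_norm)
    ultimately show "\<exists>y\<in>\<Omega>. dist y b < e" by blast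
  qed
  ultimately show "b \<in> frontier \<Omega>" using \<Omega> by (simp add: frontier_def interior_open)
next
  let ?d = "chart_fun x \<nu> h"
  assume "b \<in> frontier \<Omega>"
  then have b': "b \<notin> \<Omega>" "b \<in> closure \<Omega>" using \<Omega> by (auto simp: frontier_def interior_open)
  have "?d b \<le> 0" using r[OF b] b'(1) by simp
  moreover have "\<not> ?d b < 0"
  proof
    assume neg: "?d b < 0"
    have L1: "L + 1 > 0" using lipschitz_on_nonneg[OF L] by simp
    define e where "e = min (r - dist x b) (- ?d b / (L + 1))"
    have "e > 0" using b neg L1 by (simp add: e_def divide_neg_pos)
    then obtain y where y: "y \<in> \<Omega>" "dist y b < e" using b'(2) unfolding closure_approachable by blast
    have "dist x y < r" using dist_triangle[of x y b] y(2) by (simp add: e_def dist_commute)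
    then have "?d y > 0" using r y(1) by simp
    moreover have "(L + 1) * norm (y - b) < - ?d b"
      using y(2) L1 by (simp add: e_def dist_norm field_simps)
    ultimately show False using chart_fun_lipschitz[OF \<nu> L, of x y b] by linarith
  qed
  ultimately show "?d b = 0" by linarith
qed

text \<open>The normal at \<open>b\<close> may come from another chart, with gradient \<open>- e\<close> of its height function. The point
  \<open>z = y + d(y) \<nu>\<close> is on the boundary, so \<open>e \<bullet> (z - b) = o(\<bar>y - b\<bar>)\<close>, that is,
  \<open>d(y) (e \<bullet> \<nu>) = - e \<bullet> (y - b) + o(\<bar>y - b\<bar>)\<close>. This is the derivative of \<open>d\<close>, as \<open>e \<bullet> \<nu> = 0\<close> would
  force \<open>e = 0\<close>.\<close>

lemma outer_normal_derivative:
  fixes \<Omega> :: "(real^'n) set"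
  assumes \<Omega>: "open \<Omega>" and \<nu>: "norm \<nu> = 1" and L: "L-lipschitz_on {v. v \<bullet> \<nu> = 0} h"
    and r: "\<And>y. y \<in> ball x r \<Longrightarrow> y \<in> \<Omega> \<longleftrightarrow> chart_fun x \<nu> h y > 0" and b: "b \<in> ball x r"
    and bf: "b \<in> frontier \<Omega>" and n: "outer_normal \<Omega> b n"
  shows "\<exists>\<mu>. (chart_fun x \<nu> h has_derivative (\<lambda>v. \<mu> * (n \<bullet> v))) (at b)"
proof -
  let ?d = "chart_fun x \<nu> h"
  obtain \<nu>2 h2 g where 2: "lipschitz_chart \<Omega> b \<nu>2 h2" "g \<bullet> \<nu>2 = 0"
    "(h2 has_derivative (\<lambda>v. g \<bullet> v)) (at 0 within {v. v \<bullet> \<nu>2 = 0})" "n = (1 / norm (\<nu>2 - g)) *\<^sub>R (\<nu>2 - g)"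
    using n unfolding outer_normal_def by blast
  obtain L2 r2 where \<nu>2: "norm \<nu>2 = 1" and L2: "L2-lipschitz_on {v. v \<bullet> \<nu>2 = 0} h2" and r2: "r2 > 0"
    "\<And>y. y \<in> ball b r2 \<Longrightarrow> y \<in> \<Omega> \<longleftrightarrow> chart_fun b \<nu>2 h2 y > 0"
    using 2(1) unfolding lipschitz_chart_def chart_fun_def by (auto simp: algebra_simps)
  let ?d2 = "chart_fun b \<nu>2 h2"
  have n2: "\<nu>2 \<bullet> \<nu>2 = 1" using \<nu>2 by (simp add: norm_eq_1)
  define e where "e = \<nu>2 - g"
  have e0: "e \<noteq> 0"
  proof
    assume "e = 0"
    then have "e \<bullet> \<nu>2 = 0" by simp
    then show False using 2(2) n2 by (simp add: e_def inner_diff_left)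
  qed
  have d2: "(?d2 has_derivative (\<lambda>v. - (e \<bullet> v))) (at b)"
  proof -
    let ?\<pi> = "\<lambda>y. (y - b) - ((y - b) \<bullet> \<nu>2) *\<^sub>R \<nu>2"
    have p: "(?\<pi> has_derivative (\<lambda>v. v - (v \<bullet> \<nu>2) *\<^sub>R \<nu>2)) (at b)"
      by (auto intro!: derivative_eq_intros)
    have "(h2 has_derivative (\<lambda>v. g \<bullet> v)) (at (?\<pi> b) within ?\<pi> ` UNIV)"
      by (rule has_derivative_subset[of _ _ _ "{v. v \<bullet> \<nu>2 = 0}"])
         (use 2(3) n2 in \<open>auto simp: inner_diff_left\<close>)
    from has_derivative_in_compose[OF p this]
    have "((\<lambda>y. h2 (?\<pi> y)) has_derivative (\<lambda>v. g \<bullet> (v - (v \<bullet> \<nu>2) *\<^sub>R \<nu>2))) (at b)" .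
    moreover have "((\<lambda>y. (y - b) \<bullet> \<nu>2) has_derivative (\<lambda>v. v \<bullet> \<nu>2)) (at b)"
      by (auto intro!: derivative_eq_intros)
    ultimately have "((\<lambda>y. h2 (?\<pi> y) - (y - b) \<bullet> \<nu>2) has_derivative (\<lambda>v. g \<bullet> (v - (v \<bullet> \<nu>2) *\<^sub>R \<nu>2) - v \<bullet> \<nu>2)) (at b)"
      by (rule has_derivative_diff)
    moreover have "(\<lambda>v. g \<bullet> (v - (v \<bullet> \<nu>2) *\<^sub>R \<nu>2) - v \<bullet> \<nu>2) = (\<lambda>v. - (e \<bullet> v))"
      using 2(2) by (auto simp: e_def inner_diff_left inner_diff_right inner_commute)
    ultimately show ?thesis by (simp add: chart_fun_def[abs_def])
  qed
  have d2b: "?d2 b = 0" using chart_fun_zero_iff_frontier[OF \<Omega> \<nu>2 L2 r2(2), where b = b] r2(1) bf by simp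
  have db: "?d b = 0" using chart_fun_zero_iff_frontier[OF \<Omega> \<nu> L r b] bf by simp
  have L1: "L + 1 \<ge> 1" using lipschitz_on_nonneg[OF L] by simp
  have key: "\<exists>\<delta>>0. \<forall>y. norm (y - b) < \<delta> \<longrightarrow> \<bar>e \<bullet> (y - b) + ?d y * (e \<bullet> \<nu>)\<bar> \<le> \<epsilon> * norm (y - b)" if \<epsilon>: "\<epsilon> > 0" for \<epsilon>
  proof -
    have "\<epsilon> / (L + 2) > 0" using \<epsilon> L1 by simp
    then obtain \<delta>1 where \<delta>1: "\<delta>1 > 0" "\<And>y. norm (y - b) < \<delta>1 \<Longrightarrow> norm (?d2 y - ?d2 b - - (e \<bullet> (y - b))) \<le> \<epsilon> / (L + 2) * norm (y - b)"
      using d2 unfolding has_derivative_at_alt by blast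
    define \<delta> where "\<delta> = min \<delta>1 (min r2 (r - dist x b)) / (L + 2)"
    have \<delta>: "\<delta> > 0" using \<delta>1(1) r2(1) b L1 by (simp add: \<delta>_def)
    have "\<bar>e \<bullet> (y - b) + ?d y * (e \<bullet> \<nu>)\<bar> \<le> \<epsilon> * norm (y - b)" if y: "norm (y - b) < \<delta>" for y
    proof -
      define z where "z = y + ?d y *\<^sub>R \<nu>"
      have dz: "?d z = 0" unfolding z_def by (simp add: chart_fun_shift[OF \<nu>])
      have "\<bar>?d y\<bar> \<le> (L + 1) * norm (y - b)" using chart_fun_lipschitz[OF \<nu> L, of x y b] db by simp
      moreover have "z - b = (y - b) + ?d y *\<^sub>R \<nu>" by (simp add: z_def)
      ultimately have zb: "norm (z - b) \<le> (L + 2) * norm (y - b)"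
        using norm_triangle_ineq[of "y - b" "?d y *\<^sub>R \<nu>"] \<nu> by (simp add: algebra_simps)
      also have "\<dots> < min \<delta>1 (min r2 (r - dist x b))" using y L1 by (simp add: \<delta>_def field_simps)
      finally have z: "norm (z - b) < \<delta>1" "norm (z - b) < r2" "norm (z - b) < r - dist x b" by auto
      have "dist x z < r" using dist_triangle[of x z b] z(3) by (simp add: dist_norm norm_minus_commute)
      then have "z \<in> frontier \<Omega>" using chart_fun_zero_iff_frontier[OF \<Omega> \<nu> L r, where b = z] dz by simp
      then have "?d2 z = 0"
        using chart_fun_zero_iff_frontier[OF \<Omega> \<nu>2 L2 r2(2), where b = z] z(2) by (simp add: dist_norm norm_minus_commute)
      then have "\<bar>e \<bullet> (z - b)\<bar> \<le> \<epsilon> / (L + 2) * norm (z - b)" using \<delta>1(2)[OF z(1)] d2b by simp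
      also have "\<dots> \<le> \<epsilon> / (L + 2) * ((L + 2) * norm (y - b))" using zb \<epsilon> L1 by (intro mult_left_mono) auto
      also have "\<dots> = \<epsilon> * norm (y - b)" using L1 by simp
      finally show ?thesis by (simp add: z_def inner_add_right inner_diff_right algebra_simps)
    qed
    then show ?thesis using \<delta> by blast
  qed
  have en: "e \<bullet> \<nu> \<noteq> 0"
  proof
    assume z: "e \<bullet> \<nu> = 0"
    obtain \<delta> where \<delta>: "\<delta> > 0" "\<And>y. norm (y - b) < \<delta> \<Longrightarrow> \<bar>e \<bullet> (y - b) + ?d y * (e \<bullet> \<nu>)\<bar> \<le> norm e / 2 * norm (y - b)"
      using key[of "norm e / 2"] e0 by auto
    define t where "t = \<delta> / (2 * norm e)"
    have t: "t > 0" "t * norm e < \<delta>" using \<delta>(1) e0 by (auto simp: t_def)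
    have "\<bar>e \<bullet> (t *\<^sub>R e)\<bar> \<le> norm e / 2 * norm (t *\<^sub>R e)" using \<delta>(2)[of "b + t *\<^sub>R e"] t z by simp
    then have "t * (norm e)\<^sup>2 \<le> t * (norm e)\<^sup>2 / 2" using t by (simp add: power2_norm_eq_inner[symmetric] power2_eq_square)
    moreover have "t * (norm e)\<^sup>2 > 0" using t e0 by simp
    ultimately show False by linarith
  qed
  have "(?d has_derivative (\<lambda>v. - (e \<bullet> v) / (e \<bullet> \<nu>))) (at b)"
    unfolding has_derivative_at_alt
  proof (intro conjI allI impI)
    show "bounded_linear (\<lambda>v. - (e \<bullet> v) / (e \<bullet> \<nu>))"
      using bounded_linear_inner_right[of "(- 1 / (e \<bullet> \<nu>)) *\<^sub>R e"] by simp
    fix \<epsilon> :: real assume \<epsilon>: "\<epsilon> > 0"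
    obtain \<delta> where \<delta>: "\<delta> > 0" "\<And>y. norm (y - b) < \<delta> \<Longrightarrow> \<bar>e \<bullet> (y - b) + ?d y * (e \<bullet> \<nu>)\<bar> \<le> (\<epsilon> * \<bar>e \<bullet> \<nu>\<bar>) * norm (y - b)"
      using key[of "\<epsilon> * \<bar>e \<bullet> \<nu>\<bar>"] \<epsilon> en by auto
    show "\<exists>\<delta>>0. \<forall>y. norm (y - b) < \<delta> \<longrightarrow> norm (?d y - ?d b - - (e \<bullet> (y - b)) / (e \<bullet> \<nu>)) \<le> \<epsilon> * norm (y - b)"
    proof (intro exI[of _ \<delta>] conjI allI impI \<delta>(1))
      fix y assume "norm (y - b) < \<delta>"
      then have "\<bar>e \<bullet> (y - b) + ?d y * (e \<bullet> \<nu>)\<bar> \<le> (\<epsilon> * norm (y - b)) * \<bar>e \<bullet> \<nu>\<bar>" using \<delta>(2) by (simp add: mult_ac)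
      then have "\<bar>e \<bullet> (y - b) + ?d y * (e \<bullet> \<nu>)\<bar> / \<bar>e \<bullet> \<nu>\<bar> \<le> \<epsilon> * norm (y - b)" using en by (simp add: divide_le_eq)
      moreover have "?d y - ?d b - - (e \<bullet> (y - b)) / (e \<bullet> \<nu>) = (e \<bullet> (y - b) + ?d y * (e \<bullet> \<nu>)) / (e \<bullet> \<nu>)"
        using en db by (simp add: field_simps)
      ultimately show "norm (?d y - ?d b - - (e \<bullet> (y - b)) / (e \<bullet> \<nu>)) \<le> \<epsilon> * norm (y - b)" by (simp add: abs_divide)
    qed
  qed
  moreover have "(\<lambda>v. - (e \<bullet> v) / (e \<bullet> \<nu>)) = (\<lambda>v. (- norm e / (e \<bullet> \<nu>)) * (n \<bullet> v))"
    using e0 by (simp add: 2(4) e_def[symmetric] fun_eq_iff)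
  ultimately show ?thesis by metis
qed

section \<open>The Gauss theorem on Lipschitz domains\<close>

text \<open>A \<open>C\<^sup>1\<close> step from 0 on \<open>t \<le> 1\<close> to 1 on \<open>t \<ge> 2\<close>.\<close>

definition step_fun :: "real \<Rightarrow> real" where
  "step_fun t = (max 0 (1 - (max 0 (2 - t))\<^sup>2))\<^sup>2"

definition step_fun' :: "real \<Rightarrow> real" where
  "step_fun' t = 4 * max 0 (2 - t) * max 0 (1 - (max 0 (2 - t))\<^sup>2)"

lemma DERIV_step_fun: "(step_fun has_real_derivative step_fun' t) (at t)"
proof -
  have p: "((\<lambda>x::real. (max 0 x)\<^sup>2) has_real_derivative 2 * max 0 x) (at x)" for x
    using DERIV_pospart_power[of 0 x] by (simp add: numeral_2_eq_2)
  have "((\<lambda>t. 2 - t) has_real_derivative -1) (at t)" by (auto intro!: derivative_eq_intros)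
  from DERIV_chain2[OF p this] have "((\<lambda>t. (max 0 (2 - t))\<^sup>2) has_real_derivative 2 * max 0 (2 - t) * -1) (at t)" .
  from DERIV_diff[OF DERIV_const[of 1] this]
  have "((\<lambda>t. 1 - (max 0 (2 - t))\<^sup>2) has_real_derivative 2 * max 0 (2 - t)) (at t)" by simp
  from DERIV_chain2[OF p this] show ?thesis
    unfolding step_fun_def[abs_def] step_fun'_def by (simp add: mult_ac)
qed

lemma step_fun_le1: "t \<le> 1 \<Longrightarrow> step_fun t = 0" "t \<le> 1 \<Longrightarrow> step_fun' t = 0"
proof -
  assume "t \<le> 1"
  then have "1 \<le> (max 0 (2 - t))\<^sup>2" by (intro one_le_power) auto
  then show "step_fun t = 0" "step_fun' t = 0" by (auto simp: step_fun_def step_fun'_def)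
qed

lemma step_fun_ge2: "t \<ge> 2 \<Longrightarrow> step_fun t = 1" "t \<ge> 2 \<Longrightarrow> step_fun' t = 0"
  by (auto simp: step_fun_def step_fun'_def max_def)

lemma step_fun_range: "0 \<le> step_fun t" "step_fun t \<le> 1"
  by (auto simp: step_fun_def intro!: power_le_one)

lemma step_fun'_bound: "0 \<le> step_fun' t" "step_fun' t \<le> 4"
proof -
  show "0 \<le> step_fun' t" by (auto simp: step_fun'_def)
  show "step_fun' t \<le> 4"
  proof (cases "t \<le> 1")
    case True then show ?thesis using step_fun_le1 by simp
  next
    case False
    have "max 0 (2 - t) * max 0 (1 - (max 0 (2 - t))\<^sup>2) \<le> 1 * 1"
      using False by (intro mult_mono) auto
    then show ?thesis by (simp add: step_fun'_def)
  qed
qed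

lemma continuous_step_fun: "continuous_on A step_fun" "continuous_on A step_fun'"
  unfolding step_fun_def[abs_def] step_fun'_def[abs_def] by (intro continuous_intros)+

lemma step_fun_lipschitz: "\<bar>step_fun a - step_fun b\<bar> \<le> 4 * \<bar>a - b\<bar>"
proof -
  have "\<bar>step_fun a - step_fun b\<bar> \<le> 4 * \<bar>a - b\<bar>" if ab: "a < b" for a b
  proof -
    obtain z where z: "step_fun b - step_fun a = (b - a) * step_fun' z"
      using MVT2[OF ab DERIV_step_fun] by blast
    have "step_fun b - step_fun a \<le> (b - a) * 4" unfolding z using step_fun'_bound[of z] ab by (intro mult_left_mono) auto
    moreover have "0 \<le> step_fun b - step_fun a" unfolding z using step_fun'_bound[of z] ab by simp
    moreover have "\<bar>a - b\<bar> = b - a" using ab by simp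
    ultimately show ?thesis by (simp add: abs_le_iff)
  qed
  from this[of a b] this[of b a] show ?thesis by (cases a b rule: linorder_cases) (auto simp: abs_minus_commute)
qed

definition divergence :: "('a \<Rightarrow> (real^'n) \<Rightarrow>\<^sub>L (real^'n)) \<Rightarrow> 'a \<Rightarrow> real" where
  "divergence F' x = (\<Sum>j\<in>UNIV. F' x (axis j 1) $ j)"

text \<open>The derivative \<open>F'\<close> is a parameter because on the boundary it is only the continuous extension from inside.\<close>

definition tangential :: "(real^'n) set \<Rightarrow> (real^'n \<Rightarrow> real^'n) \<Rightarrow> (real^'n \<Rightarrow> (real^'n) \<Rightarrow>\<^sub>L (real^'n)) \<Rightarrow> bool" where
  "tangential \<Omega> F F' \<longleftrightarrow> continuous_on (closure \<Omega>) F \<and> continuous_on (closure \<Omega>) F' \<and>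
     (\<forall>x\<in>\<Omega>. (F has_derivative blinfun_apply (F' x)) (at x)) \<and>
     hausdorff_null (CARD('n) - 1) {x \<in> frontier \<Omega>. \<not> (\<exists>n. outer_normal \<Omega> x n \<and> F x \<bullet> n = 0)}"

text \<open>The translates of the strip by \<open>j / K\<close>, \<open>j < K\<close>, in direction \<open>\<nu>\<close> are disjoint and stay in the larger ball.
  So the strip has measure of order \<open>1 / K\<close>.\<close>

lemma strip_measure:
  fixes d :: "real^'n \<Rightarrow> real"
  assumes d: "continuous_on UNIV d" "\<And>y s. d (y + s *\<^sub>R \<nu>) = d y - s" and \<nu>: "norm \<nu> = 1" and K: "K > (0::nat)"
  shows "real K * measure lborel {y \<in> cball x \<rho>. 1 / K < d y \<and> d y < 2 / K} \<le> measure lborel (cball x (\<rho> + 1))"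
proof -
  let ?S = "{y \<in> cball x \<rho>. 1 / K < d y \<and> d y < 2 / K}"
  let ?A = "\<lambda>i. (\<lambda>y. y - (real i / K) *\<^sub>R \<nu>) ` ?S"
  have dm: "d \<in> borel_measurable borel" using d(1) by (rule borel_measurable_continuous_onI)
  have S: "?S \<in> sets borel"
  proof -
    have "?S = cball x \<rho> \<inter> (d -` {1/K<..<2/K})" by auto
    moreover have "d -` {1/K<..<2/K} \<in> sets borel" by (rule measurable_sets_borel[OF dm]) simp
    ultimately show ?thesis by auto
  qed
  have Sm: "?S \<in> lmeasurable"
    by (rule bounded_set_imp_lmeasurable[OF bounded_subset[OF bounded_cball]]) (use S in auto)
  have Am: "?A i \<in> lmeasurable" for i by (rule measurable_translation_subtract[OF Sm])
  have disj: "disjoint_family_on ?A {..<K}"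
    unfolding disjoint_family_on_def
  proof (intro ballI impI equals0I, elim IntE imageE)
    fix i j z y y' assume ij: "i \<in> {..<K}" "j \<in> {..<K}" "i \<noteq> j" and z: "z = y - (real i / K) *\<^sub>R \<nu>" "y \<in> ?S" "z = y' - (real j / K) *\<^sub>R \<nu>" "y' \<in> ?S"
    have "d z = d y + real i / K" "d z = d y' + real j / K"
      using d(2)[of y "- (real i / K)"] d(2)[of y' "- (real j / K)"] z by auto
    then have "\<bar>real i / K - real j / K\<bar> < 1 / K" using z(2,4) by auto
    then have "\<bar>real i - real j\<bar> < 1" using K by (simp add: diff_divide_distrib[symmetric] abs_divide divide_less_cancel)
    then show False using ij(3) by linarith
  qed
  have "(\<Sum>i<K. measure lebesgue (?A i)) = measure lebesgue (\<Union>i\<in>{..<K}. ?A i)"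
  proof (rule measure_finite_Union[symmetric])
    show "?A ` {..<K} \<subseteq> sets lebesgue" using Am by blast
    show "emeasure lebesgue (?A i) \<noteq> \<infinity>" for i unfolding infinity_ennreal_def by (rule fmeasurableD2[OF Am])
  qed (use disj in auto)
  also have "\<dots> \<le> measure lebesgue (cball x (\<rho> + 1))"
  proof (rule measure_mono_fmeasurable)
    show "(\<Union>i\<in>{..<K}. ?A i) \<subseteq> cball x (\<rho> + 1)"
    proof (clarsimp)
      fix i y assume i: "i < K" and y: "dist x y \<le> \<rho>"
      have "dist x (y - (real i / K) *\<^sub>R \<nu>) \<le> dist x y + dist y (y - (real i / K) *\<^sub>R \<nu>)" by (rule dist_triangle)
      moreover have "dist y (y - (real i / K) *\<^sub>R \<nu>) \<le> 1" using i \<nu> by (simp add: dist_norm)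
      ultimately show "dist x (y - (real i / K) *\<^sub>R \<nu>) \<le> \<rho> + 1" using y by linarith
    qed
    show "(\<Union>i\<in>{..<K}. ?A i) \<in> sets lebesgue" using Am by blast
  qed simp
  finally have "(\<Sum>i<K. measure lebesgue (?A i)) \<le> measure lebesgue (cball x (\<rho> + 1))" .
  moreover have "measure lebesgue (?A i) = measure lborel ?S" for i
    using measure_translation_subtract[of "(real i / K) *\<^sub>R \<nu>" ?S] measure_completion[of ?S lborel] S by simp
  ultimately show ?thesis using measure_completion[of "cball x (\<rho> + 1)" lborel] by simp
qed

lemma has_derivative_lipschitz_bound:
  fixes f :: "'a::real_normed_vector \<Rightarrow> real"
  assumes "(f has_derivative f') (at y)" "\<And>y z. \<bar>f y - f z\<bar> \<le> L * norm (y - z)"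
  shows "\<bar>f' v\<bar> \<le> L * norm v"
proof -
  have l: "((\<lambda>h. \<bar>(f (y + h *\<^sub>R v) - f y) / h\<bar>) \<longlongrightarrow> \<bar>f' v\<bar>) (at_right 0)"
    by (intro tendsto_rabs has_derivative_imp_right_quotient assms(1))
  have "\<forall>\<^sub>F h in at_right (0::real). \<bar>(f (y + h *\<^sub>R v) - f y) / h\<bar> \<le> L * norm v"
    unfolding eventually_at_right_field
  proof (intro exI[of _ 1] conjI allI impI)
    fix h :: real assume h: "0 < h" "h < 1"
    have "\<bar>f (y + h *\<^sub>R v) - f y\<bar> \<le> L * (h * norm v)" using assms(2)[of "y + h *\<^sub>R v" y] h by simp
    then show "\<bar>(f (y + h *\<^sub>R v) - f y) / h\<bar> \<le> L * norm v" using h by (simp add: abs_divide field_simps)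
  qed simp
  from tendsto_upperbound[OF l this] show ?thesis by simp
qed

text \<open>Almost every line in direction \<open>\<nu>\<close> meets the boundary where the normal exists and \<open>F\<close> is tangential. The chart
  function is differentiable along the whole line with the same gradient, a multiple of that normal. So
  the a.e. normal on the boundary takes the place of the theorem of Rademacher.\<close>

lemma ae_chart_derivative:
  fixes \<Omega> :: "(real^'n) set"
  assumes \<Omega>: "open \<Omega>" and \<nu>: "norm \<nu> = 1" and L: "L-lipschitz_on {v. v \<bullet> \<nu> = 0} h"
    and r: "\<And>y. y \<in> ball x r \<Longrightarrow> y \<in> \<Omega> \<longleftrightarrow> chart_fun x \<nu> h y > 0"
    and x: "x \<in> frontier \<Omega>" and \<rho>: "\<rho> > 0" "\<rho> * (L + 2) < r"
    and F: "tangential \<Omega> F F'"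
  shows "AE y in lborel. y \<in> cball x \<rho> \<longrightarrow>
     y + chart_fun x \<nu> h y *\<^sub>R \<nu> \<in> frontier \<Omega> \<and>
     (\<exists>a. (chart_fun x \<nu> h has_derivative (\<lambda>v. a \<bullet> v)) (at y) \<and> \<bar>a \<bullet> F y\<bar> \<le> (L + 1) * norm (F y - F (y + chart_fun x \<nu> h y *\<^sub>R \<nu>)))"
proof -
  let ?d = "chart_fun x \<nu> h"
  let ?Z = "{x \<in> frontier \<Omega>. \<not> (\<exists>n. outer_normal \<Omega> x n \<and> F x \<bullet> n = 0)}"
  have L0: "L \<ge> 0" using lipschitz_on_nonneg[OF L] .
  have "0 < \<rho> * (L + 2)" using \<rho> L0 by simp
  then have xr: "x \<in> ball x r" using \<rho> by simp
  have dx: "?d x = 0" using chart_fun_zero_iff_frontier[OF \<Omega> \<nu> L r xr] x by simp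
  have dy: "\<bar>?d y\<bar> \<le> (L + 1) * \<rho>" if "y \<in> cball x \<rho>" for y
  proof -
    have "\<bar>?d y\<bar> \<le> (L + 1) * norm (y - x)" using chart_fun_lipschitz[OF \<nu> L, of x y x] dx by simp
    also have "\<dots> \<le> (L + 1) * \<rho>" using that L0 by (intro mult_left_mono) (auto simp: dist_norm norm_minus_commute)
    finally show ?thesis .
  qed
  have R: "(L + 1) * \<rho> > 0" using L0 \<rho> by simp
  have "negligible {y. \<exists>s. \<bar>s\<bar> \<le> (L + 1) * \<rho> \<and> y + s *\<^sub>R \<nu> \<in> ?Z}"
    by (rule negligible_cylinder_over_hausdorff_null[OF _ \<nu> R]) (use F in \<open>simp add: tangential_def\<close>)
  then have "AE y in lebesgue. y \<notin> {y. \<exists>s. \<bar>s\<bar> \<le> (L + 1) * \<rho> \<and> y + s *\<^sub>R \<nu> \<in> ?Z}"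
    unfolding negligible_iff_null_sets by (rule AE_not_in)
  then have ae: "AE y in lborel. y \<notin> {y. \<exists>s. \<bar>s\<bar> \<le> (L + 1) * \<rho> \<and> y + s *\<^sub>R \<nu> \<in> ?Z}"
    by (simp only: AE_completion_iff)
  show ?thesis
    using ae
  proof eventually_elim
    case (elim y)
    show ?case
    proof
      assume y: "y \<in> cball x \<rho>"
      define b where "b = y + ?d y *\<^sub>R \<nu>"
      have db: "?d b = 0" by (simp add: b_def chart_fun_shift[OF \<nu>])
      have "dist x b \<le> dist x y + dist y b" by (rule dist_triangle)
      also have "dist y b = \<bar>?d y\<bar>" using \<nu> by (simp add: b_def dist_norm)
      also have "dist x y + \<bar>?d y\<bar> \<le> \<rho> * (L + 2)" using y dy[OF y] by (simp add: algebra_simps)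
      finally have bb: "b \<in> ball x r" using \<rho> by simp
      have bf: "b \<in> frontier \<Omega>" using chart_fun_zero_iff_frontier[OF \<Omega> \<nu> L r bb] db by simp
      have "b \<notin> ?Z" using elim dy[OF y] unfolding b_def by blast
      then obtain n where n: "outer_normal \<Omega> b n" "F b \<bullet> n = 0" using bf by blast
      obtain \<mu> where \<mu>: "(?d has_derivative (\<lambda>v. \<mu> * (n \<bullet> v))) (at b)"
        using outer_normal_derivative[OF \<Omega> \<nu> L r bb bf n(1)] by blast
      define a where "a = \<mu> *\<^sub>R n"
      have a: "(?d has_derivative (\<lambda>v. a \<bullet> v)) (at b)" using \<mu> by (simp add: a_def)
      have ay: "(?d has_derivative (\<lambda>v. a \<bullet> v)) (at y)"
      proof -
        have "((\<lambda>z. z + ?d y *\<^sub>R \<nu>) has_derivative (\<lambda>v. v)) (at y)" by (auto intro!: derivative_eq_intros)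
        from has_derivative_compose[OF this a[unfolded b_def]]
        have "((\<lambda>z. ?d (z + ?d y *\<^sub>R \<nu>)) has_derivative (\<lambda>v. a \<bullet> v)) (at y)" .
        then have "((\<lambda>z. ?d (z + ?d y *\<^sub>R \<nu>) + ?d y) has_derivative (\<lambda>v. a \<bullet> v)) (at y)"
          using has_derivative_add[OF _ has_derivative_const] by fastforce
        then show ?thesis by (simp add: chart_fun_shift[OF \<nu>])
      qed
      have na: "norm a \<le> L + 1"
      proof -
        have "\<bar>a \<bullet> a\<bar> \<le> (L + 1) * norm a"
          by (rule has_derivative_lipschitz_bound[OF a chart_fun_lipschitz[OF \<nu> L]])
        then have "norm a * norm a \<le> (L + 1) * norm a" by (simp add: power2_norm_eq_inner[symmetric] power2_eq_square)
        then show ?thesis using L0 by (cases "norm a = 0") auto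
      qed
      have "a \<bullet> F b = 0" using n(2) by (simp add: a_def inner_commute)
      then have "a \<bullet> F y = a \<bullet> (F y - F b)" by (simp add: inner_diff_right)
      then have "\<bar>a \<bullet> F y\<bar> \<le> norm a * norm (F y - F b)" using Cauchy_Schwarz_ineq2 by simp
      also have "\<dots> \<le> (L + 1) * norm (F y - F b)" using na by (intro mult_right_mono) auto
      finally show "y + ?d y *\<^sub>R \<nu> \<in> frontier \<Omega> \<and> (\<exists>a. (?d has_derivative (\<lambda>v. a \<bullet> v)) (at y) \<and> \<bar>a \<bullet> F y\<bar> \<le> (L + 1) * norm (F y - F (y + ?d y *\<^sub>R \<nu>)))"
        using bf ay unfolding b_def by blast
    qed
  qed
qed

text \<open>The cut-off \<open>step_fun (K d)\<close> makes the \<open>j\<close>-th component of the field vanish near the boundary; the product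
  is Lipschitz and differentiable a.e., and the integral of its derivative is zero.\<close>

lemma gauss_cutoff_component:
  fixes \<Omega> :: "(real^'n) set" and d :: "real^'n \<Rightarrow> real"
  assumes \<Omega>: "open \<Omega>" "bounded \<Omega>" and F: "tangential \<Omega> F F'"
    and d: "\<And>y z. \<bar>d y - d z\<bar> \<le> L * norm (y - z)" and L: "L > 0" and K: "K > 0"
    and r: "\<And>y. y \<in> ball x r \<Longrightarrow> y \<in> \<Omega> \<longleftrightarrow> d y > 0" and \<rho>: "0 < \<rho>" "\<rho> < r"
    and F0: "\<And>y. y \<in> \<Omega> \<Longrightarrow> y \<notin> cball x \<rho> \<Longrightarrow> F y = 0"
    and a: "AE y in lborel. y \<in> cball x \<rho> \<longrightarrow> (d has_derivative (\<lambda>v. a y \<bullet> v)) (at y)" "(\<lambda>y. a y $ j) \<in> borel_measurable borel"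
  defines "g \<equiv> \<lambda>y. indicator \<Omega> y * (step_fun' (K * d y) * K * (a y $ j) * F y $ j + step_fun (K * d y) * (F' y (axis j 1) $ j))"
  shows "integrable lborel g" "(\<integral>y. g y \<partial>lborel) = 0"
proof -
  let ?u = "axis j (1::real)"
  have nu: "norm ?u = 1" by (simp add: norm_axis_1)
  have cF: "continuous_on (closure \<Omega>) F" "continuous_on (closure \<Omega>) F'" and dF: "\<And>x. x \<in> \<Omega> \<Longrightarrow> (F has_derivative blinfun_apply (F' x)) (at x)"
    using F by (auto simp: tangential_def)
  have cl: "compact (closure \<Omega>)" using \<Omega>(2) by (simp add: compact_closure)
  have sub: "\<Omega> \<subseteq> closure \<Omega>" by (rule closure_subset)
  have cd: "continuous_on A d" for A
  proof -
    have "L-lipschitz_on UNIV d" using d L by (intro lipschitz_onI) (auto simp: dist_norm)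
    then show ?thesis using lipschitz_on_continuous_on continuous_on_subset by blast
  qed
  obtain BF where BF: "BF > 0" "\<And>y. y \<in> closure \<Omega> \<Longrightarrow> norm (F y) \<le> BF"
    using compact_imp_bounded[OF compact_continuous_image[OF cF(1) cl]] by (auto simp: bounded_pos)
  obtain BF' where BF': "BF' > 0" "\<And>y. y \<in> closure \<Omega> \<Longrightarrow> norm (F' y) \<le> BF'"
    using compact_imp_bounded[OF compact_continuous_image[OF cF(2) cl]] by (auto simp: bounded_pos)
  define f where "f y = indicator \<Omega> y * (step_fun (K * d y) * F y $ j)" for y
  define K' where "K' = {y \<in> cball x \<rho>. d y \<ge> 1 / K}"
  have cK': "closed K'"
  proof -
    have "K' = cball x \<rho> \<inter> {y. 1 / K \<le> d y}" by (auto simp: K'_def)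
    moreover have "closed {y. 1 / K \<le> d y}" by (intro closed_Collect_le continuous_on_const cd)
    ultimately show ?thesis by auto
  qed
  have K'\<Omega>: "K' \<subseteq> \<Omega>"
  proof
    fix y assume "y \<in> K'"
    then have "y \<in> ball x r" "d y > 0" using \<rho> K less_le_trans[of 0 "1/K" "d y"] by (auto simp: K'_def)
    then show "y \<in> \<Omega>" using r by blast
  qed
  have f0: "f y = 0" if "y \<notin> K'" for y
  proof (cases "y \<in> \<Omega> \<and> y \<in> cball x \<rho>")
    case True
    then have "d y < 1 / K" using that by (auto simp: K'_def)
    then have "K * d y \<le> 1" using K by (simp add: field_simps)
    then show ?thesis by (simp add: f_def step_fun_le1)
  next
    case False
    then have "y \<notin> \<Omega> \<or> F y = 0" using F0 by blast
    then show ?thesis by (auto simp: f_def)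
  qed
  have cfin: "continuous_on \<Omega> (\<lambda>y. step_fun (K * d y) * F y $ j)"
    by (intro continuous_intros continuous_on_compose2[OF continuous_step_fun(1)[of UNIV]] cd continuous_on_subset[OF cF(1) sub]) auto
  have mf: "f \<in> borel_measurable borel"
    unfolding f_def[abs_def] using borel_measurable_continuous_on_indicator[OF _ cfin] \<Omega> by simp
  have fi: "integrable lborel f"
  proof (rule integrable_compact_support(2)[OF \<Omega>(1) _ K'\<Omega> _ f0])
    have "cball x \<rho> \<inter> K' = K'" by (auto simp: K'_def)
    then show "compact K'" using cK' by (metis compact_Int_closed compact_cball)
    show "continuous_on \<Omega> f" by (rule continuous_on_eq[OF cfin]) (simp add: f_def)
  qed auto
  have mg: "g \<in> borel_measurable borel"
  proof -
    have m1: "(\<lambda>y. indicator \<Omega> y * (step_fun' (K * d y) * K * F y $ j)) \<in> borel_measurable borel"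
    proof -
      have c: "continuous_on \<Omega> (\<lambda>y. step_fun' (K * d y) * K * F y $ j)"
        by (intro continuous_intros continuous_on_compose2[OF continuous_step_fun(2)[of UNIV]] cd continuous_on_subset[OF cF(1) sub]) auto
      show ?thesis using borel_measurable_continuous_on_indicator[OF _ c] \<Omega> by simp
    qed
    have m2: "(\<lambda>y. indicator \<Omega> y * (step_fun (K * d y) * (F' y ?u $ j))) \<in> borel_measurable borel"
    proof -
      have c: "continuous_on \<Omega> (\<lambda>y. step_fun (K * d y) * (F' y ?u $ j))"
        by (intro continuous_intros continuous_on_compose2[OF continuous_step_fun(1)[of UNIV]] cd continuous_on_subset[OF cF(2) sub]) auto
      show ?thesis using borel_measurable_continuous_on_indicator[OF _ c] \<Omega> by simp
    qed
    have e: "g = (\<lambda>y. a y $ j * (indicator \<Omega> y * (step_fun' (K * d y) * K * F y $ j)) + indicator \<Omega> y * (step_fun (K * d y) * (F' y ?u $ j)))"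
      by (auto simp: g_def algebra_simps)
    show ?thesis unfolding e by (rule borel_measurable_add[OF borel_measurable_times[OF a(2) m1] m2])
  qed
  define \<delta> where "\<delta> = min (1 / (2 * K * L)) (r - \<rho>)"
  have \<delta>: "\<delta> > 0" using K L \<rho> by (simp add: \<delta>_def)
  have near: "p \<in> \<Omega>" if "y \<in> K'" "norm (p - y) < \<delta>" for y p
  proof -
    have "dist x p \<le> dist x y + dist y p" by (rule dist_triangle)
    then have "p \<in> ball x r" using that by (simp add: K'_def \<delta>_def dist_norm norm_minus_commute)
    moreover have "d p > 0"
    proof -
      have "L * norm (p - y) < L * (1 / (2 * K * L))" using that(2) L by (intro mult_strict_left_mono) (auto simp: \<delta>_def)
      also have "\<dots> = 1 / (2 * K)" using L K by simp
      also have "\<dots> < 1 / K" using K by (simp add: field_simps)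
      finally have "\<bar>d p - d y\<bar> < 1 / K" using d[of p y] by simp
      moreover have "1 / K \<le> d y" using that(1) by (simp add: K'_def)
      ultimately show ?thesis by (simp add: abs_less_iff)
    qed
    ultimately show ?thesis using r by blast
  qed
  have lipf: "\<bar>f (y + s *\<^sub>R ?u) - f y\<bar> \<le> (BF' + BF * (4 * K * L)) * s" if s: "0 < s" "s < \<delta>" for y s
  proof (cases "y \<in> K' \<or> y + s *\<^sub>R ?u \<in> K'")
    case False
    have "0 \<le> (BF' + BF * (4 * K * L)) * s" using BF(1) BF'(1) K L s by (intro mult_nonneg_nonneg add_nonneg_nonneg) auto
    then show ?thesis using False f0 by simp
  next
    case True
    have seg: "closed_segment y (y + s *\<^sub>R ?u) \<subseteq> \<Omega>"
    proof
      fix p assume "p \<in> closed_segment y (y + s *\<^sub>R ?u)"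
      then obtain t where t: "0 \<le> t" "t \<le> 1" "p = (1 - t) *\<^sub>R y + t *\<^sub>R (y + s *\<^sub>R ?u)" by (auto simp: in_segment)
      then have p: "p = y + (t * s) *\<^sub>R ?u" by (simp add: algebra_simps)
      have "norm (p - y) \<le> s" using t(1,2) s nu by (simp add: p mult_left_le_one_le)
      moreover have "norm (p - (y + s *\<^sub>R ?u)) \<le> s"
      proof -
        have "p - (y + s *\<^sub>R ?u) = - ((1 - t) * s) *\<^sub>R ?u" by (simp add: p algebra_simps)
        then show ?thesis using t(1,2) s nu by (simp add: mult_left_le_one_le)
      qed
      ultimately show "p \<in> \<Omega>" using True near s by (metis le_less_trans)
    qed
    then have y\<Omega>: "y \<in> \<Omega>" "y + s *\<^sub>R ?u \<in> \<Omega>" by auto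
    have "norm (F (y + s *\<^sub>R ?u) - F y) \<le> BF' * norm ((y + s *\<^sub>R ?u) - y)"
    proof (rule differentiable_bound[of "closed_segment y (y + s *\<^sub>R ?u)"])
      show "(F has_derivative blinfun_apply (F' p)) (at p within closed_segment y (y + s *\<^sub>R ?u))" if "p \<in> closed_segment y (y + s *\<^sub>R ?u)" for p
        using dF seg that by (meson has_derivative_at_withinI subsetD)
      show "onorm (blinfun_apply (F' p)) \<le> BF'" if "p \<in> closed_segment y (y + s *\<^sub>R ?u)" for p
        using BF'(2)[of p] seg that sub by (simp add: norm_blinfun.rep_eq[symmetric] subset_iff)
    qed auto
    then have 1: "norm (F (y + s *\<^sub>R ?u) - F y) \<le> BF' * s" using s nu by simp
    have 2: "\<bar>F (y + s *\<^sub>R ?u) $ j - F y $ j\<bar> \<le> BF' * s"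
      using component_le_norm_cart[of "F (y + s *\<^sub>R ?u) - F y" j] 1 by simp
    have 3: "\<bar>step_fun (K * d (y + s *\<^sub>R ?u)) - step_fun (K * d y)\<bar> \<le> 4 * K * L * s"
    proof -
      have "\<bar>step_fun (K * d (y + s *\<^sub>R ?u)) - step_fun (K * d y)\<bar> \<le> 4 * \<bar>K * d (y + s *\<^sub>R ?u) - K * d y\<bar>" by (rule step_fun_lipschitz)
      also have "\<bar>K * d (y + s *\<^sub>R ?u) - K * d y\<bar> = K * \<bar>d (y + s *\<^sub>R ?u) - d y\<bar>" using K by (simp add: right_diff_distrib[symmetric] abs_mult)
      also have "\<bar>d (y + s *\<^sub>R ?u) - d y\<bar> \<le> L * s" using d[of "y + s *\<^sub>R ?u" y] s nu by simp
      finally show ?thesis using K by (simp add: mult_left_mono)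
    qed
    have "f (y + s *\<^sub>R ?u) - f y = step_fun (K * d (y + s *\<^sub>R ?u)) * (F (y + s *\<^sub>R ?u) $ j - F y $ j)
        + (step_fun (K * d (y + s *\<^sub>R ?u)) - step_fun (K * d y)) * F y $ j"
      using y\<Omega> by (simp add: f_def algebra_simps)
    also have "\<bar>\<dots>\<bar> \<le> 1 * (BF' * s) + (4 * K * L * s) * BF"
    proof (rule order_trans[OF abs_triangle_ineq], unfold abs_mult, intro add_mono mult_mono)
      show "\<bar>step_fun (K * d (y + s *\<^sub>R ?u))\<bar> \<le> 1" using step_fun_range by simp
      show "\<bar>F y $ j\<bar> \<le> BF" using component_le_norm_cart[of "F y" j] BF(2)[of y] y\<Omega> sub by force
    qed (use 2 3 K L s BF(1) in auto)
    finally show ?thesis by (simp add: algebra_simps)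
  qed
  have lim: "AE y in lborel. ((\<lambda>s. (f (y + s *\<^sub>R ?u) - f y) / s) \<longlongrightarrow> g y) (at_right 0)"
    using a(1)
  proof eventually_elim
    case (elim y)
    show ?case
    proof (cases "y \<in> K'")
      case True
      then have y: "y \<in> \<Omega>" "y \<in> cball x \<rho>" using K'\<Omega> by (auto simp: K'_def)
      have "((\<lambda>y. step_fun (K * d y)) has_derivative (\<lambda>v. step_fun' (K * d y) * (K * (a y \<bullet> v)))) (at y)"
        by (rule has_derivative_compose[OF _ DERIV_step_fun[unfolded has_field_derivative_def]])
           (use elim y in \<open>auto intro!: derivative_eq_intros\<close>)
      moreover have "((\<lambda>y. F y $ j) has_derivative (\<lambda>v. F' y v $ j)) (at y)"
        by (rule bounded_linear.has_derivative[OF bounded_linear_vec_nth dF[OF y(1)]])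
      ultimately have "((\<lambda>y. step_fun (K * d y) * F y $ j) has_derivative (\<lambda>v. step_fun (K * d y) * (F' y v $ j) + step_fun' (K * d y) * (K * (a y \<bullet> v)) * F y $ j)) (at y)"
        by (rule has_derivative_mult)
      then have "(f has_derivative (\<lambda>v. step_fun (K * d y) * (F' y v $ j) + step_fun' (K * d y) * (K * (a y \<bullet> v)) * F y $ j)) (at y)"
        by (rule has_derivative_transform_within_open[of _ _ _ _ \<Omega>]) (use y \<Omega> in \<open>auto simp: f_def\<close>)
      from has_derivative_imp_right_quotient[OF this, of ?u] show ?thesis
        using y by (simp add: g_def inner_axis algebra_simps)
    next
      case False
      have "(f has_derivative (\<lambda>_. 0)) (at y)"
        by (rule has_derivative_zero_near[of "- K'"])
           (use False f0 cK' in \<open>auto simp: open_Compl\<close>)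
      from has_derivative_imp_right_quotient[OF this, of ?u]
      have "((\<lambda>s. (f (y + s *\<^sub>R ?u) - f y) / s) \<longlongrightarrow> 0) (at_right 0)" .
      moreover have "g y = 0"
      proof (cases "y \<in> \<Omega> \<and> y \<in> cball x \<rho>")
        case True
        then have "d y < 1 / K" using False by (auto simp: K'_def)
        then have "K * d y \<le> 1" using K by (simp add: field_simps)
        then show ?thesis by (simp add: g_def step_fun_le1)
      next
        case F: False
        show ?thesis
        proof (cases "y \<in> \<Omega>")
          case True
          have "(F has_derivative (\<lambda>_. 0)) (at y)"
            by (rule has_derivative_zero_near[of "\<Omega> - cball x \<rho>"])
               (use True F F0 \<Omega> in \<open>auto simp: open_Diff\<close>)
          then have "blinfun_apply (F' y) = (\<lambda>_. 0)" using dF[OF True] has_derivative_unique by blast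
          then show ?thesis using F0[OF True] F True by (simp add: g_def)
        qed (simp add: g_def)
      qed
      ultimately show ?thesis by simp
    qed
  qed
  have b: "bounded K'" by (rule bounded_subset[OF bounded_cball[of x \<rho>]]) (auto simp: K'_def)
  show "integrable lborel g" "(\<integral>y. g y \<partial>lborel) = 0"
    using integral_directional_derivative_eq_0[OF mf fi mg b f0 \<delta> lipf lim] by auto
qed

lemma has_derivative_imp_lim_quotient:
  fixes f :: "'a::real_normed_vector \<Rightarrow> real"
  assumes "(f has_derivative f') (at y)"
  shows "lim (\<lambda>n. (f (y + inverse (real (Suc n)) *\<^sub>R u) - f y) / inverse (real (Suc n))) = f' u"
proof (rule limI)
  have "filterlim (\<lambda>n. inverse (real (Suc n))) (at_right 0) sequentially"
    unfolding filterlim_at using LIMSEQ_inverse_real_of_nat by auto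
  then show "(\<lambda>n. (f (y + inverse (real (Suc n)) *\<^sub>R u) - f y) / inverse (real (Suc n))) \<longlonglongrightarrow> f' u"
    by (rule filterlim_compose[OF has_derivative_imp_right_quotient[OF assms]])
qed

text \<open>As \<open>K\<close> grows, the term with the derivative of \<open>F\<close> tends to the integral of the divergence. In the other
  term, \<open>K step_fun' (K d)\<close> has size \<open>K\<close> on a strip of measure \<open>1 / K\<close>, and the normal component of \<open>F\<close>
  is uniformly small there, because it vanishes on the boundary.\<close>

lemma gauss_in_chart:
  fixes \<Omega> :: "(real^'n) set"
  assumes \<Omega>: "open \<Omega>" "bounded \<Omega>" and \<nu>: "norm \<nu> = 1" and L: "L-lipschitz_on {v. v \<bullet> \<nu> = 0} h"
    and r: "\<And>y. y \<in> ball x r \<Longrightarrow> y \<in> \<Omega> \<longleftrightarrow> chart_fun x \<nu> h y > 0"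
    and x: "x \<in> frontier \<Omega>" and \<rho>: "\<rho> > 0" "\<rho> * (L + 2) < r"
    and F: "tangential \<Omega> F F'" and F0: "\<And>y. y \<in> \<Omega> \<Longrightarrow> y \<notin> cball x \<rho> \<Longrightarrow> F y = 0"
  shows "(\<integral>y. indicator \<Omega> y * divergence F' y \<partial>lborel) = 0"
proof -
  let ?d = "chart_fun x \<nu> h"
  have L0: "L \<ge> 0" using lipschitz_on_nonneg[OF L] .
  have "\<rho> \<le> \<rho> * (L + 2)" using mult_left_mono[of 1 "L + 2" \<rho>] \<rho> L0 by simp
  then have \<rho>r: "\<rho> < r" using \<rho>(2) by linarith
  note dl = chart_fun_lipschitz[OF \<nu> L, of x]
  have cd: "continuous_on A ?d" for A
  proof -
    have "(L + 1)-lipschitz_on UNIV ?d" using dl L0 by (intro lipschitz_onI) (auto simp: dist_norm)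
    then show ?thesis using lipschitz_on_continuous_on continuous_on_subset by blast
  qed
  have cF: "continuous_on (closure \<Omega>) F" "continuous_on (closure \<Omega>) F'" and dF: "\<And>x. x \<in> \<Omega> \<Longrightarrow> (F has_derivative blinfun_apply (F' x)) (at x)"
    using F by (auto simp: tangential_def)
  have cl: "compact (closure \<Omega>)" using \<Omega>(2) by (simp add: compact_closure)
  have sub: "\<Omega> \<subseteq> closure \<Omega>" by (rule closure_subset)
  \<comment> \<open>A measurable version of the gradient, as a limit of difference quotients.\<close>
  define a where "a y = (\<chi> j. lim (\<lambda>n. (?d (y + inverse (real (Suc n)) *\<^sub>R axis j 1) - ?d y) / inverse (real (Suc n))))" for y
  have am: "(\<lambda>y. a y $ j) \<in> borel_measurable borel" for j
  proof -
    have dm: "?d \<in> borel_measurable borel" by (rule borel_measurable_continuous_onI[OF cd])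
    have "(\<lambda>y. lim (\<lambda>n. (?d (y + inverse (real (Suc n)) *\<^sub>R axis j 1) - ?d y) / inverse (real (Suc n)))) \<in> borel_measurable borel"
    proof (rule borel_measurable_lim_metric)
      fix n
      have "(\<lambda>y. ?d (y + inverse (real (Suc n)) *\<^sub>R axis j 1)) \<in> borel_measurable borel"
        by (rule measurable_compose[OF _ dm]) simp
      then show "(\<lambda>y. (?d (y + inverse (real (Suc n)) *\<^sub>R axis j 1) - ?d y) / inverse (real (Suc n))) \<in> borel_measurable borel"
        using dm by simp
    qed
    then show ?thesis by (simp add: a_def)
  qed
  have ae0: "AE y in lborel. y \<in> cball x \<rho> \<longrightarrow> y + ?d y *\<^sub>R \<nu> \<in> frontier \<Omega> \<and>
     (\<exists>a. (?d has_derivative (\<lambda>v. a \<bullet> v)) (at y) \<and> \<bar>a \<bullet> F y\<bar> \<le> (L + 1) * norm (F y - F (y + ?d y *\<^sub>R \<nu>)))"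
    by (rule ae_chart_derivative[OF \<Omega>(1) \<nu> L _ x \<rho> F]) (rule r)
  have ae: "AE y in lborel. y \<in> cball x \<rho> \<longrightarrow> y + ?d y *\<^sub>R \<nu> \<in> frontier \<Omega> \<and> (?d has_derivative (\<lambda>v. a y \<bullet> v)) (at y) \<and>
     \<bar>a y \<bullet> F y\<bar> \<le> (L + 1) * norm (F y - F (y + ?d y *\<^sub>R \<nu>))"
    using ae0
  proof eventually_elim
    case (elim y)
    show ?case
    proof
      assume "y \<in> cball x \<rho>"
      then obtain a0 where a0: "y + ?d y *\<^sub>R \<nu> \<in> frontier \<Omega>" "(?d has_derivative (\<lambda>v. a0 \<bullet> v)) (at y)" "\<bar>a0 \<bullet> F y\<bar> \<le> (L + 1) * norm (F y - F (y + ?d y *\<^sub>R \<nu>))"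
        using elim by blast
      have "a y = a0"
        unfolding a_def has_derivative_imp_lim_quotient[OF a0(2)] by (simp add: vec_eq_iff inner_axis)
      then show "y + ?d y *\<^sub>R \<nu> \<in> frontier \<Omega> \<and> (?d has_derivative (\<lambda>v. a y \<bullet> v)) (at y) \<and>
         \<bar>a y \<bullet> F y\<bar> \<le> (L + 1) * norm (F y - F (y + ?d y *\<^sub>R \<nu>))" using a0 by simp
    qed
  qed
  have ae1: "AE y in lborel. y \<in> cball x \<rho> \<longrightarrow> (?d has_derivative (\<lambda>v. a y \<bullet> v)) (at y)"
    using ae by eventually_elim simp
  have cdv: "continuous_on (closure \<Omega>) (divergence F')"
    unfolding divergence_def[abs_def] by (intro continuous_intros cF)
  obtain B where B: "B > 0" "\<And>y. y \<in> closure \<Omega> \<Longrightarrow> \<bar>divergence F' y\<bar> \<le> B"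
    using compact_imp_bounded[OF compact_continuous_image[OF cdv cl]] by (auto simp: bounded_pos)
  have i\<Omega>: "integrable lborel (\<lambda>y. b * indicator \<Omega> y)" for b :: real
    using \<Omega>(2) \<Omega>(1) by (intro integrable_const_indicator) auto
  define A where "A K = (\<integral>y. indicator \<Omega> y * (step_fun (K * ?d y) * divergence F' y) \<partial>lborel)" for K
  have mA: "(\<lambda>y. indicator \<Omega> y * (step_fun (K * ?d y) * divergence F' y)) \<in> borel_measurable borel" for K
  proof -
    have c: "continuous_on \<Omega> (\<lambda>y. step_fun (K * ?d y) * divergence F' y)"
      by (intro continuous_intros continuous_on_compose2[OF continuous_step_fun(1)[of UNIV]] cd continuous_on_subset[OF cdv sub]) auto
    show ?thesis using borel_measurable_continuous_on_indicator[OF _ c] \<Omega> by simp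
  qed
  have bA: "norm (indicator \<Omega> y * (step_fun (K * ?d y) * divergence F' y)) \<le> B * indicator \<Omega> y" for K y
  proof (cases "y \<in> \<Omega>")
    case True
    have "\<bar>step_fun (K * ?d y)\<bar> * \<bar>divergence F' y\<bar> \<le> 1 * B"
      using step_fun_range[of "K * ?d y"] B(2)[of y] True sub by (intro mult_mono) auto
    then show ?thesis using True by (simp add: abs_mult)
  qed simp
  have iA: "integrable lborel (\<lambda>y. indicator \<Omega> y * (step_fun (K * ?d y) * divergence F' y))" for K
  proof (rule Bochner_Integration.integrable_bound[OF i\<Omega>[of B]])
    show "AE y in lborel. norm (indicator \<Omega> y * (step_fun (K * ?d y) * divergence F' y)) \<le> norm (B * indicator \<Omega> y)"
      using bA[of _ K] B(1) by (intro AE_I2) (auto simp: abs_mult)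
  qed (use mA in simp)
  have Abound: "\<bar>A (real K)\<bar> \<le> 4 * (L + 1) * \<epsilon> * measure lborel (cball x (\<rho> + 1))"
    if \<epsilon>: "\<epsilon> > 0" and K: "K > 0" and uc: "\<And>y z. y \<in> closure \<Omega> \<Longrightarrow> z \<in> closure \<Omega> \<Longrightarrow> dist y z < 2 / real K \<Longrightarrow> norm (F y - F z) \<le> \<epsilon>"
    for \<epsilon> :: real and K :: nat
  proof -
    let ?k = "real K"
    let ?S = "{y \<in> cball x \<rho>. 1 / ?k < ?d y \<and> ?d y < 2 / ?k}"
    define g where "g j y = indicator \<Omega> y * (step_fun' (?k * ?d y) * ?k * (a y $ j) * F y $ j + step_fun (?k * ?d y) * (F' y (axis j 1) $ j))" for j y
    have g: "integrable lborel (g j)" "(\<integral>y. g j y \<partial>lborel) = 0" for j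
      using gauss_cutoff_component[OF \<Omega> F dl _ _ r \<rho>(1) \<rho>r F0 ae1 am, of ?k j] L0 K
      unfolding g_def[abs_def] by auto
    have gs: "(\<Sum>j\<in>UNIV. g j y) = indicator \<Omega> y * (step_fun' (?k * ?d y) * ?k * (a y \<bullet> F y)) + indicator \<Omega> y * (step_fun (?k * ?d y) * divergence F' y)" for y
      unfolding g_def sum_distrib_left[symmetric] sum.distrib divergence_def inner_vec_def
      by (simp add: sum_distrib_left distrib_left mult.assoc)
    define G where "G y = indicator \<Omega> y * (step_fun' (?k * ?d y) * ?k * (a y \<bullet> F y))" for y
    have Ge: "G y = (\<Sum>j\<in>UNIV. g j y) - indicator \<Omega> y * (step_fun (?k * ?d y) * divergence F' y)" for y
      using gs[of y] by (simp add: G_def)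
    have iG: "integrable lborel G"
      unfolding Ge[abs_def] by (intro Bochner_Integration.integrable_diff Bochner_Integration.integrable_sum g iA)
    have intG: "(\<integral>y. G y \<partial>lborel) = - A ?k"
      unfolding Ge A_def using g iA by (simp add: Bochner_Integration.integral_sum)
    have Sb: "?S \<in> sets borel"
    proof -
      have "?S = cball x \<rho> \<inter> (?d -` {1/?k<..<2/?k})" by auto
      moreover have "?d -` {1/?k<..<2/?k} \<in> sets borel" by (rule measurable_sets_borel[OF borel_measurable_continuous_onI[OF cd]]) simp
      ultimately show ?thesis by auto
    qed
    have bS: "bounded ?S" by (rule bounded_subset[OF bounded_cball[of x \<rho>]]) auto
    have iS: "integrable lborel (\<lambda>y. b * indicator ?S y)" for b :: real
      using bS Sb by (intro integrable_const_indicator) auto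
    have "\<bar>A ?k\<bar> = \<bar>\<integral>y. G y \<partial>lborel\<bar>" by (simp add: intG)
    also have "\<dots> \<le> (\<integral>y. \<bar>G y\<bar> \<partial>lborel)" by (rule integral_abs_bound)
    also have "\<dots> \<le> (\<integral>y. (4 * ?k * ((L + 1) * \<epsilon>)) * indicator ?S y \<partial>lborel)"
    proof (rule integral_mono_AE[OF integrable_abs[OF iG] iS])
      show "AE y in lborel. \<bar>G y\<bar> \<le> (4 * ?k * ((L + 1) * \<epsilon>)) * indicator ?S y"
        using ae
      proof eventually_elim
        case (elim y)
        show ?case
        proof (cases "y \<in> \<Omega> \<and> y \<in> cball x \<rho> \<and> step_fun' (?k * ?d y) \<noteq> 0")
          case True
          have "\<not> ?k * ?d y \<le> 1" "\<not> ?k * ?d y \<ge> 2" using True step_fun_le1(2) step_fun_ge2(2) by blast+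
          then have dy: "1 / ?k < ?d y" "?d y < 2 / ?k" using K by (auto simp: field_simps)
          then have yS: "y \<in> ?S" using True by simp
          have "0 < 1 / ?k" using K by simp
          then have d0: "?d y > 0" using dy(1) by linarith
          have dist: "dist y (y + ?d y *\<^sub>R \<nu>) < 2 / ?k" using \<nu> dy d0 by (simp add: dist_norm)
          have fr: "y + ?d y *\<^sub>R \<nu> \<in> closure \<Omega>" using elim True by (auto simp: frontier_def)
          have "norm (F y - F (y + ?d y *\<^sub>R \<nu>)) \<le> \<epsilon>" using uc[OF _ fr dist] True sub by blast
          then have "(L + 1) * norm (F y - F (y + ?d y *\<^sub>R \<nu>)) \<le> (L + 1) * \<epsilon>" using L0 by (intro mult_left_mono) auto
          then have aF: "\<bar>a y \<bullet> F y\<bar> \<le> (L + 1) * \<epsilon>" using elim True by linarith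
          have "\<bar>step_fun' (?k * ?d y)\<bar> * ?k * \<bar>a y \<bullet> F y\<bar> \<le> 4 * ?k * ((L + 1) * \<epsilon>)"
            using step_fun'_bound[of "?k * ?d y"] aF by (intro mult_mono mult_nonneg_nonneg) auto
          then show ?thesis using True yS by (simp add: G_def abs_mult)
        next
          case False
          then have "y \<notin> \<Omega> \<or> F y = 0 \<or> step_fun' (?k * ?d y) = 0" using F0 by blast
          then have "G y = 0" by (auto simp: G_def)
          then show ?thesis using L0 \<epsilon> by (simp add: indicator_def)
        qed
      qed
    qed
    also have "\<dots> = (4 * (L + 1) * \<epsilon>) * (?k * measure lborel ?S)" using Sb by simp
    also have "\<dots> \<le> (4 * (L + 1) * \<epsilon>) * measure lborel (cball x (\<rho> + 1))"
      using strip_measure[OF cd chart_fun_shift[OF \<nu>] \<nu> K, where x = x and \<rho> = \<rho>] L0 \<epsilon> by (intro mult_left_mono) auto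
    finally show ?thesis .
  qed
  have "(\<lambda>n. A (real (Suc n))) \<longlonglongrightarrow> (\<integral>y. indicator \<Omega> y * divergence F' y \<partial>lborel)"
    unfolding A_def
  proof (rule integral_dominated_convergence[where w = "\<lambda>y. B * indicator \<Omega> y"])
    show "(\<lambda>y. indicator \<Omega> y * divergence F' y) \<in> borel_measurable lborel"
      using borel_measurable_continuous_on_indicator[OF _ continuous_on_subset[OF cdv sub]] \<Omega> by simp
    show "(\<lambda>y. indicator \<Omega> y * (step_fun (real (Suc n) * ?d y) * divergence F' y)) \<in> borel_measurable lborel" for n using mA by simp
    show "AE y in lborel. norm (indicator \<Omega> y * (step_fun (real (Suc n) * ?d y) * divergence F' y)) \<le> B * indicator \<Omega> y" for n
      by (intro AE_I2 bA)
    show "AE y in lborel. (\<lambda>n. indicator \<Omega> y * (step_fun (real (Suc n) * ?d y) * divergence F' y)) \<longlonglongrightarrow> indicator \<Omega> y * divergence F' y"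
    proof (rule AE_I2)
      fix y
      show "(\<lambda>n. indicator \<Omega> y * (step_fun (real (Suc n) * ?d y) * divergence F' y)) \<longlonglongrightarrow> indicator \<Omega> y * divergence F' y"
      proof (cases "y \<in> \<Omega>")
        case True
        show ?thesis
        proof (cases "y \<in> cball x \<rho>")
          case c: True
          then have dy: "?d y > 0" using r[of y] True \<rho>r by auto
          obtain N where N: "real N > 2 / ?d y" using reals_Archimedean2 by blast
          have "step_fun (real (Suc n) * ?d y) = 1" if "n \<ge> N" for n
          proof (rule step_fun_ge2(1))
            have "real N * ?d y > 2" using N dy by (simp add: field_simps)
            moreover have "real N * ?d y \<le> real (Suc n) * ?d y" using that dy by (intro mult_right_mono) auto
            ultimately show "2 \<le> real (Suc n) * ?d y" by linarith
          qed
          then have "\<forall>\<^sub>F n in sequentially. indicator \<Omega> y * (step_fun (real (Suc n) * ?d y) * divergence F' y) = indicator \<Omega> y * divergence F' y"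
            unfolding eventually_sequentially by (intro exI[of _ N]) auto
          then show ?thesis by (rule tendsto_eventually)
        next
          case False
          have "(F has_derivative (\<lambda>_. 0)) (at y)"
            by (rule has_derivative_zero_near[of "\<Omega> - cball x \<rho>"])
               (use True False F0 \<Omega> in \<open>auto simp: open_Diff\<close>)
          then have "blinfun_apply (F' y) = (\<lambda>_. 0)" using dF[OF True] has_derivative_unique by blast
          then show ?thesis by (simp add: divergence_def)
        qed
      qed simp
    qed
  qed (rule i\<Omega>)
  moreover have "(\<lambda>n. A (real (Suc n))) \<longlonglongrightarrow> 0"
  proof (rule LIMSEQ_I)
    fix e :: real assume e: "e > 0"
    let ?m = "measure lborel (cball x (\<rho> + 1))"
    define \<epsilon> where "\<epsilon> = e / (2 * (4 * (L + 1) * ?m + 1))"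
    have P: "4 * (L + 1) * ?m \<ge> 0" using L0 by simp
    have \<epsilon>: "\<epsilon> > 0" unfolding \<epsilon>_def using e P by (intro divide_pos_pos mult_pos_pos add_nonneg_pos) auto
    have small: "4 * (L + 1) * \<epsilon> * ?m < e"
    proof -
      have q: "4 * (L + 1) * \<epsilon> * ?m = \<epsilon> * (4 * (L + 1) * ?m)" by (simp add: mult_ac)
      have "\<epsilon> * (4 * (L + 1) * ?m) \<le> \<epsilon> * (4 * (L + 1) * ?m + 1)" using \<epsilon> by (intro mult_left_mono) auto
      also have "\<dots> = e / 2"
      proof -
        have "e / (2 * M) * M = e / 2" if "M \<noteq> 0" for M :: real using that by simp
        moreover have "4 * (L + 1) * ?m + 1 \<noteq> 0" using P by linarith
        ultimately show ?thesis unfolding \<epsilon>_def by blast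
      qed
      finally show ?thesis using e q by linarith
    qed
    obtain \<delta> where \<delta>: "\<delta> > 0" "\<And>y z. y \<in> closure \<Omega> \<Longrightarrow> z \<in> closure \<Omega> \<Longrightarrow> dist z y < \<delta> \<Longrightarrow> dist (F z) (F y) < \<epsilon>"
      using compact_uniformly_continuous[OF cF(1) cl] \<epsilon> unfolding uniformly_continuous_on_def by blast
    obtain N where N: "real N > 2 / \<delta>" using reals_Archimedean2 by blast
    show "\<exists>N. \<forall>n\<ge>N. norm (A (real (Suc n)) - 0) < e"
    proof (intro exI[of _ N] allI impI)
      fix n assume n: "n \<ge> N"
      have "\<bar>A (real (Suc n))\<bar> \<le> 4 * (L + 1) * \<epsilon> * ?m"
      proof (rule Abound[OF \<epsilon>])
        have "2 / real (Suc n) < \<delta>"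
        proof -
          have "2 / \<delta> < real (Suc n)" using N n by simp
          then show ?thesis using \<delta>(1) by (simp add: field_simps)
        qed
        then show "norm (F y - F z) \<le> \<epsilon>" if "y \<in> closure \<Omega>" "z \<in> closure \<Omega>" "dist y z < 2 / real (Suc n)" for y z
          using \<delta>(2)[of z y] that by (simp add: dist_norm less_imp_le)
      qed simp
      then show "norm (A (real (Suc n)) - 0) < e" using small by simp
    qed
  qed
  ultimately show ?thesis by (rule LIMSEQ_unique)
qed

text \<open>Extended by zero, \<open>\<phi>\<close> is differentiable everywhere with continuous compactly supported derivative.\<close>

lemma integral_derivative_interior:
  fixes \<phi> :: "'a::euclidean_space \<Rightarrow> real"
  assumes Q: "open Q" and \<phi>: "\<And>y. y \<in> Q \<Longrightarrow> (\<phi> has_derivative T y) (at y)" "\<And>u. continuous_on Q (\<lambda>y. T y u)"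
    and K: "compact K" "K \<subseteq> Q" "\<And>y. y \<in> Q \<Longrightarrow> y \<notin> K \<Longrightarrow> \<phi> y = 0"
  shows "integrable lborel (\<lambda>y. indicator Q y * T y u)" "(\<integral>y. indicator Q y * T y u \<partial>lborel) = 0"
proof -
  have T0: "T y u = 0" if "y \<in> Q" "y \<notin> K" for y u
  proof -
    have "(\<phi> has_derivative (\<lambda>_. 0)) (at y)"
      by (rule has_derivative_zero_near[of "Q - K"])
         (use that K Q in \<open>auto simp: open_Diff compact_imp_closed\<close>)
    then have "T y = (\<lambda>_. 0)" using \<phi>(1)[OF that(1)] has_derivative_unique by blast
    then show ?thesis by simp
  qed
  define f where "f y = indicator Q y * \<phi> y" for y
  have f_out: "(f has_derivative (\<lambda>_. 0)) (at y)" if "y \<notin> K" for y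
  proof -
    show ?thesis
      by (rule has_derivative_zero_near[of "- K"])
         (use that K in \<open>auto simp: compact_imp_closed open_Compl f_def indicator_def\<close>)
  qed
  have f_in: "(f has_derivative T y) (at y)" if "y \<in> Q" for y
    by (rule has_derivative_transform_within_open[OF \<phi>(1)[OF that], of Q]) (use that Q in \<open>auto simp: f_def\<close>)
  have Df: "dir_D u f y = indicator Q y * T y u" for u y
  proof (cases "y \<in> Q")
    case True then show ?thesis using dir_D_eqI[OF f_in] by simp
  next
    case False then show ?thesis using dir_D_eqI[OF f_out] K(2) by auto
  qed
  have cD: "continuous_on UNIV (dir_D u f)" for u
  proof (rule integrable_compact_support(1)[OF Q K(1,2)])
    show "continuous_on Q (dir_D u f)" by (rule continuous_on_eq[OF \<phi>(2)[of u]]) (simp add: Df)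
    show "dir_D u f y = 0" if "y \<notin> K" for y using T0[OF _ that] by (cases "y \<in> Q") (auto simp: Df)
  qed
  have dd: "f differentiable (at y)" for y
    by (cases "y \<in> K") (meson differentiable_def f_in f_out K(2) subsetD)+
  have f0: "f y = 0" if "y \<notin> K" for y using K(3)[OF _ that] by (cases "y \<in> Q") (auto simp: f_def)
  have e: "dir_D u f = (\<lambda>y. indicator Q y * T y u)" by (rule ext) (rule Df)
  show "integrable lborel (\<lambda>y. indicator Q y * T y u)" "(\<integral>y. indicator Q y * T y u \<partial>lborel) = 0"
    using integral_dir_D_eq_0[OF dd cD K(1) f0, of u] unfolding e by auto
qed

lemma gauss_interior:
  fixes \<Omega> :: "(real^'n) set"
  assumes \<Omega>: "open \<Omega>" and F: "\<And>x. x \<in> \<Omega> \<Longrightarrow> (F has_derivative blinfun_apply (F' x)) (at x)" "continuous_on \<Omega> F'"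
    and K: "compact K" "K \<subseteq> \<Omega>" "\<And>x. x \<in> \<Omega> \<Longrightarrow> x \<notin> K \<Longrightarrow> F x = 0"
  shows "(\<integral>y. indicator \<Omega> y * divergence F' y \<partial>lborel) = 0"
proof -
  have d: "((\<lambda>y. F y $ j) has_derivative (\<lambda>v. F' y v $ j)) (at y)" if "y \<in> \<Omega>" for j y
    by (rule bounded_linear.has_derivative[OF bounded_linear_vec_nth F(1)[OF that]])
  have c: "continuous_on \<Omega> (\<lambda>y. F' y u $ j)" for u j by (intro continuous_intros F(2))
  have z: "F y $ j = 0" if "y \<in> \<Omega>" "y \<notin> K" for y j using K(3)[OF that] by simp
  note * = integral_derivative_interior[OF \<Omega> d c K(1,2) z]
  have e: "indicator \<Omega> y * divergence F' y = (\<Sum>j\<in>UNIV. indicator \<Omega> y * (F' y (axis j 1) $ j))" for y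
    by (simp add: divergence_def sum_distrib_left)
  have "(\<integral>y. (\<Sum>j\<in>UNIV. indicator \<Omega> y * (F' y (axis j 1) $ j)) \<partial>lborel) = (\<Sum>j\<in>UNIV. \<integral>y. indicator \<Omega> y * (F' y (axis j 1) $ j) \<partial>lborel)"
    by (rule Bochner_Integration.integral_sum) (rule *(1))
  also have "\<dots> = 0" by (rule sum.neutral, rule ballI) (rule *(2))
  finally show ?thesis unfolding e .
qed

lemma divergence_integrable:
  fixes \<Omega> :: "(real^'n) set"
  assumes \<Omega>: "open \<Omega>" "bounded \<Omega>" and F: "continuous_on (closure \<Omega>) F'"
  shows "integrable lborel (\<lambda>y. indicator \<Omega> y * divergence F' y)"
proof -
  have c: "continuous_on (closure \<Omega>) (divergence F')"
    unfolding divergence_def[abs_def] by (intro continuous_intros F)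
  have "compact (closure \<Omega>)" using \<Omega>(2) by (simp add: compact_closure)
  then obtain B where B: "B > 0" "\<And>y. y \<in> closure \<Omega> \<Longrightarrow> \<bar>divergence F' y\<bar> \<le> B"
    using compact_imp_bounded[OF compact_continuous_image[OF c]] by (auto simp: bounded_pos)
  show ?thesis
  proof (rule Bochner_Integration.integrable_bound)
    show "integrable lborel (\<lambda>y. B * indicator \<Omega> y)"
      using \<Omega>(2) \<Omega>(1) by (intro integrable_const_indicator) auto
    show "(\<lambda>y. indicator \<Omega> y * divergence F' y) \<in> borel_measurable lborel"
      using borel_measurable_continuous_on_indicator[OF _ continuous_on_subset[OF c closure_subset]] \<Omega> by simp
    show "AE y in lborel. norm (indicator \<Omega> y * divergence F' y) \<le> norm (B * indicator \<Omega> y)"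
      using B closure_subset[of \<Omega>] by (intro AE_I2) (auto simp: indicator_def subset_iff)
  qed
qed

definition cutoff :: "real^'n \<Rightarrow> real \<Rightarrow> real^'n \<Rightarrow> real" where
  "cutoff x \<rho> y = step_fun (2 + (\<rho>\<^sup>2 / 4 - (y - x) \<bullet> (y - x)) * (4 / (3 * \<rho>\<^sup>2)))"

definition cutoff' :: "real^'n \<Rightarrow> real \<Rightarrow> real^'n \<Rightarrow> (real^'n) \<Rightarrow>\<^sub>L real" where
  "cutoff' x \<rho> y = (step_fun' (2 + (\<rho>\<^sup>2 / 4 - (y - x) \<bullet> (y - x)) * (4 / (3 * \<rho>\<^sup>2))) * (- 2 * (4 / (3 * \<rho>\<^sup>2)))) *\<^sub>R blinfun_inner_right (y - x)"

lemma cutoff_derivative: "(cutoff x \<rho> has_derivative blinfun_apply (cutoff' x \<rho> y)) (at y)"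
proof -
  have h: "((\<lambda>y. 2 + (c - (y - x) \<bullet> (y - x)) * k) has_derivative (\<lambda>v. (- 2 * k) * ((y - x) \<bullet> v))) (at y)" for c k :: real
    by (auto intro!: derivative_eq_intros simp: inner_commute)
  have eq: "blinfun_apply (cutoff' x \<rho> y) = (\<lambda>v. step_fun' (2 + (\<rho>\<^sup>2 / 4 - (y - x) \<bullet> (y - x)) * (4 / (3 * \<rho>\<^sup>2))) * ((- 2 * (4 / (3 * \<rho>\<^sup>2))) * ((y - x) \<bullet> v)))"
    unfolding cutoff'_def by (rule ext) (simp only: blinfun.scaleR_left blinfun_inner_right.rep_eq real_scaleR_def mult.assoc)
  show ?thesis unfolding cutoff_def[abs_def] eq
    by (rule has_derivative_compose[OF h DERIV_step_fun[unfolded has_field_derivative_def]])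
qed

lemma cutoff_continuous: "continuous_on A (cutoff x \<rho>)" "continuous_on A (cutoff' x \<rho>)"
proof -
  show "continuous_on A (cutoff x \<rho>)" unfolding cutoff_def[abs_def]
    by (intro continuous_on_compose2[OF continuous_step_fun(1)[of UNIV]] continuous_intros) auto
  show "continuous_on A (cutoff' x \<rho>)" unfolding cutoff'_def[abs_def]
    by (intro continuous_intros continuous_on_compose2[OF continuous_step_fun(2)[of UNIV]] bounded_linear.continuous_on[OF bounded_linear_blinfun_inner_right]) auto
qed

lemma cutoff_1: "\<rho> > 0 \<Longrightarrow> y \<in> cball x (\<rho> / 2) \<Longrightarrow> cutoff x \<rho> y = 1"
proof -
  assume \<rho>: "\<rho> > 0" "y \<in> cball x (\<rho> / 2)"
  then have "(norm (y - x))\<^sup>2 \<le> (\<rho> / 2)\<^sup>2" by (intro power_mono) (auto simp: dist_norm norm_minus_commute)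
  then have "(y - x) \<bullet> (y - x) \<le> \<rho>\<^sup>2 / 4" by (simp add: power2_norm_eq_inner power_divide)
  then have "0 \<le> (\<rho>\<^sup>2 / 4 - (y - x) \<bullet> (y - x)) * (4 / (3 * \<rho>\<^sup>2))" by (intro mult_nonneg_nonneg) auto
  then show ?thesis unfolding cutoff_def by (intro step_fun_ge2) linarith
qed

lemma cutoff_0: "\<rho> > 0 \<Longrightarrow> y \<notin> cball x \<rho> \<Longrightarrow> cutoff x \<rho> y = 0"
proof -
  assume \<rho>: "\<rho> > 0" "y \<notin> cball x \<rho>"
  then have "\<rho>\<^sup>2 \<le> (norm (y - x))\<^sup>2" by (intro power_mono) (auto simp: dist_norm norm_minus_commute)
  then have "\<rho>\<^sup>2 / 4 - (y - x) \<bullet> (y - x) \<le> - (3 * \<rho>\<^sup>2 / 4)" by (simp add: power2_norm_eq_inner)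
  then have "(\<rho>\<^sup>2 / 4 - (y - x) \<bullet> (y - x)) * (4 / (3 * \<rho>\<^sup>2)) \<le> - (3 * \<rho>\<^sup>2 / 4) * (4 / (3 * \<rho>\<^sup>2))"
    by (intro mult_right_mono) auto
  also have "\<dots> = -1" using \<rho> by (simp add: field_simps)
  finally show ?thesis unfolding cutoff_def by (intro step_fun_le1) linarith
qed

definition cutoff_mult' :: "real^'n \<Rightarrow> real \<Rightarrow> (real^'n \<Rightarrow> real^'n) \<Rightarrow> (real^'n \<Rightarrow> (real^'n) \<Rightarrow>\<^sub>L (real^'n)) \<Rightarrow> real^'n \<Rightarrow> (real^'n) \<Rightarrow>\<^sub>L (real^'n)" where
  "cutoff_mult' x \<rho> F F' y = cutoff x \<rho> y *\<^sub>R F' y + (blinfun_scaleR_left (F y) o\<^sub>L cutoff' x \<rho> y)"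

lemma tangential_cut:
  assumes F: "tangential \<Omega> F F'"
  shows "tangential \<Omega> (\<lambda>y. cutoff x \<rho> y *\<^sub>R F y) (cutoff_mult' x \<rho> F F')"
    and "tangential \<Omega> (\<lambda>y. F y - cutoff x \<rho> y *\<^sub>R F y) (\<lambda>y. F' y - cutoff_mult' x \<rho> F F' y)"
proof -
  have cF: "continuous_on (closure \<Omega>) F" "continuous_on (closure \<Omega>) F'" and dF: "\<And>x. x \<in> \<Omega> \<Longrightarrow> (F has_derivative blinfun_apply (F' x)) (at x)"
    and null: "hausdorff_null (CARD('a) - 1) {x \<in> frontier \<Omega>. \<not> (\<exists>n. outer_normal \<Omega> x n \<and> F x \<bullet> n = 0)}"
    using F by (auto simp: tangential_def)
  have c1: "continuous_on (closure \<Omega>) (\<lambda>y. cutoff x \<rho> y *\<^sub>R F y)" by (intro continuous_intros cF cutoff_continuous)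
  have c2: "continuous_on (closure \<Omega>) (cutoff_mult' x \<rho> F F')"
    unfolding cutoff_mult'_def[abs_def]
    by (intro continuous_intros cF cutoff_continuous bounded_linear.continuous_on[OF bounded_linear_blinfun_scaleR_left])
  have d: "((\<lambda>y. cutoff x \<rho> y *\<^sub>R F y) has_derivative blinfun_apply (cutoff_mult' x \<rho> F F' y)) (at y)" if "y \<in> \<Omega>" for y
  proof -
    have "((\<lambda>y. cutoff x \<rho> y *\<^sub>R F y) has_derivative (\<lambda>v. cutoff x \<rho> y *\<^sub>R F' y v + cutoff' x \<rho> y v *\<^sub>R F y)) (at y)"
      by (rule has_derivative_scaleR[OF cutoff_derivative dF[OF that]])
    moreover have "blinfun_apply (cutoff_mult' x \<rho> F F' y) = (\<lambda>v. cutoff x \<rho> y *\<^sub>R F' y v + cutoff' x \<rho> y v *\<^sub>R F y)"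
      by (auto simp: cutoff_mult'_def blinfun.add_left blinfun.scaleR_left)
    ultimately show ?thesis by simp
  qed
  show "tangential \<Omega> (\<lambda>y. cutoff x \<rho> y *\<^sub>R F y) (cutoff_mult' x \<rho> F F')"
    unfolding tangential_def using c1 c2 d
    by (intro conjI ballI hausdorff_null_subset[OF null]) auto
  show "tangential \<Omega> (\<lambda>y. F y - cutoff x \<rho> y *\<^sub>R F y) (\<lambda>y. F' y - cutoff_mult' x \<rho> F F' y)"
    unfolding tangential_def
  proof (intro conjI ballI hausdorff_null_subset[OF null])
    show "((\<lambda>y. F y - cutoff x \<rho> y *\<^sub>R F y) has_derivative blinfun_apply (F' y - cutoff_mult' x \<rho> F F' y)) (at y)" if "y \<in> \<Omega>" for y
      using has_derivative_diff[OF dF[OF that] d[OF that]] by (simp add: blinfun.diff_left[abs_def])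
  qed (auto intro!: continuous_intros c1 c2 cF simp: inner_diff_left)
qed

lemma gauss_near_boundary_point:
  fixes \<Omega> :: "(real^'n) set"
  assumes \<Omega>: "open \<Omega>" "bounded \<Omega>" "lipschitz_boundary \<Omega>" and x: "x \<in> frontier \<Omega>"
  shows "\<exists>\<rho>>0. \<forall>F F'. tangential \<Omega> F F' \<longrightarrow> (\<forall>y\<in>\<Omega>. y \<notin> cball x \<rho> \<longrightarrow> F y = 0) \<longrightarrow> (\<integral>y. indicator \<Omega> y * divergence F' y \<partial>lborel) = 0"
proof -
  obtain \<nu> h where "lipschitz_chart \<Omega> x \<nu> h" using \<Omega>(3) x unfolding lipschitz_boundary_def by blast
  then obtain L r where \<nu>: "norm \<nu> = 1" and L: "L-lipschitz_on {v. v \<bullet> \<nu> = 0} h" and r: "r > 0"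
    "\<And>y. y \<in> ball x r \<Longrightarrow> y \<in> \<Omega> \<longleftrightarrow> chart_fun x \<nu> h y > 0"
    unfolding lipschitz_chart_def chart_fun_def by (auto simp: algebra_simps)
  have L0: "L \<ge> 0" using lipschitz_on_nonneg[OF L] .
  define \<rho> where "\<rho> = r / (2 * (L + 2))"
  have \<rho>: "\<rho> > 0" "\<rho> * (L + 2) < r" using r(1) L0 by (auto simp: \<rho>_def field_simps add_nonneg_pos)
  show ?thesis
    using gauss_in_chart[OF \<Omega>(1,2) \<nu> L r(2) x \<rho>] \<rho>(1) by blast
qed

text \<open>The boundary is covered by finitely many balls in which the theorem is known. Cutting off ball by ball,
  instead of using a partition of unity, leaves a field that vanishes on an ever larger part of the boundary,
  and finally one with compact support in \<open>\<Omega>\<close>.\<close>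

theorem gauss_lipschitz:
  fixes \<Omega> :: "(real^'n) set"
  assumes \<Omega>: "open \<Omega>" "bounded \<Omega>" "lipschitz_boundary \<Omega>" and F: "tangential \<Omega> F F'"
  shows "(\<integral>y. indicator \<Omega> y * divergence F' y \<partial>lborel) = 0"
proof -
  define loc where "loc x \<rho> \<longleftrightarrow> (\<forall>F F'. tangential \<Omega> F F' \<longrightarrow> (\<forall>y\<in>\<Omega>. y \<notin> cball x \<rho> \<longrightarrow> F y = 0) \<longrightarrow> (\<integral>y. indicator \<Omega> y * divergence F' y \<partial>lborel) = 0)" for x \<rho>
  have "\<forall>x\<in>frontier \<Omega>. \<exists>\<rho>>0. loc x \<rho>"
    unfolding loc_def using gauss_near_boundary_point[OF \<Omega>] by (intro ballI)
  then obtain \<rho> where \<rho>': "\<And>x. x \<in> frontier \<Omega> \<Longrightarrow> \<rho> x > 0 \<and> loc x (\<rho> x)" by metis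
  have \<rho>: "\<rho> x > 0" "tangential \<Omega> F F' \<Longrightarrow> (\<And>y. y \<in> \<Omega> \<Longrightarrow> y \<notin> cball x (\<rho> x) \<Longrightarrow> F y = 0) \<Longrightarrow> (\<integral>y. indicator \<Omega> y * divergence F' y \<partial>lborel) = 0"
    if "x \<in> frontier \<Omega>" for x F F'
    using \<rho>'[OF that] unfolding loc_def by auto
  have cf: "compact (frontier \<Omega>)" using \<Omega>(2) by (rule compact_frontier_bounded)
  obtain X where X: "finite X" "X \<subseteq> frontier \<Omega>" "frontier \<Omega> \<subseteq> (\<Union>x\<in>X. ball x (\<rho> x / 2))"
  proof (rule compactE_image[OF cf, of "frontier \<Omega>" "\<lambda>x. ball x (\<rho> x / 2)"])
    show "frontier \<Omega> \<subseteq> (\<Union>x\<in>frontier \<Omega>. ball x (\<rho> x / 2))" using \<rho>(1) by force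
  qed (auto intro: that)
  have claim: "(\<integral>y. indicator \<Omega> y * divergence F' y \<partial>lborel) = 0"
    if "tangential \<Omega> F F'" "open W" "frontier \<Omega> \<subseteq> W \<union> (\<Union>x\<in>X. ball x (\<rho> x / 2))" "\<And>y. y \<in> W \<Longrightarrow> y \<in> closure \<Omega> \<Longrightarrow> F y = 0"
      "finite X" "X \<subseteq> frontier \<Omega>" for F F' W X
    using that(5,6,1-4)
  proof (induction X arbitrary: F F' W rule: finite_induct)
    case empty
    have cF: "continuous_on (closure \<Omega>) F'" "\<And>x. x \<in> \<Omega> \<Longrightarrow> (F has_derivative blinfun_apply (F' x)) (at x)"
      using empty(2) by (auto simp: tangential_def)
    show ?case
    proof (rule gauss_interior[OF \<Omega>(1) cF(2)])
      show "continuous_on \<Omega> F'" using cF(1) closure_subset continuous_on_subset by blast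
      show "compact (closure \<Omega> - W)" using \<Omega>(2) empty(3) by (simp add: compact_closure compact_diff)
      show "closure \<Omega> - W \<subseteq> \<Omega>" using empty(4) \<Omega>(1) by (auto simp: frontier_def interior_open)
      show "F y = 0" if "y \<in> \<Omega>" "y \<notin> closure \<Omega> - W" for y
        using that empty(5) closure_subset by blast
    qed
  next
    case (insert x X)
    let ?F1 = "\<lambda>y. cutoff x (\<rho> x) y *\<^sub>R F y" and ?F1' = "cutoff_mult' x (\<rho> x) F F'"
    have xf: "x \<in> frontier \<Omega>" using insert.prems by simp
    note t = tangential_cut[OF insert.prems(2), of x "\<rho> x"]
    have 1: "(\<integral>y. indicator \<Omega> y * divergence ?F1' y \<partial>lborel) = 0"
      by (rule \<rho>(2)[OF xf t(1)]) (use cutoff_0[OF \<rho>(1)[OF xf]] in auto)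
    have 2: "(\<integral>y. indicator \<Omega> y * divergence (\<lambda>y. F' y - ?F1' y) y \<partial>lborel) = 0"
    proof (rule insert.IH[OF _ t(2), of "W \<union> ball x (\<rho> x / 2)"])
      show "F y - ?F1 y = 0" if "y \<in> W \<union> ball x (\<rho> x / 2)" "y \<in> closure \<Omega>" for y
        using that insert.prems(5)[of y] cutoff_1[OF \<rho>(1)[OF xf], of y x] by auto
    qed (use insert.prems in auto)
    have "divergence F' y = divergence ?F1' y + divergence (\<lambda>y. F' y - ?F1' y) y" for y
      by (simp add: divergence_def blinfun.diff_left sum.distrib[symmetric])
    then have "(\<integral>y. indicator \<Omega> y * divergence F' y \<partial>lborel) = (\<integral>y. indicator \<Omega> y * divergence ?F1' y + indicator \<Omega> y * divergence (\<lambda>y. F' y - ?F1' y) y \<partial>lborel)"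
      by (simp add: distrib_left)
    also have "\<dots> = 0"
    proof -
      have "continuous_on (closure \<Omega>) ?F1'" "continuous_on (closure \<Omega>) (\<lambda>y. F' y - ?F1' y)"
        using t unfolding tangential_def by blast+
      note i = this[THEN divergence_integrable[OF \<Omega>(1,2)]]
      show ?thesis by (subst Bochner_Integration.integral_add[OF i]) (simp only: 1 2 add_0)
    qed
    finally show ?case .
  qed
  show ?thesis by (rule claim[OF F open_empty]) (use X in auto)
qed

section \<open>Weak convergence tested with continuous functions\<close>

lemma lebesgue_on_integral:
  fixes f :: "'a::euclidean_space \<Rightarrow> 'b::euclidean_space"
  assumes S: "S \<in> sets borel" and f: "(\<lambda>y. indicator S y *\<^sub>R f y) \<in> borel_measurable borel"
  shows "integral\<^sup>L (lebesgue_on S) f = (\<integral>y. indicator S y *\<^sub>R f y \<partial>lborel)"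
    and "integrable (lebesgue_on S) f \<longleftrightarrow> integrable lborel (\<lambda>y. indicator S y *\<^sub>R f y)"
    and "f \<in> borel_measurable (lebesgue_on S)"
proof -
  have S': "S \<inter> space lebesgue \<in> sets lebesgue" using S by (simp add: sets_completionI_sets)
  have f': "(\<lambda>y. indicator S y *\<^sub>R f y) \<in> borel_measurable lborel" using f by simp
  show "integral\<^sup>L (lebesgue_on S) f = (\<integral>y. indicator S y *\<^sub>R f y \<partial>lborel)"
    unfolding integral_restrict_space[OF S'] by (rule integral_completion[OF f'])
  show "integrable (lebesgue_on S) f \<longleftrightarrow> integrable lborel (\<lambda>y. indicator S y *\<^sub>R f y)"
    unfolding integrable_restrict_space[OF S'] by (rule integrable_completion[OF f'])
  show "f \<in> borel_measurable (lebesgue_on S)"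
    unfolding borel_measurable_restrict_space_iff[OF S'] using f' by (rule measurable_completion)
qed

lemma AE_lebesgue_on_of_lborel:
  assumes S: "S \<in> sets borel" and P: "AE y in lborel. y \<in> S \<longrightarrow> P y"
  shows "AE y in lebesgue_on S. P y"
proof -
  have S': "S \<inter> space lebesgue \<in> sets lebesgue" using S by (simp add: sets_completionI_sets)
  show ?thesis using AE_restrict_space_iff[OF S'] AE_completion[OF P] by simp
qed

lemma finite_measure_lebesgue_on:
  assumes "open S" "bounded (S :: 'a::euclidean_space set)"
  shows "finite_measure (lebesgue_on S)"
proof
  have "emeasure (lebesgue_on S) (space (lebesgue_on S)) = emeasure lborel S"
    using assms(1) by (simp add: emeasure_restrict_space sets_completionI_sets)
  then show "emeasure (lebesgue_on S) (space (lebesgue_on S)) \<noteq> \<infinity>"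
    using emeasure_bounded_finite[OF assms(2)] by simp
qed

lemma bounded_integrable_lborel:
  fixes f :: "'a::euclidean_space \<Rightarrow> 'b::euclidean_space"
  assumes S: "open S" "bounded S" and f: "(\<lambda>y. indicator S y *\<^sub>R f y) \<in> borel_measurable borel"
    and B: "AE y in lborel. y \<in> S \<longrightarrow> norm (f y) \<le> B"
  shows "integrable lborel (\<lambda>y. indicator S y *\<^sub>R f y)"
proof (rule Bochner_Integration.integrable_bound)
  show "integrable lborel (\<lambda>y. \<bar>B\<bar> * indicator S y)"
    using S(2) S(1) by (intro integrable_const_indicator) auto
  show "AE y in lborel. norm (indicator S y *\<^sub>R f y) \<le> norm (\<bar>B\<bar> * indicator S y)"
    using B by eventually_elim (auto simp: indicator_def)
qed (use f in simp)

lemma borel_measurable_lebesgue_on: "f \<in> borel_measurable borel \<Longrightarrow> f \<in> borel_measurable (lebesgue_on S)"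
  by (intro measurable_restrict_space1 measurable_completion) simp

lemma integrable_bounded_inner:
  fixes f \<phi> :: "'a \<Rightarrow> 'b::euclidean_space" and B :: real
  assumes f: "f \<in> borel_measurable M" "AE y in M. norm (f y) \<le> B" and \<phi>: "integrable M \<phi>"
  shows "integrable M (\<lambda>y. f y \<bullet> \<phi> y)"
proof (rule Bochner_Integration.integrable_bound)
  show "integrable M (\<lambda>y. B * norm (\<phi> y))" using \<phi> by auto
  show "(\<lambda>y. f y \<bullet> \<phi> y) \<in> borel_measurable M" using f(1) \<phi> by (intro borel_measurable_inner) auto
  show "AE y in M. norm (f y \<bullet> \<phi> y) \<le> norm (B * norm (\<phi> y))" using f(2)
  proof eventually_elim
    case (elim y)
    have "norm (f y \<bullet> \<phi> y) \<le> norm (f y) * norm (\<phi> y)" by (simp add: Cauchy_Schwarz_ineq2)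
    also have "\<dots> \<le> B * norm (\<phi> y)" using elim by (intro mult_right_mono) auto
    also have "\<dots> \<le> norm (B * norm (\<phi> y))" by simp
    finally show ?case .
  qed
qed

text \<open>For a bounded sequence the set of good test functions is closed in \<open>L\<^sup>1\<close>.\<close>

lemma weak_null_closure:
  fixes f :: "nat \<Rightarrow> 'a \<Rightarrow> 'b::euclidean_space" and B :: real
  assumes f: "\<And>n. f n \<in> borel_measurable M" and B: "\<And>n. AE y in M. norm (f n y) \<le> B" "B \<ge> 0"
    and \<psi>: "integrable M \<psi>"
    and approx: "\<And>e. e > 0 \<Longrightarrow> \<exists>\<phi>. integrable M \<phi> \<and> (\<integral>y. norm (\<phi> y - \<psi> y) \<partial>M) < e \<and> (\<lambda>n. \<integral>y. f n y \<bullet> \<phi> y \<partial>M) \<longlonglongrightarrow> 0"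
  shows "(\<lambda>n. \<integral>y. f n y \<bullet> \<psi> y \<partial>M) \<longlonglongrightarrow> 0"
proof (rule LIMSEQ_I)
  fix e :: real assume e: "e > 0"
  have int: "integrable M (\<lambda>y. f n y \<bullet> \<phi> y)" and bd: "\<bar>\<integral>y. f n y \<bullet> \<phi> y \<partial>M\<bar> \<le> B * (\<integral>y. norm (\<phi> y) \<partial>M)"
    if \<phi>: "integrable M \<phi>" for \<phi> n
  proof -
    have b: "AE y in M. norm (f n y \<bullet> \<phi> y) \<le> B * norm (\<phi> y)"
      using B(1)[of n]
    proof eventually_elim
      case (elim y)
      have "norm (f n y \<bullet> \<phi> y) \<le> norm (f n y) * norm (\<phi> y)" by (simp add: Cauchy_Schwarz_ineq2)
      also have "\<dots> \<le> B * norm (\<phi> y)" using elim by (intro mult_right_mono) auto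
      finally show ?case .
    qed
    have iB: "integrable M (\<lambda>y. B * norm (\<phi> y))" using \<phi> by auto
    show i: "integrable M (\<lambda>y. f n y \<bullet> \<phi> y)" by (rule integrable_bounded_inner[OF f B(1) \<phi>])
    have "\<bar>\<integral>y. f n y \<bullet> \<phi> y \<partial>M\<bar> \<le> (\<integral>y. \<bar>f n y \<bullet> \<phi> y\<bar> \<partial>M)" by (rule integral_abs_bound)
    also have "\<dots> \<le> (\<integral>y. B * norm (\<phi> y) \<partial>M)"
      using b by (intro integral_mono_AE integrable_abs i iB) auto
    finally show "\<bar>\<integral>y. f n y \<bullet> \<phi> y \<partial>M\<bar> \<le> B * (\<integral>y. norm (\<phi> y) \<partial>M)" by simp
  qed
  have e': "e / (2 * (B + 1)) > 0" using e B(2) by (intro divide_pos_pos) auto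
  obtain \<phi> where \<phi>: "integrable M \<phi>" "(\<integral>y. norm (\<phi> y - \<psi> y) \<partial>M) < e / (2 * (B + 1))" "(\<lambda>n. \<integral>y. f n y \<bullet> \<phi> y \<partial>M) \<longlonglongrightarrow> 0"
    using approx[OF e'] by blast
  obtain N where N: "\<And>n. n \<ge> N \<Longrightarrow> \<bar>\<integral>y. f n y \<bullet> \<phi> y \<partial>M\<bar> < e / 2"
    using LIMSEQ_D[OF \<phi>(3), of "e / 2"] e by auto
  have "norm ((\<integral>y. f n y \<bullet> \<psi> y \<partial>M) - 0) < e" if "n \<ge> N" for n
  proof -
    have "(\<integral>y. f n y \<bullet> (\<phi> y - \<psi> y) \<partial>M) = (\<integral>y. f n y \<bullet> \<phi> y \<partial>M) - (\<integral>y. f n y \<bullet> \<psi> y \<partial>M)"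
      unfolding inner_diff_right by (intro Bochner_Integration.integral_diff int \<phi> \<psi>)
    moreover have "\<bar>\<integral>y. f n y \<bullet> (\<phi> y - \<psi> y) \<partial>M\<bar> \<le> B * (\<integral>y. norm (\<phi> y - \<psi> y) \<partial>M)"
      by (intro bd Bochner_Integration.integrable_diff \<phi> \<psi>)
    moreover have "B * (\<integral>y. norm (\<phi> y - \<psi> y) \<partial>M) \<le> B * (e / (2 * (B + 1)))"
      using \<phi>(2) B(2) by (intro mult_left_mono) auto
    moreover have "B * (e / (2 * (B + 1))) \<le> (B + 1) * (e / (2 * (B + 1)))"
      using e' by (intro mult_right_mono) auto
    moreover have "(B + 1) * (e / (2 * (B + 1))) = e / 2" using B(2) by (simp add: field_simps)
    ultimately show ?thesis using N[OF that] unfolding real_norm_def by linarith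
  qed
  then show "\<exists>N. \<forall>n\<ge>N. norm ((\<integral>y. f n y \<bullet> \<psi> y \<partial>M) - 0) < e" by blast
qed

lemma continuous_approximation:
  fixes f :: "'a::euclidean_space \<Rightarrow> real"
  assumes S: "S \<in> sets borel" and f: "f \<in> borel_measurable (lebesgue_on S)"
  shows "\<exists>g. (\<forall>n. continuous_on UNIV (g n)) \<and> (AE x in lebesgue_on S. (\<lambda>n::nat. g n x) \<longlonglongrightarrow> f x)"
proof -
  have S': "S \<in> sets lebesgue" using S by (simp add: sets_completionI_sets)
  have "f measurable_on S" using f measurable_on_iff_borel_measurable[OF S'] by blast
  then obtain N g where N: "negligible N" and g: "\<And>n. continuous_on UNIV (g n)"
    and lim: "\<And>x. x \<notin> N \<Longrightarrow> (\<lambda>n::nat. g n x) \<longlonglongrightarrow> (if x \<in> S then f x else 0)"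
    unfolding measurable_on_def by blast
  have "AE x in lebesgue. x \<notin> N"
    using N by (intro AE_not_in) (simp add: negligible_iff_null_sets)
  then have "AE x in lebesgue. x \<in> S \<longrightarrow> (\<lambda>n. g n x) \<longlonglongrightarrow> f x"
  proof eventually_elim
    case (elim x) then show ?case using lim[of x] by auto
  qed
  then have "AE x in lebesgue_on S. (\<lambda>n. g n x) \<longlonglongrightarrow> f x"
    using AE_restrict_space_iff[of S lebesgue] S' by simp
  then show ?thesis using g by blast
qed

lemma continuous_lebesgue_on:
  fixes g :: "'a::euclidean_space \<Rightarrow> 'b::euclidean_space"
  shows "continuous_on UNIV g \<Longrightarrow> g \<in> borel_measurable (lebesgue_on S)"
  by (intro measurable_restrict_space1 measurable_completion) (simp add: borel_measurable_continuous_onI)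

text \<open>Continuous functions approximate indicators, and these generate all integrable functions.\<close>

lemma weak_null_testing:
  fixes f :: "nat \<Rightarrow> 'a::euclidean_space \<Rightarrow> 'b::euclidean_space" and B :: real
  assumes S: "open S" "bounded S"
    and f: "\<And>n. f n \<in> borel_measurable (lebesgue_on S)" and B: "\<And>n. AE y in lebesgue_on S. norm (f n y) \<le> B" "B \<ge> 0"
    and test: "\<And>g c. continuous_on UNIV g \<Longrightarrow> (\<forall>y. 0 \<le> g y \<and> g y \<le> 1) \<Longrightarrow> (\<lambda>n. \<integral>y. g y * (f n y \<bullet> c) \<partial>lebesgue_on S) \<longlonglongrightarrow> 0"
    and \<psi>: "integrable (lebesgue_on S) \<psi>"
  shows "(\<lambda>n. \<integral>y. f n y \<bullet> \<psi> y \<partial>lebesgue_on S) \<longlonglongrightarrow> 0"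
  using \<psi>
proof (induction rule: integrable_induct)
  interpret finite_measure "lebesgue_on S" using S by (rule finite_measure_lebesgue_on)
  let ?M = "lebesgue_on S"
  case (base A c)
  have A: "A \<in> sets ?M" using base by simp
  have im: "indicat_real A \<in> borel_measurable ?M" using A by simp
  obtain g0 where g0: "\<And>n. continuous_on UNIV (g0 n)" "AE x in ?M. (\<lambda>n::nat. g0 n x) \<longlonglongrightarrow> indicat_real A x"
    using continuous_approximation[OF _ im] S(1) by (metis borel_open)
  define g where "g n x = max 0 (min 1 (g0 n x))" for n x
  have cg: "continuous_on UNIV (g n)" for n unfolding g_def[abs_def] by (intro continuous_intros g0)
  have rg: "0 \<le> g n x" "g n x \<le> 1" for n x by (auto simp: g_def)
  have gm: "g n \<in> borel_measurable ?M" for n by (rule continuous_lebesgue_on[OF cg])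
  have gl: "AE x in ?M. (\<lambda>n. g n x) \<longlonglongrightarrow> indicat_real A x"
    using g0(2)
  proof eventually_elim
    case (elim x)
    have "(\<lambda>n. g n x) \<longlonglongrightarrow> max 0 (min 1 (indicat_real A x))" unfolding g_def by (intro tendsto_intros elim)
    then show ?case by (simp add: indicator_def split: if_splits)
  qed
  have ig: "integrable ?M (\<lambda>x. g n x *\<^sub>R c)" for n
    by (intro integrable_scaleR_left integrable_const_bound[of _ 1] gm) (use rg in auto)
  have iA: "integrable ?M (\<lambda>x. indicat_real A x *\<^sub>R c)"
    by (intro integrable_scaleR_left integrable_const_bound[of _ 1] im) (auto simp: indicator_def)
  have lim: "(\<lambda>n. \<integral>x. norm (g n x *\<^sub>R c - indicat_real A x *\<^sub>R c) \<partial>?M) \<longlonglongrightarrow> (\<integral>x. 0 \<partial>?M)"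
  proof (rule integral_dominated_convergence[where w = "\<lambda>x. 2 * norm c"])
    show "AE x in ?M. (\<lambda>n. norm (g n x *\<^sub>R c - indicat_real A x *\<^sub>R c)) \<longlonglongrightarrow> 0"
      using gl
    proof eventually_elim
      case (elim x)
      have "(\<lambda>n. norm (g n x *\<^sub>R c - indicat_real A x *\<^sub>R c)) \<longlonglongrightarrow> norm (indicat_real A x *\<^sub>R c - indicat_real A x *\<^sub>R c)"
        by (intro tendsto_intros elim)
      then show ?case by simp
    qed
    show "AE x in ?M. norm (norm (g n x *\<^sub>R c - indicat_real A x *\<^sub>R c)) \<le> 2 * norm c" for n
    proof (rule AE_I2)
      fix x
      have "norm (g n x *\<^sub>R c - indicat_real A x *\<^sub>R c) \<le> \<bar>g n x\<bar> * norm c + \<bar>indicat_real A x\<bar> * norm c"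
        by (rule order_trans[OF norm_triangle_ineq4]) simp
      also have "\<dots> \<le> 1 * norm c + 1 * norm c"
        using rg[of n x] by (intro add_mono mult_right_mono) (auto simp: indicator_def)
      finally show "norm (norm (g n x *\<^sub>R c - indicat_real A x *\<^sub>R c)) \<le> 2 * norm c" by simp
    qed
    show "(\<lambda>x. norm (g n x *\<^sub>R c - indicat_real A x *\<^sub>R c)) \<in> borel_measurable ?M" for n
      by (rule borel_measurable_integrable[OF integrable_norm[OF Bochner_Integration.integrable_diff[OF ig iA]]])
  qed auto
  show ?case
  proof (rule weak_null_closure[OF f B iA])
    fix e :: real assume "e > 0"
    then obtain n where n: "(\<integral>x. norm (g n x *\<^sub>R c - indicat_real A x *\<^sub>R c) \<partial>?M) < e"
      using order_tendstoD(2)[OF lim, of e] eventually_sequentially by auto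
    have "(\<lambda>k. \<integral>y. f k y \<bullet> (g n y *\<^sub>R c) \<partial>?M) \<longlonglongrightarrow> 0" using test[OF cg, of n c] rg by simp
    then show "\<exists>\<phi>. integrable ?M \<phi> \<and> (\<integral>y. norm (\<phi> y - indicat_real A y *\<^sub>R c) \<partial>?M) < e \<and> (\<lambda>k. \<integral>y. f k y \<bullet> \<phi> y \<partial>?M) \<longlonglongrightarrow> 0"
      using ig n by blast
  qed
next
  let ?M = "lebesgue_on S"
  case (add u w)
  have i: "integrable ?M (\<lambda>y. f n y \<bullet> \<phi> y)" if \<phi>: "integrable ?M \<phi>" for \<phi> n
    by (rule integrable_bounded_inner[OF f B(1) \<phi>])
  have "(\<lambda>n. (\<integral>y. f n y \<bullet> u y \<partial>?M) + (\<integral>y. f n y \<bullet> w y \<partial>?M)) \<longlonglongrightarrow> 0 + 0"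
    by (intro tendsto_add add)
  moreover have "(\<integral>y. f n y \<bullet> (u y + w y) \<partial>?M) = (\<integral>y. f n y \<bullet> u y \<partial>?M) + (\<integral>y. f n y \<bullet> w y \<partial>?M)" for n
    unfolding inner_add_right by (intro Bochner_Integration.integral_add i add)
  ultimately show ?case by simp
next
  let ?M = "lebesgue_on S"
  case (lim \<psi> s)
  have l: "(\<lambda>i. \<integral>y. norm (s i y - \<psi> y) \<partial>?M) \<longlonglongrightarrow> (\<integral>y. 0 \<partial>?M)"
  proof (rule integral_dominated_convergence[where w = "\<lambda>y. 3 * norm (\<psi> y)"])
    show "integrable ?M (\<lambda>y. 3 * norm (\<psi> y))" using lim by auto
    show "AE y in ?M. (\<lambda>i. norm (s i y - \<psi> y)) \<longlonglongrightarrow> 0"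
    proof (rule AE_I2)
      fix y assume "y \<in> space ?M"
      then have "(\<lambda>i. norm (s i y - \<psi> y)) \<longlonglongrightarrow> norm (\<psi> y - \<psi> y)" by (intro tendsto_intros lim)
      then show "(\<lambda>i. norm (s i y - \<psi> y)) \<longlonglongrightarrow> 0" by simp
    qed
    show "AE y in ?M. norm (norm (s i y - \<psi> y)) \<le> 3 * norm (\<psi> y)" for i
    proof (rule AE_I2)
      fix y assume "y \<in> space ?M"
      then have "norm (s i y) \<le> 2 * norm (\<psi> y)" by (rule lim)
      then show "norm (norm (s i y - \<psi> y)) \<le> 3 * norm (\<psi> y)" using norm_triangle_ineq4[of "s i y" "\<psi> y"] by simp
    qed
    show "(\<lambda>y. norm (s i y - \<psi> y)) \<in> borel_measurable ?M" for i
      by (rule borel_measurable_integrable[OF integrable_norm[OF Bochner_Integration.integrable_diff[OF lim(1,4)]]])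
  qed auto
  show ?case
  proof (rule weak_null_closure[OF f B lim(4)])
    fix e :: real assume "e > 0"
    then obtain i where i: "(\<integral>y. norm (s i y - \<psi> y) \<partial>?M) < e"
      using order_tendstoD(2)[OF l, of e] eventually_sequentially by auto
    then show "\<exists>\<phi>. integrable ?M \<phi> \<and> (\<integral>y. norm (\<phi> y - \<psi> y) \<partial>?M) < e \<and> (\<lambda>k. \<integral>y. f k y \<bullet> \<phi> y \<partial>?M) \<longlonglongrightarrow> 0"
      using lim(1,5)  by blast
  qed
qed

section \<open>Dyadic grids and oscillating signs\<close>

definition cell_corner :: "nat \<Rightarrow> 'a::euclidean_space \<Rightarrow> 'a" where
  "cell_corner m y = (\<Sum>b\<in>Basis. (of_int \<lfloor>2 ^ m * (y \<bullet> b)\<rfloor> / 2 ^ m) *\<^sub>R b)"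

definition grid :: "nat \<Rightarrow> 'a::euclidean_space set" where
  "grid m = {y. \<exists>b\<in>Basis. 2 ^ m * (y \<bullet> b) \<in> \<int>}"

lemma cell_corner_inner: "b \<in> Basis \<Longrightarrow> cell_corner m y \<bullet> b = of_int \<lfloor>2 ^ m * (y \<bullet> b)\<rfloor> / 2 ^ m"
  by (simp add: cell_corner_def inner_sum_left_Basis)

lemma closed_grid: "closed (grid m)"
proof -
  have e: "grid m = (\<Union>b\<in>Basis. (\<lambda>y::'a. 2 ^ m * (y \<bullet> b)) -` \<int>)" by (auto simp: grid_def)
  show ?thesis unfolding e
    by (intro closed_UN finite_Basis continuous_closed_vimage closed_Ints ballI continuous_intros)
qed

lemma AE_not_grid: "AE y in lborel. y \<notin> grid m"
proof -
  have "negligible (grid m :: 'a set)"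
  proof (rule negligible_subset)
    show "negligible (\<Union>b\<in>Basis. \<Union>k. {y::'a. b \<bullet> y = of_int k / 2 ^ m})"
    proof (rule negligible_Union)
      fix W assume "W \<in> (\<lambda>b. \<Union>k. {y::'a. b \<bullet> y = of_int k / 2 ^ m}) ` Basis"
      then obtain b where b: "b \<in> Basis" "W = (\<Union>k. {y::'a. b \<bullet> y = of_int k / 2 ^ m})" by blast
      have "negligible (\<Union>k. {y::'a. b \<bullet> y = of_int k / 2 ^ m})"
        by (intro negligible_countable_Union) (use b in \<open>auto intro!: negligible_hyperplane\<close>)
      then show "negligible W" using b(2) by simp
    qed simp
    show "grid m \<subseteq> (\<Union>b\<in>Basis. \<Union>k. {y::'a. b \<bullet> y = of_int k / 2 ^ m})"
      by (auto simp: grid_def Ints_def field_simps inner_commute)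
  qed
  moreover have "grid m \<in> sets (borel :: 'a measure)" by (intro borel_closed closed_grid)
  ultimately show ?thesis
    by (intro AE_not_in) (auto simp: negligible_iff_null_sets null_sets_def emeasure_completion)
qed

lemma floor_eventually:
  fixes y :: "'a::euclidean_space"
  assumes "y \<notin> grid m" "b \<in> Basis"
  shows "\<forall>\<^sub>F z in nhds y. \<lfloor>2 ^ m * (z \<bullet> b)\<rfloor> = \<lfloor>2 ^ m * (y \<bullet> b)\<rfloor>"
proof (rule eventually_floor_eq)
  show "((\<lambda>z. 2 ^ m * (z \<bullet> b)) \<longlongrightarrow> 2 ^ m * (y \<bullet> b)) (nhds y)" by (intro tendsto_intros filterlim_ident)
  show "2 ^ m * (y \<bullet> b) \<notin> \<int>" using assms by (auto simp: grid_def)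
qed

lemma cell_corner_eventually:
  assumes "y \<notin> grid m" shows "\<forall>\<^sub>F z in nhds y. cell_corner m z = cell_corner m y"
proof -
  have "\<forall>\<^sub>F z in nhds y. \<forall>b\<in>Basis. \<lfloor>2 ^ m * (z \<bullet> b)\<rfloor> = \<lfloor>2 ^ m * (y \<bullet> b)\<rfloor>"
    using floor_eventually[OF assms] by (intro eventually_ball_finite finite_Basis) auto
  then show ?thesis by eventually_elim (simp add: cell_corner_def)
qed

lemma cell_corner_dist: "norm (cell_corner m y - y) \<le> real DIM('a) / 2 ^ m" for y :: "'a::euclidean_space"
proof -
  have "norm (cell_corner m y - y) \<le> (\<Sum>b\<in>Basis. \<bar>(cell_corner m y - y) \<bullet> b\<bar>)" by (rule norm_le_l1)
  also have "\<dots> \<le> (\<Sum>b\<in>(Basis::'a set). 1 / 2 ^ m)"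
  proof (rule sum_mono)
    fix b :: 'a assume b: "b \<in> Basis"
    have e: "2 ^ m * ((cell_corner m y - y) \<bullet> b) = of_int \<lfloor>2 ^ m * (y \<bullet> b)\<rfloor> - 2 ^ m * (y \<bullet> b)"
      using b by (simp add: inner_diff_left cell_corner_inner field_simps)
    have "\<bar>of_int \<lfloor>2 ^ m * (y \<bullet> b)\<rfloor> - 2 ^ m * (y \<bullet> b)\<bar> \<le> (1::real)" by linarith
    then have "2 ^ m * \<bar>(cell_corner m y - y) \<bullet> b\<bar> \<le> 1" using e by (metis abs_mult abs_of_nonneg zero_le_numeral zero_le_power)
    then show "\<bar>(cell_corner m y - y) \<bullet> b\<bar> \<le> 1 / 2 ^ m" by (simp add: field_simps)
  qed
  finally show ?thesis by simp
qed

lemma cell_corner_tendsto: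
  assumes k: "filterlim k at_top sequentially"
  shows "(\<lambda>n. cell_corner (k n) y) \<longlonglongrightarrow> y"
proof -
  have "(\<lambda>m. real DIM('a) * (1 / 2) ^ m) \<longlonglongrightarrow> real DIM('a) * 0"
    by (intro tendsto_intros LIMSEQ_power_zero) simp
  then have l: "(\<lambda>m. real DIM('a) / 2 ^ m) \<longlonglongrightarrow> 0" by (simp add: power_divide)
  have "(\<lambda>n. cell_corner (k n) y - y) \<longlonglongrightarrow> 0"
    by (rule tendsto_norm_zero_cancel, rule tendsto_sandwich[OF _ _ tendsto_const filterlim_compose[OF l k]])
       (auto simp: cell_corner_dist)
  then show ?thesis by (simp add: LIM_zero_iff)
qed

lemma cell_corner_borel [measurable]: "cell_corner m \<in> borel_measurable borel"
  unfolding cell_corner_def[abs_def] by measurable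

lemma grid_snd:
  fixes y :: "'a::euclidean_space \<times> 'b::euclidean_space"
  assumes "y \<notin> grid m" shows "snd y \<notin> grid m"
proof
  assume "snd y \<in> grid m"
  then obtain b where b: "b \<in> Basis" "2 ^ m * (snd y \<bullet> b) \<in> \<int>" by (auto simp: grid_def)
  have "(0, b) \<in> (Basis :: ('a \<times> 'b) set)" using b by (simp add: Basis_prod_def)
  moreover have "y \<bullet> (0, b) = snd y \<bullet> b" by (cases y) simp
  ultimately show False using assms b by (auto simp: grid_def)
qed

definition checker :: "nat \<Rightarrow> 'a::euclidean_space \<Rightarrow> real" where
  "checker m x = (if even \<lfloor>2 ^ m * (x \<bullet> (SOME b. b \<in> Basis))\<rfloor> then 1 else -1)"

lemma checker_abs: "\<bar>checker m x\<bar> = 1" by (simp add: checker_def)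

lemma some_in_Basis: "(SOME b. b \<in> Basis) \<in> (Basis :: 'a::euclidean_space set)"
  using nonempty_Basis by (simp add: some_in_eq)

lemma checker_borel [measurable]: "checker m \<in> borel_measurable borel"
proof -
  have [measurable]: "(\<lambda>x::'a. \<lfloor>2 ^ m * (x \<bullet> (SOME b. b \<in> Basis))\<rfloor>) \<in> borel \<rightarrow>\<^sub>M count_space UNIV"
    by measurable
  have "(\<lambda>k::int. if even k then 1 else - 1 :: real) \<in> count_space UNIV \<rightarrow>\<^sub>M borel" by simp
  then show ?thesis unfolding checker_def[abs_def]
    by (rule measurable_compose[rotated]) measurable
qed

lemma checker_eventually: "x \<notin> grid m \<Longrightarrow> \<forall>\<^sub>F z in nhds x. checker m z = checker m x"
  using floor_eventually[OF _ some_in_Basis, of x m] by (auto simp: checker_def elim!: eventually_mono)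

lemma checker_shift: "checker m (x + (1 / 2 ^ m) *\<^sub>R (SOME b. b \<in> Basis)) = - checker m x"
proof -
  let ?b = "SOME b. b \<in> (Basis :: 'a set)"
  have "2 ^ m * ((x + (1 / 2 ^ m) *\<^sub>R ?b) \<bullet> ?b) = 2 ^ m * (x \<bullet> ?b) + 1"
    using some_in_Basis[where 'a = 'a] by (simp add: inner_add_left distrib_left)
  then show ?thesis by (simp add: checker_def)
qed

text \<open>Translation by one cell flips the sign, so \<open>2 \<integral> r \<psi>\<close> equals \<open>\<integral> r (\<psi> - \<psi>(\<cdot> + h))\<close>, which is small for a
  function \<open>\<psi>\<close> that is continuous a.e. The test functions are cut off on a ball, as the boundary of \<open>S\<close> may have
  positive measure.\<close>

lemma checker_weak_null:
  fixes \<psi> :: "'a::euclidean_space \<Rightarrow> real"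
  assumes k: "filterlim k at_top sequentially" and S: "open S" "bounded S" and \<psi>: "integrable (lebesgue_on S) \<psi>"
  shows "(\<lambda>n. \<integral>x. checker (k n) x * \<psi> x \<partial>lebesgue_on S) \<longlonglongrightarrow> 0"
proof -
  let ?b = "SOME b. b \<in> (Basis :: 'a set)"
  have nb: "norm ?b = 1" by (rule norm_Basis[OF some_in_Basis])
  obtain R where R: "R > 0" "S \<subseteq> ball 0 R"
    using S(2) bounded_subset_ballD by blast
  let ?B = "ball (0::'a) R"
  define h :: "nat \<Rightarrow> real" where "h n = 1 / 2 ^ k n" for n
  have h: "h \<longlonglongrightarrow> 0"
  proof -
    have "(\<lambda>m. (1 / 2 :: real) ^ m) \<longlonglongrightarrow> 0" by (intro LIMSEQ_power_zero) simp
    from filterlim_compose[OF this k] show ?thesis by (simp add: h_def[abs_def] power_divide)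
  qed
  have h1: "0 < h n" "h n \<le> 1" for n by (auto simp: h_def)
  have test: "(\<lambda>n. \<integral>x. g x * (checker (k n) x \<bullet> c) \<partial>lebesgue_on ?B) \<longlonglongrightarrow> 0"
    if g: "continuous_on UNIV g" "\<forall>x. 0 \<le> g x \<and> g x \<le> 1" for g :: "'a \<Rightarrow> real" and c :: real
  proof -
    define F where "F x = indicator ?B x * g x" for x
    have gm: "g \<in> borel_measurable borel" by (rule borel_measurable_continuous_onI[OF g(1)])
    have Fm[measurable]: "F \<in> borel_measurable borel" 
    proof -
      have "(\<lambda>x. indicator ?B x *\<^sub>R g x) \<in> borel_measurable borel"
        by (intro borel_measurable_scaleR borel_measurable_indicator gm) simp
      then show ?thesis by (simp add: F_def[abs_def])
    qed
    have F1: "\<bar>F x\<bar> \<le> indicator ?B x" for x using g(2) by (auto simp: F_def indicator_def)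
    have ib: "integrable lborel (\<lambda>x. indicat_real (ball (0::'a) r) x)" for r
      using emeasure_bounded_finite[OF bounded_ball] by (auto simp: integrable_indicator_iff)
    have iF: "integrable lborel (\<lambda>x. F x * checker (k n) x)" for n
      by (rule Bochner_Integration.integrable_bound[OF ib[of R]])
         (use F1 in \<open>auto simp: abs_mult checker_abs intro!: AE_I2\<close>)
    have half: "(\<integral>x. F x * checker (k n) x \<partial>lborel) = (\<integral>x. (F x - F (x + h n *\<^sub>R ?b)) * checker (k n) x \<partial>lborel) / 2" for n
    proof -
      have t: "(\<integral>x. F (x + h n *\<^sub>R ?b) * checker (k n) (x + h n *\<^sub>R ?b) \<partial>lborel) = (\<integral>x. F x * checker (k n) x \<partial>lborel)"
        "integrable lborel (\<lambda>x. F (x + h n *\<^sub>R ?b) * checker (k n) (x + h n *\<^sub>R ?b))"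
        using integral_translate_lborel[of "\<lambda>x. F x * checker (k n) x" "h n *\<^sub>R ?b"] iF[of n] by auto
      have s: "checker (k n) (x + h n *\<^sub>R ?b) = - checker (k n) x" for x by (simp add: h_def checker_shift)
      have "(\<integral>x. (F x - F (x + h n *\<^sub>R ?b)) * checker (k n) x \<partial>lborel) = (\<integral>x. F x * checker (k n) x + F (x + h n *\<^sub>R ?b) * checker (k n) (x + h n *\<^sub>R ?b) \<partial>lborel)"
        unfolding s by (simp add: algebra_simps)
      also have "\<dots> = 2 * (\<integral>x. F x * checker (k n) x \<partial>lborel)"
        by (subst Bochner_Integration.integral_add[OF iF t(2)]) (simp add: t(1))
      finally show ?thesis by simp
    qed
    have "(\<lambda>n. \<integral>x. (F x - F (x + h n *\<^sub>R ?b)) * checker (k n) x \<partial>lborel) \<longlonglongrightarrow> (\<integral>x. 0 \<partial>(lborel::'a measure))"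
    proof (rule integral_dominated_convergence[where w = "\<lambda>x. 2 * indicator (ball 0 (R + 1)) x"])
      show "integrable lborel (\<lambda>x. 2 * indicat_real (ball (0::'a) (R + 1)) x)" by (intro integrable_mult_right ib)
      show "AE x in lborel. norm ((F x - F (x + h n *\<^sub>R ?b)) * checker (k n) x) \<le> 2 * indicat_real (ball (0::'a) (R + 1)) x" for n
      proof (rule AE_I2)
        fix x :: 'a
        have "x \<in> ball 0 (R + 1)" if "x + h n *\<^sub>R ?b \<in> ball 0 R"
        proof -
          have "norm x \<le> norm (x + h n *\<^sub>R ?b) + norm (h n *\<^sub>R ?b)" by (metis add_diff_cancel_right' norm_triangle_ineq4)
          then show ?thesis using that h1[of n] nb by simp
        qed
        then have "indicat_real ?B (x + h n *\<^sub>R ?b) \<le> indicat_real (ball (0::'a) (R + 1)) x" by (auto simp: indicator_def)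
        moreover have "indicat_real ?B x \<le> indicat_real (ball (0::'a) (R + 1)) x" by (auto simp: indicator_def)
        ultimately show "norm ((F x - F (x + h n *\<^sub>R ?b)) * checker (k n) x) \<le> 2 * indicat_real (ball (0::'a) (R + 1)) x"
          using F1[of x] F1[of "x + h n *\<^sub>R ?b"] by (simp add: abs_mult checker_abs)
      qed
      have "AE x in lborel. x \<notin> sphere (0::'a) R"
      proof -
        have "negligible (sphere (0::'a) R)" by (rule negligible_sphere)
        then show ?thesis by (intro AE_not_in) (auto simp: negligible_iff_null_sets null_sets_def emeasure_completion)
      qed
      then show "AE x in lborel. (\<lambda>n. (F x - F (x + h n *\<^sub>R ?b)) * checker (k n) x) \<longlonglongrightarrow> 0"
      proof eventually_elim
        case (elim x)
        have "isCont F x"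
        proof (cases "x \<in> ?B")
          case True
          have "isCont g x" using g(1) by (simp add: continuous_on_eq_continuous_at)
          moreover have "\<forall>\<^sub>F z in nhds x. F z = g z"
            using eventually_nhds_in_open[OF open_ball True] by eventually_elim (simp add: F_def)
          ultimately show ?thesis using isCont_cong by blast
        next
          case False
          then have x: "x \<in> - cball 0 R" using elim by auto
          have "isCont (\<lambda>_. 0 :: real) x" by simp
          moreover have "\<forall>\<^sub>F z in nhds x. F z = 0"
            using eventually_nhds_in_open[OF open_Compl[OF closed_cball] x] by eventually_elim (simp add: F_def)
          ultimately show ?thesis using isCont_cong[of F "\<lambda>_. 0" x] by blast
        qed
        moreover have "(\<lambda>n. x + h n *\<^sub>R ?b) \<longlonglongrightarrow> x + 0 *\<^sub>R ?b" by (intro tendsto_intros h)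
        ultimately have "(\<lambda>n. F (x + h n *\<^sub>R ?b)) \<longlonglongrightarrow> F x" using isCont_tendsto_compose[of x F] by simp
        then have "(\<lambda>n. \<bar>F x - F (x + h n *\<^sub>R ?b)\<bar>) \<longlonglongrightarrow> \<bar>F x - F x\<bar>" by (intro tendsto_intros)
        then have "(\<lambda>n. norm ((F x - F (x + h n *\<^sub>R ?b)) * checker (k n) x)) \<longlonglongrightarrow> 0" by (simp add: abs_mult checker_abs)
        then show ?case by (rule tendsto_norm_zero_cancel)
      qed
    qed auto
    then have "(\<lambda>n. c * (\<integral>x. F x * checker (k n) x \<partial>lborel)) \<longlonglongrightarrow> c * ((\<integral>x. 0 \<partial>(lborel::'a measure)) / 2)"
      unfolding half by (intro tendsto_intros) auto
    moreover have "(\<integral>x. g x * (checker (k n) x \<bullet> c) \<partial>lebesgue_on ?B) = c * (\<integral>x. F x * checker (k n) x \<partial>lborel)" for n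
    proof -
      have e: "(\<lambda>x. indicator ?B x *\<^sub>R (g x * (checker (k n) x \<bullet> c))) = (\<lambda>x. c * (F x * checker (k n) x))"
        by (rule ext) (simp add: F_def mult_ac)
      have "(\<integral>x. g x * (checker (k n) x \<bullet> c) \<partial>lebesgue_on ?B) = (\<integral>x. indicator ?B x *\<^sub>R (g x * (checker (k n) x \<bullet> c)) \<partial>lborel)"
      proof (rule lebesgue_on_integral)
        show "(\<lambda>x. indicator ?B x *\<^sub>R (g x * (checker (k n) x \<bullet> c))) \<in> borel_measurable borel" unfolding e by measurable
      qed simp
      also have "\<dots> = (\<integral>x. c * (F x * checker (k n) x) \<partial>lborel)" unfolding e ..
      finally show ?thesis by simp
    qed
    ultimately show ?thesis by simp
  qed
  define \<psi>' where "\<psi>' x = indicator S x *\<^sub>R \<psi> x" for x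
  have S': "S \<in> sets lebesgue" "?B \<in> sets lebesgue" using S(1) by (auto simp: sets_completionI_sets)
  have "integrable lebesgue (\<lambda>x. indicator S x *\<^sub>R \<psi> x)" using \<psi> S' integrable_restrict_space[of S lebesgue \<psi>] by simp
  moreover have e: "indicator ?B x *\<^sub>R \<psi>' x = \<psi>' x" for x using R by (auto simp: \<psi>'_def indicator_def)
  ultimately have i': "integrable (lebesgue_on ?B) \<psi>'"
    using S' integrable_restrict_space[of ?B lebesgue \<psi>'] by (simp only: e) (simp add: \<psi>'_def[abs_def])
  have "(\<lambda>n. \<integral>x. checker (k n) x \<bullet> \<psi>' x \<partial>lebesgue_on ?B) \<longlonglongrightarrow> 0"
  proof (rule weak_null_testing[where B = 1, OF open_ball bounded_ball _ _ _ test i'])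
    show "checker (k n) \<in> borel_measurable (lebesgue_on ?B)" for n
      by (intro measurable_restrict_space1 measurable_completion) simp
  qed (auto simp: checker_abs)
  moreover have "(\<integral>x. checker (k n) x \<bullet> \<psi>' x \<partial>lebesgue_on ?B) = (\<integral>x. checker (k n) x * \<psi> x \<partial>lebesgue_on S)" for n
  proof -
    have "(\<integral>x. checker (k n) x \<bullet> \<psi>' x \<partial>lebesgue_on ?B) = (\<integral>x. indicator ?B x *\<^sub>R (checker (k n) x \<bullet> \<psi>' x) \<partial>lebesgue)"
      using S' by (intro integral_restrict_space) simp
    also have "\<dots> = (\<integral>x. indicator S x *\<^sub>R (checker (k n) x * \<psi> x) \<partial>lebesgue)"
      using R(2) by (intro Bochner_Integration.integral_cong) (auto simp: \<psi>'_def indicator_def)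
    also have "\<dots> = (\<integral>x. checker (k n) x * \<psi> x \<partial>lebesgue_on S)"
      using S' by (intro integral_restrict_space[symmetric]) simp
    finally show ?thesis .
  qed
  ultimately show ?thesis by simp
qed

section \<open>Weak solutions with a given step density\<close>

lemma isCont_locally_constant:
  assumes "\<forall>\<^sub>F z in nhds y. f z = f y" shows "isCont f y"
  using isCont_cong[OF assms] by simp

lemma has_derivative_locally_constant_scaleR:
  assumes q: "\<forall>\<^sub>F z in nhds y. q z = q y" and \<phi>: "(\<phi> has_derivative T) (at y)"
  shows "((\<lambda>z. q z *\<^sub>R \<phi> z) has_derivative (\<lambda>u. q y *\<^sub>R T u)) (at y)"
proof -
  obtain S where S: "open S" "y \<in> S" "\<And>z. z \<in> S \<Longrightarrow> q z = q y" using q unfolding eventually_nhds by blast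
  show ?thesis
    by (rule has_derivative_transform_within_open[OF has_derivative_scaleR_right[OF \<phi>, of "q y"] S(1,2)]) (simp add: S(3))
qed

lemma C1c_obtain:
  fixes \<phi> :: "'a::euclidean_space \<Rightarrow> 'b::euclidean_space"
  assumes \<phi>: "\<phi> \<in> C1c U V" and U: "open U" "U \<subseteq> V"
  obtains \<phi>' K B where "continuous_on V \<phi>" "continuous_on V \<phi>'"
    "\<And>z. z \<in> U \<Longrightarrow> (\<phi> has_derivative blinfun_apply (\<phi>' z)) (at z)"
    "compact K" "K \<subseteq> V" "\<And>z. z \<in> V \<Longrightarrow> z \<notin> K \<Longrightarrow> \<phi> z = 0"
    "0 \<le> B" "\<And>z. z \<in> U \<Longrightarrow> norm (\<phi>' z) \<le> B" "\<And>z. z \<in> U \<Longrightarrow> norm (\<phi> z) \<le> B"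
proof -
  obtain \<phi>' K where c: "continuous_on V \<phi>" "continuous_on V \<phi>'"
    and d: "\<And>z. z \<in> U \<Longrightarrow> (\<phi> has_derivative blinfun_apply (\<phi>' z)) (at z)"
    and K: "compact K" "K \<subseteq> V" and z: "\<And>z. z \<in> V \<Longrightarrow> z \<notin> K \<Longrightarrow> \<phi> z = 0"
    using \<phi> unfolding C1c_def by blast
  obtain B1 where B1: "\<And>z. z \<in> K \<Longrightarrow> norm (\<phi>' z) \<le> B1"
    using compact_imp_bounded[OF compact_continuous_image[OF continuous_on_subset[OF c(2) K(2)] K(1)]] unfolding bounded_iff by blast
  obtain B2 where B2: "\<And>z. z \<in> K \<Longrightarrow> norm (\<phi> z) \<le> B2"
    using compact_imp_bounded[OF compact_continuous_image[OF continuous_on_subset[OF c(1) K(2)] K(1)]] unfolding bounded_iff by blast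
  let ?B = "max 0 (max B1 B2)"
  have 0: "\<phi>' x = 0" if "x \<in> U" "x \<notin> K" for x
  proof -
    have "(\<phi> has_derivative (\<lambda>_. 0)) (at x)"
      by (rule has_derivative_zero_near[of "U - K"])
         (use that K U z in \<open>auto simp: open_Diff compact_imp_closed\<close>)
    then have "blinfun_apply (\<phi>' x) = (\<lambda>_. 0)" using d[OF that(1)] has_derivative_unique by blast
    then show ?thesis by (simp add: blinfun_eqI)
  qed
  have n1: "norm (\<phi>' x) \<le> ?B" if "x \<in> U" for x
    using 0[OF that] B1[of x] by (cases "x \<in> K") auto
  have n2: "norm (\<phi> x) \<le> ?B" if "x \<in> U" for x
    using z[of x] B2[of x] that U(2) by (cases "x \<in> K") auto
  show thesis by (rule that[OF c d K z _ n1 n2]) auto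
qed

lemma dt_eq: "(\<phi> has_derivative T) (at z) \<Longrightarrow> dt \<phi> z = T (1, 0)"
  unfolding dt_def using frechet_derivative_at by metis

lemma dx_eq: "(\<phi> has_derivative T) (at z) \<Longrightarrow> dx j \<phi> z = T (0, axis j 1)"
  unfolding dx_def using frechet_derivative_at by metis

lemma indicator_continuous_borel:
  assumes "open Q" "continuous_on Q f"
  shows "(\<lambda>y. indicator Q y *\<^sub>R (f y :: 'b::real_normed_vector)) \<in> borel_measurable borel"
  by (rule borel_measurable_continuous_on_indicator[OF _ assms(2)]) (use assms(1) in simp)

lemma borel_measurable_snd_compose:
  assumes "f \<in> borel_measurable borel"
  shows "(\<lambda>y. f (snd y :: 'b::second_countable_topology)) \<in> borel_measurable (borel :: ('a::second_countable_topology \<times> 'b) measure)"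
  by (rule measurable_compose[OF _ assms]) (intro borel_measurable_continuous_onI continuous_intros)

text \<open>The function \<open>\<rho> \<phi>\<close> is merely measurable in space, but Lipschitz in time with compact support in time.\<close>

lemma time_independent_transport:
  fixes \<rho> :: "real^'n \<Rightarrow> real" and \<Omega> :: "(real^'n) set"
  assumes \<Omega>: "open \<Omega>" "bounded \<Omega>" and \<rho>: "\<rho> \<in> borel_measurable borel" "\<And>x. \<bar>\<rho> x\<bar> \<le> R"
    and \<phi>: "\<phi> \<in> continuity_tests T \<Omega>"
  shows "(\<integral>y. indicator ({0<..<T} \<times> \<Omega>) y * (\<rho> (snd y) * dt \<phi> y) \<partial>lborel) = 0"
proof -
  let ?Q = "{0<..<T} \<times> \<Omega>" and ?dir_D = "{0<..<T} \<times> closure \<Omega>" and ?u = "(1, 0) :: real \<times> (real^'n)"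
  have Q: "open ?Q" "?Q \<subseteq> ?dir_D" "bounded ?Q" using \<Omega> closure_subset by (auto intro: open_Times bounded_Times)
  obtain \<phi>' K B where c: "continuous_on ?dir_D \<phi>" "continuous_on ?dir_D \<phi>'"
    and d: "\<And>z. z \<in> ?Q \<Longrightarrow> (\<phi> has_derivative blinfun_apply (\<phi>' z)) (at z)"
    and K: "compact K" "K \<subseteq> ?dir_D" and z: "\<And>z. z \<in> ?dir_D \<Longrightarrow> z \<notin> K \<Longrightarrow> \<phi> z = 0"
    and B: "0 \<le> B" "\<And>z. z \<in> ?Q \<Longrightarrow> norm (\<phi>' z) \<le> B" "\<And>z. z \<in> ?Q \<Longrightarrow> norm (\<phi> z) \<le> B"
    using C1c_obtain[OF \<phi>[unfolded continuity_tests_def] Q(1,2)] by blast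
  have "compact (fst ` K)" "fst ` K \<subseteq> {0<..<T}" using K by (auto intro!: compact_continuous_image continuous_intros)
  then obtain \<epsilon> where \<epsilon>: "\<epsilon> > 0" "(\<Union>t\<in>fst ` K. ball t \<epsilon>) \<subseteq> {0<..<T}"
    using compact_subset_open_imp_ball_epsilon_subset[of "fst ` K" "{0<..<T}"] by auto
  define \<delta> where "\<delta> = \<epsilon> / 2"
  have \<delta>: "\<delta> > 0" using \<epsilon> by (simp add: \<delta>_def)
  have tK: "\<delta> < fst y" "fst y < T - \<delta>" if "y \<in> K" for y
  proof -
    have s: "ball (fst y) \<epsilon> \<subseteq> {0<..<T}" using \<epsilon>(2) that by blast
    have "fst y - \<delta> \<in> ball (fst y) \<epsilon>" "fst y + \<delta> \<in> ball (fst y) \<epsilon>" using \<epsilon>(1) by (auto simp: \<delta>_def dist_norm)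
    then have "fst y - \<delta> \<in> {0<..<T}" "fst y + \<delta> \<in> {0<..<T}" using s by blast+
    then show "\<delta> < fst y" "fst y < T - \<delta>" by auto
  qed
  define f where "f y = indicator ?Q y * (\<rho> (snd y) * \<phi> y)" for y
  define g where "g y = indicator ?Q y * (\<rho> (snd y) * \<phi>' y ?u)" for y
  have f0: "f y = 0" if "fst y \<le> \<delta> \<or> fst y \<ge> T - \<delta> \<or> snd y \<notin> \<Omega>" for y
  proof (cases "y \<in> ?Q")
    case True
    then have "y \<notin> K" using that tK[of y] by auto
    then show ?thesis using z[of y] True Q(2) by (auto simp: f_def)
  qed (simp add: f_def)
  have sub: "continuous_on ?Q \<phi>" "continuous_on ?Q \<phi>'" using c Q(2) continuous_on_subset by blast+
  have \<rho>m: "(\<lambda>y::real \<times> (real^'n). \<rho> (snd y)) \<in> borel_measurable borel" by (rule borel_measurable_snd_compose[OF \<rho>(1)])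
  have fe: "f = (\<lambda>y. \<rho> (snd y) * (indicator ?Q y *\<^sub>R \<phi> y))" by (rule ext) (simp add: f_def)
  have ge: "g = (\<lambda>y. \<rho> (snd y) * (indicator ?Q y *\<^sub>R \<phi>' y ?u))" by (rule ext) (simp add: g_def)
  have fm: "f \<in> borel_measurable borel" unfolding fe
    by (intro borel_measurable_times \<rho>m indicator_continuous_borel Q sub)
  have gm: "g \<in> borel_measurable borel" unfolding ge
    by (intro borel_measurable_times \<rho>m indicator_continuous_borel Q sub continuous_intros)
  have R0: "R \<ge> 0" using \<rho>(2)[of 0] by linarith
  have fi: "integrable lborel f"
  proof -
    have e: "f = (\<lambda>y. indicator ?Q y *\<^sub>R f y)" by (rule ext) (simp add: f_def indicator_def)
    have "norm (f y) \<le> R * B" if "y \<in> ?Q" for y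
      using mult_mono[OF \<rho>(2)[of "snd y"] B(3)[OF that] R0] that by (simp add: f_def abs_mult)
    then show ?thesis
      by (subst e, intro bounded_integrable_lborel[where B = "R * B"] Q) (use fm e in auto)
  qed
  have lip: "\<bar>f (y + h *\<^sub>R ?u) - f y\<bar> \<le> (R * B) * h" if h: "0 < h" "h < \<delta>" for y h
  proof -
    obtain t x where y: "y = (t, x)" by (cases y)
    have yh: "y + h *\<^sub>R ?u = (t + h, x)" by (simp add: y)
    show ?thesis
    proof (cases "x \<in> \<Omega> \<and> 0 < t \<and> t + h < T")
      case True
      have in': "(s, x) \<in> ?Q" if "t \<le> s" "s \<le> t + h" for s using True that by auto
      have dir_D: "((\<lambda>s. \<phi> (s, x)) has_real_derivative \<phi>' (s, x) ?u) (at s)" if s: "t \<le> s" "s \<le> t + h" for s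
      proof -
        have "((\<lambda>s. (s, x)) has_derivative (\<lambda>k. (k, 0))) (at s)" by (auto intro!: derivative_eq_intros)
        from has_derivative_compose[OF this d[OF in'[OF s]]]
        have "((\<lambda>s. \<phi> (s, x)) has_derivative (\<lambda>k. \<phi>' (s, x) (k, 0))) (at s)" .
        moreover have "\<phi>' (s, x) (k, 0) = \<phi>' (s, x) ?u * k" for k
          using blinfun.scaleR_right[of "\<phi>' (s, x)" k ?u] by simp
        then have "(\<lambda>k. \<phi>' (s, x) (k, 0)) = (*) (\<phi>' (s, x) ?u)" by (intro ext)
        ultimately show ?thesis unfolding has_field_derivative_def by (simp only:)
      qed
      obtain s where s: "t < s" "s < t + h" "\<phi> (t + h, x) - \<phi> (t, x) = (t + h - t) * \<phi>' (s, x) ?u"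
      proof -
        have "t < t + h" using h by simp
        from MVT2[OF this, of "\<lambda>s. \<phi> (s, x)" "\<lambda>s. \<phi>' (s, x) ?u"] dir_D
        have "\<exists>s. t < s \<and> s < t + h \<and> \<phi> (t + h, x) - \<phi> (t, x) = (t + h - t) * \<phi>' (s, x) ?u" by blast
        then show thesis using that by blast
      qed
      have "\<bar>\<phi>' (s, x) ?u\<bar> \<le> B" using norm_blinfun[of "\<phi>' (s, x)" ?u] B(2)[OF in', of s] s by (simp add: norm_Pair)
      then have *: "\<bar>\<rho> x\<bar> * \<bar>\<phi>' (s, x) ?u\<bar> \<le> R * B" by (intro mult_mono \<rho>(2) R0) auto
      have "f (y + h *\<^sub>R ?u) - f y = \<rho> x * (\<phi> (t + h, x) - \<phi> (t, x))"
        unfolding yh y f_def using in'[of t] in'[of "t + h"] h by (simp add: right_diff_distrib)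
      then have "\<bar>f (y + h *\<^sub>R ?u) - f y\<bar> = (\<bar>\<rho> x\<bar> * \<bar>\<phi>' (s, x) ?u\<bar>) * h" using s(3) h by (simp add: abs_mult)
      also have "\<dots> \<le> (R * B) * h" using * h by (intro mult_right_mono) auto
      finally show ?thesis .
    next
      case False
      then have "f (y + h *\<^sub>R ?u) = 0 \<and> f y = 0"
        unfolding yh y using h by (intro conjI f0) auto
      then show ?thesis using R0 B(1) h by simp
    qed
  qed
  have lim: "((\<lambda>h. (f (y + h *\<^sub>R ?u) - f y) / h) \<longlongrightarrow> g y) (at_right 0)" for y
  proof -
    obtain t x where y: "y = (t, x)" by (cases y)
    have yh: "y + h *\<^sub>R ?u = (t + h, x)" for h by (simp add: y)
    show ?thesis
    proof (cases "y \<in> ?Q")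
      case True
      have l: "((\<lambda>h. \<rho> x * ((\<phi> (y + h *\<^sub>R ?u) - \<phi> y) / h)) \<longlongrightarrow> \<rho> x * \<phi>' y ?u) (at_right 0)"
        by (intro tendsto_intros has_derivative_imp_right_quotient d True)
      have "\<forall>\<^sub>F h in at_right 0. h < T - t" using True y by (auto simp: eventually_at_right_field intro!: exI[of _ "T - t"])
      moreover have "\<forall>\<^sub>F h in at_right (0::real). 0 < h" by (rule eventually_at_right_less)
      ultimately have "\<forall>\<^sub>F h in at_right 0. \<rho> x * ((\<phi> (y + h *\<^sub>R ?u) - \<phi> y) / h) = (f (y + h *\<^sub>R ?u) - f y) / h"
      proof eventually_elim
        case (elim h)
        then have "(t + h, x) \<in> ?Q" using True y by auto
        then show ?case unfolding yh f_def using True y by (simp add: right_diff_distrib)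
      qed
      from Lim_transform_eventually[OF l this] show ?thesis using True y by (simp add: g_def)
    next
      case False
      have "\<forall>\<^sub>F h in at_right 0. h < \<delta>" using \<delta> by (auto simp: eventually_at_right_field)
      moreover have "\<forall>\<^sub>F h in at_right (0::real). 0 < h" by (rule eventually_at_right_less)
      ultimately have "\<forall>\<^sub>F h in at_right 0. (f (y + h *\<^sub>R ?u) - f y) / h = 0"
      proof eventually_elim
        case (elim h)
        have "f (y + h *\<^sub>R ?u) = 0 \<and> f y = 0"
          unfolding yh y using elim False y \<delta> by (intro conjI f0) auto
        then show ?case by simp
      qed
      then show ?thesis using False by (simp add: g_def tendsto_eventually)
    qed
  qed
  have bd: "f y = 0" if "y \<notin> ?Q" for y using that by (simp add: f_def)
  have "(\<integral>y. g y \<partial>lborel) = 0"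
    by (rule integral_directional_derivative_eq_0(2)[OF fm fi gm Q(3) bd \<delta> lip AE_I2]) (assumption | rule lim)+
  moreover have "g y = indicator ?Q y * (\<rho> (snd y) * dt \<phi> y)" for y
    by (cases "y \<in> ?Q") (simp_all add: g_def dt_eq[OF d])
  ultimately show ?thesis by simp
qed

lemma momentum_test_C1c:
  assumes "\<phi> \<in> momentum_tests T \<Omega>"
  obtains V where "\<phi> \<in> C1c ({0<..<T} \<times> \<Omega>) V" "{0<..<T} \<times> \<Omega> \<subseteq> V"
proof (cases "\<phi> \<in> C1c ({0<..<T} \<times> \<Omega>) ({0<..<T} \<times> \<Omega>)")
  case True then show ?thesis using that by blast
next
  case False
  then have "\<phi> \<in> C1c ({0<..<T} \<times> \<Omega>) ({0<..<T} \<times> closure \<Omega>)" using assms by (auto simp: momentum_tests_def)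
  moreover have "{0<..<T} \<times> \<Omega> \<subseteq> {0<..<T} \<times> closure \<Omega>" using closure_subset by auto
  ultimately show ?thesis using that by blast
qed

text \<open>In the Lipschitz case the Gauss theorem applies on every time slice.\<close>

lemma integral_div_x_eq_0:
  fixes \<Omega> :: "(real^'n) set"
  assumes \<Omega>: "open \<Omega>" "bounded \<Omega>" and \<phi>: "\<phi> \<in> momentum_tests T \<Omega>"
  shows "(\<integral>y. indicator ({0<..<T} \<times> \<Omega>) y * div_x \<phi> y \<partial>lborel) = 0"
proof -
  let ?Q = "{0<..<T} \<times> \<Omega>" and ?dir_D = "{0<..<T} \<times> closure \<Omega>"
  have Q: "open ?Q" "bounded ?Q" "?Q \<subseteq> ?dir_D" using \<Omega> closure_subset by (auto intro: open_Times bounded_Times)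
  have dive: "div_x \<phi> y = (\<Sum>j\<in>UNIV. W (0, axis j 1) $ j)" if "(\<phi> has_derivative W) (at y)" for W y
    unfolding div_x_def dx_eq[OF that] ..
  show ?thesis
  proof (cases "\<phi> \<in> C1c ?Q ?Q")
    case True
    obtain \<phi>' K B where c: "continuous_on ?Q \<phi>" "continuous_on ?Q \<phi>'"
      and d: "\<And>z. z \<in> ?Q \<Longrightarrow> (\<phi> has_derivative blinfun_apply (\<phi>' z)) (at z)"
      and K: "compact K" "K \<subseteq> ?Q" and z: "\<And>z. z \<in> ?Q \<Longrightarrow> z \<notin> K \<Longrightarrow> \<phi> z = 0"
      using C1c_obtain[OF True Q(1) subset_refl] by metis
    have dj: "((\<lambda>y. \<phi> y $ j) has_derivative (\<lambda>v. \<phi>' y v $ j)) (at y)" if "y \<in> ?Q" for j y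
      by (rule bounded_linear.has_derivative[OF bounded_linear_vec_nth d[OF that]])
    have cj: "continuous_on ?Q (\<lambda>y. \<phi>' y u $ j)" for u j by (intro continuous_intros c)
    have zj: "\<phi> y $ j = 0" if "y \<in> ?Q" "y \<notin> K" for y j using z[OF that] by simp
    note * = integral_derivative_interior[OF Q(1) dj cj K zj]
    have e: "indicator ?Q y * div_x \<phi> y = (\<Sum>j\<in>UNIV. indicator ?Q y * (\<phi>' y (0, axis j 1) $ j))" for y
      by (cases "y \<in> ?Q") (simp_all add: dive[OF d] sum_distrib_left)
    have "(\<integral>y. (\<Sum>j\<in>UNIV. indicator ?Q y * (\<phi>' y (0, axis j 1) $ j)) \<partial>lborel) = (\<Sum>j\<in>UNIV. \<integral>y. indicator ?Q y * (\<phi>' y (0, axis j 1) $ j) \<partial>lborel)"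
      by (rule Bochner_Integration.integral_sum) (rule *(1))
    also have "\<dots> = 0" by (rule sum.neutral, rule ballI) (rule *(2))
    finally show ?thesis unfolding e .
  next
    case False
    then have \<phi>: "\<phi> \<in> C1c ?Q ?dir_D" "lipschitz_boundary \<Omega>" "zero_normal_trace T \<Omega> \<phi>"
      using \<phi> by (auto simp: momentum_tests_def)
    obtain \<phi>' K B where c: "continuous_on ?dir_D \<phi>" "continuous_on ?dir_D \<phi>'"
      and d: "\<And>z. z \<in> ?Q \<Longrightarrow> (\<phi> has_derivative blinfun_apply (\<phi>' z)) (at z)"
      and B: "0 \<le> B" "\<And>z. z \<in> ?Q \<Longrightarrow> norm (\<phi>' z) \<le> B"
      using C1c_obtain[OF \<phi>(1) Q(1,3)] by metis
    define F where "F y = (\<Sum>j\<in>UNIV. \<phi>' y (0, axis j 1) $ j)" for y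
    have cF: "continuous_on ?Q F" unfolding F_def[abs_def]
      by (intro continuous_intros continuous_on_subset[OF c(2) Q(3)])
    have Fb: "norm (F y) \<le> (\<Sum>j\<in>(UNIV::'n set). B)" if "y \<in> ?Q" for y
      unfolding F_def
    proof (rule sum_norm_le)
      fix j
      have "norm (\<phi>' y (0, axis j 1) $ j) \<le> norm (\<phi>' y (0, axis j 1))" by (simp add: component_le_norm_cart)
      also have "\<dots> \<le> B" using norm_blinfun_axis[of "\<phi>' y" j] B(2)[OF that] by linarith
      finally show "norm (\<phi>' y (0, axis j 1) $ j) \<le> B" .
    qed
    have iF: "integrable lborel (\<lambda>y. indicator ?Q y *\<^sub>R F y)"
      by (rule bounded_integrable_lborel[OF Q(1,2) indicator_continuous_borel[OF Q(1) cF]]) (use Fb in auto)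
    have slice: "(\<integral>x. indicator ?Q (t, x) *\<^sub>R F (t, x) \<partial>lborel) = 0" for t
    proof (cases "t \<in> {0<..<T}")
      case t: True
      define E where "E = Blinfun (\<lambda>x::real^'n. (0::real, x))"
      have E: "blinfun_apply E = (\<lambda>x. (0, x))" unfolding E_def
        by (intro bounded_linear_Blinfun_apply bounded_linear_Pair bounded_linear_zero bounded_linear_ident)
      have p: "continuous_on (closure \<Omega>) (\<lambda>x. (t, x))" by (intro continuous_intros)
      have sub: "(\<lambda>x. (t, x)) ` closure \<Omega> \<subseteq> ?dir_D" using t by auto
      have "tangential \<Omega> (\<lambda>x. \<phi> (t, x)) (\<lambda>x. \<phi>' (t, x) o\<^sub>L E)"
        unfolding tangential_def
      proof (intro conjI ballI)
        show "continuous_on (closure \<Omega>) (\<lambda>x. \<phi> (t, x))" using continuous_on_compose2[OF c(1) p sub] .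
        have "continuous_on (closure \<Omega>) (\<lambda>x. \<phi>' (t, x))" using continuous_on_compose2[OF c(2) p sub] .
        then show "continuous_on (closure \<Omega>) (\<lambda>x. \<phi>' (t, x) o\<^sub>L E)"
          by (intro bounded_bilinear.continuous_on[OF bounded_bilinear_blinfun_compose] continuous_intros)
        show "hausdorff_null (CARD('n) - 1) {x \<in> frontier \<Omega>. \<not> (\<exists>n. outer_normal \<Omega> x n \<and> \<phi> (t, x) \<bullet> n = 0)}"
          using \<phi>(3) t by (simp add: zero_normal_trace_def)
        fix x assume "x \<in> \<Omega>"
        then have tx: "(t, x) \<in> ?Q" using t by simp
        have "((\<lambda>x. (t, x)) has_derivative (\<lambda>v. (0, v))) (at x)" by (auto intro!: derivative_eq_intros)
        from has_derivative_compose[OF this d[OF tx]]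
        have "((\<lambda>x. \<phi> (t, x)) has_derivative (\<lambda>v. \<phi>' (t, x) (0, v))) (at x)" .
        moreover have "blinfun_apply (\<phi>' (t, x) o\<^sub>L E) = (\<lambda>v. \<phi>' (t, x) (0, v))" by (rule ext) (simp add: E)
        ultimately show "((\<lambda>x. \<phi> (t, x)) has_derivative blinfun_apply (\<phi>' (t, x) o\<^sub>L E)) (at x)" by (simp only:)
      qed
      from gauss_lipschitz[OF \<Omega> \<phi>(2) this]
      have "(\<integral>x. indicator \<Omega> x * F (t, x) \<partial>lborel) = 0" by (simp add: divergence_def F_def E)
      moreover have "indicator ?Q (t, x) *\<^sub>R F (t, x) = indicator \<Omega> x * F (t, x)" for x using t by (simp add: indicator_def)
      ultimately show ?thesis by (simp only:)
    next
      case False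
      then have "indicat_real ?Q (t, x) = 0" for x by (auto simp: indicator_def)
      then show ?thesis by (simp only: scaleR_zero_left Bochner_Integration.integral_zero)
    qed
    have "(\<integral>t. (\<integral>x. indicator ?Q (t, x) *\<^sub>R F (t, x) \<partial>lborel) \<partial>lborel) = (\<integral>y. indicator ?Q y *\<^sub>R F y \<partial>(lborel \<Otimes>\<^sub>M lborel))"
      by (rule lborel_pair.integral_fst'[where f = "\<lambda>y. indicator ?Q y *\<^sub>R F y"]) (use iF in \<open>simp only: lborel_prod\<close>)
    then have "(\<integral>y. indicator ?Q y *\<^sub>R F y \<partial>lborel) = 0" unfolding slice lborel_prod by simp
    moreover have "indicator ?Q y *\<^sub>R F y = indicator ?Q y * div_x \<phi> y" for y
      by (cases "y \<in> ?Q") (simp_all add: dive[OF d] F_def)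
    ultimately show ?thesis by (simp only:)
  qed
qed


lemma lebesgue_on_bounded_integral:
  fixes F H :: "'a::euclidean_space \<Rightarrow> real"
  assumes Q: "open Q" "bounded Q" and FH: "\<And>y. y \<in> Q \<Longrightarrow> F y = H y"
    and H: "(\<lambda>y. indicator Q y * H y) \<in> borel_measurable borel" and B: "AE y in lborel. y \<in> Q \<longrightarrow> \<bar>H y\<bar> \<le> B"
  shows "integrable (lebesgue_on Q) F" "integrable lborel (\<lambda>y. indicator Q y * H y)"
    "(\<integral>y. F y \<partial>lebesgue_on Q) = (\<integral>y. indicator Q y * H y \<partial>lborel)"
proof -
  have e: "indicator Q y *\<^sub>R F y = indicator Q y * H y" for y using FH[of y] by (simp add: indicator_def)
  have e': "indicator Q y *\<^sub>R H y = indicator Q y * H y" for y by simp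
  have m: "(\<lambda>y. indicator Q y *\<^sub>R F y) \<in> borel_measurable borel" unfolding e by (rule H)
  have Q': "Q \<in> sets borel" using Q by simp
  show i: "integrable lborel (\<lambda>y. indicator Q y * H y)"
    using bounded_integrable_lborel[OF Q, of H B] H B unfolding e' real_norm_def by blast
  show "integrable (lebesgue_on Q) F" using lebesgue_on_integral(2)[OF Q' m] i unfolding e by blast
  show "(\<integral>y. F y \<partial>lebesgue_on Q) = (\<integral>y. indicator Q y * H y \<partial>lborel)"
    using lebesgue_on_integral(1)[OF Q' m] unfolding e .
qed

text \<open>The density is constant in a neighbourhood of each point off the grid, so \<open>\<rho> \<phi>\<close> is an admitted test function
  for \<open>v\<close>. The bound for \<open>m\<close> follows from \<open>\<bar>m\<bar>\<^sup>2 = \<rho>\<^sup>2 \<bar>v\<bar>\<^sup>2 \<le> (N + 1) \<rho>\<^sup>2 c \<le> (N + 1) \<rho> P\<close>; it does not involve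
  the lower bound of \<open>\<rho>\<close>, which will degenerate along the sequence. The last clause tests \<open>div v = 0\<close> with
  \<open>\<rho> q\<close> times a linear function.\<close>

lemma euler_solution_with_step_density:
  fixes \<rho> :: "real^'n \<Rightarrow> real" and \<Omega> :: "(real^'n) set" and R :: real
  assumes N: "CARD('n) \<ge> 2" and a: "a > 0" "\<gamma> > 0" and \<Omega>: "open \<Omega>" "bounded \<Omega>"
    and \<rho>: "\<rho> \<in> borel_measurable borel" and r0: "r0 > 0" "\<And>x. r0 \<le> \<rho> x" "\<And>x. \<rho> x \<le> R"
    and step: "\<And>y :: real \<times> (real^'n). y \<notin> grid k \<Longrightarrow> \<forall>\<^sub>F z in nhds y. \<rho> (snd z) = \<rho> (snd y)"
  shows "\<exists>m. m \<in> borel_measurable borel \<and> euler_weak_solution a \<gamma> T \<Omega> (\<lambda>(t, x). \<rho> x) m \<and>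
    (AE y in lborel. y \<in> {0<..<T} \<times> \<Omega> \<longrightarrow> (norm (m y))\<^sup>2 \<le> (real CARD('n) + 1) * R * pressure a \<gamma> (2 * R)) \<and>
    (\<forall>q c. (\<forall>y. y \<notin> grid k \<longrightarrow> (\<forall>\<^sub>F z in nhds y. q z = q y)) \<and> (\<forall>y. \<bar>q y\<bar> \<le> 1) \<and> q \<in> borel_measurable borel \<longrightarrow>
       (\<integral>y. indicator ({0<..<T} \<times> \<Omega>) y * (q y * (m y \<bullet> c)) \<partial>lborel) = 0)"
proof -
  let ?Q = "{0<..<T} \<times> \<Omega>"
  \<comment> \<open>Any constant above the pressure makes \<open>c\<close> positive; \<open>2 R\<close> gives a strict inequality.\<close>
  define P where "P = pressure a \<gamma> (2 * R)"
  define p where "p y = pressure a \<gamma> (\<rho> (snd y))" for y :: "real \<times> (real^'n)"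
  define c where "c y = (P - p y) / \<rho> (snd y)" for y :: "real \<times> (real^'n)"
  define G where "G = ?Q - grid k"
  have Q: "open ?Q" "bounded ?Q" using \<Omega> by (auto intro: open_Times bounded_Times)
  have G: "open G" "bounded G" "G \<subseteq> ?Q"
    using Q closed_grid[of k] unfolding G_def by (auto intro: open_Diff bounded_subset)
  have \<rho>0: "\<rho> x > 0" for x using r0(1) r0(2)[of x] by linarith
  have R0: "R > 0" using \<rho>0[of 0] r0(3)[of 0] by linarith
  have pP: "0 < p y" "p y < P" for y
  proof -
    have "\<rho> (snd y) powr \<gamma> < (2 * R) powr \<gamma>"
      using \<rho>0[of "snd y"] r0(3)[of "snd y"] R0 by (intro powr_less_mono2 a(2)) linarith+
    then show "p y < P" unfolding p_def P_def pressure_def using a(1) by (rule mult_strict_left_mono)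
    show "0 < p y" unfolding p_def pressure_def using a(1) \<rho>0[of "snd y"] by simp
  qed
  have P0: "P > 0" using pP[of 0] by linarith
  have cpos: "0 < c y" for y unfolding c_def using pP(2)[of y] \<rho>0[of "snd y"] by simp
  have c\<rho>: "\<rho> (snd y) * c y = P - p y" for y unfolding c_def using \<rho>0[of "snd y"] by simp
  have cle: "c y \<le> P / r0" for y
    unfolding c_def using pP[of y] r0 P0 by (intro frac_le) (auto simp: less_imp_le)
  have nG: "y \<notin> grid k" if "y \<in> G" for y using that by (simp add: G_def)
  have cont: "continuous_on G c" "continuous_on G (\<lambda>y. \<rho> (snd y))"
  proof -
    have "isCont c y" "isCont (\<lambda>y. \<rho> (snd y)) y" if "y \<in> G" for y
    proof -
      show "isCont c y" by (rule isCont_locally_constant, use step[OF nG[OF that]] in eventually_elim) (simp add: c_def p_def)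
      show "isCont (\<lambda>y. \<rho> (snd y)) y" by (rule isCont_locally_constant[OF step[OF nG[OF that]]])
    qed
    then show "continuous_on G c" "continuous_on G (\<lambda>y. \<rho> (snd y))" by (auto intro: continuous_at_imp_continuous_on)
  qed
  note convex_integration[OF N G(1,2) cont(1) cpos cle]
  then obtain v where v: "v \<in> borel_measurable borel" "\<And>y. y \<notin> G \<Longrightarrow> v y = 0"
    and vb: "AE y in lborel. y \<in> G \<longrightarrow> (norm (v y))\<^sup>2 \<le> (real CARD('n) + 1) * c y"
    and v1: "\<And>\<theta> T B. (\<forall>y\<in>G. (\<theta> has_derivative blinfun_apply (T y)) (at y)) \<and> continuous_on G T \<and> (\<forall>y\<in>G. norm (T y) \<le> B) \<Longrightarrow>
       (\<integral>y. indicator G y * blinfun_apply (T y :: (real \<times> (real^'n)) \<Rightarrow>\<^sub>L real) (0, v y) \<partial>lborel) = 0"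
    and v2: "\<And>\<theta> T B. (\<forall>y\<in>G. (\<theta> has_derivative blinfun_apply (T y)) (at y)) \<and> continuous_on G T \<and> (\<forall>y\<in>G. norm (T y) \<le> B) \<Longrightarrow>
       (\<integral>y. indicator G y * (v y \<bullet> blinfun_apply (T y :: (real \<times> (real^'n)) \<Rightarrow>\<^sub>L (real^'n)) (1, v y)
          - c y * (\<Sum>j\<in>UNIV. blinfun_apply (T y) (0, axis j 1) $ j)) \<partial>lborel) = 0"
    by (elim exE conjE) (rule that, assumption, blast+)
  define m where "m y = \<rho> (snd y) *\<^sub>R v y" for y
  have \<rho>m: "(\<lambda>y::real \<times> (real^'n). \<rho> (snd y)) \<in> borel_measurable borel" by (rule borel_measurable_snd_compose[OF \<rho>])
  have mm: "m \<in> borel_measurable borel" unfolding m_def[abs_def] by (intro borel_measurable_scaleR \<rho>m v)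
  have pm: "p \<in> borel_measurable borel" unfolding p_def[abs_def] pressure_def using \<rho>m by simp
  have aeG: "AE y in lborel. indicat_real G y = indicat_real ?Q y"
    using AE_not_grid[of k] by eventually_elim (simp add: G_def indicator_def)
  have GQ: "(\<integral>y. indicator ?Q y * H y \<partial>lborel) = (\<integral>y. indicator G y * H y \<partial>lborel)"
    if H: "(\<lambda>y. indicator ?Q y * H y) \<in> borel_measurable borel" for H :: "_ \<Rightarrow> real"
  proof (rule integral_cong_AE)
    have e: "(\<lambda>y. indicator G y * H y) = (\<lambda>y. indicator G y * (indicator ?Q y * H y))"
      using G(3) by (intro ext) (auto simp: indicator_def)
    have Gb: "G \<in> sets borel" using G(1) by simp
    have "(\<lambda>y. indicator G y * H y) \<in> borel_measurable borel"
      unfolding e by (intro borel_measurable_times borel_measurable_indicator Gb H)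
    then show "(\<lambda>y. indicator G y * H y) \<in> borel_measurable lborel" by simp
    show "AE y in lborel. indicat_real ?Q y * H y = indicat_real G y * H y" using aeG by eventually_elim simp
  qed (use H in simp)
  have mb: "AE y in lborel. y \<in> ?Q \<longrightarrow> (norm (m y))\<^sup>2 \<le> (real CARD('n) + 1) * R * P"
    using vb AE_not_grid[of k]
  proof eventually_elim
    case (elim y)
    show ?case
    proof
      assume "y \<in> ?Q"
      then have "y \<in> G" using elim by (simp add: G_def)
      then have "(norm (v y))\<^sup>2 \<le> (real CARD('n) + 1) * c y" using elim by simp
      then have "(\<rho> (snd y))\<^sup>2 * (norm (v y))\<^sup>2 \<le> (\<rho> (snd y))\<^sup>2 * ((real CARD('n) + 1) * c y)" by (intro mult_left_mono) auto
      moreover have "(norm (m y))\<^sup>2 = (\<rho> (snd y))\<^sup>2 * (norm (v y))\<^sup>2" by (simp add: m_def power_mult_distrib)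
      moreover have "(\<rho> (snd y))\<^sup>2 * ((real CARD('n) + 1) * c y) = (real CARD('n) + 1) * (\<rho> (snd y) * (\<rho> (snd y) * c y))"
        by (simp add: power2_eq_square mult_ac)
      moreover have "(real CARD('n) + 1) * (\<rho> (snd y) * (\<rho> (snd y) * c y)) \<le> (real CARD('n) + 1) * (R * P)"
        unfolding c\<rho> using pP[of y] r0(3) \<rho>0[of "snd y"] R0
        by (intro mult_left_mono mult_mono) (auto simp: less_imp_le)
      moreover have "(real CARD('n) + 1) * R * P = (real CARD('n) + 1) * (R * P)" by (rule mult.assoc)
      ultimately show "(norm (m y))\<^sup>2 \<le> (real CARD('n) + 1) * R * P" by linarith
    qed
  qed
  define M where "M = sqrt ((real CARD('n) + 1) * R * P)"
  have M0: "M \<ge> 0" using R0 P0 by (simp add: M_def)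
  have mM: "AE y in lborel. y \<in> ?Q \<longrightarrow> norm (m y) \<le> M"
    using mb by eventually_elim (auto simp: M_def intro: real_le_rsqrt)
  have v_m: "v y = (1 / \<rho> (snd y)) *\<^sub>R m y" for y using \<rho>0[of "snd y"] by (simp add: m_def)
  have vM: "AE y in lborel. y \<in> ?Q \<longrightarrow> norm (v y) \<le> M / r0"
    using mM
  proof eventually_elim
    case (elim y)
    show ?case
    proof
      assume "y \<in> ?Q"
      then have "norm (m y) \<le> M" using elim by simp
      moreover have "norm (v y) = norm (m y) / \<rho> (snd y)" unfolding v_m using \<rho>0[of "snd y"] by simp
      ultimately show "norm (v y) \<le> M / r0" using r0 M0 by (simp add: frac_le)
    qed
  qed
  have weak: "(\<integral>y. indicator ?Q y * (q y * (m y \<bullet> d)) \<partial>lborel) = 0"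
    if q: "\<forall>y. y \<notin> grid k \<longrightarrow> (\<forall>\<^sub>F z in nhds y. q z = q y)" "\<forall>y. \<bar>q y\<bar> \<le> 1" "q \<in> borel_measurable borel" for q and d :: "real^'n"
  proof -
    let ?s = "\<lambda>y::real \<times> (real^'n). \<rho> (snd y) * q y"
    have s: "\<forall>\<^sub>F z in nhds y. ?s z = ?s y" if "y \<in> G" for y
      using step[OF nG[OF that]] q(1)[rule_format, OF nG[OF that]] by eventually_elim simp
    have cs: "continuous_on G ?s" using isCont_locally_constant[OF s] by (auto intro: continuous_at_imp_continuous_on)
    define W where "W y = ?s y *\<^sub>R blinfun_inner_right (0 :: real, d)" for y
    have "(\<integral>y. indicator G y * W y (0, v y) \<partial>lborel) = 0"
    proof (rule v1[of "\<lambda>y. ?s y *\<^sub>R ((0, d) \<bullet> y)" W "R * norm (blinfun_inner_right (0 :: real, d))"], intro conjI ballI)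
      fix y assume y: "y \<in> G"
      have "((\<lambda>y. (0, d) \<bullet> y) has_derivative blinfun_apply (blinfun_inner_right (0 :: real, d))) (at y)"
        unfolding blinfun_inner_right.rep_eq by (auto intro!: derivative_eq_intros)
      from has_derivative_locally_constant_scaleR[OF s[OF y] this]
      have "((\<lambda>y. ?s y *\<^sub>R ((0, d) \<bullet> y)) has_derivative (\<lambda>u. ?s y *\<^sub>R blinfun_inner_right (0 :: real, d) u)) (at y)" .
      moreover have "blinfun_apply (W y) = (\<lambda>u. ?s y *\<^sub>R blinfun_inner_right (0 :: real, d) u)"
        unfolding W_def by (rule ext) (rule blinfun.scaleR_left)
      ultimately show "((\<lambda>y. ?s y *\<^sub>R ((0, d) \<bullet> y)) has_derivative blinfun_apply (W y)) (at y)" by (simp only:)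
      have "\<bar>?s y\<bar> \<le> R * 1" unfolding abs_mult using q(2)[rule_format, of y] r0(3)[of "snd y"] \<rho>0[of "snd y"] R0 by (intro mult_mono) auto
      then show "norm (W y) \<le> R * norm (blinfun_inner_right (0 :: real, d))"
        unfolding W_def norm_scaleR by (intro mult_right_mono) auto
    next
      show "continuous_on G W" unfolding W_def[abs_def] by (intro continuous_on_scaleR cs continuous_on_const)
    qed
    moreover have "indicator G y * W y (0, v y) = indicator G y * (q y * (m y \<bullet> d))" for y
      by (simp add: W_def blinfun.scaleR_left m_def inner_commute)
    ultimately have z: "(\<integral>y. indicator G y * (q y * (m y \<bullet> d)) \<partial>lborel) = 0" by (simp only:)
    have "(\<integral>y. indicator ?Q y * (q y * (m y \<bullet> d)) \<partial>lborel) = (\<integral>y. indicator G y * (q y * (m y \<bullet> d)) \<partial>lborel)"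
    proof (rule GQ)
      have "indicat_real ?Q \<in> borel_measurable borel" using Q(1) by (intro borel_measurable_indicator) simp
      then show "(\<lambda>y. indicator ?Q y * (q y * (m y \<bullet> d))) \<in> borel_measurable borel"
        by (intro borel_measurable_times borel_measurable_inner mm q(3) borel_measurable_const)
    qed
    then show ?thesis using z by simp
  qed
  have sol: "euler_weak_solution a \<gamma> T \<Omega> (\<lambda>(t, x). \<rho> x) m"
    unfolding euler_weak_solution_def Let_def
  proof (intro conjI ballI)
    have Qs: "?Q \<in> sets borel" using Q(1) by simp
    have e: "(\<lambda>(t, x). \<rho> x) = (\<lambda>y::real \<times> (real^'n). \<rho> (snd y))" by (rule ext) (simp add: case_prod_beta)
    show "(\<lambda>(t, x). \<rho> x) \<in> borel_measurable (lebesgue_on ?Q)" unfolding e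
      by (intro measurable_restrict_space1 measurable_completion) (use \<rho>m in simp)
    show "m \<in> borel_measurable (lebesgue_on ?Q)"
      by (intro measurable_restrict_space1 measurable_completion) (use mm in simp)
    show "AE z in lebesgue_on ?Q. 0 \<le> (case z of (t, x) \<Rightarrow> \<rho> x)" using \<rho>0 by (auto simp: less_imp_le)
    show "AE z in lebesgue_on ?Q. (case z of (t, x) \<Rightarrow> \<rho> x) = 0 \<longrightarrow> m z = 0" using \<rho>0 by (auto simp: less_le)
    have \<rho>R: "\<bar>\<rho> x\<bar> \<le> R" for x using \<rho>0[of x] r0(3)[of x] by simp
    {
      fix \<phi> assume \<phi>: "\<phi> \<in> continuity_tests T \<Omega>"
      have "?Q \<subseteq> {0<..<T} \<times> closure \<Omega>" using closure_subset by auto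
      then obtain \<phi>' K B where c\<phi>: "continuous_on ({0<..<T} \<times> closure \<Omega>) \<phi>'" and sub: "?Q \<subseteq> {0<..<T} \<times> closure \<Omega>"
        and d: "\<And>z. z \<in> ?Q \<Longrightarrow> (\<phi> has_derivative blinfun_apply (\<phi>' z)) (at z)"
        and B: "0 \<le> B" "\<And>z. z \<in> ?Q \<Longrightarrow> norm (\<phi>' z) \<le> B"
        using C1c_obtain[OF \<phi>[unfolded continuity_tests_def] Q(1)] by metis
      have cQ: "continuous_on ?Q \<phi>'" using c\<phi> sub continuous_on_subset by blast
      have meas: "(\<lambda>y. indicator ?Q y *\<^sub>R \<phi>' y u) \<in> borel_measurable borel" for u
        by (intro indicator_continuous_borel Q continuous_intros cQ)
      have H1: "(\<lambda>y. indicator ?Q y * (\<rho> (snd y) * \<phi>' y (1, 0))) \<in> borel_measurable borel"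
      proof -
        have e: "indicator ?Q y * (\<rho> (snd y) * \<phi>' y (1, 0)) = \<rho> (snd y) * (indicator ?Q y *\<^sub>R \<phi>' y (1, 0))" for y by simp
        show ?thesis unfolding e by (intro borel_measurable_times \<rho>m meas)
      qed
      have H2: "(\<lambda>y. indicator ?Q y * \<phi>' y (0, m y)) \<in> borel_measurable borel"
      proof -
        have e: "indicator ?Q y * \<phi>' y (0, m y) = (\<Sum>j\<in>UNIV. m y $ j * (indicator ?Q y *\<^sub>R \<phi>' y (0, axis j 1)))" for y
          by (simp add: blinfun_expand[of "\<phi>' y" "m y"] sum_distrib_left mult_ac)
        show ?thesis unfolding e by (intro borel_measurable_sum borel_measurable_times borel_measurable_component mm meas)
      qed
      have b1: "\<bar>\<rho> (snd y) * \<phi>' y (1, 0)\<bar> \<le> R * B" if "y \<in> ?Q" for y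
      proof -
        have "\<bar>\<phi>' y (1, 0)\<bar> \<le> B" using norm_blinfun[of "\<phi>' y" "(1, 0)"] B(2)[OF that] by (simp add: norm_Pair)
        then show ?thesis unfolding abs_mult using \<rho>R R0 by (intro mult_mono) auto
      qed
      have b2: "AE y in lborel. y \<in> ?Q \<longrightarrow> \<bar>\<phi>' y (0, m y)\<bar> \<le> B * M"
        using mM
      proof eventually_elim
        case (elim y)
        have "\<bar>\<phi>' y (0, m y)\<bar> \<le> norm (\<phi>' y) * norm (m y)" using norm_blinfun[of "\<phi>' y" "(0, m y)"] by (simp add: norm_Pair)
        then show ?case using mult_mono[OF B(2)[of y], of "norm (m y)" M] elim B(1) by fastforce
      qed
      have F1: "(case y of (t, x) \<Rightarrow> \<rho> x) * dt \<phi> y = \<rho> (snd y) * \<phi>' y (1, 0)" if "y \<in> ?Q" for y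
        by (simp add: dt_eq[OF d[OF that]] case_prod_beta)
      have F2: "m y \<bullet> grad_x \<phi> y = \<phi>' y (0, m y)" if "y \<in> ?Q" for y
        by (simp add: grad_x_def dx_eq[OF d[OF that]] inner_vec_def blinfun_expand[of "\<phi>' y" "m y"])
      have b1': "AE y in lborel. y \<in> ?Q \<longrightarrow> \<bar>\<rho> (snd y) * \<phi>' y (1, 0)\<bar> \<le> R * B" using b1 by auto
      note L1 = lebesgue_on_bounded_integral[OF Q F1 H1 b1']
      note L2 = lebesgue_on_bounded_integral[OF Q F2 H2 b2]
      show "integrable (lebesgue_on ?Q) (\<lambda>z. (case z of (t, x) \<Rightarrow> \<rho> x) * dt \<phi> z)" by (rule L1(1))
      show "integrable (lebesgue_on ?Q) (\<lambda>z. m z \<bullet> grad_x \<phi> z)" by (rule L2(1))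
      have z1: "(\<integral>y. indicator ?Q y * (\<rho> (snd y) * \<phi>' y (1, 0)) \<partial>lborel) = 0"
      proof -
        have "indicator ?Q y * (\<rho> (snd y) * \<phi>' y (1, 0)) = indicator ?Q y * (\<rho> (snd y) * dt \<phi> y)" for y
          by (cases "y \<in> ?Q") (simp_all add: dt_eq[OF d])
        then show ?thesis using time_independent_transport[OF \<Omega> \<rho> \<rho>R \<phi>] by (simp only:)
      qed
      have z2: "(\<integral>y. indicator G y * \<phi>' y (0, m y) \<partial>lborel) = 0"
      proof -
        let ?W = "\<lambda>y. \<rho> (snd y) *\<^sub>R \<phi>' y"
        have "(\<integral>y. indicator G y * ?W y (0, v y) \<partial>lborel) = 0"
        proof (rule v1[of "\<lambda>y. \<rho> (snd y) *\<^sub>R \<phi> y" ?W "R * B"], intro conjI ballI)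
          fix y assume y: "y \<in> G"
          then have yQ: "y \<in> ?Q" using G(3) by blast
          have "blinfun_apply (?W y) = (\<lambda>u. \<rho> (snd y) *\<^sub>R \<phi>' y u)" by (rule ext) (rule blinfun.scaleR_left)
          then show "((\<lambda>y. \<rho> (snd y) *\<^sub>R \<phi> y) has_derivative blinfun_apply (?W y)) (at y)"
            using has_derivative_locally_constant_scaleR[OF step[OF nG[OF y]] d[OF yQ]] by (simp only:)
          show "norm (?W y) \<le> R * B" unfolding norm_scaleR using \<rho>R B(2)[OF yQ] R0 by (intro mult_mono) auto
        next
          show "continuous_on G ?W" by (intro continuous_on_scaleR cont(2) continuous_on_subset[OF cQ G(3)])
        qed
        moreover have "?W y (0, v y) = \<phi>' y (0, m y)" for y
          using blinfun.scaleR_right[of "\<phi>' y" "\<rho> (snd y)" "(0, v y)"] by (simp add: m_def blinfun.scaleR_left)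
        ultimately show ?thesis by (simp only:)
      qed
      show "(\<integral>z. (case z of (t, x) \<Rightarrow> \<rho> x) * dt \<phi> z + m z \<bullet> grad_x \<phi> z \<partial>lebesgue_on ?Q) = 0"
        using Bochner_Integration.integral_add[OF L1(1) L2(1)] trans[OF L1(3) z1] trans[OF L2(3) trans[OF GQ[OF H2] z2]] by linarith
    }
    {
      fix \<phi> assume \<phi>: "\<phi> \<in> momentum_tests T \<Omega>"
      obtain V where V: "\<phi> \<in> C1c ?Q V" "?Q \<subseteq> V" using momentum_test_C1c[OF \<phi>] by blast
      obtain \<phi>' K B where c\<phi>: "continuous_on V \<phi>'"
        and d: "\<And>z. z \<in> ?Q \<Longrightarrow> (\<phi> has_derivative blinfun_apply (\<phi>' z)) (at z)"
        and B: "0 \<le> B" "\<And>z. z \<in> ?Q \<Longrightarrow> norm (\<phi>' z) \<le> B"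
        using C1c_obtain[OF V(1) Q(1) V(2)] by metis
      have cQ: "continuous_on ?Q \<phi>'" using c\<phi> V(2) continuous_on_subset by blast
      have meas: "(\<lambda>y. indicator ?Q y *\<^sub>R (\<phi>' y u $ i)) \<in> borel_measurable borel" for u i
        by (intro indicator_continuous_borel Q continuous_intros cQ)
      define H4 where "H4 y = v y \<bullet> \<phi>' y (0, m y)" for y
      define H5 where "H5 y = (\<Sum>j\<in>UNIV. \<phi>' y (0, axis j 1) $ j)" for y
      have H3m: "(\<lambda>y. indicator ?Q y * (m y \<bullet> \<phi>' y (1, 0))) \<in> borel_measurable borel"
      proof -
        have e: "indicator ?Q y * (m y \<bullet> \<phi>' y (1, 0)) = (\<Sum>i\<in>UNIV. m y $ i * (indicator ?Q y *\<^sub>R (\<phi>' y (1, 0) $ i)))" for y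
          by (simp add: inner_vec_def sum_distrib_left mult_ac)
        show ?thesis unfolding e by (intro borel_measurable_sum borel_measurable_times borel_measurable_component mm meas)
      qed
      have H4e: "H4 y = (\<Sum>i\<in>UNIV. \<Sum>j\<in>UNIV. v y $ i * (m y $ j * (\<phi>' y (0, axis j 1) $ i)))" for y
        by (simp add: H4_def inner_vec_def blinfun_expand[of "\<phi>' y" "m y"] sum_distrib_left)
      have H4m: "(\<lambda>y. indicator ?Q y * H4 y) \<in> borel_measurable borel"
      proof -
        have e: "indicator ?Q y * H4 y = (\<Sum>i\<in>UNIV. \<Sum>j\<in>UNIV. v y $ i * (m y $ j * (indicator ?Q y *\<^sub>R (\<phi>' y (0, axis j 1) $ i))))" for y
          by (simp add: H4e sum_distrib_left mult_ac)
        show ?thesis unfolding e by (intro borel_measurable_sum borel_measurable_times borel_measurable_component mm v meas)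
      qed
      have H5m: "(\<lambda>y. indicator ?Q y * H5 y) \<in> borel_measurable borel"
      proof -
        have e: "indicator ?Q y * H5 y = (\<Sum>j\<in>UNIV. indicator ?Q y *\<^sub>R (\<phi>' y (0, axis j 1) $ j))" for y
          by (simp add: H5_def sum_distrib_left)
        show ?thesis unfolding e by (intro borel_measurable_sum meas)
      qed
      have pH5m: "(\<lambda>y. indicator ?Q y * (p y * H5 y)) \<in> borel_measurable borel"
        using borel_measurable_times[OF pm H5m] by (simp add: mult.left_commute)
      have b3: "AE y in lborel. y \<in> ?Q \<longrightarrow> \<bar>m y \<bullet> \<phi>' y (1, 0)\<bar> \<le> M * B"
        using mM
      proof eventually_elim
        case (elim y)
        show ?case
        proof
          assume y: "y \<in> ?Q"
          have "\<bar>m y \<bullet> \<phi>' y (1, 0)\<bar> \<le> norm (m y) * norm (\<phi>' y (1, 0))" by (rule Cauchy_Schwarz_ineq2)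
          also have "\<dots> \<le> M * B"
            using elim y norm_blinfun[of "\<phi>' y" "(1, 0)"] B(2)[OF y] M0 by (intro mult_mono) (auto simp: norm_Pair)
          finally show "\<bar>m y \<bullet> \<phi>' y (1, 0)\<bar> \<le> M * B" .
        qed
      qed
      have b4: "AE y in lborel. y \<in> ?Q \<longrightarrow> \<bar>H4 y\<bar> \<le> (M / r0) * (B * M)"
        using mM vM
      proof eventually_elim
        case (elim y)
        show ?case
        proof
          assume y: "y \<in> ?Q"
          have "norm (\<phi>' y (0, m y)) \<le> norm (\<phi>' y) * norm (m y)" using norm_blinfun[of "\<phi>' y" "(0, m y)"] by (simp add: norm_Pair)
          also have "\<dots> \<le> B * M" using elim y B by (intro mult_mono) auto
          finally have n: "norm (\<phi>' y (0, m y)) \<le> B * M" .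
          have "\<bar>H4 y\<bar> \<le> norm (v y) * norm (\<phi>' y (0, m y))" unfolding H4_def by (rule Cauchy_Schwarz_ineq2)
          also have "\<dots> \<le> (M / r0) * (B * M)" using elim y n M0 r0(1) by (intro mult_mono) auto
          finally show "\<bar>H4 y\<bar> \<le> (M / r0) * (B * M)" .
        qed
      qed
      have H5b: "\<bar>H5 y\<bar> \<le> (\<Sum>j\<in>(UNIV::'n set). B)" if "y \<in> ?Q" for y
        unfolding H5_def real_norm_def[symmetric]
      proof (rule sum_norm_le)
        fix j
        have "norm (\<phi>' y (0, axis j 1) $ j) \<le> norm (\<phi>' y (0, axis j 1))" by (simp add: component_le_norm_cart)
        also have "\<dots> \<le> B" using norm_blinfun_axis[of "\<phi>' y" j] B(2)[OF that] by linarith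
        finally show "norm (\<phi>' y (0, axis j 1) $ j) \<le> B" .
      qed
      have b5: "AE y in lborel. y \<in> ?Q \<longrightarrow> \<bar>p y * H5 y\<bar> \<le> P * (\<Sum>j\<in>(UNIV::'n set). B)"
      proof (intro AE_I2 impI)
        fix y assume y: "y \<in> ?Q"
        show "\<bar>p y * H5 y\<bar> \<le> P * (\<Sum>j\<in>(UNIV::'n set). B)"
          unfolding abs_mult using pP[of y] H5b[OF y] P0 by (intro mult_mono) auto
      qed
      have b5': "AE y in lborel. y \<in> ?Q \<longrightarrow> \<bar>H5 y\<bar> \<le> (\<Sum>j\<in>(UNIV::'n set). B)" using H5b by auto
      have F3: "m y \<bullet> dt \<phi> y = m y \<bullet> \<phi>' y (1, 0)" if "y \<in> ?Q" for y
        by (simp add: dt_eq[OF d[OF that]])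
      have F4: "convective (case y of (t, x) \<Rightarrow> \<rho> x) (m y) \<bullet> jac_x \<phi> y = H4 y" if "y \<in> ?Q" for y
      proof -
        have "convective (case y of (t, x) \<Rightarrow> \<rho> x) (m y) \<bullet> jac_x \<phi> y = (\<Sum>i\<in>UNIV. \<Sum>j\<in>UNIV. m y $ i * m y $ j / \<rho> (snd y) * (\<phi>' y (0, axis j 1) $ i))"
          by (simp add: convective_def jac_x_def inner_vec_def dx_eq[OF d[OF that]] case_prod_beta)
        also have "\<dots> = H4 y" unfolding H4e v_m by (simp add: mult_ac)
        finally show ?thesis .
      qed
      have F5: "pressure a \<gamma> (case y of (t, x) \<Rightarrow> \<rho> x) * div_x \<phi> y = p y * H5 y" if "y \<in> ?Q" for y
        by (simp add: p_def H5_def div_x_def dx_eq[OF d[OF that]] case_prod_beta)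
      have F5': "div_x \<phi> y = H5 y" if "y \<in> ?Q" for y by (simp add: H5_def div_x_def dx_eq[OF d[OF that]])
      note L3 = lebesgue_on_bounded_integral[OF Q F3 H3m b3]
      note L4 = lebesgue_on_bounded_integral[OF Q F4 H4m b4]
      note L5 = lebesgue_on_bounded_integral[OF Q F5 pH5m b5]
      note L5' = lebesgue_on_bounded_integral[OF Q F5' H5m b5']
      show "integrable (lebesgue_on ?Q) (\<lambda>z. m z \<bullet> dt \<phi> z)" by (rule L3(1))
      show "integrable (lebesgue_on ?Q) (\<lambda>z. convective (case z of (t, x) \<Rightarrow> \<rho> x) (m z) \<bullet> jac_x \<phi> z)" by (rule L4(1))
      show "integrable (lebesgue_on ?Q) (\<lambda>z. pressure a \<gamma> (case z of (t, x) \<Rightarrow> \<rho> x) * div_x \<phi> z)" by (rule L5(1))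
      have div0: "(\<integral>y. indicator ?Q y * H5 y \<partial>lborel) = 0"
      proof -
        have "indicator ?Q y * H5 y = indicator ?Q y * div_x \<phi> y" for y by (cases "y \<in> ?Q") (simp_all add: F5')
        then show ?thesis using integral_div_x_eq_0[OF \<Omega> \<phi>] by (simp only:)
      qed
      let ?W = "\<lambda>y. \<rho> (snd y) *\<^sub>R \<phi>' y"
      have ci: "(\<integral>y. indicator G y * (v y \<bullet> ?W y (1, v y) - c y * (\<Sum>j\<in>UNIV. ?W y (0, axis j 1) $ j)) \<partial>lborel) = 0"
      proof (rule v2[of "\<lambda>y. \<rho> (snd y) *\<^sub>R \<phi> y" ?W "R * B"], intro conjI ballI)
        fix y assume y: "y \<in> G"
        then have yQ: "y \<in> ?Q" using G(3) by blast
        have "blinfun_apply (?W y) = (\<lambda>u. \<rho> (snd y) *\<^sub>R \<phi>' y u)" by (rule ext) (rule blinfun.scaleR_left)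
        then show "((\<lambda>y. \<rho> (snd y) *\<^sub>R \<phi> y) has_derivative blinfun_apply (?W y)) (at y)"
          using has_derivative_locally_constant_scaleR[OF step[OF nG[OF y]] d[OF yQ]] by (simp only:)
        show "norm (?W y) \<le> R * B" unfolding norm_scaleR using \<rho>R B(2)[OF yQ] R0 by (intro mult_mono) auto
      next
        show "continuous_on G ?W" by (intro continuous_on_scaleR cont(2) continuous_on_subset[OF cQ G(3)])
      qed
      have id: "v y \<bullet> ?W y (1, v y) - c y * (\<Sum>j\<in>UNIV. ?W y (0, axis j 1) $ j) = m y \<bullet> \<phi>' y (1, 0) + H4 y + p y * H5 y - P * H5 y" for y
      proof -
        have "?W y (1, v y) = \<rho> (snd y) *\<^sub>R \<phi>' y (1, 0) + \<phi>' y (0, m y)"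
          using blinfun.add_right[of "\<phi>' y" "(1, 0)" "(0, v y)"] blinfun.scaleR_right[of "\<phi>' y" "\<rho> (snd y)" "(0, v y)"]
          by (simp add: blinfun.scaleR_left m_def scaleR_add_right)
        then have 1: "v y \<bullet> ?W y (1, v y) = m y \<bullet> \<phi>' y (1, 0) + H4 y" by (simp add: inner_add_right H4_def m_def)
        have "c y * (\<Sum>j\<in>UNIV. ?W y (0, axis j 1) $ j) = (\<rho> (snd y) * c y) * H5 y"
          by (simp add: H5_def blinfun.scaleR_left sum_distrib_left mult_ac)
        also have "\<dots> = P * H5 y - p y * H5 y" by (simp add: c\<rho> left_diff_distrib)
        finally show ?thesis using 1 by linarith
      qed
      have Hm: "(\<lambda>y. indicator ?Q y * (m y \<bullet> \<phi>' y (1, 0) + H4 y + p y * H5 y - P * H5 y)) \<in> borel_measurable borel"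
      proof -
        have e: "indicator ?Q y * (m y \<bullet> \<phi>' y (1, 0) + H4 y + p y * H5 y - P * H5 y) = indicator ?Q y * (m y \<bullet> \<phi>' y (1, 0)) + indicator ?Q y * H4 y + indicator ?Q y * (p y * H5 y) - P * (indicator ?Q y * H5 y)" for y
          by (simp add: algebra_simps)
        show ?thesis unfolding e by (intro borel_measurable_diff borel_measurable_add borel_measurable_times borel_measurable_const H3m H4m pH5m H5m)
      qed
      have sum0: "(\<integral>y. indicator ?Q y * (m y \<bullet> \<phi>' y (1, 0) + H4 y + p y * H5 y - P * H5 y) \<partial>lborel) = 0"
        unfolding GQ[OF Hm] using ci unfolding id .
      have "(\<integral>y. indicator ?Q y * (m y \<bullet> \<phi>' y (1, 0) + H4 y + p y * H5 y - P * H5 y) \<partial>lborel)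
        = (\<integral>y. (indicator ?Q y * (m y \<bullet> \<phi>' y (1, 0)) + indicator ?Q y * H4 y + indicator ?Q y * (p y * H5 y)) - P * (indicator ?Q y * H5 y) \<partial>lborel)"
        by (rule Bochner_Integration.integral_cong[OF refl]) (simp add: algebra_simps)
      also have "\<dots> = (\<integral>y. indicator ?Q y * (m y \<bullet> \<phi>' y (1, 0)) + indicator ?Q y * H4 y + indicator ?Q y * (p y * H5 y) \<partial>lborel) - (\<integral>y. P * (indicator ?Q y * H5 y) \<partial>lborel)"
        by (intro Bochner_Integration.integral_diff Bochner_Integration.integrable_add L3(2) L4(2) L5(2) integrable_mult_right L5'(2))
      also have "\<dots> = (\<integral>y. indicator ?Q y * (m y \<bullet> \<phi>' y (1, 0)) + indicator ?Q y * H4 y + indicator ?Q y * (p y * H5 y) \<partial>lborel)"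
        using div0 by simp
      also have "\<dots> = (\<integral>y. indicator ?Q y * (m y \<bullet> \<phi>' y (1, 0)) \<partial>lborel) + (\<integral>y. indicator ?Q y * H4 y \<partial>lborel) + (\<integral>y. indicator ?Q y * (p y * H5 y) \<partial>lborel)"
        using Bochner_Integration.integral_add[OF Bochner_Integration.integrable_add[OF L3(2) L4(2)] L5(2)]
          Bochner_Integration.integral_add[OF L3(2) L4(2)] by linarith
      finally have tot: "(\<integral>y. indicator ?Q y * (m y \<bullet> \<phi>' y (1, 0)) \<partial>lborel) + (\<integral>y. indicator ?Q y * H4 y \<partial>lborel) + (\<integral>y. indicator ?Q y * (p y * H5 y) \<partial>lborel) = 0"
        using sum0 by linarith
      show "(\<integral>z. m z \<bullet> dt \<phi> z + convective (case z of (t, x) \<Rightarrow> \<rho> x) (m z) \<bullet> jac_x \<phi> z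
                + pressure a \<gamma> (case z of (t, x) \<Rightarrow> \<rho> x) * div_x \<phi> z \<partial>lebesgue_on ?Q) = 0"
        using Bochner_Integration.integral_add[OF Bochner_Integration.integrable_add[OF L3(1) L4(1)] L5(1)]
          Bochner_Integration.integral_add[OF L3(1) L4(1)] L3(3) L4(3) L5(3) tot by linarith
    }
  qed
  show ?thesis
    using mm sol mb[unfolded P_def] weak by blast
qed

section \<open>The oscillating sequence\<close>

text \<open>Continuous functions converge to \<open>\<rho>0\<close> a.e.; truncated from below at \<open>1 / (n + 1)\<close> they are positive, and sampling
  at the corners of a fine grid changes them little in \<open>L\<^sup>1\<close>.\<close>

lemma dyadic_step_approximation:
  fixes \<rho>0 :: "'a::euclidean_space \<Rightarrow> real" and C :: real
  assumes \<Omega>: "open \<Omega>" "bounded \<Omega>" and \<rho>0: "\<rho>0 \<in> borel_measurable (lebesgue_on \<Omega>)"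
    and C: "AE x in lebesgue_on \<Omega>. 0 < \<rho>0 x \<and> \<rho>0 x \<le> C" "C > 0"
  shows "\<exists>k \<sigma>. (\<forall>n. n \<le> k n) \<and> (\<forall>n::nat. \<sigma> n \<in> borel_measurable borel) \<and>
    (\<forall>n x. inverse (real (Suc n)) \<le> \<sigma> n x \<and> \<sigma> n x \<le> C + 1) \<and>
    (\<lambda>n. \<integral>x. \<bar>\<sigma> n (cell_corner (k n) x) - \<rho>0 x\<bar> \<partial>lebesgue_on \<Omega>) \<longlonglongrightarrow> 0"
proof -
  let ?M = "lebesgue_on \<Omega>"
  interpret finite_measure ?M using \<Omega> by (rule finite_measure_lebesgue_on)
  obtain g where g: "\<And>n. continuous_on UNIV (g n)" "AE x in ?M. (\<lambda>n::nat. g n x) \<longlonglongrightarrow> \<rho>0 x"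
    using continuous_approximation[OF _ \<rho>0] \<Omega>(1) by (metis borel_open)
  define \<sigma> where "\<sigma> n x = max (inverse (real (Suc n))) (min (C + 1) (g n x))" for n x
  have c\<sigma>: "continuous_on UNIV (\<sigma> n)" for n unfolding \<sigma>_def[abs_def] by (intro continuous_intros g)
  have i1: "inverse (real (Suc n)) \<le> 1" for n by (simp add: inverse_le_1_iff)
  have r: "inverse (real (Suc n)) \<le> \<sigma> n x" "\<sigma> n x \<le> C + 1" for n x
  proof -
    show "inverse (real (Suc n)) \<le> \<sigma> n x" unfolding \<sigma>_def by (rule max.cobounded1)
    show "\<sigma> n x \<le> C + 1" unfolding \<sigma>_def using i1[of n] C(2) by (intro max.boundedI min.cobounded1) linarith
  qed
  have \<sigma>0: "0 < \<sigma> n x" for n x using r(1)[of n x] by (rule less_le_trans[rotated]) simp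
  have \<sigma>b: "\<sigma> n \<in> borel_measurable borel" for n by (rule borel_measurable_continuous_onI[OF c\<sigma>])
  have \<sigma>m: "\<sigma> n \<in> borel_measurable ?M" for n by (rule borel_measurable_lebesgue_on[OF \<sigma>b])
  have \<sigma>cm: "(\<lambda>x. \<sigma> n (cell_corner j x)) \<in> borel_measurable ?M" for n j
    by (rule borel_measurable_lebesgue_on) (rule measurable_compose[OF cell_corner_borel \<sigma>b])
  have lim\<sigma>: "AE x in ?M. (\<lambda>n. \<sigma> n x) \<longlonglongrightarrow> \<rho>0 x"
    using g(2) C(1)
  proof eventually_elim
    case (elim x)
    have "(\<lambda>n. \<sigma> n x) \<longlonglongrightarrow> max 0 (min (C + 1) (\<rho>0 x))"
      unfolding \<sigma>_def by (intro tendsto_intros LIMSEQ_inverse_real_of_nat elim)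
    then show ?case using elim by simp
  qed
  have bA: "AE x in ?M. norm \<bar>\<tau> x - \<rho>0 x\<bar> \<le> 2 * C + 1" if "\<And>x. 0 < \<tau> x \<and> \<tau> x \<le> C + 1" for \<tau> :: "'a \<Rightarrow> real"
    using C(1)
  proof eventually_elim
    case (elim x) then show ?case using that[of x] by (simp add: abs_le_iff)
  qed
  have iA: "integrable ?M (\<lambda>x. \<bar>\<tau> x - \<rho>0 x\<bar>)" if "\<And>x. 0 < \<tau> x \<and> \<tau> x \<le> C + 1" "\<tau> \<in> borel_measurable ?M" for \<tau> :: "'a \<Rightarrow> real"
    by (rule integrable_const_bound[OF bA[OF that(1)]]) (intro borel_measurable_abs borel_measurable_diff that \<rho>0)
  have bB: "norm \<bar>\<sigma> n x - \<sigma> n y\<bar> \<le> C + 1" for n x y using r[of n x] r[of n y] \<sigma>0[of n x] \<sigma>0[of n y] by (simp add: abs_le_iff)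
  have iB: "integrable ?M (\<lambda>x. \<bar>\<sigma> n (cell_corner j x) - \<sigma> n x\<bar>)" for n j
    by (rule integrable_const_bound[where B = "C + 1"]) (use bB in \<open>simp, intro borel_measurable_abs borel_measurable_diff \<sigma>cm \<sigma>m\<close>)
  have a: "(\<lambda>n. \<integral>x. \<bar>\<sigma> n x - \<rho>0 x\<bar> \<partial>?M) \<longlonglongrightarrow> (\<integral>x. 0 \<partial>?M)"
  proof (rule integral_dominated_convergence[where w = "\<lambda>_. 2 * C + 1"])
    show "AE x in ?M. (\<lambda>n. \<bar>\<sigma> n x - \<rho>0 x\<bar>) \<longlonglongrightarrow> 0"
      using lim\<sigma>
    proof eventually_elim
      case (elim x)
      have "(\<lambda>n. \<bar>\<sigma> n x - \<rho>0 x\<bar>) \<longlonglongrightarrow> \<bar>\<rho>0 x - \<rho>0 x\<bar>" by (intro tendsto_intros elim)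
      then show ?case by simp
    qed
    show "AE x in ?M. norm \<bar>\<sigma> n x - \<rho>0 x\<bar> \<le> 2 * C + 1" for n by (rule bA) (use \<sigma>0 r in auto)
    show "(\<lambda>x. \<bar>\<sigma> n x - \<rho>0 x\<bar>) \<in> borel_measurable ?M" for n by (intro borel_measurable_abs borel_measurable_diff \<sigma>m \<rho>0)
  qed simp_all
  have b: "(\<lambda>j. \<integral>x. \<bar>\<sigma> n (cell_corner j x) - \<sigma> n x\<bar> \<partial>?M) \<longlonglongrightarrow> (\<integral>x. 0 \<partial>?M)" for n
  proof (rule integral_dominated_convergence[where w = "\<lambda>_. C + 1"])
    show "AE x in ?M. (\<lambda>j. \<bar>\<sigma> n (cell_corner j x) - \<sigma> n x\<bar>) \<longlonglongrightarrow> 0"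
    proof (rule AE_I2)
      fix x
      have "isCont (\<sigma> n) x" using c\<sigma> by (simp add: continuous_on_eq_continuous_at)
      from isCont_tendsto_compose[OF this cell_corner_tendsto[OF filterlim_ident]]
      have "(\<lambda>j. \<bar>\<sigma> n (cell_corner j x) - \<sigma> n x\<bar>) \<longlonglongrightarrow> \<bar>\<sigma> n x - \<sigma> n x\<bar>" by (intro tendsto_intros)
      then show "(\<lambda>j. \<bar>\<sigma> n (cell_corner j x) - \<sigma> n x\<bar>) \<longlonglongrightarrow> 0" by simp
    qed
    show "AE x in ?M. norm \<bar>\<sigma> n (cell_corner j x) - \<sigma> n x\<bar> \<le> C + 1" for j using bB by (intro AE_I2)
    show "(\<lambda>x. \<bar>\<sigma> n (cell_corner j x) - \<sigma> n x\<bar>) \<in> borel_measurable ?M" for j by (intro borel_measurable_abs borel_measurable_diff \<sigma>m \<sigma>cm)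
  qed simp_all
  have "\<exists>j\<ge>n. (\<integral>x. \<bar>\<sigma> n (cell_corner j x) - \<sigma> n x\<bar> \<partial>?M) < inverse (real (Suc n))" for n
  proof -
    have "\<forall>\<^sub>F j in sequentially. (\<integral>x. \<bar>\<sigma> n (cell_corner j x) - \<sigma> n x\<bar> \<partial>?M) < inverse (real (Suc n))"
      by (rule order_tendstoD(2)[OF b]) simp
    then obtain J where "\<And>j. j \<ge> J \<Longrightarrow> (\<integral>x. \<bar>\<sigma> n (cell_corner j x) - \<sigma> n x\<bar> \<partial>?M) < inverse (real (Suc n))"
      unfolding eventually_sequentially by blast
    then show ?thesis by (intro exI[of _ "max n J"]) auto
  qed
  then obtain k where k: "\<And>n. k n \<ge> n" "\<And>n. (\<integral>x. \<bar>\<sigma> n (cell_corner (k n) x) - \<sigma> n x\<bar> \<partial>?M) < inverse (real (Suc n))"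
    by metis
  have "(\<lambda>n. \<integral>x. \<bar>\<sigma> n (cell_corner (k n) x) - \<rho>0 x\<bar> \<partial>?M) \<longlonglongrightarrow> 0"
  proof (rule tendsto_sandwich)
    show "\<forall>\<^sub>F n in sequentially. 0 \<le> (\<integral>x. \<bar>\<sigma> n (cell_corner (k n) x) - \<rho>0 x\<bar> \<partial>?M)" by (simp add: integral_nonneg)
    show "(\<lambda>n. inverse (real (Suc n)) + (\<integral>x. \<bar>\<sigma> n x - \<rho>0 x\<bar> \<partial>?M)) \<longlonglongrightarrow> 0"
      using tendsto_add[OF LIMSEQ_inverse_real_of_nat a] by simp
    show "\<forall>\<^sub>F n in sequentially. (\<integral>x. \<bar>\<sigma> n (cell_corner (k n) x) - \<rho>0 x\<bar> \<partial>?M) \<le> inverse (real (Suc n)) + (\<integral>x. \<bar>\<sigma> n x - \<rho>0 x\<bar> \<partial>?M)"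
    proof (rule always_eventually, rule allI)
      fix n
      have i: "integrable ?M (\<lambda>x. \<bar>\<sigma> n x - \<rho>0 x\<bar>)" "integrable ?M (\<lambda>x. \<bar>\<sigma> n (cell_corner (k n) x) - \<rho>0 x\<bar>)"
        by (rule iA; use \<sigma>0 r \<sigma>m \<sigma>cm in auto)+
      have "(\<integral>x. \<bar>\<sigma> n (cell_corner (k n) x) - \<rho>0 x\<bar> \<partial>?M) \<le> (\<integral>x. \<bar>\<sigma> n (cell_corner (k n) x) - \<sigma> n x\<bar> + \<bar>\<sigma> n x - \<rho>0 x\<bar> \<partial>?M)"
        by (intro integral_mono i iB Bochner_Integration.integrable_add) linarith
      also have "\<dots> = (\<integral>x. \<bar>\<sigma> n (cell_corner (k n) x) - \<sigma> n x\<bar> \<partial>?M) + (\<integral>x. \<bar>\<sigma> n x - \<rho>0 x\<bar> \<partial>?M)"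
        by (rule Bochner_Integration.integral_add[OF iB i(1)])
      finally show "(\<integral>x. \<bar>\<sigma> n (cell_corner (k n) x) - \<rho>0 x\<bar> \<partial>?M) \<le> inverse (real (Suc n)) + (\<integral>x. \<bar>\<sigma> n x - \<rho>0 x\<bar> \<partial>?M)"
        using k(2)[of n] by linarith
    qed
  qed simp
  then show ?thesis using k(1) \<sigma>b r by blast
qed

lemma integral_pos_of_AE_pos:
  fixes f :: "'a::euclidean_space \<Rightarrow> real"
  assumes \<Omega>: "open \<Omega>" "\<Omega> \<noteq> {}" and f: "integrable (lebesgue_on \<Omega>) f" "AE x in lebesgue_on \<Omega>. 0 < f x"
  shows "(\<integral>x. f x \<partial>lebesgue_on \<Omega>) > 0"
proof (rule ccontr)
  have S: "\<Omega> \<in> sets lebesgue" using \<Omega>(1) by (simp add: sets_completionI_sets)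
  have nn: "AE x in lebesgue_on \<Omega>. 0 \<le> f x" using f(2) by eventually_elim simp
  assume "\<not> ?thesis"
  then have "(\<integral>x. f x \<partial>lebesgue_on \<Omega>) = 0" using integral_nonneg_AE[OF nn] by linarith
  then have "AE x in lebesgue_on \<Omega>. f x = 0" using integral_nonneg_eq_0_iff_AE[OF f(1) nn] by blast
  then have "AE x in lebesgue_on \<Omega>. False" using f(2) by eventually_elim simp
  then have "AE x in lebesgue. x \<notin> \<Omega>" using AE_restrict_space_iff[of \<Omega> lebesgue "\<lambda>_. False"] S by simp
  then have "negligible \<Omega>" using AE_iff_null_sets[OF S] by (simp add: negligible_iff_null_sets)
  then show False using open_not_negligible[OF \<Omega>] by blast
qed

text \<open>Write \<open>\<rho> - \<rho>0 = (1 + r / 2) (s - \<rho>0) + r \<rho>0 / 2\<close>: the first part tends to zero in \<open>L\<^sup>1\<close>, the second one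
  weakly. As \<open>\<bar>r\<bar> = 1\<close>, the second one has norm \<open>\<integral> \<rho>0 / 2 > 0\<close>.\<close>

lemma checker_density_weak:
  fixes \<rho>0 :: "'a::euclidean_space \<Rightarrow> real" and s :: "nat \<Rightarrow> 'a \<Rightarrow> real" and C :: real
  assumes \<Omega>: "open \<Omega>" "bounded \<Omega>" and k: "filterlim k at_top sequentially"
    and \<rho>0: "\<rho>0 \<in> borel_measurable (lebesgue_on \<Omega>)" "AE x in lebesgue_on \<Omega>. 0 < \<rho>0 x \<and> \<rho>0 x \<le> C"
    and s: "\<And>n. s n \<in> borel_measurable borel" "\<And>n x. 0 \<le> s n x" "\<And>n x. s n x \<le> C"
    and lim: "(\<lambda>n. \<integral>x. \<bar>s n x - \<rho>0 x\<bar> \<partial>lebesgue_on \<Omega>) \<longlonglongrightarrow> 0"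
  shows "weak_star_Linfty (lebesgue_on \<Omega>) (\<lambda>n x. s n x * (1 + checker (k n) x / 2)) \<rho>0"
    and "\<Omega> \<noteq> {} \<Longrightarrow> liminf (\<lambda>n. ereal (\<integral>x. \<bar>s n x * (1 + checker (k n) x / 2) - \<rho>0 x\<bar> \<partial>lebesgue_on \<Omega>)) > 0"
proof -
  let ?M = "lebesgue_on \<Omega>"
  interpret finite_measure ?M using \<Omega> by (rule finite_measure_lebesgue_on)
  define \<rho> where "\<rho> n x = s n x * (1 + checker (k n) x / 2)" for n x
  have ck: "checker j x = 1 \<or> checker j x = -1" for j and x :: 'a by (simp add: checker_def)
  have \<rho>b: "\<rho> n \<in> borel_measurable borel" for n unfolding \<rho>_def[abs_def] using s(1)[of n] by simp
  have \<rho>m: "\<rho> n \<in> borel_measurable ?M" for n by (rule borel_measurable_lebesgue_on[OF \<rho>b])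
  have sm: "s n \<in> borel_measurable ?M" for n by (rule borel_measurable_lebesgue_on[OF s(1)])
  have cm: "checker j \<in> borel_measurable ?M" for j by (rule borel_measurable_lebesgue_on) simp
  have C0: "C \<ge> 0" using s(2,3)[of 0 undefined] by linarith
  have \<rho>B: "norm (\<rho> n x) \<le> 3 / 2 * C" for n x
    using s(2,3)[of n x] ck[of "k n" x] unfolding \<rho>_def by (elim disjE) (simp_all add: abs_le_iff)
  have \<rho>0B: "AE x in ?M. norm (\<rho>0 x) \<le> C" using \<rho>0(2) by eventually_elim simp
  have i\<rho>: "integrable ?M (\<rho> n)" for n by (rule integrable_const_bound[OF AE_I2 \<rho>m]) (rule \<rho>B)
  have i\<rho>0: "integrable ?M \<rho>0" by (rule integrable_const_bound[OF \<rho>0B \<rho>0(1)])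
  have int_s: "integrable ?M (s n)" for n by (rule integrable_const_bound[OF AE_I2 sm, where B = C]) (use s(2,3) in simp)
  define e where "e n = (\<integral>x. \<bar>s n x - \<rho>0 x\<bar> \<partial>?M)" for n
  have ie: "integrable ?M (\<lambda>x. \<bar>s n x - \<rho>0 x\<bar>)" for n by (intro integrable_abs Bochner_Integration.integrable_diff int_s i\<rho>0)
  have e: "e \<longlonglongrightarrow> 0" using lim by (simp add: e_def[abs_def])
  have null: "(\<lambda>n. \<integral>x. (\<rho> n x - \<rho>0 x) \<bullet> \<psi> x \<partial>?M) \<longlonglongrightarrow> 0" if \<psi>: "integrable ?M \<psi>" for \<psi>
  proof (rule weak_null_testing[OF \<Omega> _ _ _ _ \<psi>, where B = "3 / 2 * C + C"])
    show "(\<lambda>x. \<rho> n x - \<rho>0 x) \<in> borel_measurable ?M" for n by (intro borel_measurable_diff \<rho>m \<rho>0)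
    show "AE x in ?M. norm (\<rho> n x - \<rho>0 x) \<le> 3 / 2 * C + C" for n
      using \<rho>0B
    proof eventually_elim
      case (elim x) then show ?case using norm_triangle_ineq4[of "\<rho> n x" "\<rho>0 x"] \<rho>B[of n x] by linarith
    qed
    show "0 \<le> 3 / 2 * C + C" using C0 by simp
    fix g :: "'a \<Rightarrow> real" and c :: real assume g: "continuous_on UNIV g" "\<forall>y. 0 \<le> g y \<and> g y \<le> 1"
    have gm: "g \<in> borel_measurable ?M" by (rule continuous_lebesgue_on[OF g(1)])
    define u where "u n x = g x * (1 + checker (k n) x / 2) * c * (s n x - \<rho>0 x)" for n x
    define w where "w x = g x * \<rho>0 x * c / 2" for x
    have iw: "integrable ?M w"
    proof (rule integrable_const_bound)
      show "AE x in ?M. norm (w x) \<le> 1 * C * \<bar>c\<bar> / 2"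
        using \<rho>0B
      proof eventually_elim
        case (elim x)
        have "\<bar>g x\<bar> * \<bar>\<rho>0 x\<bar> * \<bar>c\<bar> \<le> 1 * C * \<bar>c\<bar>" using elim g(2)[rule_format, of x] by (intro mult_mono) auto
        then show ?case by (simp add: w_def abs_mult)
      qed
      show "w \<in> borel_measurable ?M" unfolding w_def[abs_def] using gm \<rho>0(1) by simp
    qed
    have ub: "\<bar>u n x\<bar> \<le> 3 / 2 * \<bar>c\<bar> * \<bar>s n x - \<rho>0 x\<bar>" for n x
    proof -
      have "\<bar>1 + checker (k n) x / 2\<bar> \<le> 3 / 2" using ck[of "k n" x] by (elim disjE) simp_all
      then have "\<bar>g x\<bar> * \<bar>1 + checker (k n) x / 2\<bar> \<le> 1 * (3 / 2)" using g(2)[rule_format, of x] by (intro mult_mono) auto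
      then have "(\<bar>g x\<bar> * \<bar>1 + checker (k n) x / 2\<bar>) * (\<bar>c\<bar> * \<bar>s n x - \<rho>0 x\<bar>) \<le> (1 * (3 / 2)) * (\<bar>c\<bar> * \<bar>s n x - \<rho>0 x\<bar>)"
        by (intro mult_right_mono) auto
      then show ?thesis by (simp add: u_def abs_mult mult.assoc)
    qed
    have iu: "integrable ?M (u n)" for n
    proof (rule Bochner_Integration.integrable_bound)
      show "integrable ?M (\<lambda>x. 3 / 2 * \<bar>c\<bar> * \<bar>s n x - \<rho>0 x\<bar>)" by (intro integrable_mult_right ie)
      show "u n \<in> borel_measurable ?M" unfolding u_def[abs_def] using gm cm[of "k n"] sm[of n] \<rho>0(1) by simp
      show "AE x in ?M. norm (u n x) \<le> norm (3 / 2 * \<bar>c\<bar> * \<bar>s n x - \<rho>0 x\<bar>)" using ub[of n] by (intro AE_I2) (simp add: abs_mult)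
    qed
    have icw: "integrable ?M (\<lambda>x. checker (k n) x * w x)" for n
      using integrable_bounded_inner[of "checker (k n)" ?M 1 w] cm iw by (simp add: checker_abs)
    have u0: "(\<lambda>n. \<integral>x. u n x \<partial>?M) \<longlonglongrightarrow> 0"
    proof (rule tendsto_norm_zero_cancel, rule tendsto_sandwich[OF _ _ tendsto_const])
      show "(\<lambda>n. 3 / 2 * \<bar>c\<bar> * e n) \<longlonglongrightarrow> 0" using tendsto_mult_left[OF e, of "3 / 2 * \<bar>c\<bar>"] by simp
      have "norm (\<integral>x. u n x \<partial>?M) \<le> 3 / 2 * \<bar>c\<bar> * e n" for n
      proof -
        have "norm (\<integral>x. u n x \<partial>?M) \<le> (\<integral>x. \<bar>u n x\<bar> \<partial>?M)" unfolding real_norm_def by (rule integral_abs_bound)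
        also have "\<dots> \<le> (\<integral>x. 3 / 2 * \<bar>c\<bar> * \<bar>s n x - \<rho>0 x\<bar> \<partial>?M)"
          by (intro integral_mono integrable_abs iu integrable_mult_right ie ub)
        finally show ?thesis by (simp add: e_def)
      qed
      then show "\<forall>\<^sub>F n in sequentially. norm (\<integral>x. u n x \<partial>?M) \<le> 3 / 2 * \<bar>c\<bar> * e n" by simp
    qed simp
    have "(\<lambda>n. (\<integral>x. u n x \<partial>?M) + (\<integral>x. checker (k n) x * w x \<partial>?M)) \<longlonglongrightarrow> 0 + 0"
      by (intro tendsto_add u0 checker_weak_null k \<Omega> iw)
    moreover have "(\<integral>x. g x * ((\<rho> n x - \<rho>0 x) \<bullet> c) \<partial>?M) = (\<integral>x. u n x \<partial>?M) + (\<integral>x. checker (k n) x * w x \<partial>?M)" for n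
    proof -
      have eq: "g x * ((\<rho> n x - \<rho>0 x) \<bullet> c) = u n x + checker (k n) x * w x" for x
        by (simp add: \<rho>_def u_def w_def field_simps)
      show ?thesis unfolding eq by (rule Bochner_Integration.integral_add[OF iu icw])
    qed
    ultimately show "(\<lambda>n. \<integral>x. g x * ((\<rho> n x - \<rho>0 x) \<bullet> c) \<partial>?M) \<longlonglongrightarrow> 0" by simp
  qed
  have "weak_star_Linfty ?M \<rho> \<rho>0"
    unfolding weak_star_Linfty_def
  proof (intro conjI allI impI)
    show "\<rho> n \<in> Linfty ?M" for n unfolding Linfty_def 
      using \<rho>m[of n] \<rho>B[of n] by (intro CollectI conjI exI[of _ "3 / 2 * C"] AE_I2) auto
    show "\<rho>0 \<in> Linfty ?M" unfolding Linfty_def using \<rho>0(1) \<rho>0B by blast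
    fix \<psi> :: "'a \<Rightarrow> real" assume \<psi>: "integrable ?M \<psi>"
    have i0: "integrable ?M (\<lambda>x. \<rho>0 x \<bullet> \<psi> x)" by (rule integrable_bounded_inner[OF \<rho>0(1) \<rho>0B \<psi>])
    have i: "integrable ?M (\<lambda>x. \<rho> n x \<bullet> \<psi> x)" for n by (rule integrable_bounded_inner[OF \<rho>m AE_I2 \<psi>]) (rule \<rho>B)
    have "(\<integral>x. (\<rho> n x - \<rho>0 x) \<bullet> \<psi> x \<partial>?M) = (\<integral>x. \<rho> n x \<bullet> \<psi> x \<partial>?M) - (\<integral>x. \<rho>0 x \<bullet> \<psi> x \<partial>?M)" for n
      unfolding inner_diff_left by (rule Bochner_Integration.integral_diff[OF i i0])
    then have "(\<lambda>n. (\<integral>x. \<rho> n x \<bullet> \<psi> x \<partial>?M) - (\<integral>x. \<rho>0 x \<bullet> \<psi> x \<partial>?M)) \<longlonglongrightarrow> 0" using null[OF \<psi>] by simp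
    then show "(\<lambda>n. \<integral>x. \<rho> n x \<bullet> \<psi> x \<partial>?M) \<longlonglongrightarrow> (\<integral>x. \<rho>0 x \<bullet> \<psi> x \<partial>?M)" by (simp only: LIM_zero_iff)
  qed
  then show "weak_star_Linfty ?M (\<lambda>n x. s n x * (1 + checker (k n) x / 2)) \<rho>0" unfolding \<rho>_def[abs_def] .
  assume ne: "\<Omega> \<noteq> {}"
  define I where "I = (\<integral>x. \<rho>0 x \<partial>?M)"
  have "AE x in ?M. 0 < \<rho>0 x" using \<rho>0(2) by eventually_elim simp
  then have I: "I > 0" unfolding I_def by (rule integral_pos_of_AE_pos[OF \<Omega>(1) ne i\<rho>0])
  have low: "I / 2 - 3 / 2 * e n \<le> (\<integral>x. \<bar>\<rho> n x - \<rho>0 x\<bar> \<partial>?M)" for n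
  proof -
    have "\<rho>0 x / 2 - 3 / 2 * \<bar>s n x - \<rho>0 x\<bar> \<le> \<bar>\<rho> n x - \<rho>0 x\<bar>" for x
    proof -
      have "r - 3 * A \<le> 2 * W" if "0 \<le> A" "s - r \<le> A" "r - s \<le> A" "p - r \<le> W" "r - p \<le> W" "2 * p = 3 * s \<or> 2 * p = s" for r s p A W :: real
        using that(6) that(1-5) by (elim disjE) linarith+
      note gen = this[of "\<bar>s n x - \<rho>0 x\<bar>" "s n x" "\<rho>0 x" "\<rho> n x" "\<bar>\<rho> n x - \<rho>0 x\<bar>"]
      have "2 * \<rho> n x = 3 * s n x \<or> 2 * \<rho> n x = s n x" using ck[of "k n" x] unfolding \<rho>_def by auto
      then have "\<rho>0 x - 3 * \<bar>s n x - \<rho>0 x\<bar> \<le> 2 * \<bar>\<rho> n x - \<rho>0 x\<bar>" by (intro gen) auto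
      then show ?thesis by (simp add: field_simps)
    qed
    then have "(\<integral>x. \<rho>0 x / 2 - 3 / 2 * \<bar>s n x - \<rho>0 x\<bar> \<partial>?M) \<le> (\<integral>x. \<bar>\<rho> n x - \<rho>0 x\<bar> \<partial>?M)"
      by (intro integral_mono integrable_abs Bochner_Integration.integrable_diff integrable_mult_right ie i\<rho>0 i\<rho> integrable_divide)
    moreover have "(\<integral>x. \<rho>0 x / 2 - 3 / 2 * \<bar>s n x - \<rho>0 x\<bar> \<partial>?M) = (\<integral>x. \<rho>0 x / 2 \<partial>?M) - (\<integral>x. 3 / 2 * \<bar>s n x - \<rho>0 x\<bar> \<partial>?M)"
      by (intro Bochner_Integration.integral_diff integrable_mult_right ie i\<rho>0 integrable_divide)
    ultimately show ?thesis by (simp add: I_def e_def)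
  qed
  have "(\<lambda>n. I / 2 - 3 / 2 * e n) \<longlonglongrightarrow> I / 2 - 3 / 2 * 0" by (intro tendsto_intros e)
  then have "\<forall>\<^sub>F n in sequentially. I / 4 < I / 2 - 3 / 2 * e n" by (rule order_tendstoD(1)) (use I in simp)
  then have "\<forall>\<^sub>F n in sequentially. ereal (I / 4) \<le> ereal (\<integral>x. \<bar>\<rho> n x - \<rho>0 x\<bar> \<partial>?M)"
  proof eventually_elim
    case (elim n) then show ?case using low[of n] by simp
  qed
  then have "ereal (I / 4) \<le> liminf (\<lambda>n. ereal (\<integral>x. \<bar>\<rho> n x - \<rho>0 x\<bar> \<partial>?M))" by (rule Liminf_bounded)
  moreover have "0 < ereal (I / 4)" using I by simp
  ultimately show "liminf (\<lambda>n. ereal (\<integral>x. \<bar>s n x * (1 + checker (k n) x / 2) - \<rho>0 x\<bar> \<partial>?M)) > 0"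
    unfolding \<rho>_def using less_le_trans by blast
qed

text \<open>A continuous test function differs little from its sampling on the grid, and the latter gives zero.\<close>

lemma weak_null_of_step_tests:
  fixes m :: "nat \<Rightarrow> 'a::euclidean_space \<Rightarrow> 'b::euclidean_space" and B :: real
  assumes Q: "open Q" "bounded Q" and k: "filterlim k at_top sequentially"
    and m: "\<And>n. m n \<in> borel_measurable borel" "\<And>n. AE y in lborel. y \<in> Q \<longrightarrow> norm (m n y) \<le> B" "B \<ge> 0"
    and step: "\<And>n q c. (\<And>y. y \<notin> grid (k n) \<Longrightarrow> \<forall>\<^sub>F z in nhds y. q z = q y) \<Longrightarrow> (\<And>y. \<bar>q y\<bar> \<le> 1) \<Longrightarrow> q \<in> borel_measurable borel \<Longrightarrow>
       (\<integral>y. indicator Q y * (q y * (m n y \<bullet> c)) \<partial>lborel) = 0"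
  shows "weak_star_Linfty (lebesgue_on Q) m (\<lambda>_. 0)"
proof -
  let ?M = "lebesgue_on Q"
  have Q': "Q \<in> sets borel" using Q(1) by simp
  have mm: "m n \<in> borel_measurable ?M" for n by (rule borel_measurable_lebesgue_on[OF m(1)])
  have mB: "AE y in ?M. norm (m n y) \<le> B" for n by (rule AE_lebesgue_on_of_lborel[OF Q' m(2)])
  have ind: "indicat_real Q \<in> borel_measurable borel" using Q' by simp
  have iQ: "integrable lborel (\<lambda>y. b * indicat_real Q y)" for b
    using Q(2) Q(1) by (intro integrable_const_indicator) auto
  have test: "(\<lambda>n. \<integral>y. g y * (m n y \<bullet> c) \<partial>?M) \<longlonglongrightarrow> 0"
    if g: "continuous_on UNIV g" "\<forall>y. 0 \<le> g y \<and> g y \<le> 1" for g :: "'a \<Rightarrow> real" and c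
  proof -
    have gm: "g \<in> borel_measurable borel" by (rule borel_measurable_continuous_onI[OF g(1)])
    define q where "q n y = g (cell_corner (k n) y)" for n y
    have qm: "q n \<in> borel_measurable borel" for n unfolding q_def[abs_def] by (rule measurable_compose[OF cell_corner_borel gm])
    have mc: "(\<lambda>y. m n y \<bullet> c) \<in> borel_measurable borel" for n by (intro borel_measurable_inner m(1) borel_measurable_const)
    have cb: "AE y in lborel. y \<in> Q \<longrightarrow> \<bar>h y * (m n y \<bullet> c)\<bar> \<le> \<bar>h y\<bar> * (B * norm c)" for h :: "'a \<Rightarrow> real" and n
      using m(2)[of n]
    proof eventually_elim
      case (elim y)
      show ?case
      proof
        assume y: "y \<in> Q"
        have "\<bar>m n y \<bullet> c\<bar> \<le> norm (m n y) * norm c" by (rule Cauchy_Schwarz_ineq2)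
        also have "\<dots> \<le> B * norm c" using elim y by (intro mult_right_mono) auto
        finally have mc: "\<bar>m n y \<bullet> c\<bar> \<le> B * norm c" .
        have "\<bar>h y\<bar> * \<bar>m n y \<bullet> c\<bar> \<le> \<bar>h y\<bar> * (B * norm c)" by (rule mult_left_mono[OF mc abs_ge_zero])
        then show "\<bar>h y * (m n y \<bullet> c)\<bar> \<le> \<bar>h y\<bar> * (B * norm c)" by (simp only: abs_mult)
      qed
    qed
    have int: "integrable lborel (\<lambda>y. indicator Q y * (h y * (m n y \<bullet> c)))" "(\<integral>y. h y * (m n y \<bullet> c) \<partial>?M) = (\<integral>y. indicator Q y * (h y * (m n y \<bullet> c)) \<partial>lborel)"
      if h: "h \<in> borel_measurable borel" "\<And>y. \<bar>h y\<bar> \<le> 1" for h n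
    proof -
      have H: "(\<lambda>y. indicator Q y * (h y * (m n y \<bullet> c))) \<in> borel_measurable borel"
        by (intro borel_measurable_times ind h mc)
      have b: "AE y in lborel. y \<in> Q \<longrightarrow> \<bar>h y * (m n y \<bullet> c)\<bar> \<le> 1 * (B * norm c)"
        using cb[of h n]
      proof eventually_elim
        case (elim y)
        have "\<bar>h y\<bar> * (B * norm c) \<le> 1 * (B * norm c)" using h(2)[of y] m(3) by (intro mult_right_mono) auto
        then show ?case using elim by linarith
      qed
      note * = lebesgue_on_bounded_integral[OF Q refl H b]
      show "integrable lborel (\<lambda>y. indicator Q y * (h y * (m n y \<bullet> c)))" by (rule *(2))
      show "(\<integral>y. h y * (m n y \<bullet> c) \<partial>?M) = (\<integral>y. indicator Q y * (h y * (m n y \<bullet> c)) \<partial>lborel)" by (rule *(3))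
    qed
    have g1: "\<bar>g y\<bar> \<le> 1" for y using g(2)[rule_format, of y] by simp
    have q1: "\<bar>q n y\<bar> \<le> 1" for n y unfolding q_def by (rule g1)
    have z: "(\<integral>y. indicator Q y * (q n y * (m n y \<bullet> c)) \<partial>lborel) = 0" for n
    proof (rule step[OF _ q1 qm])
      fix y :: 'a assume "y \<notin> grid (k n)"
      from cell_corner_eventually[OF this] show "\<forall>\<^sub>F z in nhds y. q n z = q n y" by eventually_elim (simp add: q_def)
    qed
    define d where "d n = (\<integral>y. indicator Q y * \<bar>g y - q n y\<bar> \<partial>lborel)" for n
    have dm: "(\<lambda>y. indicator Q y * \<bar>g y - q n y\<bar>) \<in> borel_measurable lborel" for n
      using ind gm qm[of n] by simp
    have db: "norm (indicator Q y * \<bar>g y - q n y\<bar>) \<le> 1 * indicat_real Q y" for n y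
    proof -
      have "\<bar>g y - q n y\<bar> \<le> 1" unfolding q_def using g(2)[rule_format, of y] g(2)[rule_format, of "cell_corner (k n) y"] by (simp add: abs_le_iff)
      then show ?thesis by (simp add: indicator_def)
    qed
    have di: "integrable lborel (\<lambda>y. indicator Q y * \<bar>g y - q n y\<bar>)" for n
      by (rule Bochner_Integration.integrable_bound[OF iQ[of 1] dm]) (use db in \<open>auto intro!: AE_I2\<close>)
    have "d \<longlonglongrightarrow> (\<integral>y. 0 \<partial>(lborel :: 'a measure))"
      unfolding d_def[abs_def]
    proof (rule integral_dominated_convergence[OF _ dm iQ[of 1]])
      show "AE y in lborel. norm (indicator Q y * \<bar>g y - q n y\<bar>) \<le> 1 * indicat_real Q y" for n by (intro AE_I2 db)
      show "AE y in lborel. (\<lambda>n. indicator Q y * \<bar>g y - q n y\<bar>) \<longlonglongrightarrow> 0"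
      proof (rule AE_I2)
        fix y
        have "isCont g y" using g(1) by (simp add: continuous_on_eq_continuous_at)
        from isCont_tendsto_compose[OF this cell_corner_tendsto[OF k]]
        have "(\<lambda>n. indicator Q y * \<bar>g y - q n y\<bar>) \<longlonglongrightarrow> indicator Q y * \<bar>g y - g y\<bar>" unfolding q_def by (intro tendsto_intros)
        then show "(\<lambda>n. indicator Q y * \<bar>g y - q n y\<bar>) \<longlonglongrightarrow> 0" by simp
      qed
    qed simp
    then have d0: "(\<lambda>n. d n * (B * norm c)) \<longlonglongrightarrow> 0" using tendsto_mult_right[of d 0 sequentially "B * norm c"] by simp
    have "norm (\<integral>y. g y * (m n y \<bullet> c) \<partial>?M) \<le> d n * (B * norm c)" for n
    proof -
      have hm: "(\<lambda>y. g y - q n y) \<in> borel_measurable borel" using gm qm by simp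
      have "(\<integral>y. g y * (m n y \<bullet> c) \<partial>?M) = (\<integral>y. indicator Q y * (g y * (m n y \<bullet> c)) \<partial>lborel) - (\<integral>y. indicator Q y * (q n y * (m n y \<bullet> c)) \<partial>lborel)"
        unfolding z int(2)[OF gm g1] by simp
      also have "\<dots> = (\<integral>y. indicator Q y * (g y * (m n y \<bullet> c)) - indicator Q y * (q n y * (m n y \<bullet> c)) \<partial>lborel)"
        by (rule Bochner_Integration.integral_diff[symmetric, OF int(1)[OF gm g1] int(1)[OF qm q1]])
      finally have e: "(\<integral>y. g y * (m n y \<bullet> c) \<partial>?M) = (\<integral>y. indicator Q y * (g y * (m n y \<bullet> c)) - indicator Q y * (q n y * (m n y \<bullet> c)) \<partial>lborel)" .
      have "norm (\<integral>y. g y * (m n y \<bullet> c) \<partial>?M) \<le> (\<integral>y. \<bar>indicator Q y * (g y * (m n y \<bullet> c)) - indicator Q y * (q n y * (m n y \<bullet> c))\<bar> \<partial>lborel)"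
        unfolding e real_norm_def by (rule integral_abs_bound)
      also have "\<dots> \<le> (\<integral>y. (indicator Q y * \<bar>g y - q n y\<bar>) * (B * norm c) \<partial>lborel)"
      proof (rule integral_mono_AE)
        show "integrable lborel (\<lambda>y. \<bar>indicator Q y * (g y * (m n y \<bullet> c)) - indicator Q y * (q n y * (m n y \<bullet> c))\<bar>)"
          by (intro integrable_abs Bochner_Integration.integrable_diff int gm g1 qm q1)
        show "integrable lborel (\<lambda>y. (indicator Q y * \<bar>g y - q n y\<bar>) * (B * norm c))" by (intro integrable_mult_left di)
        show "AE y in lborel. \<bar>indicator Q y * (g y * (m n y \<bullet> c)) - indicator Q y * (q n y * (m n y \<bullet> c))\<bar> \<le> (indicator Q y * \<bar>g y - q n y\<bar>) * (B * norm c)"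
          using cb[of "\<lambda>y. g y - q n y" n]
        proof eventually_elim
          case (elim y)
          then show ?case by (cases "y \<in> Q") (simp_all add: left_diff_distrib)
        qed
      qed
      finally show ?thesis by (simp add: d_def)
    qed
    then show ?thesis
      by (intro tendsto_norm_zero_cancel[OF tendsto_sandwich[OF _ _ tendsto_const d0]]) auto
  qed
  show ?thesis
    unfolding weak_star_Linfty_def
  proof (intro conjI allI impI)
    show "m n \<in> Linfty ?M" for n unfolding Linfty_def using mm mB by blast
    show "(\<lambda>_. 0) \<in> Linfty ?M" unfolding Linfty_def by auto
    fix \<psi> :: "'a \<Rightarrow> 'b" assume \<psi>: "integrable ?M \<psi>"
    have "(\<lambda>n. \<integral>y. m n y \<bullet> \<psi> y \<partial>?M) \<longlonglongrightarrow> 0"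
      by (rule weak_null_testing[OF Q mm mB m(3) _ \<psi>]) (rule test)
    then show "(\<lambda>n. \<integral>y. m n y \<bullet> \<psi> y \<partial>?M) \<longlonglongrightarrow> (\<integral>y. 0 \<bullet> \<psi> y \<partial>?M)"
      by (simp only: inner_zero_left Bochner_Integration.integral_zero)
  qed
qed

theorem proposition2p1:
  fixes a \<gamma> T :: real
    and \<Omega> :: "(real^'n) set"
    and \<rho>0 :: "real^'n \<Rightarrow> real"
  assumes "CARD('n) \<in> {2, 3}"
    and "a > 0" and "\<gamma> > 1" and "T > 0"
    and "open \<Omega>" and "connected \<Omega>" and "\<Omega> \<noteq> {}" and "bounded \<Omega>"
    and "\<rho>0 \<in> Linfty (lebesgue_on \<Omega>)"
    and "AE x in lebesgue_on \<Omega>. \<rho>0 x > 0"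
  shows "\<exists>(\<rho> :: nat \<Rightarrow> real^'n \<Rightarrow> real) (m :: nat \<Rightarrow> real \<times> (real^'n) \<Rightarrow> real^'n).
    (\<forall>n. euler_weak_solution a \<gamma> T \<Omega> (\<lambda>(t, x). \<rho> n x) (m n)) \<and>
    weak_star_Linfty (lebesgue_on \<Omega>) \<rho> \<rho>0 \<and>
    weak_star_Linfty (lebesgue_on ({0<..<T} \<times> \<Omega>)) m (\<lambda>_. 0) \<and>
    liminf (\<lambda>n. ereal (\<integral>x. \<bar>\<rho> n x - \<rho>0 x\<bar> \<partial>lebesgue_on \<Omega>)) > 0"
proof -
  let ?Q = "{0<..<T} \<times> \<Omega>"
  note \<Omega> = \<open>open \<Omega>\<close> \<open>bounded \<Omega>\<close>
  have Q: "open ?Q" "bounded ?Q" using \<Omega> by (auto intro: open_Times bounded_Times)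
  have N: "CARD('n) \<ge> 2" using assms(1) by auto
  obtain C1 where C1: "\<rho>0 \<in> borel_measurable (lebesgue_on \<Omega>)" "AE x in lebesgue_on \<Omega>. norm (\<rho>0 x) \<le> C1"
    using assms(9) unfolding Linfty_def by blast
  define C where "C = max C1 1"
  have C: "AE x in lebesgue_on \<Omega>. 0 < \<rho>0 x \<and> \<rho>0 x \<le> C" "C > 0"
    using C1(2) assms(10) by (auto simp: C_def elim!: eventually_elim2)
  obtain k \<sigma> where k: "\<And>n::nat. n \<le> k n" and \<sigma>: "\<And>n. \<sigma> n \<in> borel_measurable borel"
    and r: "\<And>n x. inverse (real (Suc n)) \<le> \<sigma> n x" "\<And>n x. \<sigma> n x \<le> C + 1"
    and lim: "(\<lambda>n. \<integral>x. \<bar>\<sigma> n (cell_corner (k n) x) - \<rho>0 x\<bar> \<partial>lebesgue_on \<Omega>) \<longlonglongrightarrow> 0"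
    using dyadic_step_approximation[OF \<Omega> C1(1) C] by blast
  have k_top: "filterlim k at_top sequentially"
    by (rule filterlim_at_top_mono[OF filterlim_ident]) (simp add: k)
  define s where "s n x = \<sigma> n (cell_corner (k n) x)" for n x
  define \<rho> where "\<rho> n x = s n x * (1 + checker (k n) x / 2)" for n x
  define R where "R = 3 / 2 * (C + 1)"
  have sb: "s n \<in> borel_measurable borel" for n unfolding s_def[abs_def] by (rule measurable_compose[OF cell_corner_borel \<sigma>])
  have s0: "0 \<le> s n x" for n x unfolding s_def using r(1)[of n "cell_corner (k n) x"] by (rule order_trans[rotated]) simp
  have sC: "s n x \<le> C + 1" for n x unfolding s_def by (rule r)
  have \<rho>b: "\<rho> n \<in> borel_measurable borel" for n unfolding \<rho>_def[abs_def] using sb[of n] by simp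
  have ck: "checker j x = 1 \<or> checker j x = -1" for j and x :: "real^'n" by (simp add: checker_def)
  have \<rho>low: "inverse (real (Suc n)) / 2 \<le> \<rho> n x" for n x
  proof -
    have "s n x / 2 \<le> \<rho> n x" using ck[of "k n" x] s0[of n x] unfolding \<rho>_def by (elim disjE) simp_all
    moreover have "inverse (real (Suc n)) \<le> s n x" unfolding s_def by (rule r)
    ultimately show ?thesis by linarith
  qed
  have \<rho>R: "\<rho> n x \<le> R" for n x
  proof -
    have "\<rho> n x \<le> 3 / 2 * s n x" using ck[of "k n" x] s0[of n x] unfolding \<rho>_def by (elim disjE) simp_all
    also have "\<dots> \<le> R" unfolding R_def using sC[of n x] by (intro mult_left_mono) auto
    finally show ?thesis .
  qed
  have stepn: "\<forall>\<^sub>F z in nhds y. \<rho> n (snd z) = \<rho> n (snd y)" if "y \<notin> grid (k n)" for n and y :: "real \<times> (real^'n)"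
  proof -
    have g: "snd y \<notin> grid (k n)" by (rule grid_snd[OF that])
    have "\<forall>\<^sub>F x in nhds (snd y). \<rho> n x = \<rho> n (snd y)"
      using cell_corner_eventually[OF g] checker_eventually[OF g] by eventually_elim (simp add: \<rho>_def s_def)
    then show ?thesis by (rule eventually_compose_filterlim[OF _ tendsto_snd[OF filterlim_ident]])
  qed
  define good where "good n m \<longleftrightarrow> m \<in> borel_measurable borel \<and> euler_weak_solution a \<gamma> T \<Omega> (\<lambda>(t, x). \<rho> n x) m \<and>
    (AE y in lborel. y \<in> ?Q \<longrightarrow> (norm (m y))\<^sup>2 \<le> (real CARD('n) + 1) * R * pressure a \<gamma> (2 * R)) \<and>
    (\<forall>q c. (\<forall>y. y \<notin> grid (k n) \<longrightarrow> (\<forall>\<^sub>F z in nhds y. q z = q y)) \<and> (\<forall>y. \<bar>q y\<bar> \<le> 1) \<and> q \<in> borel_measurable borel \<longrightarrow>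
       (\<integral>y. indicator ?Q y * (q y * (m y \<bullet> c)) \<partial>lborel) = 0)" for n and m :: "real \<times> (real^'n) \<Rightarrow> real^'n"
  have "\<exists>m. good n m" for n
    unfolding good_def
    by (rule euler_solution_with_step_density[OF N \<open>a > 0\<close> _ \<Omega> \<rho>b _ \<rho>low \<rho>R stepn]) (use \<open>\<gamma> > 1\<close> in auto)
  then obtain m where m: "\<And>n. good n (m n)" by metis
  define B where "B = sqrt ((real CARD('n) + 1) * R * pressure a \<gamma> (2 * R))"
  have R0: "R > 0" using C(2) by (simp add: R_def)
  have m_weak: "weak_star_Linfty (lebesgue_on ?Q) m (\<lambda>_. 0)"
  proof (rule weak_null_of_step_tests[OF Q k_top, where B = B])
    show "m n \<in> borel_measurable borel" for n using m[of n] unfolding good_def by blast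
    have "AE y in lborel. y \<in> ?Q \<longrightarrow> (norm (m n y))\<^sup>2 \<le> (real CARD('n) + 1) * R * pressure a \<gamma> (2 * R)" for n
      using m[of n] unfolding good_def by blast
    then show "AE y in lborel. y \<in> ?Q \<longrightarrow> norm (m n y) \<le> B" for n
      by (rule AE_mp) (auto simp: B_def intro!: real_le_rsqrt)
    show "B \<ge> 0" using R0 \<open>a > 0\<close> by (simp add: B_def pressure_def)
    show "(\<integral>y. indicator ?Q y * (q y * (m n y \<bullet> c)) \<partial>lborel) = 0"
      if "\<And>y. y \<notin> grid (k n) \<Longrightarrow> \<forall>\<^sub>F z in nhds y. q z = q y" "\<And>y. \<bar>q y\<bar> \<le> 1" "q \<in> borel_measurable borel" for n q c
      using m[of n] that unfolding good_def by blast
  qed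
  have "AE x in lebesgue_on \<Omega>. 0 < \<rho>0 x \<and> \<rho>0 x \<le> C + 1" using C(1) by eventually_elim simp
  note w = checker_density_weak[OF \<Omega> k_top C1(1) this sb s0 sC lim[folded s_def]]
  have \<rho>_weak: "weak_star_Linfty (lebesgue_on \<Omega>) \<rho> \<rho>0" using w(1) unfolding \<rho>_def[abs_def] .
  have strong: "liminf (\<lambda>n. ereal (\<integral>x. \<bar>\<rho> n x - \<rho>0 x\<bar> \<partial>lebesgue_on \<Omega>)) > 0"
    using w(2)[OF \<open>\<Omega> \<noteq> {}\<close>] unfolding \<rho>_def .
  have sol: "\<forall>n. euler_weak_solution a \<gamma> T \<Omega> (\<lambda>(t, x). \<rho> n x) (m n)" using m unfolding good_def by blast
  show ?thesis using sol \<rho>_weak m_weak strong by (intro exI[of _ \<rho>] exI[of _ m] conjI)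
qed

end
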